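(* Let $G$ be a finite group. Then $G$ is a minimal PF-group if and only if it is isomorphic to one of the following groups: (1) $Q_8$, the quaternion group of order $8$; (2) $C_p\times C_{p^2}$, where $p$ is a prime; (3) $M_3(p)$, where $p\neq 2$ is a prime; (4) $C_p^2\times C_q$, where $p$ and $q$ are distinct primes; (5) a quasi-Frobenius group isomorphic to $C_r\times (C_p: C_q)$, where $p,q,r$ are pairwise distinct primes; (6) $\langle x,y \mid x^q=y^{p^{n}}=1,\ y^{-1}xy=x^{r}\rangle$, where $p,q$ are distinct primes, $n\geq 2$ is a natural number, and $r$ is an integer with $r\not\equiv 1 \pmod q$ and $r^p\equiv 1\pmod q$; (7) a quasi-Frobenius group $G$ such that $G/\mathbf{Z}(G)$ is a minimal Frobenius group of order $q^{\alpha}p$, with Frobenius kernel of order $q^\alpha$, for some distinct primes $p,q$ and some positive integer $\alpha$, and such that moreover $\mathbf{Z}(G)\cong C_q$ and the Sylow $q$-subgroup of $G$ is a group of exponent $q$.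
   Context: All groups are finite. A non-trivial partition of a group $G$ is a collection $\{H_1,\dots,H_r\}$ of non-identity subgroups of $G$ with $r>1$ such that every non-identity element of $G$ belongs to one and only one $H_i$. A PF-group (partition-free group) is a non-cyclic group that does not admit a non-trivial partition. A minimal PF-group is a PF-group all of whose proper non-cyclic subgroups admit non-trivial partitions. $C_n$ is the cyclic group of order $n$; $G^k$ is the direct product of $k$ copies of $G$; $M:N$ denotes a semidirect product of $M$ by $N$ (with $M$ normal) in which the action of $N$ on $M$ is non-trivial; $\mathbf{Z}(G)$ is the center of $G$. For a prime $p$, $M_3(p)=\langle x,y \mid x^p=y^{p^{2}}=1,\ x^{-1}yx=y^{1+p}\rangle$. A quasi-Frobenius group is a group $G$ such that $G/\mathbf{Z}(G)$ is a Frobenius group. A minimal Frobenius group is a Frobenius group none of whose proper subgroups is a Frobenius group. *)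

theory Defs
  imports "HOL-Algebra.Algebra" "HOL-Number_Theory.Cong"
begin

section \<open>Partitions and PF-groups\<close>

definition nontrivial_partition :: "('a, 'b) monoid_scheme \<Rightarrow> 'a set set \<Rightarrow> bool" where
  "nontrivial_partition G P \<longleftrightarrow>
     finite P \<and> card P > 1 \<and>
     (\<forall>H\<in>P. subgroup H G \<and> H \<noteq> {\<one>\<^bsub>G\<^esub>}) \<and>
     (\<forall>g\<in>carrier G. g \<noteq> \<one>\<^bsub>G\<^esub> \<longrightarrow> (\<exists>!H. H \<in> P \<and> g \<in> H))"

definition admits_partition :: "('a, 'b) monoid_scheme \<Rightarrow> bool" where
  "admits_partition G \<longleftrightarrow> (\<exists>P. nontrivial_partition G P)"

definition PF_group :: "('a, 'b) monoid_scheme \<Rightarrow> bool" where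
  "PF_group G \<longleftrightarrow> group G \<and> finite (carrier G) \<and> \<not> cyclic_group G \<and> \<not> admits_partition G"

definition minimal_PF_group :: "('a, 'b) monoid_scheme \<Rightarrow> bool" where
  "minimal_PF_group G \<longleftrightarrow> PF_group G \<and>
     (\<forall>H. subgroup H G \<and> H \<noteq> carrier G \<and> \<not> cyclic_group (G\<lparr>carrier := H\<rparr>) \<longrightarrow>
          admits_partition (G\<lparr>carrier := H\<rparr>))"


section \<open>Frobenius and quasi-Frobenius groups\<close>

definition group_center :: "('a, 'b) monoid_scheme \<Rightarrow> 'a set" where
  "group_center G = {z \<in> carrier G. \<forall>g\<in>carrier G. z \<otimes>\<^bsub>G\<^esub> g = g \<otimes>\<^bsub>G\<^esub> z}"

definition conjugate_set :: "('a, 'b) monoid_scheme \<Rightarrow> 'a \<Rightarrow> 'a set \<Rightarrow> 'a set" where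
  "conjugate_set G g S = (\<lambda>s. g \<otimes>\<^bsub>G\<^esub> s \<otimes>\<^bsub>G\<^esub> inv\<^bsub>G\<^esub> g) ` S"

definition frobenius_complement :: "('a, 'b) monoid_scheme \<Rightarrow> 'a set \<Rightarrow> bool" where
  "frobenius_complement G H \<longleftrightarrow>
     subgroup H G \<and> H \<noteq> {\<one>\<^bsub>G\<^esub>} \<and> H \<noteq> carrier G \<and>
     (\<forall>g\<in>carrier G - H. H \<inter> conjugate_set G g H = {\<one>\<^bsub>G\<^esub>})"

definition frobenius_group :: "('a, 'b) monoid_scheme \<Rightarrow> bool" where
  "frobenius_group G \<longleftrightarrow>
     group G \<and> finite (carrier G) \<and> (\<exists>H. frobenius_complement G H)"

definition frobenius_kernel :: "('a, 'b) monoid_scheme \<Rightarrow> 'a set \<Rightarrow> bool" where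
  "frobenius_kernel G K \<longleftrightarrow>
     (\<exists>H. frobenius_complement G H \<and>
          K = insert \<one>\<^bsub>G\<^esub> (carrier G - (\<Union>g\<in>carrier G. conjugate_set G g H)))"

definition minimal_frobenius_group :: "('a, 'b) monoid_scheme \<Rightarrow> bool" where
  "minimal_frobenius_group G \<longleftrightarrow> frobenius_group G \<and>
     (\<forall>H. subgroup H G \<and> H \<noteq> carrier G \<longrightarrow> \<not> frobenius_group (G\<lparr>carrier := H\<rparr>))"

definition quasi_frobenius_group :: "('a, 'b) monoid_scheme \<Rightarrow> bool" where
  "quasi_frobenius_group G \<longleftrightarrow> group G \<and> finite (carrier G) \<and> frobenius_group (G Mod group_center G)"


section \<open>Sylow subgroups and the exponent\<close>

definition sylow_subgroup :: "nat \<Rightarrow> ('a, 'b) monoid_scheme \<Rightarrow> 'a set \<Rightarrow> bool" where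
  "sylow_subgroup q G S \<longleftrightarrow> subgroup S G \<and> card S = q ^ multiplicity q (Coset.order G)"

definition group_exponent :: "('a, 'b) monoid_scheme \<Rightarrow> nat" where
  "group_exponent G = (LEAST n. n > 0 \<and> (\<forall>x\<in>carrier G. x [^]\<^bsub>G\<^esub> n = \<one>\<^bsub>G\<^esub>))"


section \<open>Constructions of groups\<close>

abbreviation cyc :: "nat \<Rightarrow> int monoid" where
  "cyc n \<equiv> integer_mod_group n"

text \<open>The group of units of the Hamilton quaternions with integer coordinates;
  \<open>(a, b, c, d)\<close> stands for \<open>a + b i + c j + d k\<close>.\<close>

fun hamilton_mult :: "int \<times> int \<times> int \<times> int \<Rightarrow> int \<times> int \<times> int \<times> int \<Rightarrow> int \<times> int \<times> int \<times> int" where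
  "hamilton_mult (a, b, c, d) (a', b', c', d') =
     (a * a' - b * b' - c * c' - d * d',
      a * b' + b * a' + c * d' - d * c',
      a * c' - b * d' + c * a' + d * b',
      a * d' + b * c' - c * b' + d * a')"

definition Q8 :: "(int \<times> int \<times> int \<times> int) monoid" where
  "Q8 = \<lparr>carrier = {(1,0,0,0), (-1,0,0,0), (0,1,0,0), (0,-1,0,0),
                   (0,0,1,0), (0,0,-1,0), (0,0,0,1), (0,0,0,-1)},
        monoid.mult = hamilton_mult, one = (1,0,0,0)\<rparr>"

text \<open>The outer semidirect product \<open>M : N\<close> for an action \<open>\<phi>\<close> of \<open>N\<close> on \<open>M\<close>.\<close>

definition semidirect ::
  "('a, 'c) monoid_scheme \<Rightarrow> ('b, 'd) monoid_scheme \<Rightarrow> ('b \<Rightarrow> 'a \<Rightarrow> 'a) \<Rightarrow> ('a \<times> 'b) monoid" where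
  "semidirect M N \<phi> =
     \<lparr>carrier = carrier M \<times> carrier N,
      monoid.mult = (\<lambda>(m, n) (m', n'). (m \<otimes>\<^bsub>M\<^esub> \<phi> n m', n \<otimes>\<^bsub>N\<^esub> n')),
      one = (\<one>\<^bsub>M\<^esub>, \<one>\<^bsub>N\<^esub>)\<rparr>"

definition nontrivial_action ::
  "('a, 'c) monoid_scheme \<Rightarrow> ('b, 'd) monoid_scheme \<Rightarrow> ('b \<Rightarrow> 'a \<Rightarrow> 'a) \<Rightarrow> bool" where
  "nontrivial_action M N \<phi> \<longleftrightarrow>
     \<phi> \<in> hom N (AutoGroup M) \<and> (\<exists>n\<in>carrier N. \<exists>m\<in>carrier M. \<phi> n m \<noteq> m)"


section \<open>Free groups and presentations\<close>

text \<open>A word is a list of letters; \<open>(x, True)\<close> stands for the generator \<open>x\<close> and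
  \<open>(x, False)\<close> for its formal inverse. The free group has all elements of the type of
  generators as its basis.\<close>

type_synonym 'x word = "('x \<times> bool) list"

inductive cancel_step :: "'x word \<Rightarrow> 'x word \<Rightarrow> bool" where
  "cancel_step (u @ [(x, b), (x, \<not> b)] @ v) (u @ v)"

definition word_rel :: "('x word \<times> 'x word) set" where
  "word_rel = {(u, v). equivclp cancel_step u v}"

definition free_group :: "'x word set monoid" where
  "free_group = \<lparr>carrier = UNIV // word_rel,
                 monoid.mult = (\<lambda>A B. \<Union>u\<in>A. \<Union>v\<in>B. word_rel `` {u @ v}),
                 one = word_rel `` {[]}\<rparr>"

definition free_gen :: "'x \<Rightarrow> 'x word set" where
  "free_gen x = word_rel `` {[(x, True)]}"

definition normal_closure :: "('a, 'b) monoid_scheme \<Rightarrow> 'a set \<Rightarrow> 'a set" where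
  "normal_closure G R = generate G (\<Union>g\<in>carrier G. conjugate_set G g R)"

definition presented_group :: "'x word set set \<Rightarrow> 'x word set set monoid" where
  "presented_group R = free_group Mod normal_closure free_group R"

datatype two_gens = Gen_x | Gen_y

abbreviation F2 :: "two_gens word set monoid" where
  "F2 \<equiv> free_group"

abbreviation F2_x :: "two_gens word set" where
  "F2_x \<equiv> free_gen Gen_x"

abbreviation F2_y :: "two_gens word set" where
  "F2_y \<equiv> free_gen Gen_y"

text \<open>The relator of a relation \<open>u = v\<close> is \<open>u v\<^sup>-\<^sup>1\<close>.\<close>

definition M3 :: "nat \<Rightarrow> two_gens word set set monoid" where
  "M3 p = presented_group
     {F2_x [^]\<^bsub>F2\<^esub> p,
      F2_y [^]\<^bsub>F2\<^esub> (p ^ 2),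
      (inv\<^bsub>F2\<^esub> F2_x \<otimes>\<^bsub>F2\<^esub> F2_y \<otimes>\<^bsub>F2\<^esub> F2_x) \<otimes>\<^bsub>F2\<^esub> inv\<^bsub>F2\<^esub> (F2_y [^]\<^bsub>F2\<^esub> (1 + p))}"

definition metacyclic_presented :: "nat \<Rightarrow> nat \<Rightarrow> nat \<Rightarrow> int \<Rightarrow> two_gens word set set monoid" where
  "metacyclic_presented p q n r = presented_group
     {F2_x [^]\<^bsub>F2\<^esub> q,
      F2_y [^]\<^bsub>F2\<^esub> (p ^ n),
      (inv\<^bsub>F2\<^esub> F2_y \<otimes>\<^bsub>F2\<^esub> F2_x \<otimes>\<^bsub>F2\<^esub> F2_y) \<otimes>\<^bsub>F2\<^esub> inv\<^bsub>F2\<^esub> (F2_x [^]\<^bsub>F2\<^esub> r)}"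

end

theory Submission
  imports Defs "HOL-Number_Theory.Number_Theory"
begin

text \<open>
  The classification rests on one remark about a central element z of prime order p. If M is partitioned, z \<in>
  M and x \<in> M with x^p \<noteq> 1, then x and x z have the same p-th power and therefore lie in the same
  component, which contains z. So z and all such x lie in one component (partition_component). Conversely, if all
  elements outside a proper subgroup K \<noteq> 1 satisfy x^p = 1, then K is a component of a partition
  (admits_partition_outside). Hence in a minimal PF-group G the elements with x^p \<noteq> 1 generate G together
  with z, whereas those in a proper subgroup M containing z generate a cyclic group together with z (hughes_eq,
  hughesM). Such a z exists, since otherwise these cyclic groups, taken in the centralizers of the elements of
  prime order, would form a partition of G (center_prime).

  Consequently two non-commuting elements with non-trivial p-th powers generate G together with z (proper_comm),
  and a non-central e with e^p \<noteq> 1 has a cyclic centralizer (centralizer_cyclic). A p-group is thereby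
  found to have order p^3 (pgroup_classification), and a non-cyclic q-subgroup with q \<noteq> p forces G to be
  C_q^2 \<times> C_p (q_subgroup_cyclic). In the remaining non-abelian case the cyclic centralizers pairwise meet
  in the centre. If one of them is normal, G is generated by z, an element w of prime order in it and an element y
  acting on w (normal_centralizer_case). If none is normal but some normal p-subgroup contains a non-central
  element of order p, then G is an extension of a group of exponent p by an element of prime order q, acting
  without fixed points modulo the centre (normal_pgroup_case). Otherwise the conjugates of the cyclic centralizers
  and of the maximal p-subgroups are too many for G (contradiction).

  For the converse, the presented groups and products are treated uniformly as split metacyclic groups (split_mc).
  Each listed group is generated by elements with non-trivial p-th powers for a central element of order p, so it
  has no partition (minimal_PF_I); its proper subgroups are inspected.
\<close>

hide_const (open) Divisibility.prime

section \<open>Cyclic subgroups, centralizers and Hughes subgroups\<close>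

definition cyclic_subset :: "('a, 'b) monoid_scheme => 'a set => bool" where
  "cyclic_subset G H \<longleftrightarrow> (\<exists>c\<in>carrier G. H = generate G {c})"

definition centralizer :: "('a, 'b) monoid_scheme => 'a => 'a set" where
  "centralizer G x = {g \<in> carrier G. g \<otimes>\<^bsub>G\<^esub> x = x \<otimes>\<^bsub>G\<^esub> g}"

text \<open>
  A relative form of the Hughes subgroup H_p; the central element z of order p is added so that the arguments
  below apply to hughes G p z M itself.
\<close>
definition hughes :: "('a, 'b) monoid_scheme => nat => 'a => 'a set => 'a set" where
  "hughes G p z M = generate G (insert z {x \<in> M. x [^]\<^bsub>G\<^esub> p \<noteq> \<one>\<^bsub>G\<^esub>})"

locale fin_group = group G for G (structure) +
  assumes fin: "finite (carrier G)"
begin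

lemma ord_pos: "x \<in> carrier G ==> 0 < ord x"
  using fin ord_ge_1 by fastforce

lemma generate_single_iff:
  assumes "x \<in> carrier G"
  shows "y \<in> generate G {x} \<longleftrightarrow> (\<exists>k::nat. y = x [^] k)"
  using generate_pow_nat[OF assms] ord_pos[OF assms] by auto

lemma pow_in_subgroup:
  assumes "subgroup H G" "x \<in> H" shows "x [^] (k::nat) \<in> H"
proof (induction k)
  case 0 then show ?case using subgroup.one_closed[OF assms(1)] by simp
next
  case (Suc k) then show ?case using subgroup.m_closed[OF assms(1)] assms(2) by simp
qed

lemma generate_single_incl:
  assumes "subgroup H G" "x \<in> H" shows "generate G {x} \<subseteq> H"
  using assms generate_subgroup_incl by blast

lemma finite_subgroup: "subgroup H G ==> finite H"
  using fin finite_subset subgroup.subset by blast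

lemma fin_group_subgroup: "subgroup H G ==> fin_group (G\<lparr>carrier := H\<rparr>)"
  using finite_subgroup subgroup_imp_group by (simp add: fin_group_def fin_group_axioms_def)

lemma cyclic_group_iff:
  assumes H: "subgroup H G"
  shows "cyclic_group (G\<lparr>carrier := H\<rparr>) \<longleftrightarrow> cyclic_subset G H"
proof -
  interpret H: fin_group "G\<lparr>carrier := H\<rparr>" by (rule fin_group_subgroup[OF H])
  have sub: "subgroup (generate G {x}) G" if "x \<in> carrier G" for x
    using that generate_is_subgroup by simp
  have "cyclic_group (G\<lparr>carrier := H\<rparr>) \<longleftrightarrow> (\<exists>x\<in>H. H = range (\<lambda>n::int. x [^]\<^bsub>G\<lparr>carrier := H\<rparr>\<^esub> n))"
    by (simp add: H.cyclic_group)
  also have "\<dots> \<longleftrightarrow> (\<exists>x\<in>H. H = range (\<lambda>n::int. x [^] n))"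
    using int_pow_consistent[OF H] by auto
  also have "\<dots> \<longleftrightarrow> (\<exists>x\<in>H. H = generate G {x})"
    using generate_pow subgroup.mem_carrier[OF H] by (auto simp: full_SetCompr_eq)
  also have "\<dots> \<longleftrightarrow> cyclic_subset G H"
    unfolding cyclic_subset_def using subgroup.mem_carrier[OF H] generate.incl[of _ "{_}" G] by blast
  finally show ?thesis .
qed

lemma cyclic_group_iff': "cyclic_group G \<longleftrightarrow> cyclic_subset G (carrier G)"
  using cyclic_group_iff[OF subgroup_self] by simp

lemma subgroup_generate1: "x \<in> carrier G ==> subgroup (generate G {x}) G"
  using generate_is_subgroup by simp

lemma in_generate1: "x \<in> generate G {x}"
  by (simp add: generate.incl)

lemma cyclic_subset_generate1: "x \<in> carrier G ==> cyclic_subset G (generate G {x})"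
  by (auto simp: cyclic_subset_def)

lemma subgroup_centralizer:
  assumes "x \<in> carrier G" shows "subgroup (centralizer G x) G"
proof (rule subgroupI)
  show "inv a \<in> centralizer G x" if "a \<in> centralizer G x" for a
  proof -
    have a: "a \<in> carrier G" "a \<otimes> x = x \<otimes> a" using that by (auto simp: centralizer_def)
    have "inv a \<otimes> x = inv a \<otimes> (x \<otimes> a) \<otimes> inv a" using a assms by (simp add: m_assoc)
    also have "\<dots> = x \<otimes> inv a" using a assms by (simp add: a(2)[symmetric] inv_solve_left' m_assoc)
    finally show ?thesis using a by (simp add: centralizer_def)
  qed
  show "a \<otimes> b \<in> centralizer G x" if "a \<in> centralizer G x" "b \<in> centralizer G x" for a b
    using that assms by (auto simp: centralizer_def) (metis m_assoc)
qed (use assms in \<open>auto simp: centralizer_def\<close>)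

lemma subgroup_center: "subgroup (group_center G) G"
proof -
  have eq: "group_center G = (\<Inter>x\<in>carrier G. centralizer G x)"
    by (auto simp: group_center_def centralizer_def)
  show ?thesis
    unfolding eq by (rule subgroups_Inter) (use subgroup_centralizer in auto)
qed

lemma center_comm: "z \<in> group_center G ==> x \<in> carrier G ==> z \<otimes> x = x \<otimes> z"
  by (auto simp: group_center_def)

lemma comm_inv:
  assumes "x \<in> carrier G" "y \<in> carrier G" "x \<otimes> y = y \<otimes> x"
  shows "inv x \<otimes> y = y \<otimes> inv x"
  using subgroup.m_inv_closed[OF subgroup_centralizer[of y], of x] assms by (simp add: centralizer_def)

lemma comm_pow:
  assumes "x \<in> carrier G" "y \<in> carrier G" "x \<otimes> y = y \<otimes> x"
  shows "x [^] (k::nat) \<otimes> y = y \<otimes> x [^] k"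
  using assms group_commutes_pow by blast

lemma cyclic_comm:
  assumes "cyclic_subset G C" "x \<in> C" "y \<in> C" shows "x \<otimes> y = y \<otimes> x"
  using assms by (auto simp: cyclic_subset_def generate_single_iff nat_pow_mult add.commute)

lemma cyclic_subset_subgroup: "cyclic_subset G C ==> subgroup C G"
  by (auto simp: cyclic_subset_def subgroup_generate1)

lemma cyclic_subset_sub:
  assumes C: "cyclic_subset G C" and H: "subgroup H G" "H \<subseteq> C"
  shows "cyclic_subset G H"
proof -
  obtain c where c: "c \<in> carrier G" "C = generate G {c}" using C by (auto simp: cyclic_subset_def)
  define d where "d = (LEAST k::nat. k > 0 \<and> c [^] k \<in> H)"
  have ex: "ord c > 0 \<and> c [^] ord c \<in> H" using c ord_pos subgroup.one_closed[OF H(1)] by simp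
  have d: "d > 0 \<and> c [^] d \<in> H" unfolding d_def using ex by (rule LeastI)
  have least: "d \<le> k" if "k > 0" "c [^] k \<in> H" for k unfolding d_def using that by (intro Least_le) simp
  have "H \<subseteq> generate G {c [^] d}"
  proof
    fix h assume h: "h \<in> H"
    then obtain k :: nat where k: "h = c [^] k" using H(2) c generate_single_iff by blast
    have e: "c [^] k = (c [^] d) [^] (k div d) \<otimes> c [^] (k mod d)"
      using c by (simp add: nat_pow_pow nat_pow_mult)
    have "c [^] (k mod d) = inv ((c [^] d) [^] (k div d)) \<otimes> c [^] k"
      using c e by (simp add: inv_solve_left)
    moreover have "inv ((c [^] d) [^] (k div d)) \<otimes> c [^] k \<in> H"
      using d h k H(1) pow_in_subgroup[OF H(1)] by (metis subgroup.m_closed subgroup.m_inv_closed)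
    ultimately have "c [^] (k mod d) \<in> H" by simp
    then have "k mod d = 0" using least[of "k mod d"] d by (metis gr0I leD mod_less_divisor)
    then have "h = (c [^] d) [^] (k div d)" using e k c by simp
    then show "h \<in> generate G {c [^] d}" using generate_single_iff c by blast
  qed
  moreover have "generate G {c [^] d} \<subseteq> H" using generate_single_incl[OF H(1)] d by simp
  ultimately show ?thesis using c by (auto simp: cyclic_subset_def)
qed

lemma pow_cong:
  assumes "x \<in> carrier G" "x [^] i = \<one>" "[k = l] (mod i)"
  shows "x [^] k = x [^] (l::nat)"
proof -
  have m: "x [^] k = x [^] (k mod i)" for k
  proof -
    have "x [^] (i * (k div i) + k mod i) = x [^] (k mod i)"
      using assms(1,2) by (simp only: nat_pow_mult[symmetric] nat_pow_pow[symmetric] nat_pow_one nat_pow_closed l_one)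
    then show ?thesis by simp
  qed
  show ?thesis using m[of k] m[of l] assms(3) by (simp add: cong_def)
qed

lemma ord_prime:
  assumes "x \<in> carrier G" "x \<noteq> \<one>" "x [^] p = \<one>" "prime (p::nat)"
  shows "ord x = p"
  using assms pow_eq_id ord_eq_1 prime_nat_iff by metis

lemma prime_order_generator:
  assumes "x \<in> carrier G" "x [^] p = \<one>" "prime (p::nat)" "y \<in> generate G {x}" "y \<noteq> \<one>"
  shows "x \<in> generate G {y}"
proof -
  have "x \<noteq> \<one>" using assms generate_single_iff by fastforce
  then have o: "ord x = p" using ord_prime assms by blast
  obtain k :: nat where k: "y = x [^] k" using assms generate_single_iff by blast
  have "\<not> p dvd k" using k assms o pow_eq_id by metis
  then have "coprime k p" using assms(3) by (metis coprime_commute prime_imp_coprime)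
  then obtain l where "[k * l = Suc 0] (mod p)" using cong_solve_coprime_nat by blast
  from pow_cong[OF assms(1,2) this] have "x [^] (k * l) = x" using assms(1) by simp
  then have "x = y [^] l" using k assms(1) by (simp add: nat_pow_pow)
  then show ?thesis using generate_single_iff[of y x] k assms(1) by auto
qed

text \<open>
  A cyclic group has only one subgroup of order p. This is used throughout: an element of order p in a cyclic
  subgroup that contains z lies in \<langle>z\<rangle> and is therefore central.
\<close>
lemma cyclic_prime_order:
  assumes C: "cyclic_subset G C" and z: "z \<in> C" "z \<noteq> \<one>" "z [^] p = \<one>" "prime (p::nat)" and x: "x \<in> C" "x [^] p = \<one>"
  shows "x \<in> generate G {z}"
proof -
  obtain c where c: "c \<in> carrier G" "C = generate G {c}" using C by (auto simp: cyclic_subset_def)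
  obtain i j :: nat where ij: "x = c [^] i" "z = c [^] j" using c x z generate_single_iff by blast
  let ?n = "ord c"
  have n: "?n dvd i * p" "?n dvd j * p" "\<not> ?n dvd j"
    using ij x z c by (auto simp: nat_pow_pow pow_eq_id)
  have "p dvd ?n"
  proof (rule ccontr)
    assume "\<not> p dvd ?n"
    then have "coprime ?n p" using z by (metis coprime_commute prime_imp_coprime)
    then show False using n coprime_dvd_mult_left_iff by blast
  qed
  then obtain m where m: "?n = p * m" by blast
  then have mpos: "p > 0" "m > 0" using ord_pos[OF c(1)] by auto
  have "m dvd i" "m dvd j" using n m mpos by (auto simp: mult.commute)
  then obtain i' j' where ij': "i = m * i'" "j = m * j'" by blast
  have "\<not> p dvd j'" using n(3) m ij' by (metis mult.commute mult_dvd_mono dvd_refl)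
  then have "coprime j' p" using z by (metis coprime_commute prime_imp_coprime)
  define w where "w = c [^] m"
  have w: "w \<in> carrier G" "w [^] p = \<one>" using c m pow_ord_eq_1[OF c(1)] by (auto simp: w_def nat_pow_pow mult.commute)
  have "z = w [^] j'" "x = w [^] i'" using ij ij' c by (auto simp: w_def nat_pow_pow)
  then have "w \<in> generate G {z}" using prime_order_generator[of w p z] w z generate_single_iff by blast
  moreover have "subgroup (generate G {z}) G" using z c by (intro subgroup_generate1) (use ij in simp)
  ultimately show ?thesis using pow_in_subgroup \<open>x = w [^] i'\<close> by blast
qed

lemma coprime_generate:
  assumes "x \<in> carrier G" "y \<in> carrier G" "x \<otimes> y = y \<otimes> x" "x [^] i = \<one>" "y [^] j = \<one>" "coprime i (j::nat)"
  shows "x \<in> generate G {x \<otimes> y}" "y \<in> generate G {x \<otimes> y}"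
proof -
  have *: "a \<in> generate G {a \<otimes> b}"
    if a: "a \<in> carrier G" "b \<in> carrier G" "a \<otimes> b = b \<otimes> a" "a [^] i = \<one>" "b [^] j = \<one>" "coprime i j"
    for a b and i j :: nat
  proof -
    obtain k where k: "[k = 1] (mod i)" "[k = 0] (mod j)"
      using binary_chinese_remainder_nat[OF a(6), of 1 0] by blast
    have "b [^] k = \<one>" using k(2) a by (metis cong_0_iff pow_eq_id dvd_trans)
    moreover have "a [^] k = a"
    proof -
      have "a [^] k = a [^] (1::nat)" by (rule pow_cong[OF a(1,4) k(1)])
      then show ?thesis using a by simp
    qed
    ultimately have "a = (a \<otimes> b) [^] k" using a by (simp add: pow_mult_distrib)
    then show ?thesis using generate_single_iff[of "a \<otimes> b" a] a by auto
  qed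
  show "x \<in> generate G {x \<otimes> y}" using * assms by blast
  show "y \<in> generate G {x \<otimes> y}" using *[of y x j i] assms by (simp add: coprime_commute)
qed

lemma cauchy:
  assumes H: "subgroup H G" and "prime q" "q dvd card H"
  shows "\<exists>x\<in>H. x \<noteq> \<one> \<and> x [^] q = \<one>"
proof -
  interpret H: fin_group "G\<lparr>carrier := H\<rparr>" by (rule fin_group_subgroup[OF H])
  obtain m where m: "card H = q ^ 1 * m" using assms by auto
  obtain K where K: "subgroup K (G\<lparr>carrier := H\<rparr>)" "card K = q ^ 1"
    using sylow_thm[OF assms(2) H.is_group, of 1 m] m H.fin by (auto simp: order_def)
  have KG: "subgroup K G" "K \<subseteq> H" using K H incl_subgroup subgroup.subset by fastforce+
  have "\<not> K \<subseteq> {\<one>}"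
    using K(2) prime_gt_1_nat[OF assms(2)] card_mono[of "{\<one>}" K] by auto
  then obtain x where x: "x \<in> K" "x \<noteq> \<one>" by blast
  interpret K: fin_group "G\<lparr>carrier := K\<rparr>" by (rule fin_group_subgroup[OF KG(1)])
  have "x [^]\<^bsub>G\<lparr>carrier := K\<rparr>\<^esub> q = \<one>" using K.pow_order_eq_1[of x] x K(2) by (simp add: order_def)
  then show ?thesis using x KG nat_pow_consistent by auto
qed

lemma pow_card_subgroup:
  assumes H: "subgroup H G" "x \<in> H" shows "x [^] card H = \<one>"
proof -
  interpret H: fin_group "G\<lparr>carrier := H\<rparr>" by (rule fin_group_subgroup[OF H(1)])
  show ?thesis using H.pow_order_eq_1[of x] H nat_pow_consistent by (simp add: order_def)
qed

lemma subgroup_card_dvd: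
  assumes "subgroup H G" "subgroup K G" "H \<subseteq> K" shows "card H dvd card K"
proof -
  interpret K: fin_group "G\<lparr>carrier := K\<rparr>" by (rule fin_group_subgroup[OF assms(2)])
  have "subgroup H (G\<lparr>carrier := K\<rparr>)" using assms subgroup_incl by blast
  from K.lagrange[OF this] show ?thesis by (metis dvd_triv_right order_def partial_object.select_convs(1) partial_object.update_convs(1) partial_object.surjective)
qed

lemma prime_power_of:
  assumes "x \<in> carrier G" "x \<noteq> \<one>"
  obtains k q :: nat where "prime q" "x [^] k \<noteq> \<one>" "(x [^] k) [^] q = \<one>"
proof -
  have "ord x \<noteq> 1" using assms ord_eq_1 by blast
  then obtain q where q: "prime q" "q dvd ord x" using prime_factor_nat by blast
  then obtain k where k: "ord x = q * k" by blast
  have "k > 0" using k ord_pos[OF assms(1)] by (cases k) auto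
  have "k < ord x" using k \<open>k > 0\<close> prime_gt_1_nat[OF q(1)] by simp
  then have "\<not> ord x dvd k" using \<open>k > 0\<close> dvd_imp_le leD by blast
  then have "x [^] k \<noteq> \<one>" using pow_eq_id[OF assms(1)] by blast
  moreover have "(x [^] k) [^] q = \<one>" using nat_pow_pow[OF assms(1)] pow_ord_eq_1[OF assms(1)] k by (simp add: mult.commute)
  ultimately show ?thesis using that q(1) by blast
qed

lemma subset_one_generate:
  assumes "subgroup H G" "H \<subseteq> {\<one>}" shows "cyclic_subset G H"
  using assms subgroup.one_closed[OF assms(1)] generate_one
  by (metis cyclic_subset_def one_closed subset_singletonD empty_iff)

end

section \<open>Partitions and central elements of prime order\<close>

context fin_group begin

text \<open>
  The components are K and the cyclic groups generated by the elements outside K. The latter have order p, so any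
  two components meet trivially.
\<close>
lemma admits_partition_outside:
  assumes K: "subgroup K G" "K \<noteq> carrier G" "K \<noteq> {\<one>}" and p: "prime (p::nat)"
    and out: "\<And>x. x \<in> carrier G ==> x \<notin> K ==> x [^] p = \<one>"
  shows "admits_partition G"
proof -
  define P where "P = insert K ((\<lambda>x. generate G {x}) ` (carrier G - K))"
  have Kc: "K \<subseteq> carrier G" using K subgroup.subset by blast
  have K1: "\<one> \<in> K" using K subgroup.one_closed by blast
  have gen: "x \<in> generate G {g}" if "x \<in> carrier G" "x \<notin> K" "g \<in> generate G {x}" "g \<noteq> \<one>" for x g
    using prime_order_generator[OF that(1) out[OF that(1,2)] p] that by blast
  have carr: "g \<in> carrier G" if "x \<in> carrier G" "g \<in> generate G {x}" for x g
    using that subgroup.mem_carrier[OF subgroup_generate1] by blast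
  have "finite P" unfolding P_def using fin by simp
  moreover have "card P > 1"
  proof -
    obtain x where x: "x \<in> carrier G" "x \<notin> K" using K Kc by blast
    then have ne: "K \<noteq> generate G {x}" using in_generate1 by blast
    have "{K, generate G {x}} \<subseteq> P" using x by (auto simp: P_def)
    from card_mono[OF \<open>finite P\<close> this] show ?thesis using ne by simp
  qed
  moreover have "\<forall>H\<in>P. subgroup H G \<and> H \<noteq> {\<one>}"
  proof
    fix H assume H: "H \<in> P"
    show "subgroup H G \<and> H \<noteq> {\<one>}"
    proof (cases "H = K")
      case False
      then obtain x where x: "x \<in> carrier G" "x \<notin> K" "H = generate G {x}" using H by (auto simp: P_def)
      then have "x \<noteq> \<one>" "x \<in> H" using K1 in_generate1 by auto
      then show ?thesis using x(1,3) subgroup_generate1 by auto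
    qed (use K in simp)
  qed
  moreover have "\<forall>g\<in>carrier G. g \<noteq> \<one> --> (\<exists>!H. H \<in> P \<and> g \<in> H)"
  proof (intro ballI impI)
    fix g assume g: "g \<in> carrier G" "g \<noteq> \<one>"
    show "\<exists>!H. H \<in> P \<and> g \<in> H"
    proof (cases "g \<in> K")
      case True
      have "H = K" if H: "H \<in> P" "g \<in> H" for H
      proof (rule ccontr)
        assume "H \<noteq> K"
        then obtain x where x: "x \<in> carrier G" "x \<notin> K" "H = generate G {x}" using H by (auto simp: P_def)
        then have "x \<in> generate G {g}" using gen H g by blast
        then show False using x generate_single_incl[OF K(1) True] by blast
      qed
      then show ?thesis using True by (auto simp: P_def)
    next
      case False
      have uniq: "H = generate G {g}" if H: "H \<in> P" "g \<in> H" for H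
      proof -
        obtain x where x: "x \<in> carrier G" "x \<notin> K" "H = generate G {x}" using H False by (auto simp: P_def)
        show ?thesis using gen[of x g] x H g generate_single_incl subgroup_generate1 by blast
      qed
      have "generate G {g} \<in> P" using False g by (auto simp: P_def)
      then show ?thesis by (intro ex1I[of _ "generate G {g}"] conjI in_generate1) (assumption, elim conjE, rule uniq)
    qed
  qed
  ultimately show ?thesis unfolding admits_partition_def nontrivial_partition_def by (intro exI[of _ P] conjI)
qed

text \<open>
  If x^p \<noteq> 1 then x and x z have the same non-trivial p-th power. Hence they share a component, which then
  contains z.
\<close>
lemma partition_component:
  assumes "admits_partition G" and z: "z \<in> carrier G" "z \<noteq> \<one>" "z [^] (p::nat) = \<one>"
    and comm: "\<And>x. x \<in> carrier G ==> x \<otimes> z = z \<otimes> x"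
  shows "\<exists>W. subgroup W G \<and> W \<noteq> carrier G \<and> z \<in> W \<and> (\<forall>x\<in>carrier G. x [^] p \<noteq> \<one> --> x \<in> W)"
proof -
  obtain P where P: "nontrivial_partition G P" using assms(1) by (auto simp: admits_partition_def)
  have fP: "finite P" and cP: "card P > 1" using P by (simp_all add: nontrivial_partition_def)
  have sub: "subgroup H G" and ne1: "H \<noteq> {\<one>}" if "H \<in> P" for H
    using P that by (simp_all add: nontrivial_partition_def)
  have ex1: "\<exists>!H. H \<in> P \<and> g \<in> H" if "g \<in> carrier G" "g \<noteq> \<one>" for g
    using P that by (simp add: nontrivial_partition_def)
  have cover: "\<exists>H. H \<in> P \<and> g \<in> H" if "g \<in> carrier G" "g \<noteq> \<one>" for g
    using ex1_implies_ex[OF ex1[OF that]] .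
  have carr: "g \<in> carrier G" if "H \<in> P" "g \<in> H" for H g
    using subgroup.mem_carrier[OF sub[OF that(1)] that(2)] .
  have uniq: "H = K" if "H \<in> P" "g \<in> H" "K \<in> P" "g \<in> K" "g \<noteq> \<one>" for H K g
    using ex1[OF carr[OF that(1,2)] that(5)] that(1-4) by (auto elim: ex1E)
  have proper: "W \<noteq> carrier G" if W: "W \<in> P" for W
  proof
    assume eq: "W = carrier G"
    obtain Y where Y: "Y \<in> P" "Y \<noteq> W"
      using cP W card_le_Suc0_iff_eq[OF fP] by (metis One_nat_def not_le)
    obtain y where y: "y \<in> Y" "y \<noteq> \<one>" using ne1[OF Y(1)] subgroup.one_closed[OF sub[OF Y(1)]] by auto
    then have "y \<in> W" using carr[OF Y(1)] eq by simp
    then show False using uniq[OF Y(1) y(1) W _ y(2)] Y(2) by simp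
  qed
  have key: "z \<in> W" if W: "W \<in> P" "x \<in> W" "x [^] p \<noteq> \<one>" for W x
  proof -
    have x: "x \<in> carrier G" using carr W by simp
    have xz: "(x \<otimes> z) [^] p = x [^] p" using pow_mult_distrib[OF comm[OF x] x z(1)] z x by simp
    then have "x \<otimes> z \<noteq> \<one>" using W(3) by auto
    then obtain Y where Y: "Y \<in> P" "x \<otimes> z \<in> Y" using cover[of "x \<otimes> z"] x z by auto
    have "x [^] p \<in> Y" using pow_in_subgroup[OF sub[OF Y(1)] Y(2), of p] xz by simp
    then have "W = Y" using uniq[OF W(1) pow_in_subgroup[OF sub[OF W(1)] W(2)] Y(1) _ W(3)] by simp
    then have "inv x \<otimes> (x \<otimes> z) \<in> W"
      using Y(2) subgroup.m_closed[OF sub[OF W(1)] subgroup.m_inv_closed[OF sub[OF W(1)] W(2)]] by simp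
    then show ?thesis using x z by (simp add: m_assoc[symmetric])
  qed
  obtain W where W: "W \<in> P" "z \<in> W" using cover[OF z(1,2)] by auto
  have "x \<in> W" if x: "x \<in> carrier G" "x [^] p \<noteq> \<one>" for x
  proof -
    have "x \<noteq> \<one>" using x by auto
    then obtain Y where Y: "Y \<in> P" "x \<in> Y" using cover[OF x(1)] by auto
    then have "z \<in> Y" using key x(2) by simp
    then have "W = Y" using uniq[OF W Y(1) _ z(2)] by simp
    then show ?thesis using Y by simp
  qed
  then show ?thesis using W(2) sub[OF W(1)] proper[OF W(1)] by (intro exI[of _ W]) simp
qed

lemma partition_component_sub:
  assumes M: "subgroup M G" "admits_partition (G\<lparr>carrier := M\<rparr>)" and z: "z \<in> M" "z \<noteq> \<one>" "z [^] (p::nat) = \<one>"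
    and comm: "\<And>x. x \<in> M ==> x \<otimes> z = z \<otimes> x"
  shows "\<exists>W. subgroup W G \<and> W \<subseteq> M \<and> W \<noteq> M \<and> z \<in> W \<and> (\<forall>x\<in>M. x [^] p \<noteq> \<one> --> x \<in> W)"
proof -
  interpret M: fin_group "G\<lparr>carrier := M\<rparr>" by (rule fin_group_subgroup[OF M(1)])
  have "\<exists>W. subgroup W (G\<lparr>carrier := M\<rparr>) \<and> W \<noteq> M \<and> z \<in> W \<and> (\<forall>x\<in>M. x [^]\<^bsub>G\<lparr>carrier := M\<rparr>\<^esub> p \<noteq> \<one> --> x \<in> W)"
    using M.partition_component[of z p] M z comm nat_pow_consistent[of z p M] by simp
  then obtain W where W: "subgroup W (G\<lparr>carrier := M\<rparr>)" "W \<noteq> M" "z \<in> W"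
    "\<forall>x\<in>M. x [^]\<^bsub>G\<lparr>carrier := M\<rparr>\<^esub> p \<noteq> \<one> --> x \<in> W" by blast
  have "subgroup W G" "W \<subseteq> M" using W(1) M(1) incl_subgroup subgroup.subset by fastforce+
  moreover have "\<forall>x\<in>M. x [^] p \<noteq> \<one> --> x \<in> W" using W(4) nat_pow_consistent by simp
  ultimately show ?thesis using W by blast
qed

lemma hughes_subgroup:
  assumes "subgroup M G" "z \<in> M" shows "subgroup (hughes G p z M) G" "hughes G p z M \<subseteq> M"
    "z \<in> hughes G p z M"
proof -
  have sub: "insert z {x \<in> M. x [^] p \<noteq> \<one>} \<subseteq> M" using assms by auto
  then show "hughes G p z M \<subseteq> M" unfolding hughes_def using generate_subgroup_incl assms(1) by blast
  show "subgroup (hughes G p z M) G" unfolding hughes_def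
    using sub subgroup.subset[OF assms(1)] by (intro generate_is_subgroup) auto
  show "z \<in> hughes G p z M" unfolding hughes_def by (auto intro: generate.incl)
qed

lemma hughes_incl: "x \<in> M ==> x [^] p \<noteq> \<one> ==> x \<in> hughes G p z M"
  unfolding hughes_def by (auto intro: generate.incl)

lemma hughes_least:
  assumes "subgroup W G" "z \<in> W" "\<And>x. x \<in> M ==> x [^] p \<noteq> \<one> ==> x \<in> W"
  shows "hughes G p z M \<subseteq> W"
  unfolding hughes_def using assms by (intro generate_subgroup_incl) auto

lemma not_partition_if_hughes:
  assumes z: "z \<in> group_center G" "z \<noteq> \<one>" "z [^] (p::nat) = \<one>" and "hughes G p z (carrier G) = carrier G"
  shows "\<not> admits_partition G"
proof
  assume a: "admits_partition G"
  have zc: "z \<in> carrier G" using z by (simp add: group_center_def)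
  from partition_component[OF a zc z(2,3)] center_comm[OF z(1)]
  obtain W where W: "subgroup W G" "W \<noteq> carrier G" "z \<in> W" "\<forall>x\<in>carrier G. x [^] p \<noteq> \<one> --> x \<in> W"
    by auto
  have "carrier G \<subseteq> W" using hughes_least[OF W(1,3), of "carrier G" p] W(4) assms(4) by simp
  then show False using W(1,2) subgroup.subset by auto
qed
end

locale min_PF = fin_group +
  assumes mpf: "minimal_PF_group G"
begin

lemma not_cyclic: "\<not> cyclic_subset G (carrier G)"
  using mpf cyclic_group_iff' by (simp add: minimal_PF_group_def PF_group_def)

lemma no_partition: "\<not> admits_partition G"
  using mpf by (simp add: minimal_PF_group_def PF_group_def)

lemma proper_partition:
  "subgroup H G ==> H \<noteq> carrier G ==> \<not> cyclic_subset G H ==> admits_partition (G\<lparr>carrier := H\<rparr>)"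
  using mpf cyclic_group_iff by (simp add: minimal_PF_group_def)

text \<open>
  Otherwise this subgroup is partitioned, and the component of z contains all its generators.
\<close>
lemma hughes_cyclic:
  assumes M: "subgroup M G" "M \<noteq> carrier G" and z: "z \<in> M" "z \<noteq> \<one>" "z [^] (p::nat) = \<one>"
    and comm: "\<And>x. x \<in> M ==> x \<otimes> z = z \<otimes> x"
  shows "cyclic_subset G (hughes G p z M)"
proof (rule ccontr)
  let ?N = "hughes G p z M"
  note N = hughes_subgroup[OF M(1) z(1), of p]
  assume nc: "\<not> cyclic_subset G ?N"
  then have "\<not> cyclic_subset G M" using cyclic_subset_sub N by blast
  have "?N \<noteq> carrier G" using N M subgroup.subset by blast
  then have "admits_partition (G\<lparr>carrier := ?N\<rparr>)" using proper_partition N nc by blast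
  from partition_component_sub[OF N(1) this N(3) z(2,3)] comm N(2)
  obtain W where W: "subgroup W G" "W \<subseteq> ?N" "W \<noteq> ?N" "z \<in> W" "\<forall>x\<in>?N. x [^] p \<noteq> \<one> --> x \<in> W"
    by auto
  have "?N \<subseteq> W" by (rule hughes_least[OF W(1,4)]) (use W(5) hughes_incl[of _ M p z] in simp)
  then show False using W(2,3) by simp
qed

text \<open>
  If no element of prime order were central, the Hughes subgroups C z of the centralizers of the elements z of
  prime order would be cyclic, would cover G, and would pairwise coincide or meet trivially: a partition of G.
\<close>
lemma center_prime: "\<exists>z p. z \<in> group_center G \<and> prime p \<and> z \<noteq> \<one> \<and> z [^] (p::nat) = \<one>"
proof (rule ccontr)
  assume no: "\<not> ?thesis"
  define C where "C = (\<lambda>z. hughes G (ord z) z (centralizer G z))"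
  define S where "S = {z \<in> carrier G. prime (ord z)}"
  have SI: "z \<in> S" "ord z = p" if "z \<in> carrier G" "prime p" "z \<noteq> \<one>" "z [^] (p::nat) = \<one>" for z p
    using ord_prime that by (auto simp: S_def)
  have S1: "z \<noteq> \<one>" "z [^] ord z = \<one>" "z \<in> carrier G" "prime (ord z)" if "z \<in> S" for z
    using that by (auto simp: S_def)
  have cen: "subgroup (centralizer G z) G" "z \<in> centralizer G z" "centralizer G z \<noteq> carrier G" if "z \<in> S" for z
  proof -
    show "subgroup (centralizer G z) G" by (rule subgroup_centralizer[OF S1(3)[OF that]])
    show "z \<in> centralizer G z" using S1(3)[OF that] by (simp add: centralizer_def)
    have zz: "z \<notin> group_center G"
    proof
      assume "z \<in> group_center G"
      with S1[OF that] have "\<exists>z p. z \<in> group_center G \<and> prime p \<and> z \<noteq> \<one> \<and> z [^] (p::nat) = \<one>" by (intro exI[of _ z] exI[of _ "ord z"]) simp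
      with no show False ..
    qed
    show "centralizer G z \<noteq> carrier G"
    proof
      assume "centralizer G z = carrier G"
      then have "\<And>g. g \<in> carrier G ==> g \<otimes> z = z \<otimes> g" by (auto simp: centralizer_def)
      then show False using zz S1(3)[OF that] by (auto simp: group_center_def)
    qed
  qed
  have C: "cyclic_subset G (C z)" "z \<in> C z" "C z \<subseteq> centralizer G z" "subgroup (C z) G" if "z \<in> S" for z
  proof -
    show "cyclic_subset G (C z)" unfolding C_def
      using that by (intro hughes_cyclic cen S1) (auto simp: centralizer_def)
    show "z \<in> C z" "C z \<subseteq> centralizer G z" "subgroup (C z) G"
      unfolding C_def using hughes_subgroup[OF cen(1,2)[OF that]] by auto
  qed
  have sub: "C z \<subseteq> C v" if z: "z \<in> S" and v: "v \<in> S" "v \<in> C z" for z v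
  proof -
    obtain c where c: "c \<in> carrier G" "C z = generate G {c}" using C(1)[OF z] unfolding cyclic_subset_def by auto
    have cC: "c \<in> C z" using c in_generate1 by simp
    show ?thesis
    proof (cases "c [^] ord v = \<one>")
      case False
      have "c \<in> centralizer G v" using cyclic_comm[OF C(1)[OF z] cC v(2)] c by (auto simp: centralizer_def)
      then have "c \<in> C v" unfolding C_def using hughes_incl False by blast
      then show ?thesis using c generate_single_incl C(4)[OF v(1)] by auto
    next
      case True
      have "c \<in> generate G {v}"
        using prime_order_generator[OF c(1) True] S1[OF v(1)] v c by blast
      then show ?thesis using c generate_single_incl C(2,4)[OF v(1)] subgroup_generate1 S1[OF v(1)] by (metis subset_trans)
    qed
  qed
  have eq: "C z = C v" if z: "z \<in> S" and v: "v \<in> S" "v \<in> C z" for z v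
    using sub[OF z v] sub[OF v(1) z] C(2)[OF z] by blast
  have disj: "C z = C w" if z: "z \<in> S" and w: "w \<in> S" and u: "u \<in> C z" "u \<in> C w" "u \<noteq> \<one>" for z w u
  proof -
    have uc: "u \<in> carrier G" using subgroup.mem_carrier[OF C(4)[OF z] u(1)] .
    obtain k q :: nat where "prime q" "u [^] k \<noteq> \<one>" "(u [^] k) [^] q = \<one>" using prime_power_of[OF uc u(3)] .
    then have uS: "u [^] k \<in> S" using SI(1)[of "u [^] k" q] uc by simp
    show ?thesis
      using eq[OF z uS pow_in_subgroup[OF C(4)[OF z] u(1)]] eq[OF w uS pow_in_subgroup[OF C(4)[OF w] u(2)]] by simp
  qed
  have cover: "\<exists>z\<in>S. u \<in> C z" if u: "u \<in> carrier G" "u \<noteq> \<one>" for u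
  proof (cases "prime (ord u)")
    case True
    then show ?thesis using u C(2)[of u] by (auto simp: S_def)
  next
    case False
    obtain k q :: nat where k: "prime q" "u [^] k \<noteq> \<one>" "(u [^] k) [^] q = \<one>" using prime_power_of[OF u] .
    then have z: "u [^] k \<in> S" "ord (u [^] k) = q" using SI[of "u [^] k" q] u by simp_all
    have "u [^] q \<noteq> \<one>" using ord_prime[OF u _ k(1)] k(1) False by auto
    moreover have "u \<in> centralizer G (u [^] k)" using u comm_pow[of u u k] by (simp add: centralizer_def)
    ultimately have "u \<in> C (u [^] k)" unfolding C_def z(2) by (intro hughes_incl)
    then show ?thesis using z(1) by (intro bexI)
  qed
  have ne: "S \<noteq> {}"
  proof
    assume "S = {}"
    then have "carrier G \<subseteq> {\<one>}" using cover by auto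
    then show False using not_cyclic subset_one_generate[OF subgroup_self] by simp
  qed
  have "nontrivial_partition G (C ` S)"
  proof -
    have fS: "finite (C ` S)" using fin by (auto simp: S_def)
    moreover have "card (C ` S) > 1"
    proof (rule ccontr)
      assume "\<not> card (C ` S) > 1"
      then have "card (C ` S) \<le> Suc 0" by simp
      then have le: "\<forall>W\<in>C ` S. \<forall>Y\<in>C ` S. W = Y" by (simp only: card_le_Suc0_iff_eq[OF fS])
      obtain z where z: "z \<in> S" using ne by blast
      have "carrier G \<subseteq> C z"
      proof
        fix u assume u: "u \<in> carrier G"
        show "u \<in> C z"
        proof (cases "u = \<one>")
          case True then show ?thesis using subgroup.one_closed[OF C(4)[OF z]] by simp
        next
          case False
          then obtain w where w: "w \<in> S" "u \<in> C w" using cover[OF u] by auto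
          then show ?thesis using bspec[OF bspec[OF le imageI[OF w(1)]] imageI[OF z]] by simp
        qed
      qed
      then have "C z = carrier G" using subgroup.subset[OF C(4)[OF z]] by simp
      then show False using not_cyclic C(1)[OF z] by simp
    qed
    moreover have "\<forall>H\<in>C ` S. subgroup H G \<and> H \<noteq> {\<one>}" using C(2,4) S1(1) by auto
    moreover have "\<forall>g\<in>carrier G. g \<noteq> \<one> --> (\<exists>!H. H \<in> C ` S \<and> g \<in> H)"
    proof (intro ballI impI)
      fix g assume g: "g \<in> carrier G" "g \<noteq> \<one>"
      obtain w where w: "w \<in> S" "g \<in> C w" using cover[OF g] by auto
      then show "\<exists>!H. H \<in> C ` S \<and> g \<in> H"
        by (intro ex1I[of _ "C w"]) (auto dest: disj[OF _ w(1) _ w(2) g(2)])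
    qed
    ultimately show ?thesis by (simp add: nontrivial_partition_def)
  qed
  then show False using no_partition by (auto simp: admits_partition_def)
qed

end

locale min_PF_z = min_PF +
  fixes z p
  assumes z: "z \<in> group_center G" "z \<noteq> \<one>" "z [^] (p::nat) = \<one>" and p: "prime p"
begin

lemma zc: "z \<in> carrier G" and zcomm: "x \<in> carrier G ==> x \<otimes> z = z \<otimes> x"
  using z by (auto simp: group_center_def)

text \<open>
  Otherwise all elements outside this subgroup have order p, and it is a component of a partition.
\<close>
lemma hughes_eq: "hughes G p z (carrier G) = carrier G"
proof (rule ccontr)
  let ?N = "hughes G p z (carrier G)"
  note N = hughes_subgroup[OF subgroup_self zc, of p]
  assume "?N \<noteq> carrier G"
  then have "admits_partition G"
    using admits_partition_outside[OF N(1) _ _ p] N(3) z(2) hughes_incl[of _ "carrier G" p z] by blast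
  then show False using no_partition by simp
qed

lemma hughesM:
  assumes "subgroup M G" "M \<noteq> carrier G" "z \<in> M"
  shows "cyclic_subset G (hughes G p z M)"
  using hughes_cyclic[OF assms z(2,3)] zcomm subgroup.mem_carrier[OF assms(1)] by blast

text \<open>
  The form in which minimality is mostly used: two elements with non-trivial p-th powers that do not commute
  generate G together with z.
\<close>
lemma proper_comm:
  assumes "subgroup M G" "M \<noteq> carrier G" "z \<in> M" "x \<in> M" "y \<in> M" "x [^] p \<noteq> \<one>" "y [^] p \<noteq> \<one>"
  shows "x \<otimes> y = y \<otimes> x"
  using cyclic_comm[OF hughesM[OF assms(1-3)]] hughes_incl assms by blast

text \<open>
  For v^p = 1 the elements e and v e both have non-trivial p-th power, so v lies in the cyclic Hughes subgroup as
  well.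
\<close>
lemma proper_cyclic:
  assumes M: "subgroup M G" "M \<noteq> carrier G" "z \<in> M" and e: "e \<in> M" "e [^] p \<noteq> \<one>"
    and comm: "\<And>x. x \<in> M ==> x \<otimes> e = e \<otimes> x"
  shows "cyclic_subset G M"
proof -
  let ?N = "hughes G p z M"
  note N = hughes_subgroup[OF M(1,3), of p]
  have eN: "e \<in> ?N" using hughes_incl e by blast
  have "v \<in> ?N" if v: "v \<in> M" for v
  proof (cases "v [^] p = \<one>")
    case False then show ?thesis using hughes_incl v by blast
  next
    case True
    have c: "v \<in> carrier G" "e \<in> carrier G" using v e(1) subgroup.mem_carrier[OF M(1)] by simp_all
    have "(v \<otimes> e) [^] p \<noteq> \<one>" using pow_mult_distrib[OF comm[OF v] c] True e c by simp
    then have "v \<otimes> e \<in> ?N" by (rule hughes_incl[OF subgroup.m_closed[OF M(1) v e(1)]])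
    then have "(v \<otimes> e) \<otimes> inv e \<in> ?N" using subgroup.m_closed[OF N(1)] subgroup.m_inv_closed[OF N(1) eN] by simp
    then show ?thesis using c by (simp add: m_assoc)
  qed
  then have "?N = M" using N(2) by blast
  then show ?thesis using hughesM[OF M] by simp
qed

end

section \<open>Conjugation, normalizers and products with a cyclic group\<close>

definition conj_el :: "('a, 'b) monoid_scheme => 'a => 'a => 'a" where
  "conj_el G g x = g \<otimes>\<^bsub>G\<^esub> x \<otimes>\<^bsub>G\<^esub> inv\<^bsub>G\<^esub> g"

definition normset :: "('a, 'b) monoid_scheme => 'a set => 'a set" where
  "normset G H = {g \<in> carrier G. \<forall>h\<in>H. conj_el G g h \<in> H}"

text \<open>
  The product of N with the cyclic group of y; a subgroup when y normalizes N.
\<close>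
definition ext :: "('a, 'b) monoid_scheme => 'a set => 'a => 'a set" where
  "ext G N y = {n \<otimes>\<^bsub>G\<^esub> y [^]\<^bsub>G\<^esub> i |n (i::nat). n \<in> N}"

lemma conjugate_set_conj_el: "conjugate_set G g S = conj_el G g ` S"
  by (simp add: conjugate_set_def conj_el_def)

context group begin

lemma conj_closed [simp, intro]: "g \<in> carrier G ==> x \<in> carrier G ==> conj_el G g x \<in> carrier G"
  by (simp add: conj_el_def)

lemma conj_mult_left: "g \<in> carrier G ==> h \<in> carrier G ==> x \<in> carrier G ==>
    conj_el G (g \<otimes> h) x = conj_el G g (conj_el G h x)"
  by (simp add: conj_el_def m_assoc inv_mult_group)

lemma conj_one_left [simp]: "x \<in> carrier G ==> conj_el G \<one> x = x"
  by (simp add: conj_el_def)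

lemma conj_inv_left [simp]: "g \<in> carrier G ==> x \<in> carrier G ==> conj_el G (inv g) (conj_el G g x) = x"
  by (simp add: conj_mult_left[symmetric])

lemma conj_inv_left' [simp]: "g \<in> carrier G ==> x \<in> carrier G ==> conj_el G g (conj_el G (inv g) x) = x"
  by (simp add: conj_mult_left[symmetric])

lemma conj_mult: "g \<in> carrier G ==> x \<in> carrier G ==> y \<in> carrier G ==>
    conj_el G g (x \<otimes> y) = conj_el G g x \<otimes> conj_el G g y"
  by (simp add: conj_el_def m_assoc inv_solve_left') (simp add: m_assoc[symmetric])

lemma conj_one [simp]: "g \<in> carrier G ==> conj_el G g \<one> = \<one>"
  by (simp add: conj_el_def)

lemma conj_pow: "g \<in> carrier G ==> x \<in> carrier G ==> conj_el G g (x [^] (k::nat)) = conj_el G g x [^] k"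
  by (induction k) (simp_all add: conj_mult)

lemma conj_inj: "g \<in> carrier G ==> x \<in> carrier G ==> y \<in> carrier G ==> conj_el G g x = conj_el G g y \<longleftrightarrow> x = y"
  by (metis conj_inv_left)

lemma conj_inv: "g \<in> carrier G ==> x \<in> carrier G ==> conj_el G g (inv x) = inv (conj_el G g x)"
  by (rule inv_equality[symmetric]) (simp_all add: conj_mult[symmetric])

lemma conj_eq_self: "g \<in> carrier G ==> x \<in> carrier G ==> conj_el G g x = x \<longleftrightarrow> g \<otimes> x = x \<otimes> g"
  by (simp add: conj_el_def inv_solve_right')

lemma conj_eq_one: "g \<in> carrier G ==> x \<in> carrier G ==> conj_el G g x = \<one> \<longleftrightarrow> x = \<one>"
  using conj_inj[of g x \<one>] by simp

lemma mult_eq_conj: "g \<in> carrier G ==> x \<in> carrier G ==> g \<otimes> x = conj_el G g x \<otimes> g"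
  by (simp add: conj_el_def m_assoc)

lemma conj_in_subgroup: "subgroup H G ==> g \<in> H ==> x \<in> H ==> conj_el G g x \<in> H"
  unfolding conj_el_def by (intro subgroup.m_closed subgroup.m_inv_closed)

end

context fin_group begin

lemma subgroup_normset:
  assumes "subgroup H G" shows "subgroup (normset G H) G"
proof (rule subgroupI)
  have Hc: "\<And>h. h \<in> H ==> h \<in> carrier G" using subgroup.mem_carrier[OF assms] .
  show "inv a \<in> normset G H" if a: "a \<in> normset G H" for a
  proof -
    have ac: "a \<in> carrier G" and img: "conj_el G a ` H \<subseteq> H" using a by (auto simp: normset_def)
    have "inj_on (conj_el G a) H" using ac Hc by (auto simp: inj_on_def conj_inj)
    then have s: "conj_el G a ` H = H" using endo_inj_surj[OF finite_subgroup[OF assms] img] by simp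
    have "conj_el G (inv a) h \<in> H" if h: "h \<in> H" for h
    proof -
      obtain k where "k \<in> H" "h = conj_el G a k" using h s by auto
      then show ?thesis using ac Hc by simp
    qed
    then show ?thesis using ac by (simp add: normset_def)
  qed
  show "a \<otimes> b \<in> normset G H" if "a \<in> normset G H" "b \<in> normset G H" for a b
    using that Hc by (simp add: normset_def conj_mult_left)
  show "normset G H \<noteq> {}" using Hc by (auto simp: normset_def intro!: exI[of _ \<one>])
qed (auto simp: normset_def)

lemma subgroup_le_normset: "subgroup H G ==> H \<subseteq> normset G H"
  using conj_in_subgroup subgroup.mem_carrier by (auto simp: normset_def)

lemma conj_pow_left_closed:
  assumes "subgroup N G" "y \<in> normset G N" "n \<in> N" shows "conj_el G (y [^] (i::nat)) n \<in> N"
  using pow_in_subgroup[OF subgroup_normset[OF assms(1)] assms(2)] assms(3) by (auto simp: normset_def)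

lemma subgroup_ext:
  assumes N: "subgroup N G" and y: "y \<in> normset G N"
  shows "subgroup (ext G N y) G"
proof -
  have yc: "y \<in> carrier G" using y by (simp add: normset_def)
  have Nc: "\<And>n. n \<in> N ==> n \<in> carrier G" using subgroup.mem_carrier[OF N] .
  have mult: "a \<otimes> b \<in> ext G N y" if ab: "a \<in> ext G N y" "b \<in> ext G N y" for a b
  proof -
    obtain n i m j where a: "n \<in> N" "a = n \<otimes> y [^] (i::nat)" and b: "m \<in> N" "b = m \<otimes> y [^] (j::nat)"
      using ab by (auto simp: ext_def)
    let ?m = "conj_el G (y [^] i) m"
    have m: "?m \<in> N" using conj_pow_left_closed[OF N y b(1)] .
    have "a \<otimes> b = n \<otimes> (y [^] i \<otimes> m) \<otimes> y [^] j" using a b Nc yc by (simp add: m_assoc)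
    also have "\<dots> = n \<otimes> (?m \<otimes> y [^] i) \<otimes> y [^] j" using mult_eq_conj[of "y [^] i" m] b Nc yc by simp
    also have "\<dots> = (n \<otimes> ?m) \<otimes> y [^] (i + j)" using a m Nc yc by (simp add: m_assoc nat_pow_mult)
    finally show ?thesis using subgroup.m_closed[OF N a(1) m] unfolding ext_def by blast
  qed
  have sub: "ext G N y \<subseteq> carrier G" using Nc yc by (auto simp: ext_def)
  have one: "\<one> \<in> ext G N y" unfolding ext_def using subgroup.one_closed[OF N]
    by (intro CollectI exI[of _ \<one>] exI[of _ 0]) simp
  have pw: "a [^] (k::nat) \<in> ext G N y" if "a \<in> ext G N y" for a k
    by (induction k) (use one mult that in auto)
  show ?thesis
  proof (rule subgroupI[OF sub])
    show "inv a \<in> ext G N y" if a: "a \<in> ext G N y" for a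
    proof -
      have ac: "a \<in> carrier G" using a sub by blast
      have "a [^] (ord a - 1) \<otimes> a = \<one>"
        using ord_pos[OF ac] pow_ord_eq_1[OF ac] nat_pow_Suc[of a "ord a - 1"] by simp
      then have "inv a = a [^] (ord a - 1)" using ac by (intro inv_equality) simp_all
      then show ?thesis using pw[OF a] by simp
    qed
  qed (use one mult in auto)
qed

lemma ext_incl:
  assumes N: "subgroup N G" and y: "y \<in> carrier G"
  shows "N \<subseteq> ext G N y" "y \<in> ext G N y"
proof -
  show "N \<subseteq> ext G N y"
  proof
    fix n assume n: "n \<in> N"
    then have "n = n \<otimes> y [^] (0::nat)" using subgroup.mem_carrier[OF N n] by simp
    then show "n \<in> ext G N y" unfolding ext_def using n by blast
  qed
  have "y = \<one> \<otimes> y [^] (1::nat)" using y by simp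
  then show "y \<in> ext G N y" unfolding ext_def using subgroup.one_closed[OF N] by blast
qed

lemma ext_least:
  assumes "subgroup H G" "N \<subseteq> H" "y \<in> H" shows "ext G N y \<subseteq> H"
  unfolding ext_def using assms pow_in_subgroup[OF assms(1,3)] by (auto intro!: subgroup.m_closed[OF assms(1)])

lemma card_ext:
  assumes N: "subgroup N G" and y: "y \<in> carrier G" "y \<notin> N" "y [^] q \<in> N" "prime (q::nat)"
  shows "card (ext G N y) = card N * q"
proof -
  have Nc: "\<And>n. n \<in> N ==> n \<in> carrier G" using subgroup.mem_carrier[OF N] .
  have q0: "q > 0" using y(4) prime_gt_0_nat by blast
  have notin: "y [^] d \<notin> N" if d: "0 < d" "d < q" for d :: nat
  proof
    assume dN: "y [^] d \<in> N"
    have "coprime d q" using d y(4) by (meson coprime_commute nat_dvd_not_less prime_imp_coprime)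
    then obtain l where "[d * l = Suc 0] (mod q)" using cong_solve_coprime_nat by blast
    then have "(d * l) mod q = 1" using prime_gt_1_nat[OF y(4)] by (simp add: cong_def)
    then have e: "d * l = q * (d * l div q) + 1" by (metis mult_div_mod_eq)
    have "y [^] (d * l) = (y [^] q) [^] (d * l div q) \<otimes> y"
      by (subst e) (simp add: y(1) nat_pow_pow)
    then have "y = inv ((y [^] q) [^] (d * l div q)) \<otimes> (y [^] d) [^] l"
      using y(1) by (simp add: nat_pow_pow inv_solve_left)
    moreover have "inv ((y [^] q) [^] (d * l div q)) \<otimes> (y [^] d) [^] l \<in> N"
      by (intro subgroup.m_closed[OF N] subgroup.m_inv_closed[OF N] pow_in_subgroup[OF N] dN y(3))
    ultimately show False using y(2) by simp
  qed
  have inj: "inj_on (\<lambda>(n, i). n \<otimes> y [^] i) (N \<times> {..<q})"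
  proof (rule inj_onI, clarify)
    fix n m and i j :: nat
    assume nm: "n \<in> N" "m \<in> N" "i < q" "j < q" "n \<otimes> y [^] i = m \<otimes> y [^] j"
    have *: "i = j \<and> n = m" if nm: "n \<in> N" "m \<in> N" "i < q" "j < q" "i \<le> j" "n \<otimes> y [^] i = m \<otimes> y [^] j" for n m and i j :: nat
    proof -
      have "y [^] j = y [^] (j - i) \<otimes> y [^] i" using nm(5) y(1) by (simp add: nat_pow_mult)
      then have "n \<otimes> y [^] i = (m \<otimes> y [^] (j - i)) \<otimes> y [^] i" using nm Nc y(1) by (simp add: m_assoc)
      then have "n = m \<otimes> y [^] (j - i)" using Nc nm y(1) by simp
      then have "y [^] (j - i) = inv m \<otimes> n" using Nc nm y(1) by (simp add: inv_solve_left)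
      then have "y [^] (j - i) \<in> N" using nm by (simp add: subgroup.m_closed[OF N] subgroup.m_inv_closed[OF N])
      then have "i = j" using notin[of "j - i"] nm by (cases "i < j") auto
      then show ?thesis using \<open>n = m \<otimes> y [^] (j - i)\<close> Nc nm by simp
    qed
    show "n = m \<and> i = j" using *[OF nm(1-4) _ nm(5)] *[OF nm(2,1,4,3) _ nm(5)[symmetric]] by (cases "i \<le> j") auto
  qed
  have "ext G N y = (\<lambda>(n, i). n \<otimes> y [^] i) ` (N \<times> {..<q})"
  proof
    show "(\<lambda>(n, i). n \<otimes> y [^] i) ` (N \<times> {..<q}) \<subseteq> ext G N y" by (auto simp: ext_def)
    show "ext G N y \<subseteq> (\<lambda>(n, i). n \<otimes> y [^] i) ` (N \<times> {..<q})"
    proof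
      fix x assume "x \<in> ext G N y"
      then obtain n and i :: nat where x: "n \<in> N" "x = n \<otimes> y [^] i" by (auto simp: ext_def)
      have "y [^] (q * (i div q) + i mod q) = (y [^] q) [^] (i div q) \<otimes> y [^] (i mod q)"
        by (simp only: nat_pow_mult[symmetric] nat_pow_pow[symmetric] y(1))
      then have "x = (n \<otimes> (y [^] q) [^] (i div q)) \<otimes> y [^] (i mod q)"
        using x Nc y(1) by (simp add: m_assoc)
      moreover have "n \<otimes> (y [^] q) [^] (i div q) \<in> N"
        by (intro subgroup.m_closed[OF N] x pow_in_subgroup[OF N] y(3))
      ultimately show "x \<in> (\<lambda>(n, i). n \<otimes> y [^] i) ` (N \<times> {..<q})"
        using q0 by (intro image_eqI[of _ _ "(n \<otimes> (y [^] q) [^] (i div q), i mod q)"]) simp_all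
    qed
  qed
  then show ?thesis using card_image[OF inj] by (simp add: card_cartesian_product)
qed

text \<open>
  If N is exactly the set of elements of M that map some element of S into S, then the conjugates of S under
  distinct cosets of N are disjoint.
\<close>
lemma card_conj_union:
  assumes M: "subgroup M G" and N: "subgroup N G" "N \<subseteq> M" and S: "S \<subseteq> carrier G"
    and stab: "\<And>g s. g \<in> N ==> s \<in> S ==> conj_el G g s \<in> S"
    and ti: "\<And>g s. g \<in> M ==> s \<in> S ==> conj_el G g s \<in> S ==> g \<in> N"
  shows "card (\<Union>g\<in>M. conj_el G g ` S) * card N = card M * card S"
proof -
  let ?U = "\<Union>g\<in>M. conj_el G g ` S"
  define F where "F = (\<lambda>y. {(g, s) \<in> M \<times> S. conj_el G g s = y})"
  have Mc: "\<And>g. g \<in> M ==> g \<in> carrier G" using subgroup.mem_carrier[OF M] .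
  have Nc: "\<And>g. g \<in> N ==> g \<in> carrier G" using N Mc by blast
  have Sc: "\<And>g. g \<in> S ==> g \<in> carrier G" using S by blast
  have finM: "finite M" "finite S" using finite_subgroup[OF M] S fin finite_subset by blast+
  have cF: "card (F y) = card N" if yU: "y \<in> ?U" for y
  proof -
    obtain g0 s0 where g0: "g0 \<in> M" "s0 \<in> S" "y = conj_el G g0 s0" using yU by blast
    have "bij_betw (\<lambda>n. (g0 \<otimes> n, conj_el G (inv n) s0)) N (F y)"
    proof (rule bij_betwI')
      show "((g0 \<otimes> x, conj_el G (inv x) s0) = (g0 \<otimes> y, conj_el G (inv y) s0)) = (x = y)" if "x \<in> N" "y \<in> N" for x y
        using that g0 Mc Nc by auto
      show "(g0 \<otimes> n, conj_el G (inv n) s0) \<in> F y" if n: "n \<in> N" for n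
        using n g0 Mc Nc Sc N(2) stab[OF subgroup.m_inv_closed[OF N(1) n] g0(2)] subgroup.m_closed[OF M]
        by (auto simp: F_def conj_mult_left)
      show "\<exists>n\<in>N. gs = (g0 \<otimes> n, conj_el G (inv n) s0)" if gsF: "gs \<in> F y" for gs
      proof -
        obtain g s where gs: "gs = (g, s)" "g \<in> M" "s \<in> S" "conj_el G g s = y" using gsF by (auto simp: F_def)
        define n where "n = inv g0 \<otimes> g"
        have nM: "n \<in> M" unfolding n_def using g0 gs by (intro subgroup.m_closed[OF M] subgroup.m_inv_closed[OF M])
        have ns: "conj_el G n s = s0" using g0 gs Mc Sc by (simp add: n_def conj_mult_left)
        then have nN: "n \<in> N" using ti[OF nM gs(3)] g0 by simp
        have "g = g0 \<otimes> n" using g0 gs Mc by (simp add: n_def m_assoc[symmetric])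
        moreover have "s = conj_el G (inv n) s0" using ns Mc[OF nM] Sc[OF gs(3)] by auto
        ultimately show ?thesis using nN gs by blast
      qed
    qed
    then show ?thesis using bij_betw_same_card by fastforce
  qed
  have fU: "finite ?U" using finM by simp
  have "M \<times> S = (\<Union>y\<in>?U. F y)" by (auto simp: F_def)
  then have "card M * card S = card (\<Union>y\<in>?U. F y)" by (metis card_cartesian_product)
  also have "\<dots> = (\<Sum>y\<in>?U. card (F y))"
  proof (rule card_UN_disjoint[OF fU])
    show "\<forall>i\<in>?U. finite (F i)" using finM by (auto simp: F_def intro: finite_subset[of _ "M \<times> S"])
    show "\<forall>i\<in>?U. \<forall>j\<in>?U. i \<noteq> j --> F i \<inter> F j = {}" by (auto simp: F_def)
  qed
  also have "\<dots> = card ?U * card N" using cF by simp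
  finally show ?thesis by simp
qed

end

lemma fixed_points_cong:
  fixes D (structure)
  assumes D: "group D" and card: "card (carrier D) = p ^ k" "prime (p::nat)" and E: "finite E"
    and closed: "\<And>g x. g \<in> carrier D ==> x \<in> E ==> f g x \<in> E"
    and one: "\<And>x. x \<in> E ==> f \<one> x = x"
    and mult: "\<And>g h x. g \<in> carrier D ==> h \<in> carrier D ==> x \<in> E ==> f (g \<otimes> h) x = f g (f h x)"
  shows "[card E = card {x \<in> E. \<forall>g\<in>carrier D. f g x = x}] (mod p)"
proof -
  interpret D: group D by fact
  define \<phi> where "\<phi> = (\<lambda>g. restrict (f g) E)"
  have bij: "\<phi> g \<in> Bij E" if g: "g \<in> carrier D" for g
  proof -
    have 1: "f (inv g) (f g x) = x" "f g (f (inv g) x) = x" if "x \<in> E" for x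
      using mult[of "inv g" g x] mult[of g "inv g" x] one g that by auto
    have "bij_betw (f g) E E" by (rule bij_betwI[of _ _ _ "f (inv g)"]) (use closed g 1 in auto)
    then have "bij_betw (\<phi> g) E E" unfolding \<phi>_def by (subst bij_betw_cong[of E _ "f g"]) simp_all
    then show ?thesis by (simp add: Bij_def \<phi>_def)
  qed
  have "\<phi> \<in> hom D (BijGroup E)"
  proof (rule homI)
    show "\<phi> g \<in> carrier (BijGroup E)" if "g \<in> carrier D" for g using bij that by (simp add: BijGroup_def)
    show "\<phi> (g \<otimes> h) = \<phi> g \<otimes>\<^bsub>BijGroup E\<^esub> \<phi> h" if "g \<in> carrier D" "h \<in> carrier D" for g h
      using that bij by (auto simp: BijGroup_def \<phi>_def compose_def mult closed intro!: ext)
  qed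
  then interpret A: group_action D E \<phi>
    by (simp add: group_action_def group_hom_def group_hom_axioms_def D group_BijGroup)
  define C where "C = {B \<in> orbits D E \<phi>. card B \<noteq> 1}"
  let ?Fix = "{x \<in> E. \<forall>g\<in>carrier D. f g x = x}"
  have orb: "orbit D \<phi> x = (\<lambda>g. f g x) ` carrier D" if "x \<in> E" for x
    using that by (auto simp: orbit_def \<phi>_def)
  have orbE: "orbit D \<phi> x \<subseteq> E" if "x \<in> E" for x using orb[OF that] closed that by auto
  have UC: "\<Union>C = E - ?Fix"
  proof
    show "\<Union>C \<subseteq> E - ?Fix"
    proof
      fix x assume "x \<in> \<Union>C"
      then obtain B where B: "B \<in> orbits D E \<phi>" "card B \<noteq> 1" "x \<in> B" by (auto simp: C_def)
      then obtain y where y: "y \<in> E" "B = orbit D \<phi> y" by (auto simp: orbits_def)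
      then have xE: "x \<in> E" using orbE B by blast
      have "orbit D \<phi> x \<in> orbits D E \<phi>" using xE by (auto simp: orbits_def)
      then have Ox: "B = orbit D \<phi> x" using A.disjoint_union[OF B(1)] B(3) A.orbit_refl[OF xE] by blast
      have "x \<notin> ?Fix"
      proof
        assume "x \<in> ?Fix"
        then have "orbit D \<phi> x = {x}" using orb[OF xE] D.one_closed by auto
        then show False using B Ox by simp
      qed
      then show "x \<in> E - ?Fix" using xE by blast
    qed
    show "E - ?Fix \<subseteq> \<Union>C"
    proof
      fix x assume x: "x \<in> E - ?Fix"
      have "card (orbit D \<phi> x) \<noteq> 1"
      proof
        assume "card (orbit D \<phi> x) = 1"
        then obtain y where "orbit D \<phi> x = {y}" using card_1_singletonE by blast
        then have s: "orbit D \<phi> x = {x}" using A.orbit_refl[of x] x by auto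
        have "f g x = x" if "g \<in> carrier D" for g
        proof -
          have "f g x \<in> orbit D \<phi> x" using orb[of x] x that by auto
          then show ?thesis using s by simp
        qed
        then show False using x by blast
      qed
      then show "x \<in> \<Union>C" using x A.orbit_refl[of x] by (auto simp: C_def orbits_def)
    qed
  qed
  have "p dvd card (\<Union>C)"
  proof (rule dvd_partition)
    show "finite (\<Union>C)" using UC E by simp
    show "\<forall>c\<in>C. p dvd card c"
    proof
      fix B assume "B \<in> C"
      then obtain x where x: "x \<in> E" "B = orbit D \<phi> x" "card B \<noteq> 1" by (auto simp: C_def orbits_def)
      then have "card B dvd p ^ k" using A.orbit_stabilizer_theorem[OF x(1)] card by (metis dvd_triv_left order_def)
      then obtain j where "card B = p ^ j" using divides_primepow_nat[OF card(2)] by blast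
      then show "p dvd card B" using x(3) by (cases j) auto
    qed
    show "\<forall>c1\<in>C. \<forall>c2\<in>C. c1 \<noteq> c2 --> c1 \<inter> c2 = {}" using A.disjoint_union by (auto simp: C_def)
  qed
  moreover have "card E = card (\<Union>C) + card ?Fix"
    unfolding UC using card_Diff_subset[of ?Fix E] card_mono[OF E, of ?Fix] E finite_subset[of ?Fix E] by auto
  ultimately show ?thesis unfolding cong_def by (elim dvdE) simp
qed

context fin_group begin

lemma pgroup_center:
  assumes card: "order G = p ^ k" "prime (p::nat)" "k > 0"
  shows "\<exists>z\<in>carrier G. z \<noteq> \<one> \<and> z [^] p = \<one> \<and> (\<forall>x\<in>carrier G. x \<otimes> z = z \<otimes> x)"
proof -
  let ?F = "{x \<in> carrier G. \<forall>g\<in>carrier G. conj_el G g x = x}"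
  have "[card (carrier G) = card ?F] (mod p)"
    by (rule fixed_points_cong[OF is_group _ card(2) fin, of k "conj_el G"])
       (use card in \<open>auto simp: order_def conj_mult_left\<close>)
  moreover have "p dvd card (carrier G)" using card by (simp add: order_def)
  ultimately have dvd: "p dvd card ?F" using cong_dvd_iff by blast
  have "\<not> ?F \<subseteq> {\<one>}"
  proof
    assume "?F \<subseteq> {\<one>}"
    then have "?F = {\<one>}" by auto
    then have "card ?F = 1" by simp
    then show False using dvd card(2) by (metis not_prime_unit nat_dvd_1_iff_1 dvd_refl)
  qed
  then obtain w where wF: "w \<in> ?F" "w \<noteq> \<one>" by blast
  then have w: "w \<in> carrier G" "w \<noteq> \<one>" "\<forall>g\<in>carrier G. g \<otimes> w = w \<otimes> g" by (auto simp: conj_eq_self)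
  obtain l q where q: "prime q" "w [^] l \<noteq> \<one>" "(w [^] (l::nat)) [^] (q::nat) = \<one>" using prime_power_of[OF w(1,2)] .
  have "ord (w [^] l) = q" using ord_prime q w by simp
  then have "q dvd p ^ k" using ord_dvd_group_order[of "w [^] l"] w(1) card by simp
  then have "q = p" using q card primes_dvd_imp_eq prime_dvd_power by blast
  moreover have "\<forall>x\<in>carrier G. x \<otimes> w [^] l = w [^] l \<otimes> x" using w comm_pow[of w _ l] by simp
  ultimately show ?thesis using q w by (intro bexI[of _ "w [^] l"]) auto
qed

lemma pgroup_normalizer_grows_order:
  assumes card: "order G = p ^ k" "prime (p::nat)" and D: "subgroup D G" "D \<noteq> carrier G"
  shows "\<exists>x\<in>carrier G. x \<notin> D \<and> x \<in> normset G D"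
proof -
  interpret D: fin_group "G\<lparr>carrier := D\<rparr>" by (rule fin_group_subgroup[OF D(1)])
  have Dc: "\<And>g. g \<in> D ==> g \<in> carrier G" using subgroup.mem_carrier[OF D(1)] .
  have Dsub: "D \<subseteq> carrier G" using Dc by blast
  let ?E = "rcosets D"
  let ?f = "\<lambda>g C. C #> inv g"
  have lag: "card ?E * card D = p ^ k" using lagrange[OF D(1)] card by simp
  then obtain j where j: "card D = p ^ j" by (metis card(2) divides_primepow_nat dvd_triv_right)
  obtain i where i: "card ?E = p ^ i" using lag by (metis card(2) divides_primepow_nat dvd_triv_left)
  have "i \<noteq> 0"
  proof
    assume "i = 0"
    then have "card D = order G" using lag i card by simp
    then show False using D Dsub fin by (metis card_subset_eq order_def)
  qed
  then have pE: "p dvd card ?E" using i by simp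
  have finE: "finite ?E" using fin by (metis card.infinite i card(2) not_prime_0 power_not_zero)
  have Esub: "C \<subseteq> carrier G" if "C \<in> ?E" for C using that rcosets_part_G[OF D(1)] by blast
  have "[card ?E = card {C \<in> ?E. \<forall>g\<in>carrier (G\<lparr>carrier := D\<rparr>). ?f g C = C}] (mod p)"
  proof (rule fixed_points_cong[OF D.is_group _ card(2) finE])
    show "card (carrier (G\<lparr>carrier := D\<rparr>)) = p ^ j" using j by simp
    show "C #> inv g \<in> ?E" if gC: "g \<in> carrier (G\<lparr>carrier := D\<rparr>)" "C \<in> ?E" for g C
    proof -
      obtain a where a: "a \<in> carrier G" "C = D #> a" using gC by (auto simp: RCOSETS_def)
      then have "C #> inv g = D #> (a \<otimes> inv g)" using gC Dc Dsub by (simp add: coset_mult_assoc)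
      then show ?thesis using a gC Dc by (auto simp: RCOSETS_def)
    qed
    show "C #> inv \<one>\<^bsub>G\<lparr>carrier := D\<rparr>\<^esub> = C" if "C \<in> ?E" for C
      using Esub[OF that] by (simp add: coset_mult_one)
    show "C #> inv (g \<otimes>\<^bsub>G\<lparr>carrier := D\<rparr>\<^esub> h) = (C #> inv h) #> inv g"
      if "g \<in> carrier (G\<lparr>carrier := D\<rparr>)" "h \<in> carrier (G\<lparr>carrier := D\<rparr>)" "C \<in> ?E" for g h C
      using that Esub Dc by (simp add: coset_mult_assoc inv_mult_group)
  qed
  then have dvd: "p dvd card {C \<in> ?E. \<forall>g\<in>D. ?f g C = C}" using pE cong_dvd_iff by auto
  let ?F = "{C \<in> ?E. \<forall>g\<in>D. ?f g C = C}"
  have DF: "D \<in> ?F"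
  proof -
    have "D #> inv g = D" if "g \<in> D" for g
      using that Dc by (intro coset_join2 D(1)) (auto intro: subgroup.m_inv_closed[OF D(1)])
    then show ?thesis using subgroup.subgroup_in_rcosets[OF D(1) is_group] by simp
  qed
  have "\<not> ?F \<subseteq> {D}"
  proof
    assume "?F \<subseteq> {D}"
    then have "?F = {D}" using DF by blast
    then have "card ?F = 1" by simp
    then show False using dvd card(2) by (metis not_prime_unit nat_dvd_1_iff_1 dvd_refl)
  qed
  then obtain C where C: "C \<in> ?E" "\<forall>g\<in>D. C #> inv g = C" "C \<noteq> D" by blast
  then obtain a where a: "a \<in> carrier G" "C = D #> a" by (auto simp: RCOSETS_def)
  have "a \<notin> D" using a C(3) coset_join2[OF a(1) D(1)] by blast
  moreover have "conj_el G a h \<in> D" if h: "h \<in> D" for h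
  proof -
    have "D #> a #> h = D #> a" using C(2) a h subgroup.m_inv_closed[OF D(1) h] Dc by force
    then have "D #> (a \<otimes> h) = D #> a" using a h Dc Dsub by (simp add: coset_mult_assoc)
    then have "D #> (a \<otimes> h \<otimes> inv a) = D"
      using a h Dc Dsub by (metis coset_mult_assoc coset_mult_one inv_closed m_closed r_inv)
    then show ?thesis unfolding conj_el_def using a h Dc by (intro coset_join1[OF _ _ D(1)]) auto
  qed
  ultimately show ?thesis using a by (intro bexI[of _ a]) (auto simp: normset_def)
qed

lemma pgroup_normalizer_grows:
  assumes P: "subgroup P G" "card P = p ^ k" "prime (p::nat)" and D: "subgroup D G" "D \<subseteq> P" "D \<noteq> P"
  shows "\<exists>x\<in>P. x \<notin> D \<and> x \<in> normset G D"
proof -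
  interpret P: fin_group "G\<lparr>carrier := P\<rparr>" by (rule fin_group_subgroup[OF P(1)])
  have "subgroup D (G\<lparr>carrier := P\<rparr>)" using subgroup_incl[OF D(1) P(1) D(2)] .
  then obtain x where x: "x \<in> P" "x \<notin> D" "x \<in> normset (G\<lparr>carrier := P\<rparr>) D"
    using P.pgroup_normalizer_grows_order[of p k D] P D by (auto simp: order_def)
  have "x \<in> normset G D"
    using x(1,3) D(2) subgroup.mem_carrier[OF P(1)] m_inv_consistent[OF P(1) x(1)] by (simp add: normset_def conj_el_def)
  then show ?thesis using x by blast
qed

lemma pgroup_center_sub:
  assumes P: "subgroup P G" "card P = p ^ k" "prime (p::nat)" "k > 0"
  shows "\<exists>z\<in>P. z \<noteq> \<one> \<and> z [^] p = \<one> \<and> (\<forall>x\<in>P. x \<otimes> z = z \<otimes> x)"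
proof -
  interpret P: fin_group "G\<lparr>carrier := P\<rparr>" by (rule fin_group_subgroup[OF P(1)])
  have "\<exists>z\<in>P. z \<noteq> \<one> \<and> z [^]\<^bsub>G\<lparr>carrier := P\<rparr>\<^esub> p = \<one> \<and> (\<forall>x\<in>P. x \<otimes> z = z \<otimes> x)"
    using P.pgroup_center[of p k] P(2-4) by (simp add: order_def)
  then show ?thesis by (simp only: nat_pow_consistent[symmetric])
qed

end

section \<open>Split metacyclic groups\<close>

text \<open>
  The relation is written as a b = b a^k with an integer exponent, so that a^j b^i = b^i a^(j k^i) holds without
  side conditions.
\<close>
definition mc_rel :: "('a, 'b) monoid_scheme => 'a => 'a => nat => nat => int => bool" where
  "mc_rel G a b n m k \<longleftrightarrow> a \<in> carrier G \<and> b \<in> carrier G \<and> 0 < n \<and> 0 < m \<and>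
     a [^]\<^bsub>G\<^esub> n = \<one>\<^bsub>G\<^esub> \<and> b [^]\<^bsub>G\<^esub> m = \<one>\<^bsub>G\<^esub> \<and> a \<otimes>\<^bsub>G\<^esub> b = b \<otimes>\<^bsub>G\<^esub> a [^]\<^bsub>G\<^esub> k"

text \<open>
  Given the relations, the order condition says that no further relation holds. The parameters thus determine the
  group up to isomorphism, and this predicate covers all groups of the list except the quaternion group and the
  last family.
\<close>
definition split_mc :: "('a, 'b) monoid_scheme => 'a => 'a => nat => nat => int => bool" where
  "split_mc G a b n m k \<longleftrightarrow> group G \<and> mc_rel G a b n m k \<and>
     generate G {a, b} = carrier G \<and> card (carrier G) = n * m"

definition mc_elt :: "('a, 'b) monoid_scheme => 'a => 'a => nat \<times> int => 'a" where
  "mc_elt G a b = (\<lambda>(i, j). b [^]\<^bsub>G\<^esub> i \<otimes>\<^bsub>G\<^esub> a [^]\<^bsub>G\<^esub> j)"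

definition mc_mult :: "nat => nat => int => nat \<times> int => nat \<times> int => nat \<times> int" where
  "mc_mult n m k = (\<lambda>(i, j) (i', j'). ((i + i') mod m, (j * k ^ i' + j') mod int n))"

abbreviation mc_index :: "nat => nat => (nat \<times> int) set" where
  "mc_index n m \<equiv> {..<m} \<times> {0..<int n}"

context group begin

lemma conj_int_pow: "g \<in> carrier G ==> x \<in> carrier G ==> conj_el G g (x [^] (k::int)) = conj_el G g x [^] k"
  by (cases k rule: int_cases2) (simp_all add: int_pow_int int_pow_neg_int conj_pow conj_inv)

lemma int_pow_mod:
  assumes "x \<in> carrier G" "x [^] (n::nat) = \<one>" shows "x [^] (i mod int n) = x [^] (i::int)"
proof -
  have "i = int n * (i div int n) + i mod int n" by simp
  then have "x [^] i = (x [^] int n) [^] (i div int n) \<otimes> x [^] (i mod int n)"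
    using assms(1) by (metis int_pow_mult int_pow_pow)
  then show ?thesis using assms by (simp add: int_pow_int)
qed

lemma int_pow_cong:
  assumes "x \<in> carrier G" "x [^] (n::nat) = \<one>" "[i = j] (mod int n)" shows "x [^] (i::int) = x [^] j"
  using int_pow_mod[OF assms(1,2), of i] int_pow_mod[OF assms(1,2), of j] assms(3) by (simp add: cong_def)

lemma nat_pow_mod:
  assumes "x \<in> carrier G" "x [^] (n::nat) = \<one>" shows "x [^] (i mod n) = x [^] (i::nat)"
  using int_pow_mod[OF assms, of "int i"] by (metis int_pow_int zmod_int)

lemma mc_comm:
  assumes "mc_rel G a b n m k"
  shows "a [^] (j::int) \<otimes> b [^] (i::nat) = b [^] i \<otimes> a [^] (j * k ^ i)"
proof -
  have ab: "a \<in> carrier G" "b \<in> carrier G" "a \<otimes> b = b \<otimes> a [^] k" using assms by (auto simp: mc_rel_def)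
  have "conj_el G (inv b) a = a [^] k" using ab by (simp add: conj_el_def m_assoc inv_solve_left')
  then have 1: "a [^] j \<otimes> b = b \<otimes> a [^] (j * k)" for j :: int
  proof -
    assume e: "conj_el G (inv b) a = a [^] k"
    have "conj_el G (inv b) (a [^] j) = a [^] (k * j)" using ab e by (simp add: conj_int_pow int_pow_pow)
    then have "inv b \<otimes> (a [^] j \<otimes> b) = a [^] (j * k)" using ab by (simp add: conj_el_def m_assoc mult.commute)
    then show ?thesis using ab by (metis inv_solve_left' int_pow_closed m_closed)
  qed
  show ?thesis
  proof (induction i)
    case (Suc i)
    have "a [^] j \<otimes> b [^] Suc i = (a [^] j \<otimes> b [^] i) \<otimes> b" using ab by (simp add: m_assoc)
    also have "\<dots> = b [^] i \<otimes> (a [^] (j * k ^ i) \<otimes> b)" using Suc ab by (simp add: m_assoc)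
    also have "\<dots> = (b [^] i \<otimes> b) \<otimes> a [^] (j * k ^ i * k)" using 1 ab by (simp add: m_assoc)
    finally show ?case by (simp add: mult_ac)
  qed (use ab in simp)
qed

lemma mc_elt_mult:
  assumes r: "mc_rel G a b n m k"
  shows "mc_elt G a b x \<otimes> mc_elt G a b y = mc_elt G a b (mc_mult n m k x y)"
proof -
  obtain i j i' j' where xy: "x = (i, j)" "y = (i', j')" by fastforce
  have ab: "a \<in> carrier G" "b \<in> carrier G" "a [^] n = \<one>" "b [^] m = \<one>" using r by (auto simp: mc_rel_def)
  have "mc_elt G a b x \<otimes> mc_elt G a b y = b [^] i \<otimes> (a [^] j \<otimes> b [^] i') \<otimes> a [^] j'"
    using ab by (simp add: mc_elt_def xy m_assoc)
  also have "\<dots> = b [^] (i + i') \<otimes> a [^] (j * k ^ i' + j')"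
    unfolding mc_comm[OF r] using ab by (simp add: m_assoc nat_pow_mult[symmetric] int_pow_mult)
  finally show ?thesis using ab by (simp add: mc_elt_def xy mc_mult_def int_pow_mod nat_pow_mod)
qed

lemma mc_mult_index: "0 < n ==> 0 < m ==> mc_mult n m k x y \<in> mc_index n m"
  by (auto simp: mc_mult_def split: prod.splits)

lemma mc_generate:
  assumes r: "mc_rel G a b n m k" shows "generate G {a, b} = mc_elt G a b ` mc_index n m"
proof
  have ab: "a \<in> carrier G" "b \<in> carrier G" "a [^] n = \<one>" "b [^] m = \<one>" "0 < n" "0 < m"
    using r by (auto simp: mc_rel_def)
  have in_img: "b [^] i \<otimes> a [^] j \<in> mc_elt G a b ` mc_index n m" for i :: nat and j :: int
  proof (rule image_eqI[of _ _ "(i mod m, j mod int n)"])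
    show "b [^] i \<otimes> a [^] j = mc_elt G a b (i mod m, j mod int n)" using ab by (simp add: mc_elt_def int_pow_mod nat_pow_mod)
  qed (use ab in auto)
  show "generate G {a, b} \<subseteq> mc_elt G a b ` mc_index n m"
  proof
    fix x assume "x \<in> generate G {a, b}"
    then show "x \<in> mc_elt G a b ` mc_index n m"
    proof induction
      case one then show ?case using in_img[of 0 0] by simp
    next
      case (incl h)
      then show ?case using in_img[of 0 1] in_img[of 1 0] ab by auto
    next
      case (inv h)
      have "inv b = b [^] (m - 1)"
        using ab nat_pow_Suc[of b "m - 1"] by (intro inv_equality) simp_all
      then show ?case using inv in_img[of 0 "-1"] in_img[of "m - 1" 0] ab by (auto simp: int_pow_neg)
    next
      case (eng h1 h2)
      then obtain x y where "h1 = mc_elt G a b x" "h2 = mc_elt G a b y" by blast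
      then show ?case using mc_elt_mult[OF r] mc_mult_index ab by auto
    qed
  qed
  show "mc_elt G a b ` mc_index n m \<subseteq> generate G {a, b}"
  proof -
    have s: "subgroup (generate G {a, b}) G" using ab by (intro generate_is_subgroup) simp
    have "a \<in> generate G {a, b}" "b \<in> generate G {a, b}" by (auto intro: generate.incl)
    then have "b [^] i \<otimes> a [^] j \<in> generate G {a, b}" for i :: nat and j :: int
      using subgroup.m_closed[OF s] subgroup_int_pow_closed[OF s] by (metis int_pow_int)
    then show ?thesis by (auto simp: mc_elt_def)
  qed
qed

lemma mc_relI:
  assumes "a \<in> carrier G" "b \<in> carrier G" "0 < n" "0 < m" "a [^] n = \<one>" "b [^] m = \<one>"
    "a \<otimes> b = b \<otimes> a [^] nat (k mod int n)"
  shows "mc_rel G a b n m k"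
proof -
  have "a [^] nat (k mod int n) = a [^] (k mod int n)" using assms(3) by (intro pow_nat) simp
  then show ?thesis unfolding mc_rel_def using assms int_pow_mod[of a n k] by simp
qed

end

lemma card_mc_index: "card (mc_index n m) = n * m"
  by (simp add: card_cartesian_product)

lemma split_mc_bij:
  assumes "split_mc G a b n m k" shows "bij_betw (mc_elt G a b) (mc_index n m) (carrier G)"
proof -
  interpret group G using assms by (simp add: split_mc_def)
  have "mc_elt G a b ` mc_index n m = carrier G" using assms mc_generate by (auto simp: split_mc_def)
  moreover have "card (mc_index n m) = card (carrier G)" using assms card_mc_index by (simp add: split_mc_def)
  ultimately show ?thesis by (metis bij_betw_def card_mc_index eq_card_imp_inj_on finite_SigmaI finite_atLeastLessThan_int finite_lessThan)
qed

lemma split_mc_iso: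
  assumes G: "split_mc G a b n m k" and H: "split_mc H c d n m k" shows "G \<cong> H"
proof -
  interpret G: group G using G by (simp add: split_mc_def)
  interpret H: group H using H by (simp add: split_mc_def)
  have r: "mc_rel G a b n m k" "mc_rel H c d n m k" using G H by (auto simp: split_mc_def)
  then have nm: "0 < n" "0 < m" by (auto simp: mc_rel_def)
  let ?f = "mc_elt G a b" and ?g = "mc_elt H c d" and ?I = "mc_index n m"
  note bf = split_mc_bij[OF G] and bg = split_mc_bij[OF H]
  let ?h = "?g \<circ> inv_into ?I ?f"
  have bij: "bij_betw ?h (carrier G) (carrier H)"
    using bij_betw_trans[OF bij_betw_inv_into[OF bf] bg] .
  have h: "?h (?f x) = ?g x" if "x \<in> ?I" for x using bij_betw_inv_into_left[OF bf that] by simp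
  have "?h \<in> hom G H"
  proof (rule homI)
    show "?h x \<in> carrier H" if "x \<in> carrier G" for x by (rule bspec[OF bij_betwE[OF bij] that])
    show "?h (x \<otimes>\<^bsub>G\<^esub> y) = ?h x \<otimes>\<^bsub>H\<^esub> ?h y" if xy: "x \<in> carrier G" "y \<in> carrier G" for x y
    proof -
      obtain u where u: "u \<in> ?I" "x = ?f u"
        using xy(1) unfolding bij_betw_imp_surj_on[OF bf, symmetric] by (elim imageE)
      obtain v where v: "v \<in> ?I" "y = ?f v"
        using xy(2) unfolding bij_betw_imp_surj_on[OF bf, symmetric] by (elim imageE)
      note uv = u v
      have "?h (x \<otimes>\<^bsub>G\<^esub> y) = ?h (?f (mc_mult n m k u v))" using G.mc_elt_mult[OF r(1)] uv by simp
      also have "\<dots> = ?g (mc_mult n m k u v)" by (rule h[OF G.mc_mult_index[OF nm]])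
      also have "\<dots> = ?g u \<otimes>\<^bsub>H\<^esub> ?g v" using H.mc_elt_mult[OF r(2)] by simp
      also have "\<dots> = ?h x \<otimes>\<^bsub>H\<^esub> ?h y" using uv h by simp
      finally show ?thesis .
    qed
  qed
  then show ?thesis using bij by (auto simp: is_iso_def iso_def)
qed

lemma split_mc_transport:
  assumes G: "group G" "G \<cong> H" and H: "split_mc H a b n m k"
  shows "\<exists>c d. split_mc G c d n m k"
proof -
  interpret G: group G by fact
  interpret H: group H using H by (simp add: split_mc_def)
  have "H \<cong> G" using G.iso_sym[OF G(2)] .
  then obtain h where h: "h \<in> hom H G" "bij_betw h (carrier H) (carrier G)" by (auto simp: is_iso_def iso_def)
  interpret h: group_hom H G h by (simp add: group_hom_def group_hom_axioms_def h G H.is_group)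
  have r: "mc_rel H a b n m k" "generate H {a, b} = carrier H" "card (carrier H) = n * m" using H by (auto simp: split_mc_def)
  then have ab: "a \<in> carrier H" "b \<in> carrier H" by (auto simp: mc_rel_def)
  have "mc_rel G (h a) (h b) n m k"
  proof -
    have "h (a \<otimes>\<^bsub>H\<^esub> b) = h (b \<otimes>\<^bsub>H\<^esub> a [^]\<^bsub>H\<^esub> k)" using r(1) by (simp add: mc_rel_def)
    then show ?thesis using r(1) ab by (simp add: mc_rel_def h.hom_int_pow h.hom_nat_pow[symmetric])
  qed
  moreover have "generate G {h a, h b} = carrier G"
    using h.generate_img[of "{a, b}"] ab r(2) h(2) by (simp add: bij_betw_def)
  moreover have "card (carrier G) = n * m" using bij_betw_same_card[OF h(2)] r(3) by simp
  ultimately have "split_mc G (h a) (h b) n m k" using G(1) by (simp add: split_mc_def)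
  then show ?thesis by (intro exI)
qed

lemma split_mc_one:
  assumes G: "split_mc G a b n m k"
  shows "b [^]\<^bsub>G\<^esub> (i::nat) \<otimes>\<^bsub>G\<^esub> a [^]\<^bsub>G\<^esub> (j::int) = \<one>\<^bsub>G\<^esub> \<longleftrightarrow> m dvd i \<and> int n dvd j"
proof -
  interpret G: group G using G by (simp add: split_mc_def)
  have ab: "a \<in> carrier G" "b \<in> carrier G" "a [^]\<^bsub>G\<^esub> n = \<one>\<^bsub>G\<^esub>" "b [^]\<^bsub>G\<^esub> m = \<one>\<^bsub>G\<^esub>" "0 < n" "0 < m"
    using G by (auto simp: mc_rel_def split_mc_def)
  have e: "b [^]\<^bsub>G\<^esub> i \<otimes>\<^bsub>G\<^esub> a [^]\<^bsub>G\<^esub> j = mc_elt G a b (i mod m, j mod int n)"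
    using ab by (simp add: mc_elt_def G.int_pow_mod G.nat_pow_mod)
  have o: "mc_elt G a b (0, 0) = \<one>\<^bsub>G\<^esub>" by (simp add: mc_elt_def)
  have "(i mod m, j mod int n) \<in> mc_index n m" "(0, 0) \<in> mc_index n m" using ab by auto
  from inj_on_eq_iff[OF bij_betw_imp_inj_on[OF split_mc_bij[OF G]] this] show ?thesis
    unfolding e o by simp presburger
qed

lemma split_mc_elt:
  assumes G: "split_mc G a b n m k" and "x \<in> carrier G"
  obtains i :: nat and j :: nat where "x = b [^]\<^bsub>G\<^esub> i \<otimes>\<^bsub>G\<^esub> a [^]\<^bsub>G\<^esub> j" "i < m" "j < n"
proof -
  obtain y where y: "y \<in> mc_index n m" "x = mc_elt G a b y"
    using assms(2) unfolding bij_betw_imp_surj_on[OF split_mc_bij[OF G], symmetric] by (elim imageE)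
  obtain i j where ij: "y = (i, j)" by (cases y)
  have "0 \<le> j" "j < int n" "i < m" using y ij by auto
  moreover from this have "a [^]\<^bsub>G\<^esub> nat j = a [^]\<^bsub>G\<^esub> j" by (simp add: pow_nat)
  then have "x = b [^]\<^bsub>G\<^esub> i \<otimes>\<^bsub>G\<^esub> a [^]\<^bsub>G\<^esub> nat j" using y ij by (simp add: mc_elt_def)
  ultimately show ?thesis using that[of i "nat j"] by simp
qed

lemma semidirect_group:
  assumes M: "group M" and N: "group N" and \<phi>: "\<phi> \<in> hom N (AutoGroup M)"
  shows "group (semidirect M N \<phi>)"
proof -
  interpret M: group M by fact
  interpret N: group N by fact
  interpret A: group "AutoGroup M" by (rule M.AutoGroup)
  interpret P: group_hom N "AutoGroup M" \<phi> by (simp add: group_hom_def group_hom_axioms_def N.is_group A.is_group \<phi>)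
  have aut: "\<phi> n \<in> hom M M" "\<phi> n \<in> Bij (carrier M)" if "n \<in> carrier N" for n
    using P.hom_closed[OF that] by (auto simp: AutoGroup_def auto_def)
  have cl: "\<phi> n x \<in> carrier M" if "n \<in> carrier N" "x \<in> carrier M" for n x
    using aut(1)[OF that(1)] that(2) by (auto simp: hom_def)
  have mul: "\<phi> n (x \<otimes>\<^bsub>M\<^esub> y) = \<phi> n x \<otimes>\<^bsub>M\<^esub> \<phi> n y" if "n \<in> carrier N" "x \<in> carrier M" "y \<in> carrier M" for n x y
    using aut(1)[OF that(1)] that(2,3) by (auto simp: hom_def)
  have comp: "\<phi> (n \<otimes>\<^bsub>N\<^esub> n') x = \<phi> n (\<phi> n' x)" if "n \<in> carrier N" "n' \<in> carrier N" "x \<in> carrier M" for n n' x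
    using P.hom_mult[OF that(1,2)] that aut by (simp add: AutoGroup_def BijGroup_def compose_def)
  have one: "\<phi> \<one>\<^bsub>N\<^esub> x = x" if "x \<in> carrier M" for x
    using P.hom_one that by (simp add: AutoGroup_def BijGroup_def)
  show ?thesis
  proof (rule groupI)
    show "\<exists>y\<in>carrier (semidirect M N \<phi>). y \<otimes>\<^bsub>semidirect M N \<phi>\<^esub> x = \<one>\<^bsub>semidirect M N \<phi>\<^esub>"
      if xS: "x \<in> carrier (semidirect M N \<phi>)" for x
    proof -
      obtain u v where x: "x = (u, v)" "u \<in> carrier M" "v \<in> carrier N" using xS by (auto simp: semidirect_def)
      define w where "w = (inv\<^bsub>M\<^esub> (\<phi> (inv\<^bsub>N\<^esub> v) u), inv\<^bsub>N\<^esub> v)"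
      have "w \<otimes>\<^bsub>semidirect M N \<phi>\<^esub> x = \<one>\<^bsub>semidirect M N \<phi>\<^esub>"
        using x cl by (simp add: semidirect_def w_def del: P.hom_inv)
      moreover have "w \<in> carrier (semidirect M N \<phi>)"
        using x cl by (simp add: semidirect_def w_def del: P.hom_inv)
      ultimately show ?thesis by blast
    qed
  qed (auto simp: semidirect_def cl mul comp one M.m_assoc N.m_assoc simp del: P.hom_mult P.hom_one)
qed

lemma semidirect_split_mc:
  assumes nm: "1 < n" "1 < m" and \<phi>: "\<phi> \<in> hom (cyc m) (AutoGroup (cyc n))" and k: "\<phi> 1 (k mod int n) = 1"
  shows "split_mc (semidirect (cyc n) (cyc m) \<phi>) (1, 0) (0, 1) n m k"
proof -
  let ?S = "semidirect (cyc n) (cyc m) \<phi>"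
  interpret S: group ?S by (rule semidirect_group[OF group_integer_mod_group group_integer_mod_group \<phi>])
  interpret A: group "AutoGroup (cyc n)" by (rule group.AutoGroup[OF group_integer_mod_group])
  interpret P: group_hom "cyc m" "AutoGroup (cyc n)" \<phi>
    unfolding group_hom_def group_hom_axioms_def by (intro conjI group_integer_mod_group A.is_group \<phi>)
  have carr: "carrier ?S = {0..<int n} \<times> {0..<int m}" using nm by (simp add: semidirect_def carrier_integer_mod_group)
  have one: "\<phi> 0 x = x" if "x \<in> carrier (cyc n)" for x
    using P.hom_one that by (simp add: AutoGroup_def BijGroup_def)
  have aut: "\<phi> j \<in> hom (cyc n) (cyc n)" if "j \<in> carrier (cyc m)" for j
    using P.hom_closed[OF that] by (auto simp: AutoGroup_def auto_def)
  have zero: "\<phi> j 0 = 0" if "j \<in> carrier (cyc m)" for j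
    using Group.hom_one[OF aut[OF that]] by simp
  have Sone: "\<one>\<^bsub>?S\<^esub> = (0, 0)" by (simp add: semidirect_def)
  have pa: "(1, 0) [^]\<^bsub>?S\<^esub> (i::nat) = (int i mod int n, 0)" for i
  proof (induction i)
    case (Suc i)
    have "(1, 0) [^]\<^bsub>?S\<^esub> Suc i = (int i mod int n, 0) \<otimes>\<^bsub>?S\<^esub> (1, 0)" using Suc by simp
    also have "\<dots> = (int (Suc i) mod int n, 0)"
      using nm one[of 1] by (simp add: semidirect_def carrier_integer_mod_group mod_simps add.commute)
    finally show ?case .
  qed (use Sone in simp)
  have pb: "(0, 1) [^]\<^bsub>?S\<^esub> (i::nat) = (0, int i mod int m)" for i
  proof (induction i)
    case (Suc i)
    have "(0, 1) [^]\<^bsub>?S\<^esub> Suc i = (0, int i mod int m) \<otimes>\<^bsub>?S\<^esub> (0, 1)" using Suc by simp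
    also have "\<dots> = (0, int (Suc i) mod int m)"
      using nm zero[of "int i mod int m"] by (simp add: semidirect_def carrier_integer_mod_group mod_simps add.commute)
    finally show ?case .
  qed (use Sone in simp)
  have r: "mc_rel ?S (1, 0) (0, 1) n m k"
  proof (rule S.mc_relI)
    have e: "int (nat (k mod int n)) mod int n = k mod int n" using nm by simp
    show "(1, 0) \<otimes>\<^bsub>?S\<^esub> (0, 1) = (0, 1) \<otimes>\<^bsub>?S\<^esub> (1, 0) [^]\<^bsub>?S\<^esub> nat (k mod int n)"
      unfolding pa e using nm k one[of 0] by (simp add: semidirect_def carrier_integer_mod_group)
  qed (use nm pa pb Sone carr in auto)
  have "carrier ?S \<subseteq> generate ?S {(1, 0), (0, 1)}"
  proof
    fix x assume "x \<in> carrier ?S"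
    then obtain i j where x: "x = (i, j)" "0 \<le> i" "i < int n" "0 \<le> j" "j < int m" using carr by auto
    have s: "subgroup (generate ?S {(1, 0), (0, 1)}) ?S" using nm carr by (intro S.generate_is_subgroup) auto
    have "(1, 0) [^]\<^bsub>?S\<^esub> (int (nat i)) \<otimes>\<^bsub>?S\<^esub> (0, 1) [^]\<^bsub>?S\<^esub> (int (nat j)) \<in> generate ?S {(1, 0), (0, 1)}"
      by (intro subgroup.m_closed[OF s] S.subgroup_int_pow_closed[OF s] generate.incl) auto
    moreover have "(1, 0) [^]\<^bsub>?S\<^esub> (int (nat i)) \<otimes>\<^bsub>?S\<^esub> (0, 1) [^]\<^bsub>?S\<^esub> (int (nat j)) = x"
      unfolding int_pow_int pa pb using x nm one[of 0] by (simp add: semidirect_def carrier_integer_mod_group)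
    ultimately show "x \<in> generate ?S {(1, 0), (0, 1)}" by simp
  qed
  moreover have "generate ?S {(1, 0), (0, 1)} \<subseteq> carrier ?S" using nm carr by (intro S.generate_incl) auto
  moreover have "card (carrier ?S) = n * m" using carr by (simp add: card_cartesian_product)
  ultimately show ?thesis using r S.is_group by (auto simp: split_mc_def)
qed

text \<open>
  As b^-1 a b = a^k, the generator b has to act by the inverse of k, which is k^(m-1) modulo n.
\<close>
definition mult_action :: "nat => nat => int => int => int => int" where
  "mult_action n m k = (\<lambda>j. \<lambda>i\<in>{0..<int n}. (i * (k ^ (m - 1)) ^ nat j) mod int n)"

lemma mult_action_hom:
  assumes nm: "1 < n" "1 < m" and k: "[k ^ m = 1] (mod int n)"
  shows "mult_action n m k \<in> hom (cyc m) (AutoGroup (cyc n))"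
proof -
  define l where "l = k ^ (m - 1)"
  have "l ^ m = (k ^ m) ^ (m - 1)" by (simp add: l_def power_mult[symmetric] mult.commute)
  then have lm: "[l ^ m = 1] (mod int n)" using cong_pow[OF k, of "m - 1"] by simp
  have lcong: "[l ^ (x mod m) = l ^ x] (mod int n)" for x
  proof -
    have "l ^ x = (l ^ m) ^ (x div m) * l ^ (x mod m)" by (simp add: power_mult[symmetric] power_add[symmetric])
    moreover have "[(l ^ m) ^ (x div m) * l ^ (x mod m) = 1 * l ^ (x mod m)] (mod int n)"
      using cong_pow[OF lm, of "x div m"] by (intro cong_mult) simp_all
    ultimately show ?thesis by (simp add: cong_sym)
  qed
  have cn: "carrier (cyc n) = {0..<int n}" "carrier (cyc m) = {0..<int m}" using nm by (simp_all add: carrier_integer_mod_group)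
  have act: "mult_action n m k j i = (i * l ^ nat j) mod int n" if "i \<in> {0..<int n}" for i j
    using that by (simp add: mult_action_def l_def)
  have act_cl: "mult_action n m k j i \<in> {0..<int n}" if "i \<in> {0..<int n}" for i j
    using act[OF that] nm by simp
  have comp: "mult_action n m k j (mult_action n m k j' i) = mult_action n m k ((j + j') mod int m) i"
    if "j \<in> {0..<int m}" "j' \<in> {0..<int m}" "i \<in> {0..<int n}" for j j' i
  proof -
    have "mult_action n m k j (mult_action n m k j' i) = (i * l ^ (nat j' + nat j)) mod int n"
      using act_cl[OF that(3)] that by (simp add: act mod_mult_left_eq power_add mult.assoc)
    moreover have "nat ((j + j') mod int m) = (nat j' + nat j) mod m"
      using that by (simp add: nat_mod_distrib nat_add_distrib add.commute)
    moreover have "[i * l ^ ((nat j' + nat j) mod m) = i * l ^ (nat j' + nat j)] (mod int n)"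
      using lcong by (intro cong_mult) simp_all
    ultimately show ?thesis using that by (simp add: act cong_def)
  qed
  have act0: "mult_action n m k 0 i = i" if "i \<in> {0..<int n}" for i using act[OF that, of 0] that by simp
  have hom: "mult_action n m k j \<in> hom (cyc n) (cyc n)" if "j \<in> {0..<int m}" for j
    by (rule homI) (use cn act_cl nm in \<open>auto simp: act distrib_right mod_simps\<close>)
  have bij: "mult_action n m k j \<in> Bij (carrier (cyc n))" if j: "j \<in> {0..<int m}" for j
  proof -
    let ?j = "(- j) mod int m"
    have jj: "?j \<in> {0..<int m}" using nm by simp
    have e: "(j + ?j) mod int m = 0" "(?j + j) mod int m = 0" by (simp_all add: mod_simps)
    have "bij_betw (mult_action n m k j) {0..<int n} {0..<int n}"
      by (rule bij_betwI[of _ _ _ "mult_action n m k ?j"])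
         (use act_cl comp[OF j jj] comp[OF jj j] e act0 in auto)
    then show ?thesis by (simp add: Bij_def cn mult_action_def)
  qed
  show ?thesis
  proof (rule homI)
    show "mult_action n m k j \<in> carrier (AutoGroup (cyc n))" if "j \<in> carrier (cyc m)" for j
      using hom bij that cn by (simp add: AutoGroup_def auto_def)
    show "mult_action n m k (i \<otimes>\<^bsub>cyc m\<^esub> j) = mult_action n m k i \<otimes>\<^bsub>AutoGroup (cyc n)\<^esub> mult_action n m k j"
      if ij: "i \<in> carrier (cyc m)" "j \<in> carrier (cyc m)" for i j
    proof (rule HOL.ext)
      fix x
      have b: "mult_action n m k i \<in> Bij {0..<int n}" "mult_action n m k j \<in> Bij {0..<int n}" using bij ij cn by auto
      show "mult_action n m k (i \<otimes>\<^bsub>cyc m\<^esub> j) x = (mult_action n m k i \<otimes>\<^bsub>AutoGroup (cyc n)\<^esub> mult_action n m k j) x"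
      proof (cases "x \<in> {0..<int n}")
        case True then show ?thesis using comp[of i j x] ij cn b by (simp add: AutoGroup_def BijGroup_def compose_def)
      next
        case False
        then have "mult_action n m k t x = undefined" for t by (simp only: mult_action_def restrict_apply if_False)
        then show ?thesis using False b by (auto simp: AutoGroup_def BijGroup_def compose_def cn)
      qed
    qed
  qed
qed

lemma mult_action_inverse:
  assumes nm: "1 < n" "1 < m" and k: "[k ^ m = 1] (mod int n)"
  shows "mult_action n m k 1 (k mod int n) = 1"
proof -
  have "k * k ^ (m - 1) = k ^ m" using nm by (simp add: power_Suc[symmetric])
  then have "mult_action n m k 1 (k mod int n) = k ^ m mod int n" using nm by (simp add: mult_action_def mod_mult_left_eq)
  then show ?thesis using k nm by (simp add: cong_def)
qed

lemma split_mc_model: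
  assumes "1 < n" "1 < m" "[k ^ m = 1] (mod int n)"
  shows "split_mc (semidirect (cyc n) (cyc m) (mult_action n m k)) (1, 0) (0, 1) n m k"
  by (rule semidirect_split_mc[OF assms(1,2) mult_action_hom[OF assms] mult_action_inverse[OF assms]])

lemma nat_pow_DirProd:
  "(x, y) [^]\<^bsub>G \<times>\<times> H\<^esub> (n::nat) = (x [^]\<^bsub>G\<^esub> n, y [^]\<^bsub>H\<^esub> n)"
  by (induction n) simp_all

lemma int_pow_DirProd:
  assumes "group G" "group H" "x \<in> carrier G" "y \<in> carrier H"
  shows "(x, y) [^]\<^bsub>G \<times>\<times> H\<^esub> (n::int) = (x [^]\<^bsub>G\<^esub> n, y [^]\<^bsub>H\<^esub> n)"
proof -
  interpret G: group G by fact
  interpret H: group H by fact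
  interpret D: group "G \<times>\<times> H" by (rule DirProd_group[OF assms(1,2)])
  show ?thesis using assms(3,4)
    by (cases n rule: int_cases2) (simp_all add: int_pow_int G.int_pow_neg_int H.int_pow_neg_int D.int_pow_neg_int nat_pow_DirProd G.is_group H.is_group)
qed

text \<open>
  The exponent K is given by the Chinese remainder theorem.
\<close>
lemma split_mc_DirProd:
  assumes H: "split_mc H a b n m k" and r: "1 < r" "coprime r n" and K: "[K = 1] (mod int r)" "[K = k] (mod int n)"
  shows "split_mc (cyc r \<times>\<times> H) (1, a) (0, b) (r * n) m K"
proof -
  interpret H: group H using H by (simp add: split_mc_def)
  let ?D = "cyc r \<times>\<times> H"
  interpret D: group ?D by (rule DirProd_group[OF group_integer_mod_group H.is_group])
  have rH: "mc_rel H a b n m k" using H by (simp add: split_mc_def)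
  then have ab: "a \<in> carrier H" "b \<in> carrier H" "0 < n" "0 < m" "a [^]\<^bsub>H\<^esub> n = \<one>\<^bsub>H\<^esub>" "b [^]\<^bsub>H\<^esub> m = \<one>\<^bsub>H\<^esub>" "a \<otimes>\<^bsub>H\<^esub> b = b \<otimes>\<^bsub>H\<^esub> a [^]\<^bsub>H\<^esub> k"
    by (auto simp: mc_rel_def)
  have c: "(1::int) \<in> carrier (cyc r)" "(0::int) \<in> carrier (cyc r)" using r by (auto simp: carrier_integer_mod_group)
  have pw: "(1, a) [^]\<^bsub>?D\<^esub> (j::int) = (j mod int r, a [^]\<^bsub>H\<^esub> j)" "(0, b) [^]\<^bsub>?D\<^esub> (i::nat) = (0, b [^]\<^bsub>H\<^esub> i)" for i j
    using int_pow_DirProd[OF group_integer_mod_group H.is_group c(1) ab(1), of j]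
    by (simp_all add: int_pow_integer_mod_group nat_pow_DirProd)
  have aK: "a [^]\<^bsub>H\<^esub> K = a [^]\<^bsub>H\<^esub> k" using H.int_pow_cong[OF ab(1,5) K(2)] .
  have an: "(1, a) [^]\<^bsub>?D\<^esub> (r * n) = \<one>\<^bsub>?D\<^esub>"
  proof -
    have "a [^]\<^bsub>H\<^esub> (r * n) = \<one>\<^bsub>H\<^esub>" using H.nat_pow_pow[OF ab(1), of n r] ab(5) by (simp add: mult.commute)
    then show ?thesis by (simp add: nat_pow_DirProd)
  qed
  have rel: "mc_rel ?D (1, a) (0, b) (r * n) m K"
    unfolding mc_rel_def
  proof (intro conjI)
    show "(1, a) \<otimes>\<^bsub>?D\<^esub> (0, b) = (0, b) \<otimes>\<^bsub>?D\<^esub> (1, a) [^]\<^bsub>?D\<^esub> K"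
      unfolding pw using K(1) r ab aK by (simp add: cong_def)
  qed (use c ab an pw r in auto)
  have "carrier ?D \<subseteq> generate ?D {(1, a), (0, b)}"
  proof
    fix x assume "x \<in> carrier ?D"
    then obtain c0 h where x: "x = (c0, h)" "0 \<le> c0" "c0 < int r" "h \<in> carrier H"
      using r by (auto simp: carrier_integer_mod_group)
    obtain i j :: nat where h: "h = b [^]\<^bsub>H\<^esub> i \<otimes>\<^bsub>H\<^esub> a [^]\<^bsub>H\<^esub> j" "i < m" "j < n"
      using split_mc_elt[OF H x(4)] .
    obtain J where J: "[J = c0] (mod int r)" "[J = int j] (mod int n)"
      using binary_chinese_remainder_int[of "int r" "int n" c0 "int j"] r by auto
    have s: "subgroup (generate ?D {(1, a), (0, b)}) ?D" using c ab by (intro D.generate_is_subgroup) auto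
    have "(0, b) [^]\<^bsub>?D\<^esub> int i \<otimes>\<^bsub>?D\<^esub> (1, a) [^]\<^bsub>?D\<^esub> J \<in> generate ?D {(1, a), (0, b)}"
      by (intro subgroup.m_closed[OF s] D.subgroup_int_pow_closed[OF s] generate.incl) auto
    moreover have "(0, b) [^]\<^bsub>?D\<^esub> int i \<otimes>\<^bsub>?D\<^esub> (1, a) [^]\<^bsub>?D\<^esub> J = x"
      unfolding int_pow_int pw using x h(1) J(1) H.int_pow_cong[OF ab(1,5) J(2)] by (simp add: cong_def int_pow_int)
    ultimately show "x \<in> generate ?D {(1, a), (0, b)}" by simp
  qed
  moreover have "generate ?D {(1, a), (0, b)} \<subseteq> carrier ?D" using c ab by (intro D.generate_incl) auto
  moreover have "card (carrier ?D) = r * n * m" using H r by (simp add: card_cartesian_product carrier_integer_mod_group split_mc_def)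
  ultimately show ?thesis using rel D.is_group by (auto simp: split_mc_def)
qed

lemma split_mc_cyc_cyc:
  assumes nm: "1 < n" "1 < m" shows "split_mc (cyc m \<times>\<times> cyc n) (0, 1) (1, 0) n m 1"
proof -
  let ?D = "cyc m \<times>\<times> cyc n"
  interpret D: group ?D by (rule DirProd_group[OF group_integer_mod_group group_integer_mod_group])
  have pw: "(0, 1) [^]\<^bsub>?D\<^esub> (j::nat) = (0, int j mod int n)" "(1, 0) [^]\<^bsub>?D\<^esub> (i::nat) = (int i mod int m, 0)" for i j
    by (simp_all add: nat_pow_DirProd)
  have c: "(0, 1) \<in> carrier ?D" "(1, 0) \<in> carrier ?D" using nm by (auto simp: carrier_integer_mod_group)
  have rel: "mc_rel ?D (0, 1) (1, 0) n m 1" unfolding mc_rel_def using nm c pw D.int_pow_1[OF c(1)] by auto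
  have "carrier ?D \<subseteq> generate ?D {(0, 1), (1, 0)}"
  proof
    fix x assume "x \<in> carrier ?D"
    then obtain i j where x: "x = (i, j)" "0 \<le> i" "i < int m" "0 \<le> j" "j < int n"
      using nm by (auto simp: carrier_integer_mod_group)
    have s: "subgroup (generate ?D {(0, 1), (1, 0)}) ?D" using c by (intro D.generate_is_subgroup) blast
    have "(1, 0) [^]\<^bsub>?D\<^esub> int (nat i) \<otimes>\<^bsub>?D\<^esub> (0, 1) [^]\<^bsub>?D\<^esub> int (nat j) \<in> generate ?D {(0, 1), (1, 0)}"
      by (intro subgroup.m_closed[OF s] D.subgroup_int_pow_closed[OF s] generate.incl) auto
    moreover have "(1, 0) [^]\<^bsub>?D\<^esub> int (nat i) \<otimes>\<^bsub>?D\<^esub> (0, 1) [^]\<^bsub>?D\<^esub> int (nat j) = x"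
      unfolding int_pow_int pw using x by simp
    ultimately show "x \<in> generate ?D {(0, 1), (1, 0)}" by simp
  qed
  moreover have "generate ?D {(0, 1), (1, 0)} \<subseteq> carrier ?D" using c by (intro D.generate_incl) blast
  moreover have "card (carrier ?D) = n * m" using nm by (simp add: card_cartesian_product carrier_integer_mod_group)
  ultimately show ?thesis using rel D.is_group by (auto simp: split_mc_def)
qed

section \<open>Free groups and presentations\<close>

lemma word_rel_equiv: "equiv UNIV word_rel"
proof (rule equivI)
  show "refl word_rel" by (auto simp: refl_on_def word_rel_def)
  show "sym word_rel" by (auto simp: sym_def word_rel_def dest: equivclp_sym)
  show "trans word_rel" by (auto simp: trans_def word_rel_def intro: equivclp_trans)
qed simp

lemma cancel_step_append:
  assumes "cancel_step u v" shows "cancel_step (a @ u @ b) (a @ v @ b)"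
  using assms
proof cases
  case (1 u0 x c v0)
  then show ?thesis using cancel_step.intros[of "a @ u0" x c "v0 @ b"] by simp
qed

lemma word_rel_append1:
  assumes "(u, v) \<in> word_rel" shows "(a @ u @ b, a @ v @ b) \<in> word_rel"
proof -
  have "equivclp cancel_step u v" using assms by (simp add: word_rel_def)
  then have "equivclp cancel_step (a @ u @ b) (a @ v @ b)"
  proof (induction rule: equivclp_induct)
    case (step y z)
    then have "cancel_step (a @ y @ b) (a @ z @ b) \<or> cancel_step (a @ z @ b) (a @ y @ b)"
      using cancel_step_append by blast
    then show ?case using step.IH equivclp_into_equivclp by metis
  qed simp
  then show ?thesis by (simp add: word_rel_def)
qed

lemma word_rel_refl: "(u, u) \<in> word_rel" by (simp add: word_rel_def)

lemma word_rel_append: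
  assumes "(u, v) \<in> word_rel" "(s, t) \<in> word_rel" shows "(u @ s, v @ t) \<in> word_rel"
proof -
  have "(u @ s, v @ s) \<in> word_rel" using word_rel_append1[OF assms(1), of "[]" s] by simp
  moreover have "(v @ s, v @ t) \<in> word_rel" using word_rel_append1[OF assms(2), of v "[]"] by simp
  ultimately show ?thesis using word_rel_equiv by (meson equivE transE)
qed

abbreviation wclass :: "'x word => 'x word set" where "wclass u \<equiv> word_rel `` {u}"

lemma wclass_eq_iff: "wclass u = wclass v \<longleftrightarrow> (u, v) \<in> word_rel"
  using eq_equiv_class_iff[OF word_rel_equiv] by simp

lemma wclass_mem: "v \<in> wclass u \<longleftrightarrow> (u, v) \<in> word_rel" by simp

lemma carrier_free_group: "carrier free_group = range wclass"
  by (auto simp: free_group_def quotient_def)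

lemma one_free_group: "\<one>\<^bsub>free_group\<^esub> = wclass []"
  by (simp add: free_group_def)

lemma mult_free_group: "wclass u \<otimes>\<^bsub>free_group\<^esub> wclass v = wclass (u @ v)"
proof -
  have 1: "wclass (u' @ v') = wclass (u @ v)" if "u' \<in> wclass u" "v' \<in> wclass v" for u' v'
    using word_rel_append[of u u' v v'] that unfolding wclass_mem by (intro wclass_eq_iff[THEN iffD2, symmetric])
  have ne: "wclass u \<noteq> {}" for u :: "'x word" using word_rel_refl[of u] by blast
  have "(\<Union>v'\<in>wclass v. wclass (u' @ v')) = wclass (u @ v)" if "u' \<in> wclass u" for u'
    by (rule SUP_eq_const[OF ne 1[OF that]])
  then have "(\<Union>u'\<in>wclass u. \<Union>v'\<in>wclass v. wclass (u' @ v')) = wclass (u @ v)"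
    by (rule SUP_eq_const[OF ne])
  then show ?thesis unfolding free_group_def by simp
qed

definition word_inv :: "'x word => 'x word" where
  "word_inv w = rev (map (\<lambda>(x, s). (x, \<not> s)) w)"

lemma word_inv_cancel: "(word_inv w @ w, []) \<in> word_rel"
proof (induction w)
  case (Cons l w)
  obtain x s where l: "l = (x, s)" by fastforce
  have "cancel_step (word_inv w @ [(x, \<not> s), (x, \<not> \<not> s)] @ w) (word_inv w @ w)" by (rule cancel_step.intros)
  then have "(word_inv (l # w) @ l # w, word_inv w @ w) \<in> word_rel"
    by (simp add: word_inv_def l word_rel_def r_into_equivclp)
  then show ?case using Cons word_rel_equiv by (meson equivE transE)
qed (simp add: word_inv_def word_rel_refl)

lemma group_free_group: "group (free_group :: 'x word set monoid)"
proof (rule groupI)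
  fix A B C :: "'x word set"
  assume "A \<in> carrier free_group" "B \<in> carrier free_group" "C \<in> carrier free_group"
  then obtain u v w where "A = wclass u" "B = wclass v" "C = wclass w" by (auto simp: carrier_free_group)
  then show "A \<otimes>\<^bsub>free_group\<^esub> B \<otimes>\<^bsub>free_group\<^esub> C = A \<otimes>\<^bsub>free_group\<^esub> (B \<otimes>\<^bsub>free_group\<^esub> C)"
    by (simp only: mult_free_group append_assoc)
next
  fix A B :: "'x word set"
  assume "A \<in> carrier free_group" "B \<in> carrier free_group"
  then obtain u v where "A = wclass u" "B = wclass v" by (auto simp: carrier_free_group)
  then show "A \<otimes>\<^bsub>free_group\<^esub> B \<in> carrier free_group"
    by (simp only: mult_free_group carrier_free_group) blast
next
  fix A :: "'x word set"
  assume "A \<in> carrier free_group"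
  then obtain u where u: "A = wclass u" by (auto simp: carrier_free_group)
  show "\<one>\<^bsub>free_group\<^esub> \<otimes>\<^bsub>free_group\<^esub> A = A" by (simp only: u one_free_group mult_free_group append_Nil)
  show "\<exists>B\<in>carrier free_group. B \<otimes>\<^bsub>free_group\<^esub> A = \<one>\<^bsub>free_group\<^esub>"
  proof
    show "wclass (word_inv u) \<otimes>\<^bsub>free_group\<^esub> A = \<one>\<^bsub>free_group\<^esub>"
      unfolding u one_free_group mult_free_group wclass_eq_iff by (rule word_inv_cancel)
    show "wclass (word_inv u) \<in> carrier free_group" by (simp add: carrier_free_group)
  qed
next
  show "\<one>\<^bsub>free_group\<^esub> \<in> carrier (free_group :: 'x word set monoid)" by (simp add: carrier_free_group one_free_group)
qed

interpretation free: group "free_group :: 'x word set monoid" by (rule group_free_group)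

lemma free_gen_closed [simp]: "free_gen x \<in> carrier free_group"
  by (simp add: free_gen_def carrier_free_group)

lemma free_group_generated: "generate free_group (range free_gen) = carrier (free_group :: 'x word set monoid)"
proof
  show "generate free_group (range free_gen) \<subseteq> carrier (free_group :: 'x word set monoid)"
    by (rule free.generate_incl) (simp add: image_subset_iff)
  show "carrier (free_group :: 'x word set monoid) \<subseteq> generate free_group (range free_gen)"
  proof
    fix A :: "'x word set" assume "A \<in> carrier free_group"
    then obtain w where w: "A = wclass w" by (auto simp: carrier_free_group)
    have "wclass w \<in> generate free_group (range free_gen)"
    proof (induction w)
      case Nil then show ?case using generate.one[of free_group] by (simp only: one_free_group)
    next
      case (Cons l w)
      obtain x s where l: "l = (x, s)" by fastforce
      have "wclass [l] \<in> generate free_group (range free_gen)"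
      proof (cases s)
        case True
        then have "wclass [l] = free_gen x" by (simp add: l free_gen_def)
        then show ?thesis by (auto intro: generate.incl)
      next
        case False
        have "wclass [l] = inv\<^bsub>free_group\<^esub> (free_gen x)"
        proof (rule free.inv_equality[symmetric])
          have "([(x, False), (x, True)], []) \<in> word_rel" using word_inv_cancel[of "[(x, True)]"] by (simp add: word_inv_def)
          then show "wclass [l] \<otimes>\<^bsub>free_group\<^esub> free_gen x = \<one>\<^bsub>free_group\<^esub>"
            using False by (simp only: l free_gen_def mult_free_group one_free_group wclass_eq_iff append.simps)
        qed (simp_all add: carrier_free_group free_gen_def)
        then show ?thesis by (auto intro: generate.inv)
      qed
      then have "wclass [l] \<otimes>\<^bsub>free_group\<^esub> wclass w \<in> generate free_group (range free_gen)"
        using Cons by (rule generate.eng)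
      then show ?case by (simp only: mult_free_group append.simps)
    qed
    then show "A \<in> generate free_group (range free_gen)" using w by simp
  qed
qed

definition word_eval :: "('a, 'b) monoid_scheme => ('x => 'a) => 'x word => 'a" where
  "word_eval G f w = foldr (\<lambda>(x, s) g. (if s then f x else inv\<^bsub>G\<^esub> (f x)) \<otimes>\<^bsub>G\<^esub> g) w \<one>\<^bsub>G\<^esub>"

context group begin

lemma word_eval_closed: "(\<And>x. f x \<in> carrier G) ==> word_eval G f w \<in> carrier G"
  by (induction w) (auto simp: word_eval_def)

lemma word_eval_append:
  "(\<And>x. f x \<in> carrier G) ==> word_eval G f (u @ v) = word_eval G f u \<otimes> word_eval G f v"
proof (induction u)
  case Nil then show ?case using word_eval_closed[of f v] by (simp add: word_eval_def)
next
  case (Cons l u)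
  then show ?case using word_eval_closed[of f u] word_eval_closed[of f v]
    by (cases l) (simp add: word_eval_def m_assoc)
qed

lemma word_eval_cancel_step:
  assumes f: "\<And>x. f x \<in> carrier G" and "cancel_step u v" shows "word_eval G f u = word_eval G f v"
  using assms(2)
proof cases
  case (1 u0 x b v0)
  have "word_eval G f [(x, b), (x, \<not> b)] = \<one>" using f by (cases b) (simp_all add: word_eval_def)
  then show ?thesis unfolding 1 word_eval_append[where f = f, OF f] using word_eval_closed[where f = f, OF f] by simp
qed

lemma word_eval_rel:
  assumes f: "\<And>x. f x \<in> carrier G" and "(u, v) \<in> word_rel" shows "word_eval G f u = word_eval G f v"
proof -
  have "equivclp cancel_step u v" using assms(2) by (simp add: word_rel_def)
  then show ?thesis
  proof (induction rule: equivclp_induct)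
    case (step y z)
    then show ?case using word_eval_cancel_step[where f = f, OF f, of y z] word_eval_cancel_step[where f = f, OF f, of z y] by auto
  qed simp
qed

lemma free_group_hom:
  assumes f: "\<And>x. f x \<in> carrier G"
  obtains h where "h \<in> hom free_group G" "\<And>x. h (free_gen x) = f x"
proof -
  define h where "h = (\<lambda>A. word_eval G f (SOME u. u \<in> A))"
  have h: "h (wclass u) = word_eval G f u" for u
  proof -
    have "(SOME v. v \<in> wclass u) \<in> wclass u" by (rule someI[of _ u]) (simp add: word_rel_refl)
    then have "(u, SOME v. v \<in> wclass u) \<in> word_rel" by simp
    from word_eval_rel[where f = f, OF f this] show ?thesis unfolding h_def by simp
  qed
  have "h \<in> hom free_group G"
  proof (rule homI)
    show "h A \<in> carrier G" if "A \<in> carrier free_group" for A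
      using that h word_eval_closed[where f = f, OF f] by (auto simp: carrier_free_group)
    show "h (A \<otimes>\<^bsub>free_group\<^esub> B) = h A \<otimes> h B" if AB: "A \<in> carrier free_group" "B \<in> carrier free_group" for A B
    proof -
      obtain u v where "A = wclass u" "B = wclass v" using AB by (auto simp: carrier_free_group)
      then show ?thesis by (simp only: mult_free_group h word_eval_append[where f = f, OF f])
    qed
  qed
  moreover have "h (free_gen x) = f x" for x unfolding free_gen_def h using f by (simp add: word_eval_def)
  ultimately show ?thesis using that by blast
qed

lemma normal_closure_normal:
  assumes "R \<subseteq> carrier G" shows "normal_closure G R \<lhd> G" "R \<subseteq> normal_closure G R"
proof -
  have sub: "(\<Union>g\<in>carrier G. conjugate_set G g R) \<subseteq> carrier G"
    using assms by (auto simp: conjugate_set_def)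
  show "normal_closure G R \<lhd> G"
    unfolding normal_closure_def
  proof (rule normal_generateI[OF sub])
    fix h g assume h: "h \<in> (\<Union>g\<in>carrier G. conjugate_set G g R)" and g: "g \<in> carrier G"
    then obtain g' r where g': "g' \<in> carrier G" "r \<in> R" "h = conj_el G g' r" by (auto simp: conjugate_set_conj_el)
    then have "g \<otimes> h \<otimes> inv g = conj_el G (g \<otimes> g') r"
      using g assms conj_mult_left[of g g' r] by (auto simp: conj_el_def[of G g])
    then show "g \<otimes> h \<otimes> inv g \<in> (\<Union>g\<in>carrier G. conjugate_set G g R)"
      using g g' by (auto simp: conjugate_set_conj_el)
  qed
  show "R \<subseteq> normal_closure G R"
  proof
    fix r assume r: "r \<in> R"
    then have "r = conj_el G \<one> r" using assms by auto
    then have "r \<in> conjugate_set G \<one> R" using r by (auto simp: conjugate_set_conj_el)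
    then show "r \<in> normal_closure G R" unfolding normal_closure_def by (intro generate.incl) auto
  qed
qed

end

lemma (in group_hom) normal_closure_kernel:
  assumes "R \<subseteq> carrier G" "\<And>r. r \<in> R ==> h r = \<one>\<^bsub>H\<^esub>" "x \<in> normal_closure G R"
  shows "h x = \<one>\<^bsub>H\<^esub>"
proof -
  have "subgroup (kernel G H h) G" using normal_kernel normal_imp_subgroup by blast
  moreover have "(\<Union>g\<in>carrier G. conjugate_set G g R) \<subseteq> kernel G H h"
    using assms(1,2) by (auto simp: conjugate_set_def kernel_def subset_iff)
  ultimately have "normal_closure G R \<subseteq> kernel G H h"
    unfolding normal_closure_def by (intro G.generate_subgroup_incl)
  then show ?thesis using assms(3) by (auto simp: kernel_def)
qed

text \<open>
  The relators hold in the presented group, which therefore has at most n m elements. It maps onto the semidirect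
  product, so it has at least that many.
\<close>
lemma presented_split_mc:
  fixes ga gb :: two_gens
  assumes g: "{ga, gb} = UNIV" "ga \<noteq> gb" and nm: "1 < n" "1 < m" and k: "[k ^ m = 1] (mod int n)"
    and R: "R = {free_gen ga [^]\<^bsub>F2\<^esub> n, free_gen gb [^]\<^bsub>F2\<^esub> m,
      (inv\<^bsub>F2\<^esub> free_gen gb \<otimes>\<^bsub>F2\<^esub> free_gen ga \<otimes>\<^bsub>F2\<^esub> free_gen gb) \<otimes>\<^bsub>F2\<^esub> inv\<^bsub>F2\<^esub> (free_gen ga [^]\<^bsub>F2\<^esub> k)}"
  shows "\<exists>a b. split_mc (presented_group R) a b n m k"
proof -
  let ?N = "normal_closure F2 R" and ?P = "presented_group R"
  have Rc: "R \<subseteq> carrier F2" unfolding R by auto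
  interpret N: normal ?N F2 using free.normal_closure_normal[OF Rc] by blast
  have P: "?P = F2 Mod ?N" by (simp add: presented_group_def)
  interpret P: group ?P unfolding P by (rule N.factorgroup_is_group)
  define \<pi> where "\<pi> = (\<lambda>a. ?N #>\<^bsub>F2\<^esub> a)"
  have hom\<pi>: "\<pi> \<in> hom F2 ?P" unfolding P \<pi>_def by (rule N.r_coset_hom_Mod)
  interpret \<pi>: group_hom F2 ?P \<pi> using hom\<pi> by (simp add: group_hom_def group_hom_axioms_def free.is_group P.is_group)
  have one: "\<pi> r = \<one>\<^bsub>?P\<^esub>" if "r \<in> R" for r
  proof -
    have "r \<in> ?N" using free.normal_closure_normal(2)[OF Rc] that by blast
    then show ?thesis unfolding P \<pi>_def using free.coset_join2[OF _ N.subgroup_axioms] by simp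
  qed
  let ?a = "\<pi> (free_gen ga)" and ?b = "\<pi> (free_gen gb)"
  have rel: "mc_rel ?P ?a ?b n m k"
    unfolding mc_rel_def
  proof (intro conjI)
    show "?a [^]\<^bsub>?P\<^esub> n = \<one>\<^bsub>?P\<^esub>" using one[of "free_gen ga [^]\<^bsub>F2\<^esub> n"] by (simp add: R \<pi>.hom_nat_pow)
    show "?b [^]\<^bsub>?P\<^esub> m = \<one>\<^bsub>?P\<^esub>" using one[of "free_gen gb [^]\<^bsub>F2\<^esub> m"] by (simp add: R \<pi>.hom_nat_pow)
    have "inv\<^bsub>?P\<^esub> ?b \<otimes>\<^bsub>?P\<^esub> ?a \<otimes>\<^bsub>?P\<^esub> ?b \<otimes>\<^bsub>?P\<^esub> inv\<^bsub>?P\<^esub> (?a [^]\<^bsub>?P\<^esub> k) = \<one>\<^bsub>?P\<^esub>"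
      using one[of "(inv\<^bsub>F2\<^esub> free_gen gb \<otimes>\<^bsub>F2\<^esub> free_gen ga \<otimes>\<^bsub>F2\<^esub> free_gen gb) \<otimes>\<^bsub>F2\<^esub> inv\<^bsub>F2\<^esub> (free_gen ga [^]\<^bsub>F2\<^esub> k)"]
      by (simp add: R \<pi>.hom_int_pow)
    then have "inv\<^bsub>?P\<^esub> ?b \<otimes>\<^bsub>?P\<^esub> ?a \<otimes>\<^bsub>?P\<^esub> ?b = ?a [^]\<^bsub>?P\<^esub> k"
      by (simp add: P.inv_solve_right')
    then show "?a \<otimes>\<^bsub>?P\<^esub> ?b = ?b \<otimes>\<^bsub>?P\<^esub> ?a [^]\<^bsub>?P\<^esub> k"
      by (simp add: P.m_assoc P.inv_solve_left')
  qed (use nm in simp_all)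
  have range: "range free_gen = {free_gen ga, free_gen gb}" using g(1) by (metis image_empty image_insert)
  have genF: "generate F2 {free_gen ga, free_gen gb} = carrier F2"
    using free_group_generated[where ?'x = two_gens] unfolding range .
  have gen: "generate ?P {?a, ?b} = carrier ?P"
  proof -
    have "generate ?P (\<pi> ` {free_gen ga, free_gen gb}) = \<pi> ` generate F2 {free_gen ga, free_gen gb}"
      by (rule \<pi>.generate_img) auto
    also have "\<dots> = \<pi> ` carrier F2" using genF by simp
    also have "\<dots> = carrier ?P" unfolding P \<pi>_def by (simp add: carrier_FactGroup)
    finally show ?thesis by simp
  qed
  have img: "carrier ?P = mc_elt ?P ?a ?b ` mc_index n m" using P.mc_generate[OF rel] gen by simp
  then have fin: "finite (carrier ?P)" by simp
  have le: "card (carrier ?P) \<le> n * m" unfolding img card_mc_index[symmetric] by (rule card_image_le) simp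
  let ?M = "semidirect (cyc n) (cyc m) (mult_action n m k)"
  have M: "split_mc ?M (1, 0) (0, 1) n m k" by (rule split_mc_model[OF nm k])
  interpret M: group ?M using M by (simp add: split_mc_def)
  define f where "f = (\<lambda>x. if x = ga then (1, 0) else (0, 1) :: int \<times> int)"
  have f: "f ga = (1, 0)" "f gb = (0, 1)" using g by (auto simp: f_def)
  have relM: "mc_rel ?M (1, 0) (0, 1) n m k" using M by (simp add: split_mc_def)
  then have ab: "(1, 0) \<in> carrier ?M" "(0, 1) \<in> carrier ?M" by (auto simp: mc_rel_def)
  then have fc: "f x \<in> carrier ?M" for x by (simp add: f_def)
  obtain h where h: "h \<in> hom F2 ?M" "\<And>x. h (free_gen x) = f x" using M.free_group_hom[of f, OF fc] by blast
  interpret h: group_hom F2 ?M h using h by (simp add: group_hom_def group_hom_axioms_def free.is_group M.is_group)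
  have hR: "h r = \<one>\<^bsub>?M\<^esub>" if "r \<in> R" for r
  proof -
    have "(1, 0) \<otimes>\<^bsub>?M\<^esub> (0, 1) = (0, 1) \<otimes>\<^bsub>?M\<^esub> (1, 0) [^]\<^bsub>?M\<^esub> k" using relM by (simp add: mc_rel_def)
    then have "inv\<^bsub>?M\<^esub> (0, 1) \<otimes>\<^bsub>?M\<^esub> (1, 0) \<otimes>\<^bsub>?M\<^esub> (0, 1) = (1, 0) [^]\<^bsub>?M\<^esub> k"
      using ab by (simp add: M.m_assoc M.inv_solve_left')
    then show ?thesis using that relM ab f h by (auto simp: R h.hom_nat_pow h.hom_int_pow mc_rel_def)
  qed
  have N1: "h x = h y" if xy: "x \<in> carrier F2" "y \<in> carrier F2" "\<pi> x = \<pi> y" for x y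
  proof -
    have "x \<in> ?N #>\<^bsub>F2\<^esub> y" using xy free.rcos_self[OF xy(1) N.subgroup_axioms] by (simp add: \<pi>_def)
    then obtain u where u: "u \<in> ?N" "x = u \<otimes>\<^bsub>F2\<^esub> y" by (auto simp: r_coset_def)
    have "u \<in> carrier F2" using u N.subset by blast
    then show ?thesis using u xy h.normal_closure_kernel[OF Rc hR u(1)] by simp
  qed
  obtain t where t: "t \<in> hom ?P ?M" "\<And>x. x \<in> carrier F2 ==> t (\<pi> x) = h x"
    using FactGroup_universal[OF h(1) N.normal_axioms] N1 unfolding P \<pi>_def by blast
  have "h ` carrier F2 = carrier ?M"
  proof -
    have "h ` generate F2 {free_gen ga, free_gen gb} = generate ?M {(1, 0), (0, 1)}"
      using h.generate_img[of "{free_gen ga, free_gen gb}"] h(2) f by simp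
    then show ?thesis using genF M by (simp add: split_mc_def)
  qed
  then have sub: "carrier ?M \<subseteq> h ` carrier F2" by simp
  have "carrier ?M \<subseteq> t ` carrier ?P"
  proof
    fix y assume "y \<in> carrier ?M"
    then obtain x where x: "x \<in> carrier F2" "y = h x" using sub by auto
    then have "y = t (\<pi> x)" using t(2) by simp
    then show "y \<in> t ` carrier ?P" using \<pi>.hom_closed[OF x(1)] by (rule image_eqI)
  qed
  then have "card (carrier ?M) \<le> card (carrier ?P)" by (rule surj_card_le[OF fin])
  then have "card (carrier ?P) = n * m" using le M by (simp add: split_mc_def)
  then have "split_mc ?P ?a ?b n m k" using rel gen P.is_group by (simp add: split_mc_def)
  then show ?thesis by (intro exI)
qed

section \<open>Recognizing the listed groups and minimal PF-groups\<close>

lemma iso_split_mc_iff: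
  assumes "group G" "split_mc H a b n m k"
  shows "G \<cong> H \<longleftrightarrow> (\<exists>c d. split_mc G c d n m k)"
  using split_mc_transport[OF assms(1) _ assms(2)] split_mc_iso[OF _ assms(2)] by auto

lemma iso_C_p_C_p2:
  assumes "group G" "prime (p::nat)"
  shows "G \<cong> cyc p \<times>\<times> cyc (p ^ 2) \<longleftrightarrow> (\<exists>a b. split_mc G a b (p ^ 2) p 1)"
proof -
  have "1 < p" using assms(2) prime_gt_1_nat by blast
  then have "1 < p ^ 2" by (rule one_less_power) simp
  with \<open>1 < p\<close> show ?thesis by (intro iso_split_mc_iff[OF assms(1) split_mc_cyc_cyc])
qed

lemma one_plus_power_cong: "[(1 + int p) ^ i = 1 + int i * int p] (mod int (p ^ 2))"
proof (induction i)
  case (Suc i)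
  have "[(1 + int p) ^ i * (1 + int p) = (1 + int i * int p) * (1 + int p)] (mod int (p ^ 2))"
    using Suc by (intro cong_mult) simp_all
  moreover have "(1 + int i * int p) * (1 + int p) = (1 + int (Suc i) * int p) + int i * int (p ^ 2)"
    by (simp add: algebra_simps power2_eq_square)
  ultimately show ?case by (simp add: cong_def mult.commute)
qed simp

lemma iso_M3:
  assumes "group G" "prime (p::nat)"
  shows "G \<cong> M3 p \<longleftrightarrow> (\<exists>a b. split_mc G a b (p ^ 2) p (1 + int p))"
proof -
  have p1: "1 < p" using assms(2) prime_gt_1_nat by blast
  then have p2: "1 < p ^ 2" by (rule one_less_power) simp
  have k: "[(1 + int p) ^ p = 1] (mod int (p ^ 2))"
    using one_plus_power_cong[of p p] by (simp add: cong_def power2_eq_square)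
  have e: "F2_y [^]\<^bsub>F2\<^esub> (1 + p) = F2_y [^]\<^bsub>F2\<^esub> (1 + int p)" by (simp add: int_pow_int[symmetric])
  have "\<exists>a b. split_mc (M3 p) a b (p ^ 2) p (1 + int p)"
    unfolding M3_def e
    by (rule presented_split_mc[where ga = Gen_y and gb = Gen_x, OF _ _ p2 p1 k]) (auto intro: two_gens.exhaust)
  then obtain a b where "split_mc (M3 p) a b (p ^ 2) p (1 + int p)" by blast
  then show ?thesis by (rule iso_split_mc_iff[OF assms(1)])
qed

lemma iso_metacyclic:
  assumes "group G" "prime (p::nat)" "prime (q::nat)" "n \<ge> 1" "[r ^ p = 1] (mod int q)"
  shows "G \<cong> metacyclic_presented p q n r \<longleftrightarrow> (\<exists>a b. split_mc G a b q (p ^ n) r)"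
proof -
  have q1: "1 < q" using assms(3) prime_gt_1_nat by blast
  have p1: "1 < p ^ n" using assms(2,4) prime_gt_1_nat by (metis one_less_power not_one_le_zero neq0_conv)
  have "r ^ (p ^ n) = (r ^ p) ^ (p ^ (n - 1))" using assms(4) by (simp add: power_mult[symmetric] power_Suc[symmetric])
  then have k: "[r ^ (p ^ n) = 1] (mod int q)" using cong_pow[OF assms(5), of "p ^ (n - 1)"] by simp
  have "\<exists>a b. split_mc (metacyclic_presented p q n r) a b q (p ^ n) r"
    unfolding metacyclic_presented_def
    by (rule presented_split_mc[where ga = Gen_x and gb = Gen_y, OF _ _ q1 p1 k]) (auto intro: two_gens.exhaust)
  then obtain a b where "split_mc (metacyclic_presented p q n r) a b q (p ^ n) r" by blast
  then show ?thesis by (rule iso_split_mc_iff[OF assms(1)])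
qed

lemma iso_C_p2_C_q:
  assumes "group G" "prime (p::nat)" "prime (q::nat)" "p \<noteq> q"
  shows "G \<cong> (cyc p \<times>\<times> cyc p) \<times>\<times> cyc q \<longleftrightarrow> (\<exists>a b. split_mc G a b (q * p) p 1)"
proof -
  have p1: "1 < p" "1 < q" using assms prime_gt_1_nat by blast+
  have s: "split_mc (cyc q \<times>\<times> (cyc p \<times>\<times> cyc p)) (1, (0, 1)) (0, (1, 0)) (q * p) p 1"
    using primes_coprime[OF assms(3,2)] assms(4)
    by (intro split_mc_DirProd[OF split_mc_cyc_cyc[OF p1(1) p1(1)] p1(2)]) auto
  have g: "group ((cyc p \<times>\<times> cyc p) \<times>\<times> cyc q)" by (intro DirProd_group group_integer_mod_group)
  obtain a b where "split_mc ((cyc p \<times>\<times> cyc p) \<times>\<times> cyc q) a b (q * p) p 1"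
    using split_mc_transport[OF g DirProd_commute_iso s] by auto
  then show ?thesis by (rule iso_split_mc_iff[OF assms(1)])
qed

lemma split_mc_abelian:
  assumes G: "split_mc G a b n m k" and k: "[k = 1] (mod int n)" and xy: "x \<in> carrier G" "y \<in> carrier G"
  shows "x \<otimes>\<^bsub>G\<^esub> y = y \<otimes>\<^bsub>G\<^esub> x"
proof -
  interpret G: group G using G by (simp add: split_mc_def)
  have r: "mc_rel G a b n m k" using G by (simp add: split_mc_def)
  obtain u where u: "u \<in> mc_index n m" "x = mc_elt G a b u"
    using xy(1) unfolding bij_betw_imp_surj_on[OF split_mc_bij[OF G], symmetric] by (elim imageE)
  obtain v where v: "v \<in> mc_index n m" "y = mc_elt G a b v"
    using xy(2) unfolding bij_betw_imp_surj_on[OF split_mc_bij[OF G], symmetric] by (elim imageE)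
  obtain i j i' j' where ij: "u = (i, j)" "v = (i', j')" by (cases u; cases v)
  have 1: "[j * k ^ i' + j' = j + j'] (mod int n)" for i' j j'
    using cong_add[OF cong_mult[OF cong_refl cong_pow[OF k]] cong_refl, of j i' j'] by simp
  have "mc_mult n m k u v = mc_mult n m k v u"
    using 1[of j i' j'] 1[of j' i j] by (simp add: mc_mult_def ij cong_def add.commute)
  then show ?thesis unfolding u(2) v(2) G.mc_elt_mult[OF r] by simp
qed

lemma split_mc_power:
  assumes G: "split_mc G a b n m k" shows "[k ^ m = 1] (mod int n)"
proof -
  interpret G: group G using G by (simp add: split_mc_def)
  have r: "mc_rel G a b n m k" using G by (simp add: split_mc_def)
  then have ab: "a \<in> carrier G" "b \<in> carrier G" "b [^]\<^bsub>G\<^esub> m = \<one>\<^bsub>G\<^esub>" by (auto simp: mc_rel_def)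
  have "a [^]\<^bsub>G\<^esub> (k ^ m) = a [^]\<^bsub>G\<^esub> (1::int)" using G.mc_comm[OF r, of 1 m] ab by simp
  then have "a [^]\<^bsub>G\<^esub> (k ^ m - 1) = \<one>\<^bsub>G\<^esub>" using ab by (simp add: G.int_pow_diff)
  then have "int n dvd k ^ m - 1" using split_mc_one[OF G, of 0 "k ^ m - 1"] ab by simp
  then show ?thesis by (simp add: cong_iff_dvd_diff)
qed

lemma iso_C_r_semidirect:
  assumes G: "group G" and primes: "prime (p::nat)" "prime (q::nat)" "prime (r::nat)" "p \<noteq> r"
  shows "(\<exists>\<phi>. nontrivial_action (cyc p) (cyc q) \<phi> \<and> G \<cong> cyc r \<times>\<times> semidirect (cyc p) (cyc q) \<phi>) \<longleftrightarrow>
    (\<exists>a b k. split_mc G a b (r * p) q k \<and> [k = 1] (mod int r) \<and> \<not> [k = 1] (mod int p))"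
proof -
  have gt: "1 < p" "1 < q" "1 < r" using primes prime_gt_1_nat by blast+
  have cop: "coprime r p" using primes primes_coprime by metis
  have cp: "carrier (cyc p) = {0..<int p}" "carrier (cyc q) = {0..<int q}" using gt by (simp_all add: carrier_integer_mod_group)
  show ?thesis
  proof
    assume "\<exists>\<phi>. nontrivial_action (cyc p) (cyc q) \<phi> \<and> G \<cong> cyc r \<times>\<times> semidirect (cyc p) (cyc q) \<phi>"
    then obtain \<phi> where hom: "\<phi> \<in> hom (cyc q) (AutoGroup (cyc p))"
      and nt: "\<exists>n\<in>carrier (cyc q). \<exists>m\<in>carrier (cyc p). \<phi> n m \<noteq> m"
      and iso: "G \<cong> cyc r \<times>\<times> semidirect (cyc p) (cyc q) \<phi>" by (auto simp: nontrivial_action_def)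
    have aut: "\<phi> j \<in> hom (cyc p) (cyc p)" "\<phi> j \<in> Bij (carrier (cyc p))" if "j \<in> carrier (cyc q)" for j
      using hom that by (auto simp: hom_def AutoGroup_def auto_def)
    have c1: "1 \<in> carrier (cyc q)" using cp gt by simp
    have "\<phi> 1 ` {0..<int p} = {0..<int p}" using aut(2)[OF c1] cp by (simp add: Bij_def bij_betw_def)
    then have "1 \<in> \<phi> 1 ` {0..<int p}" using gt by simp
    then obtain k0 where k0: "k0 \<in> {0..<int p}" "\<phi> 1 k0 = 1" by (elim imageE) simp
    then have "\<phi> 1 (k0 mod int p) = 1" by simp
    note s = semidirect_split_mc[OF gt(1,2) hom this]
    interpret S: group "semidirect (cyc p) (cyc q) \<phi>" using s by (simp add: split_mc_def)
    have nk0: "\<not> [k0 = 1] (mod int p)"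
    proof
      assume k1: "[k0 = 1] (mod int p)"
      obtain n m where nm: "n \<in> carrier (cyc q)" "m \<in> carrier (cyc p)" "\<phi> n m \<noteq> m" using nt by blast
      interpret A: group "AutoGroup (cyc p)" by (rule group.AutoGroup[OF group_integer_mod_group])
      interpret P: group_hom "cyc q" "AutoGroup (cyc p)" \<phi>
        unfolding group_hom_def group_hom_axioms_def by (intro conjI group_integer_mod_group A.is_group hom)
      have z: "\<phi> 0 0 = 0" using P.hom_one cp gt by (simp add: AutoGroup_def BijGroup_def)
      have "(m, 0) \<otimes>\<^bsub>semidirect (cyc p) (cyc q) \<phi>\<^esub> (0, n) = (0, n) \<otimes>\<^bsub>semidirect (cyc p) (cyc q) \<phi>\<^esub> (m, 0)"
        using nm by (intro split_mc_abelian[OF s k1]) (auto simp: semidirect_def)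
      moreover have "\<phi> n m \<in> {0..<int p}" using aut(1)[OF nm(1)] nm(2) cp by (auto simp: hom_def)
      ultimately show False using nm z cp by (simp add: semidirect_def)
    qed
    obtain k where k: "[k = 1] (mod int r)" "[k = k0] (mod int p)"
      using binary_chinese_remainder_int[of "int r" "int p" 1 k0] cop by auto
    obtain a b where "split_mc G a b (r * p) q k"
      using split_mc_transport[OF G iso split_mc_DirProd[OF s gt(3) cop k]] by auto
    moreover have "\<not> [k = 1] (mod int p)" using nk0 k(2) cong_trans cong_sym by blast
    ultimately show "\<exists>a b k. split_mc G a b (r * p) q k \<and> [k = 1] (mod int r) \<and> \<not> [k = 1] (mod int p)"
      using k(1) by blast
  next
    assume "\<exists>a b k. split_mc G a b (r * p) q k \<and> [k = 1] (mod int r) \<and> \<not> [k = 1] (mod int p)"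
    then obtain a b k where s: "split_mc G a b (r * p) q k" and k: "[k = 1] (mod int r)" "\<not> [k = 1] (mod int p)" by blast
    have kq: "[k ^ q = 1] (mod int p)" using split_mc_power[OF s] cong_modulus_mult[of "k ^ q" 1 "int p" "int r"] by (simp add: mult.commute)
    note m = split_mc_DirProd[OF split_mc_model[OF gt(1,2) kq] gt(3) cop k(1) cong_refl]
    have "G \<cong> cyc r \<times>\<times> semidirect (cyc p) (cyc q) (mult_action p q k)" by (rule split_mc_iso[OF s m])
    moreover have "nontrivial_action (cyc p) (cyc q) (mult_action p q k)"
      unfolding nontrivial_action_def
    proof (intro conjI bexI)
      show "mult_action p q k \<in> hom (cyc q) (AutoGroup (cyc p))" by (rule mult_action_hom[OF gt(1,2) kq])
      show "mult_action p q k 1 (k mod int p) \<noteq> k mod int p"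
        unfolding mult_action_inverse[OF gt(1,2) kq] using k(2) gt by (simp add: cong_def)
    qed (use cp gt in simp_all)
    ultimately show "\<exists>\<phi>. nontrivial_action (cyc p) (cyc q) \<phi> \<and> G \<cong> cyc r \<times>\<times> semidirect (cyc p) (cyc q) \<phi>" by blast
  qed
qed

context fin_group begin

lemma admits_partition_sub:
  assumes H: "subgroup H G" and K: "subgroup K G" "K \<subseteq> H" "K \<noteq> H" "K \<noteq> {\<one>}" and p: "prime (p::nat)"
    and out: "\<And>x. x \<in> H ==> x \<notin> K ==> x [^] p = \<one>"
  shows "admits_partition (G\<lparr>carrier := H\<rparr>)"
proof -
  interpret H: fin_group "G\<lparr>carrier := H\<rparr>" by (rule fin_group_subgroup[OF H(1)])
  show ?thesis
  proof (rule H.admits_partition_outside[OF _ _ _ p])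
    show "subgroup K (G\<lparr>carrier := H\<rparr>)" using subgroup_incl[OF K(1) H K(2)] .
    show "x [^]\<^bsub>G\<lparr>carrier := H\<rparr>\<^esub> p = \<one>\<^bsub>G\<lparr>carrier := H\<rparr>\<^esub>" if "x \<in> carrier (G\<lparr>carrier := H\<rparr>)" "x \<notin> K" for x
      using out that nat_pow_consistent[of x p H] by simp
  qed (use K in auto)
qed

lemma exponent_p_partition:
  assumes H: "subgroup H G" "\<not> cyclic_subset G H" and p: "prime (p::nat)" and e: "\<And>x. x \<in> H ==> x [^] p = \<one>"
  shows "admits_partition (G\<lparr>carrier := H\<rparr>)"
proof -
  obtain x where x: "x \<in> H" "x \<noteq> \<one>" using subset_one_generate[OF H(1)] H(2) by auto
  have xc: "x \<in> carrier G" using subgroup.mem_carrier[OF H(1) x(1)] .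
  show ?thesis
  proof (rule admits_partition_sub[OF H(1) subgroup_generate1[OF xc] generate_single_incl[OF H(1) x(1)] _ _ p])
    show "generate G {x} \<noteq> H" using H(2) cyclic_subset_generate1[OF xc] by auto
    show "generate G {x} \<noteq> {\<one>}" using in_generate1 x(2) by auto
  qed (use e in auto)
qed

text \<open>
  Generators with non-trivial p-th powers exclude a partition, because the component of the central element z
  would contain all of them.
\<close>
lemma minimal_PF_I:
  assumes "\<not> cyclic_subset G (carrier G)"
    and z: "z \<in> group_center G" "z \<noteq> \<one>" "z [^] (p::nat) = \<one>"
    and S: "S \<subseteq> carrier G" "generate G S = carrier G" "\<And>s. s \<in> S ==> s [^] p \<noteq> \<one>"
    and H: "\<And>H. subgroup H G ==> H \<noteq> carrier G ==> \<not> cyclic_subset G H ==> admits_partition (G\<lparr>carrier := H\<rparr>)"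
  shows "minimal_PF_group G"
proof -
  have zc: "z \<in> carrier G" using z by (simp add: group_center_def)
  note h = hughes_subgroup[OF subgroup_self zc, of p]
  have "S \<subseteq> hughes G p z (carrier G)" using S(1,3) hughes_incl by blast
  from generate_subgroup_incl[OF this h(1)] have "hughes G p z (carrier G) = carrier G" using S(2) h(2) by simp
  then have "\<not> admits_partition G" by (rule not_partition_if_hughes[OF z])
  then have "PF_group G" using assms(1) cyclic_group_iff' fin is_group by (simp add: PF_group_def)
  moreover have "admits_partition (G\<lparr>carrier := H\<rparr>)"
    if "subgroup H G" "H \<noteq> carrier G" "\<not> cyclic_group (G\<lparr>carrier := H\<rparr>)" for H
    using H[OF that(1,2)] that(3) cyclic_group_iff[OF that(1)] by simp
  ultimately show ?thesis by (simp add: minimal_PF_group_def)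
qed

lemma cyclic_if_ord:
  assumes "subgroup H G" "x \<in> H" "card H \<le> ord x" shows "cyclic_subset G H"
proof -
  have xc: "x \<in> carrier G" using subgroup.mem_carrier[OF assms(1,2)] .
  have "generate G {x} = H"
    using card_seteq[OF finite_subgroup[OF assms(1)] generate_single_incl[OF assms(1,2)]] generate_pow_card[OF xc] assms(3) by simp
  then show ?thesis using cyclic_subset_generate1[OF xc] by simp
qed

lemma ord_dvd_card: "subgroup H G ==> x \<in> H ==> ord x dvd card H"
  using pow_card_subgroup[of H x] pow_eq_id[OF subgroup.mem_carrier[of H G x], of "card H"] by simp

lemma cyclic_prime_card:
  assumes H: "subgroup H G" "card H dvd p" "prime (p::nat)" shows "cyclic_subset G H"
proof (cases "H \<subseteq> {\<one>}")
  case True then show ?thesis by (rule subset_one_generate[OF H(1)])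
next
  case False
  then obtain x where x: "x \<in> H" "x \<noteq> \<one>" by auto
  have xc: "x \<in> carrier G" using subgroup.mem_carrier[OF H(1) x(1)] .
  have "x [^] p = \<one>" using ord_dvd_card[OF H(1) x(1)] H(2) pow_eq_id[OF xc] by (meson dvd_trans)
  then have "ord x = p" using ord_prime[OF xc x(2) _ H(3)] by simp
  moreover have "card H \<le> p" using H(2,3) dvd_imp_le prime_gt_0_nat by blast
  ultimately show ?thesis using cyclic_if_ord[OF H(1) x(1)] by simp
qed

lemma ord_coprime_mult:
  assumes "x \<in> carrier G" "y \<in> carrier G" "x \<otimes> y = y \<otimes> x" "coprime (ord x) (ord y)"
  shows "ord (x \<otimes> y) = ord x * ord y"
proof (rule dvd_antisym)
  show "ord (x \<otimes> y) dvd ord x * ord y" using ord_mul_divides assms by blast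
  let ?S = "generate G {x \<otimes> y}"
  have xy: "x \<otimes> y \<in> carrier G" using assms by simp
  have "x \<in> ?S" "y \<in> ?S" using coprime_generate[OF assms(1-3) pow_ord_eq_1 pow_ord_eq_1] assms by auto
  then have "ord x dvd card ?S" "ord y dvd card ?S" using ord_dvd_card[OF subgroup_generate1[OF xy]] by auto
  then show "ord x * ord y dvd ord (x \<otimes> y)" using divides_mult assms(4) generate_pow_card[OF xy] by simp
qed

lemma cyclic_two_primes:
  assumes H: "subgroup H G" "card H dvd r * s" "prime (r::nat)" "prime (s::nat)" "r \<noteq> s"
    and x: "x \<in> H" "x \<noteq> \<one>" "x [^] r = \<one>" "\<And>y. y \<in> H ==> x \<otimes> y = y \<otimes> x"
  shows "cyclic_subset G H"
proof -
  have xc: "x \<in> carrier G" using subgroup.mem_carrier[OF H(1) x(1)] .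
  have ox: "ord x = r" using ord_prime[OF xc x(2,3) H(3)] .
  show ?thesis
  proof (cases "s dvd card H")
    case True
    then obtain y where y: "y \<in> H" "y \<noteq> \<one>" "y [^] s = \<one>" using cauchy[OF H(1,4)] by auto
    have yc: "y \<in> carrier G" using subgroup.mem_carrier[OF H(1) y(1)] .
    have oy: "ord y = s" using ord_prime[OF yc y(2,3) H(4)] .
    have "ord (x \<otimes> y) = r * s" using ord_coprime_mult[OF xc yc x(4)[OF y(1)]] ox oy primes_coprime[OF H(3,4,5)] by simp
    moreover have "card H \<le> r * s" using H(2,3,4) by (intro dvd_imp_le) (auto simp: prime_gt_0_nat)
    ultimately show ?thesis using cyclic_if_ord[OF H(1) subgroup.m_closed[OF H(1) x(1) y(1)]] by simp
  next
    case False
    then have "coprime (card H) s" using H(4) by (metis coprime_commute prime_imp_coprime)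
    then have "card H dvd r" using H(2) coprime_dvd_mult_left_iff by blast
    then show ?thesis by (rule cyclic_prime_card[OF H(1) _ H(3)])
  qed
qed

lemma card_proper:
  assumes "subgroup H G" "H \<noteq> carrier G" shows "card H dvd card (carrier G)" "card H \<noteq> card (carrier G)"
  using subgroup_card_dvd[OF assms(1) subgroup_self subgroup.subset[OF assms(1)]]
    card_subset_eq[OF fin subgroup.subset[OF assms(1)]] assms(2) by auto

text \<open>
  A non-cyclic proper subgroup has order p^2 and hence exponent p.
\<close>
lemma order_p3_minimal_PF:
  assumes "order G = p ^ 3" "prime (p::nat)" "\<not> cyclic_subset G (carrier G)"
    and z: "z \<in> group_center G" "z \<noteq> \<one>" "z [^] p = \<one>"
    and S: "S \<subseteq> carrier G" "generate G S = carrier G" "\<And>s. s \<in> S ==> s [^] p \<noteq> \<one>"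
  shows "minimal_PF_group G"
proof (rule minimal_PF_I[OF assms(3) z S])
  fix H assume H: "subgroup H G" "H \<noteq> carrier G" "\<not> cyclic_subset G H"
  have d: "card H dvd p ^ 3" "card H \<noteq> p ^ 3" using card_proper[OF H(1,2)] assms(1) by (simp_all add: order_def)
  then obtain i where i: "i \<le> 3" "card H = p ^ i" using divides_primepow_nat[OF assms(2)] by auto
  then have "i \<le> 2" using d(2) by (cases "i = 3") auto
  then have dH: "card H dvd p ^ 2" using i by (simp add: le_imp_power_dvd)
  have "x [^] p = \<one>" if x: "x \<in> H" for x
  proof (rule ccontr)
    assume n: "x [^] p \<noteq> \<one>"
    have xc: "x \<in> carrier G" using subgroup.mem_carrier[OF H(1) x] .
    have "ord x dvd p ^ 2" using ord_dvd_card[OF H(1) x] dH by (rule dvd_trans)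
    then obtain j where j: "j \<le> 2" "ord x = p ^ j" using divides_primepow_nat[OF assms(2)] by auto
    have "\<not> ord x dvd p" using n pow_eq_id[OF xc] by simp
    then have "\<not> j \<le> 1" using j(2) le_imp_power_dvd[of j 1 p] by auto
    then have "ord x = p ^ 2" using j by (cases "j = 2") auto
    then have "card H \<le> ord x" using dvd_imp_le[OF dH] assms(2) prime_gt_0_nat by simp
    then show False using cyclic_if_ord[OF H(1) x] H(3) by simp
  qed
  then show "admits_partition (G\<lparr>carrier := H\<rparr>)" by (rule exponent_p_partition[OF H(1,3) assms(2)])
qed

end

section \<open>The split metacyclic groups of the list\<close>

context fin_group begin

lemma mc_comm_nat:
  assumes G: "split_mc G a b n m k" shows "a [^] (j::nat) \<otimes> b [^] (i::nat) = b [^] i \<otimes> a [^] (int j * k ^ i)"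
  using mc_comm[of a b n m k "int j" i] G by (simp add: split_mc_def int_pow_int)

lemma mc_facts:
  assumes "split_mc G a b n m k"
  shows "a \<in> carrier G" "b \<in> carrier G" "a [^] n = \<one>" "b [^] m = \<one>" "0 < n" "0 < m"
    "generate G {a, b} = carrier G" "card (carrier G) = n * m"
  using assms by (simp_all add: split_mc_def mc_rel_def)

lemma mc_eq: "split_mc G a b n m k ==> a \<otimes> b = b \<otimes> a [^] k"
  by (simp add: split_mc_def mc_rel_def)

lemma mc_one_nat:
  assumes "split_mc G a b n m k"
  shows "b [^] (i::nat) \<otimes> a [^] (j::nat) = \<one> \<longleftrightarrow> m dvd i \<and> n dvd j"
    "a [^] j = \<one> \<longleftrightarrow> n dvd j" "b [^] i = \<one> \<longleftrightarrow> m dvd i" "a [^] (l::int) = \<one> \<longleftrightarrow> int n dvd l"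
  using split_mc_one[OF assms, of i "int j"] split_mc_one[OF assms, of 0 "int j"] split_mc_one[OF assms, of i 0]
    split_mc_one[OF assms, of 0 l] mc_facts[OF assms]
  by (simp_all add: int_pow_int)

lemma mc_nonabelian:
  assumes G: "split_mc G a b n m k" and "a \<otimes> b = b \<otimes> a" shows "[k = 1] (mod int n)"
proof -
  note f = mc_facts[OF G]
  have "b \<otimes> a [^] k = b \<otimes> a [^] (1::int)" using f assms(2) mc_eq[OF G] by simp
  then have "a [^] k = a [^] (1::int)" using f by simp
  then have "a [^] (k - 1) = \<one>" using f by (simp add: int_pow_diff)
  then show ?thesis using mc_one_nat(4)[OF G] by (simp add: cong_iff_dvd_diff)
qed

lemma mc_noncyclic:
  assumes G: "split_mc G a b n m k" and "\<not> [k = 1] (mod int n) \<or> \<not> coprime n m"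
  shows "\<not> cyclic_subset G (carrier G)"
proof
  assume c: "cyclic_subset G (carrier G)"
  note f = mc_facts[OF G]
  have comm: "\<And>x y. x \<in> carrier G ==> y \<in> carrier G ==> x \<otimes> y = y \<otimes> x" using cyclic_comm[OF c] .
  have "\<not> coprime n m" using assms(2) mc_nonabelian[OF G comm[OF f(1,2)]] by blast
  then have "gcd n m \<noteq> 1" using coprime_iff_gcd_eq_1[of n m] by blast
  moreover have "0 < gcd n m" "0 < lcm n m" using f by (simp_all add: lcm_pos_nat)
  moreover have "lcm n m * gcd n m = n * m" using prod_gcd_lcm_nat[of n m] by (simp add: mult.commute)
  moreover from calculation have "1 < gcd n m" by linarith
  ultimately have lt: "lcm n m < n * m" by (metis mult.right_neutral nat_mult_less_cancel1)
  obtain x where x: "x \<in> carrier G" "carrier G = generate G {x}" using c by (auto simp: cyclic_subset_def)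
  obtain i j :: nat where ij: "x = b [^] i \<otimes> a [^] j" "i < m" "j < n" using split_mc_elt[OF G x(1)] .
  have "x [^] lcm n m = (b [^] i) [^] lcm n m \<otimes> (a [^] j) [^] lcm n m"
    unfolding ij using f(1,2) by (intro pow_mult_distrib comm) simp_all
  also have "\<dots> = b [^] (i * lcm n m) \<otimes> a [^] (j * lcm n m)" using f by (simp add: nat_pow_pow)
  also have "\<dots> = \<one>" using mc_one_nat(1)[OF G] by simp
  finally have "ord x dvd lcm n m" using pow_eq_id[OF x(1)] by simp
  moreover have "ord x = n * m" using generate_pow_card[OF x(1)] x(2) f by simp
  ultimately show False using lt f dvd_imp_le[of "n * m" "lcm n m"] by (simp add: lcm_pos_nat)
qed

lemma mc_central:
  assumes G: "split_mc G a b n m k" and "z \<in> carrier G" "z \<otimes> a = a \<otimes> z" "z \<otimes> b = b \<otimes> z"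
  shows "z \<in> group_center G"
proof -
  note f = mc_facts[OF G]
  have "{a, b} \<subseteq> centralizer G z" using f(1,2) assms(3,4) by (simp add: centralizer_def)
  from generate_subgroup_incl[OF this subgroup_centralizer[OF assms(2)]] have sub: "carrier G \<subseteq> centralizer G z" unfolding f(7) .
  have "z \<otimes> g = g \<otimes> z" if "g \<in> carrier G" for g using subsetD[OF sub that] by (simp add: centralizer_def)
  then show ?thesis using assms(2) by (simp add: group_center_def)
qed

lemma mc_proper:
  assumes G: "split_mc G a b n m k" and "subgroup H G" "a \<in> H" "b \<in> H" shows "H = carrier G"
  using generate_subgroup_incl[of "{a, b}" H] mc_facts(7)[OF G] assms subgroup.subset[of H G] by auto

lemma mc_power_central:
  assumes G: "split_mc G a b n m k" and "int n dvd int j * (k - 1)"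
  shows "a [^] (j::nat) \<in> group_center G"
proof (rule mc_central[OF G])
  note f = mc_facts[OF G]
  show "a [^] j \<otimes> a = a \<otimes> a [^] j" using f comm_pow[of a a j] by simp
  have "a [^] (int j * k) = a [^] (int j)" by (rule int_pow_cong[OF f(1,3)]) (use assms(2) in \<open>simp add: cong_iff_dvd_diff algebra_simps\<close>)
  then show "a [^] j \<otimes> b = b \<otimes> a [^] j" using mc_comm_nat[OF G, of j 1] f by (simp add: int_pow_int)
qed (use mc_facts[OF G] in simp)

lemma mc_ba_pow:
  assumes G: "split_mc G a b n m k"
  shows "(b \<otimes> a) [^] (j::nat) = b [^] j \<otimes> a [^] (\<Sum>i<j. k ^ i)"
proof (induction j)
  case (Suc j)
  note f = mc_facts[OF G]
  have r: "mc_rel G a b n m k" using G by (simp add: split_mc_def)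
  let ?s = "\<Sum>i<j. k ^ i"
  have "(b \<otimes> a) [^] Suc j = b [^] j \<otimes> (a [^] ?s \<otimes> b) \<otimes> a" using Suc f by (simp add: m_assoc)
  also have "a [^] ?s \<otimes> b = b \<otimes> a [^] (?s * k)" using mc_comm[OF r, of ?s 1] f by simp
  also have "b [^] j \<otimes> (b \<otimes> a [^] (?s * k)) \<otimes> a = b [^] Suc j \<otimes> a [^] (?s * k + 1)"
    using f by (simp add: m_assoc int_pow_mult)
  also have "?s * k + 1 = (\<Sum>i<Suc j. k ^ i)"
    unfolding sum.lessThan_Suc_shift by (simp add: sum_distrib_left mult.commute)
  finally show ?case .
qed simp

text \<open>
  The generators a and b a have non-trivial p-th powers; the p-th power of b a is a raised to the sum in the
  hypothesis.
\<close>
lemma mc_p2_p: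
  assumes G: "split_mc G a b (p ^ 2) p k" and p: "prime (p::nat)" and k: "[k = 1] (mod int p)"
    and s: "\<not> int (p ^ 2) dvd (\<Sum>i<p. k ^ i)"
  shows "minimal_PF_group G"
proof -
  note f = mc_facts[OF G]
  have p1: "1 < p" using p prime_gt_1_nat by blast
  have nd: "\<not> p ^ 2 dvd p" using p1 by (auto dest!: dvd_imp_le simp: power2_eq_square)
  show ?thesis
  proof (rule order_p3_minimal_PF[where p = p and z = "a [^] p" and S = "{a, b \<otimes> a}", OF _ p])
    show "order G = p ^ 3" using f by (simp add: order_def power2_eq_square power3_eq_cube)
    show "\<not> cyclic_subset G (carrier G)" using p1 by (intro mc_noncyclic[OF G] disjI2) (simp add: power2_eq_square)
    show "a [^] p \<in> group_center G"
      using k by (intro mc_power_central[OF G]) (simp add: cong_iff_dvd_diff power2_eq_square)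
    show "a [^] p \<noteq> \<one>" using mc_one_nat(2)[OF G] nd by simp
    show "(a [^] p) [^] p = \<one>" using f by (simp add: nat_pow_pow power2_eq_square)
    show "{a, b \<otimes> a} \<subseteq> carrier G" using f by simp
    show "generate G {a, b \<otimes> a} = carrier G"
    proof (rule mc_proper[OF G])
      show s: "subgroup (generate G {a, b \<otimes> a}) G" using f by (intro generate_is_subgroup) simp
      show a: "a \<in> generate G {a, b \<otimes> a}" by (simp add: generate.incl)
      have "b \<otimes> a \<in> generate G {a, b \<otimes> a}" by (simp add: generate.incl)
      then have "(b \<otimes> a) \<otimes> inv a \<in> generate G {a, b \<otimes> a}" using a s by (simp add: subgroup.m_closed subgroup.m_inv_closed)
      then show "b \<in> generate G {a, b \<otimes> a}" using f by (simp add: m_assoc)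
    qed
    show "x [^] p \<noteq> \<one>" if "x \<in> {a, b \<otimes> a}" for x
    proof -
      have "(b \<otimes> a) [^] p = a [^] (\<Sum>i<p. k ^ i)" using mc_ba_pow[OF G, of p] f by simp
      then have "(b \<otimes> a) [^] p \<noteq> \<one>" using mc_one_nat(4)[OF G] s by simp
      moreover have "a [^] p \<noteq> \<one>" using mc_one_nat(2)[OF G] nd by simp
      ultimately show ?thesis using that by auto
    qed
  qed
qed

lemma sum_one_plus_power:
  assumes "prime (p::nat)" "p \<noteq> 2" shows "\<not> int (p ^ 2) dvd (\<Sum>i<p. (1 + int p) ^ i)"
proof
  assume d: "int (p ^ 2) dvd (\<Sum>i<p. (1 + int p) ^ i)"
  have p1: "1 < p" using assms prime_gt_1_nat by blast
  have "[(\<Sum>i<p. (1 + int p) ^ i) = (\<Sum>i<p. 1 + int i * int p)] (mod int (p ^ 2))"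
    by (intro cong_sum one_plus_power_cong)
  moreover have "(\<Sum>i<p. 1 + int i * int p) = int p + int p * (\<Sum>i<p. int i)"
    by (simp add: sum.distrib sum_distrib_left mult.commute)
  moreover have "int p dvd (\<Sum>i<p. int i)"
  proof -
    have e: "2 * (\<Sum>i<n. int i) = int n * (int n - 1)" for n by (induction n) (simp_all add: algebra_simps)
    have "int p dvd 2 * (\<Sum>i<p. int i)" unfolding e by simp
    moreover have "coprime (int p) 2" using assms primes_coprime[OF assms(1) two_is_prime_nat] by (metis coprime_int_iff of_nat_numeral)
    ultimately show ?thesis using coprime_dvd_mult_right_iff by blast
  qed
  then obtain t where "(\<Sum>i<p. int i) = int p * t" by blast
  ultimately have "[(\<Sum>i<p. (1 + int p) ^ i) = int p + int (p ^ 2) * t] (mod int (p ^ 2))"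
    by (simp add: power2_eq_square mult.assoc)
  then have "[(\<Sum>i<p. (1 + int p) ^ i) = int p] (mod int (p ^ 2))" by (simp add: cong_def)
  from cong_dvd_iff[OF this] d have "int (p ^ 2) dvd int p" by simp
  then have "p ^ 2 dvd p" by (simp only: int_dvd_int_iff)
  then show False using p1 by (auto dest!: dvd_imp_le simp: power2_eq_square)
qed

lemma mc_case2: assumes "split_mc G a b (p ^ 2) p 1" "prime (p::nat)" shows "minimal_PF_group G"
proof (rule mc_p2_p[OF assms])
  have p1: "1 < p" using assms prime_gt_1_nat by blast
  show "\<not> int (p ^ 2) dvd (\<Sum>i<p. 1 ^ i)"
  proof
    assume "int (p ^ 2) dvd (\<Sum>i<p. 1 ^ i)"
    then have "p ^ 2 dvd p" using int_dvd_int_iff[of "p ^ 2" p] by simp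
    then show False using p1 by (auto dest!: dvd_imp_le simp: power2_eq_square)
  qed
qed simp

lemma mc_case3: assumes "split_mc G a b (p ^ 2) p (1 + int p)" "prime (p::nat)" "p \<noteq> 2" shows "minimal_PF_group G"
  by (rule mc_p2_p[OF assms(1,2) _ sum_one_plus_power[OF assms(2,3)]]) (simp add: cong_def)

lemma mc_order_in_A:
  assumes G: "split_mc G a b n m k" and x: "x \<in> carrier G" "x [^] (s::nat) = \<one>" and cop: "coprime s m"
  shows "x \<in> generate G {a}"
proof -
  note f = mc_facts[OF G]
  have r: "mc_rel G a b n m k" using G by (simp add: split_mc_def)
  obtain i j :: nat where ij: "x = b [^] i \<otimes> a [^] j" "i < m" "j < n" using split_mc_elt[OF G x(1)] .
  have "\<exists>l::int. x [^] t = b [^] (i * t) \<otimes> a [^] l" for t :: nat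
  proof (induction t)
    case 0 show ?case by (intro exI[of _ 0]) simp
  next
    case (Suc t)
    then obtain l :: int where l: "x [^] t = b [^] (i * t) \<otimes> a [^] l" by blast
    have "x [^] Suc t = b [^] (i * t) \<otimes> (a [^] l \<otimes> b [^] i) \<otimes> a [^] int j"
      using l f by (simp add: ij m_assoc int_pow_int)
    also have "\<dots> = (b [^] (i * t) \<otimes> b [^] i) \<otimes> a [^] (l * k ^ i + int j)"
      unfolding mc_comm[OF r] using f(1,2) by (simp add: m_assoc int_pow_mult)
    also have "b [^] (i * t) \<otimes> b [^] i = b [^] (i * Suc t)" using f(2) by (simp add: nat_pow_mult add.commute)
    finally show ?case by (rule exI)
  qed
  then obtain l :: int where "x [^] s = b [^] (i * s) \<otimes> a [^] l" by blast
  then have "m dvd i * s" using split_mc_one[OF G, of "i * s" l] x(2) by simp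
  then have "m dvd i" using cop coprime_dvd_mult_left_iff[of m s i] by (simp add: coprime_commute)
  then have "i = 0" using ij(2) by (meson dvd_imp_le neq0_conv not_le)
  then have "x = a [^] j" using ij f by simp
  then show ?thesis using generate_single_iff[OF f(1)] by blast
qed

lemma mc_case4:
  assumes G: "split_mc G a b (q * p) p 1" and p: "prime (p::nat)" and q: "prime (q::nat)" and pq: "p \<noteq> q"
  shows "minimal_PF_group G"
proof -
  note f = mc_facts[OF G]
  have gt: "1 < p" "1 < q" using p q prime_gt_1_nat by blast+
  have comm: "x \<otimes> y = y \<otimes> x" if "x \<in> carrier G" "y \<in> carrier G" for x y using split_mc_abelian[OF G _ that] by simp
  have ndp: "\<not> p dvd q" "\<not> q dvd p" using p q pq primes_dvd_imp_eq by metis+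
  let ?z = "a [^] p"
  have z: "?z \<in> carrier G" "?z \<noteq> \<one>" "?z [^] q = \<one>"
  proof -
    show "?z \<noteq> \<one>" using mc_one_nat(2)[OF G, of p] gt by auto
    show "?z [^] q = \<one>" using nat_pow_pow[OF f(1), of p q] f(3) by (simp add: mult.commute)
  qed (use f in simp)
  show ?thesis
  proof (rule minimal_PF_I[where z = ?z and p = q and S = "{a, b}"])
    show "\<not> cyclic_subset G (carrier G)" using gt by (intro mc_noncyclic[OF G] disjI2) simp
    show "?z \<in> group_center G" unfolding group_center_def using z(1) comm[OF z(1)] by blast
    show "s [^] q \<noteq> \<one>" if "s \<in> {a, b}" for s
      using that mc_one_nat(2,3)[OF G] ndp dvd_mult_right[of q p q] by auto
    fix H assume H: "subgroup H G" "H \<noteq> carrier G" "\<not> cyclic_subset G H"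
    have d: "card H dvd q * p * p" "card H \<noteq> q * p * p" using card_proper[OF H(1,2)] unfolding f(8) .
    have Hc: "\<And>h. h \<in> H ==> h \<in> carrier G" using subgroup.mem_carrier[OF H(1)] .
    have "x [^] p = \<one>" if x: "x \<in> H" for x
    proof (rule ccontr)
      assume n: "x [^] p \<noteq> \<one>"
      have "(x [^] p) [^] q = \<one>"
      proof -
        obtain i j :: nat where ij: "x = b [^] i \<otimes> a [^] j" "i < p" "j < q * p" using split_mc_elt[OF G Hc[OF x]] .
        have "x [^] (p * q) = b [^] (i * (p * q)) \<otimes> a [^] (j * (p * q))"
          unfolding ij using f(1,2) comm[of "b [^] i" "a [^] j"] pow_mult_distrib[of "b [^] i" "a [^] j" "p * q"] by (simp add: nat_pow_pow)
        also have "\<dots> = \<one>" using mc_one_nat(1)[OF G] by (simp add: mult.commute)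
        finally show ?thesis using Hc[OF x] by (simp add: nat_pow_pow)
      qed
      then have yq: "x [^] p \<in> H" "x [^] p \<noteq> \<one>" "(x [^] p) [^] q = \<one>" using pow_in_subgroup[OF H(1) x] n by auto
      have "ord (x [^] p) = q" using ord_prime[OF _ n yq(3) q] Hc[OF x] by simp
      then have "q dvd card H" using ord_dvd_card[OF H(1) yq(1)] by simp
      then obtain e where e: "card H = q * e" by blast
      then have "e dvd p ^ 2" "e \<noteq> p ^ 2" using d gt by (auto simp: power2_eq_square mult.assoc)
      then obtain i where "i \<le> 2" "e = p ^ i" using divides_primepow_nat[OF p] by auto
      then have "e dvd p" using \<open>e \<noteq> p ^ 2\<close> le_imp_power_dvd[of i 1 p] by (cases "i = 2") auto
      then have "card H dvd q * p" using e by simp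
      then show False
        using cyclic_two_primes[OF H(1) _ q p pq[symmetric] yq] comm Hc yq(1) H(3) by simp
    qed
    then show "admits_partition (G\<lparr>carrier := H\<rparr>)" by (rule exponent_p_partition[OF H(1,3) p])
  qed (use f z in auto)
qed

text \<open>
  Elements of order r are central, so a non-cyclic proper subgroup has order p q; it is partitioned by its
  subgroup of order p and the subgroups of order q.
\<close>
lemma mc_case5:
  assumes G: "split_mc G a b (r * p) q k" and p: "prime (p::nat)" and q: "prime (q::nat)" and r: "prime (r::nat)"
    and ne: "p \<noteq> q" "p \<noteq> r" "q \<noteq> r" and k: "[k = 1] (mod int r)" "\<not> [k = 1] (mod int p)"
  shows "minimal_PF_group G"
proof -
  note f = mc_facts[OF G]
  have gt: "1 < p" "1 < q" "1 < r" using p q r prime_gt_1_nat by blast+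
  have nd: "\<not> r dvd p" "\<not> r dvd q" "\<not> p dvd r" "\<not> q dvd r" "\<not> p dvd q" "\<not> q dvd p" using p q r ne primes_dvd_imp_eq by metis+
  let ?z = "a [^] p"
  have zC: "?z \<in> group_center G"
    using k(1) by (intro mc_power_central[OF G]) (simp add: cong_iff_dvd_diff mult.commute)
  have z: "?z \<in> carrier G" "?z \<noteq> \<one>" "?z [^] r = \<one>"
  proof -
    show "?z \<noteq> \<one>" using mc_one_nat(2)[OF G, of p] gt by auto
    show "?z [^] r = \<one>" using nat_pow_pow[OF f(1), of p r] f(3) by (simp add: mult.commute)
  qed (use f in simp)
  have rA: "x \<in> generate G {?z}" if "x \<in> carrier G" "x [^] r = \<one>" for x
  proof -
    have xA: "x \<in> generate G {a}" by (rule mc_order_in_A[OF G that primes_coprime[OF r q ne(3)[symmetric]]])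
    have "?z \<in> generate G {a}" using generate_single_iff[OF f(1)] by blast
    from cyclic_prime_order[OF cyclic_subset_generate1[OF f(1)] this z(2,3) r xA that(2)] show ?thesis .
  qed
  have zcomm: "x \<otimes> y = y \<otimes> x" if xy: "x \<in> carrier G" "x [^] r = \<one>" "y \<in> carrier G" for x y
  proof -
    obtain t :: nat where "x = ?z [^] t" using rA[OF xy(1,2)] generate_single_iff[OF z(1)] by blast
    then show ?thesis using comm_pow[OF z(1) xy(3) center_comm[OF zC xy(3)], of t] by simp
  qed
  show ?thesis
  proof (rule minimal_PF_I[where z = ?z and p = r and S = "{a, b}"])
    have "\<not> [k = 1] (mod int (r * p))" using k(2) cong_modulus_mult[of k 1 "int p" "int r"] by (auto simp: mult.commute)
    then show "\<not> cyclic_subset G (carrier G)" by (intro mc_noncyclic[OF G] disjI1)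
    show "s [^] r \<noteq> \<one>" if "s \<in> {a, b}" for s
      using that mc_one_nat(2,3)[OF G] nd dvd_mult_right[of r p r] by auto
    fix H assume H: "subgroup H G" "H \<noteq> carrier G" "\<not> cyclic_subset G H"
    have d: "card H dvd r * (p * q)" "card H \<noteq> r * (p * q)" using card_proper[OF H(1,2)] unfolding f(8) mult.assoc .
    have Hc: "\<And>h. h \<in> H ==> h \<in> carrier G" using subgroup.mem_carrier[OF H(1)] .
    have nr: "\<not> r dvd card H"
    proof
      assume rd: "r dvd card H"
      then obtain x where x: "x \<in> H" "x \<noteq> \<one>" "x [^] r = \<one>" using cauchy[OF H(1) r] by auto
      have xcomm: "\<And>y. y \<in> H ==> x \<otimes> y = y \<otimes> x" using zcomm Hc x by simp
      obtain e where e: "card H = r * e" using rd by blast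
      then have e2: "e dvd p * q" "e \<noteq> p * q" using d gt by auto
      show False
      proof (cases "p dvd e")
        case True
        then obtain e' where e': "e = p * e'" by blast
        then have "e' dvd q" "e' \<noteq> q" using e2 gt by auto
        then have "e' = 1" using q prime_nat_iff by blast
        then have "card H dvd r * p" using e e' by simp
        then show False using cyclic_two_primes[OF H(1) _ r p ne(2)[symmetric] x xcomm] H(3) by simp
      next
        case False
        then have "e dvd q" using e2(1) p by (metis coprime_commute coprime_dvd_mult_right_iff prime_imp_coprime)
        then have "card H dvd r * q" using e by simp
        then show False using cyclic_two_primes[OF H(1) _ r q ne(3)[symmetric] x xcomm] H(3) by simp
      qed
    qed
    then have dpq: "card H dvd p * q" using d(1) r by (metis coprime_commute coprime_dvd_mult_right_iff prime_imp_coprime)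
    have pd: "p dvd card H"
    proof (rule ccontr)
      assume "\<not> p dvd card H"
      then have "card H dvd q" using dpq p by (metis coprime_commute coprime_dvd_mult_right_iff prime_imp_coprime)
      then show False using cyclic_prime_card[OF H(1) _ q] H(3) by simp
    qed
    then obtain w where w: "w \<in> H" "w \<noteq> \<one>" "w [^] p = \<one>" using cauchy[OF H(1) p] by auto
    let ?K = "generate G {w}"
    have wc: "w \<in> carrier G" using Hc w by simp
    have wA: "w \<in> generate G {a}" by (rule mc_order_in_A[OF G wc w(3) primes_coprime[OF p q ne(1)]])
    show "admits_partition (G\<lparr>carrier := H\<rparr>)"
    proof (rule admits_partition_sub[OF H(1) subgroup_generate1[OF wc] generate_single_incl[OF H(1) w(1)] _ _ q])
      show "?K \<noteq> H" using cyclic_subset_generate1[OF wc] H(3) by auto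
      show "?K \<noteq> {\<one>}" using w in_generate1 by auto
      fix x assume x: "x \<in> H" "x \<notin> ?K"
      have xc: "x \<in> carrier G" using Hc x by simp
      have od: "ord x dvd p * q" using ord_dvd_card[OF H(1) x(1)] dpq by (rule dvd_trans)
      have "\<not> p dvd ord x"
      proof
        assume "p dvd ord x"
        then obtain e where e: "ord x = p * e" by blast
        then have "e dvd q" using od gt by auto
        then consider "e = 1" | "e = q" using q prime_nat_iff by blast
        then show False
        proof cases
          case 1
          then have xp: "x [^] p = \<one>" using e pow_ord_eq_1[OF xc] by simp
          have "x \<in> generate G {a}" by (rule mc_order_in_A[OF G xc xp primes_coprime[OF p q ne(1)]])
          from cyclic_prime_order[OF cyclic_subset_generate1[OF f(1)] wA w(2,3) p this xp] have "x \<in> ?K" .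
          then show False using x by simp
        next
          case 2
          have "card H \<le> p * q" using dpq gt by (intro dvd_imp_le) simp_all
          then show False using cyclic_if_ord[OF H(1) x(1)] e 2 H(3) by simp
        qed
      qed
      then have "ord x dvd q" using od p by (metis coprime_commute coprime_dvd_mult_right_iff prime_imp_coprime)
      then show "x [^] q = \<one>" using pow_eq_id[OF xc] by simp
    qed
  qed (use f z zC in auto)
qed

text \<open>
  Such an H embeds into the cyclic quotient G/A. The generator is the element of H with the least positive
  exponent of y.
\<close>
lemma cyclic_ext_trivial_int:
  assumes A: "subgroup A G" and y: "y \<in> normset G A" and ext: "carrier G = ext G A y"
    and H: "subgroup H G" "H \<inter> A \<subseteq> {\<one>}"
  shows "cyclic_subset G H"
proof -
  have yc: "y \<in> carrier G" using y by (simp add: normset_def)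
  have Ac: "\<And>h. h \<in> A ==> h \<in> carrier G" using subgroup.mem_carrier[OF A] .
  have Hc: "\<And>h. h \<in> H ==> h \<in> carrier G" using subgroup.mem_carrier[OF H(1)] .
  have cj: "conj_el G (y [^] i) v \<in> A" if "v \<in> A" for i :: nat and v using conj_pow_left_closed[OF A y that] .
  define Q where "Q = (\<lambda>d::nat. d > 0 \<and> (\<exists>v\<in>A. v \<otimes> y [^] d \<in> H))"
  define d where "d = (LEAST d. Q d)"
  have "Q (ord y)" unfolding Q_def using ord_pos[OF yc] yc subgroup.one_closed[OF H(1)] subgroup.one_closed[OF A]
    by (auto intro!: bexI[of _ \<one>])
  then have Qd: "Q d" unfolding d_def by (rule LeastI)
  have least: "d \<le> e" if "Q e" for e unfolding d_def using that by (rule Least_le)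
  obtain v where v: "v \<in> A" "v \<otimes> y [^] d \<in> H" and d0: "d > 0" using Qd by (auto simp: Q_def)
  define h0 where "h0 = v \<otimes> y [^] d"
  have h0: "h0 \<in> H" "h0 \<in> carrier G" using v Hc by (auto simp: h0_def)
  have pw: "\<exists>u\<in>A. h0 [^] t = u \<otimes> y [^] (d * t)" for t :: nat
  proof (induction t)
    case 0 show ?case using subgroup.one_closed[OF A] by (intro bexI[of _ \<one>]) simp_all
  next
    case (Suc t)
    then obtain u where u: "u \<in> A" "h0 [^] t = u \<otimes> y [^] (d * t)" by blast
    have vc: "v \<in> carrier G" and uc: "u \<in> carrier G" using Ac u(1) v(1) by simp_all
    let ?c = "conj_el G (y [^] (d * t)) v"
    have cc: "?c \<in> carrier G" using vc yc by simp
    have e: "y [^] (d * t) \<otimes> v = ?c \<otimes> y [^] (d * t)" using mult_eq_conj[of "y [^] (d * t)" v] vc yc by simp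
    have "h0 [^] Suc t = u \<otimes> (y [^] (d * t) \<otimes> v) \<otimes> y [^] d"
      unfolding nat_pow_Suc u(2) unfolding h0_def using uc vc yc by (simp add: m_assoc)
    also have "\<dots> = (u \<otimes> ?c) \<otimes> (y [^] (d * t) \<otimes> y [^] d)"
      unfolding e using uc cc yc by (simp add: m_assoc)
    also have "\<dots> = (u \<otimes> ?c) \<otimes> y [^] (d * Suc t)" using yc by (simp add: nat_pow_mult add.commute)
    finally show ?case using subgroup.m_closed[OF A u(1) cj[OF v(1)]] by (intro bexI)
  qed
  have "H \<subseteq> generate G {h0}"
  proof
    fix h assume h: "h \<in> H"
    have "h \<in> ext G A y" using Hc[OF h] unfolding ext .
    then obtain u and i :: nat where u: "u \<in> A" "h = u \<otimes> y [^] i" by (auto simp: ext_def)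
    obtain w where w: "w \<in> A" "h0 [^] (i div d) = w \<otimes> y [^] (d * (i div d))" using pw by blast
    let ?s = "i mod d"
    define g where "g = u \<otimes> conj_el G (y [^] ?s) (inv w)"
    have gA: "g \<in> A" unfolding g_def by (intro subgroup.m_closed[OF A u(1)] cj subgroup.m_inv_closed[OF A w(1)])
    have e: "h = g \<otimes> y [^] ?s \<otimes> h0 [^] (i div d)"
    proof -
      have "g \<otimes> y [^] ?s = u \<otimes> (y [^] ?s \<otimes> inv w)"
        unfolding g_def using mult_eq_conj[of "y [^] ?s" "inv w"] u w Ac yc by (simp add: m_assoc)
      then have "g \<otimes> y [^] ?s \<otimes> h0 [^] (i div d) = u \<otimes> (y [^] ?s \<otimes> (inv w \<otimes> (w \<otimes> y [^] (d * (i div d)))))"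
        using w u Ac yc by (simp add: m_assoc)
      also have "\<dots> = u \<otimes> (y [^] ?s \<otimes> y [^] (d * (i div d)))"
      proof -
        have "inv w \<otimes> (w \<otimes> y [^] (d * (i div d))) = y [^] (d * (i div d))"
          using w(1) Ac[OF w(1)] yc by (simp add: m_assoc[symmetric])
        then show ?thesis by simp
      qed
      also have "\<dots> = h" using yc u(2) by (simp add: nat_pow_mult add.commute)
      finally show ?thesis by simp
    qed
    then have "g \<otimes> y [^] ?s = h \<otimes> inv (h0 [^] (i div d))" using gA Ac yc h0 Hc[OF h] by (simp add: m_assoc)
    then have gH: "g \<otimes> y [^] ?s \<in> H"
      using subgroup.m_closed[OF H(1) h subgroup.m_inv_closed[OF H(1) pow_in_subgroup[OF H(1) h0(1)]]] by simp
    have "?s = 0"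
    proof (rule ccontr)
      assume "?s \<noteq> 0"
      then have "Q ?s" unfolding Q_def using gA gH by auto
      then show False using least d0 by (meson leD mod_less_divisor)
    qed
    then have "g \<in> H" using gH gA Ac by simp
    then have "g = \<one>" using gA H(2) by blast
    then have "h = h0 [^] (i div d)" using e \<open>?s = 0\<close> h0 by simp
    then show "h \<in> generate G {h0}" using generate_single_iff[OF h0(2)] by blast
  qed
  then have "H = generate G {h0}" using generate_single_incl[OF H(1) h0(1)] by blast
  then show ?thesis using cyclic_subset_generate1[OF h0(2)] by simp
qed

text \<open>
  Here every proper subgroup is cyclic: it either meets \<langle>a\<rangle> trivially, or it contains a and is
  generated by a and a power of the central element b^p.
\<close>
lemma mc_case6:
  assumes G: "split_mc G a b q (p ^ n) k" and p: "prime (p::nat)" and q: "prime (q::nat)" and ne: "p \<noteq> q"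
    and n: "n \<ge> 2" and k: "\<not> [k = 1] (mod int q)" "[k ^ p = 1] (mod int q)"
  shows "minimal_PF_group G"
proof -
  note f = mc_facts[OF G]
  have r: "mc_rel G a b q (p ^ n) k" using G by (simp add: split_mc_def)
  have gt: "1 < p" "1 < q" using p q prime_gt_1_nat by blast+
  have nd: "\<not> p dvd q" "\<not> q dvd p" using p q ne primes_dvd_imp_eq by metis+
  have bpa: "b [^] p \<otimes> a = a \<otimes> b [^] p"
  proof -
    have "a \<otimes> b [^] p = b [^] p \<otimes> a [^] (k ^ p)" using mc_comm_nat[OF G, of 1 p] f by simp
    also have "a [^] (k ^ p) = a [^] (1::int)" by (rule int_pow_cong[OF f(1,3) k(2)])
    finally show ?thesis using f by simp
  qed
  let ?z = "b [^] (p ^ (n - 1))"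
  have zb: "?z = (b [^] p) [^] (p ^ (n - 2))"
    using n f by (simp add: nat_pow_pow power_Suc[symmetric] Suc_diff_Suc numeral_2_eq_2 del: power_Suc)
  have pn: "p ^ n = p ^ (n - 1) * p" using n by (simp add: power_Suc2[symmetric] del: power_Suc2)
  have pn1: "\<not> p ^ n dvd p ^ (n - 1)" using power_dvd_imp_le[of p n "n - 1"] gt(1) n by auto
  have pn2: "\<not> p ^ n dvd p" using power_dvd_imp_le[of p n 1] gt(1) n by auto
  have zC: "?z \<in> group_center G"
  proof (rule mc_central[OF G])
    show "?z \<otimes> a = a \<otimes> ?z" unfolding zb by (rule comm_pow[OF _ f(1) bpa]) (use f(2) in simp)
    show "?z \<otimes> b = b \<otimes> ?z" by (rule comm_pow[OF f(2,2) refl])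
  qed (use f in simp)
  have z: "?z \<noteq> \<one>" "?z [^] p = \<one>"
    using mc_one_nat(3)[OF G] pn1 f pn by (simp_all add: nat_pow_pow)
  show ?thesis
  proof (rule minimal_PF_I[where z = ?z and p = p and S = "{a, b}"])
    show "\<not> cyclic_subset G (carrier G)" using k(1) by (intro mc_noncyclic[OF G] disjI1)
    show "s [^] p \<noteq> \<one>" if "s \<in> {a, b}" for s using that mc_one_nat(2,3)[OF G] nd pn2 by auto
    fix H assume H: "subgroup H G" "H \<noteq> carrier G" "\<not> cyclic_subset G H"
    have Hc: "\<And>h. h \<in> H ==> h \<in> carrier G" using subgroup.mem_carrier[OF H(1)] .
    have sA: "subgroup (generate G {a}) G" using subgroup_generate1 f by simp
    have bA: "b \<in> normset G (generate G {a})"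
    proof -
      have "inv b \<in> normset G (generate G {a})"
      proof -
        have e: "conj_el G (inv b) a = a [^] k" using f mc_eq[OF G] by (simp add: conj_el_def m_assoc inv_solve_left')
        have "conj_el G (inv b) h \<in> generate G {a}" if h: "h \<in> generate G {a}" for h
        proof -
          obtain t :: nat where t: "h = a [^] t" using h generate_single_iff f by blast
          then have "conj_el G (inv b) h = (a [^] k) [^] t" using f e by (simp add: conj_pow)
          moreover have "a [^] k \<in> generate G {a}" using generate_pow[OF f(1)] by auto
          ultimately show ?thesis using pow_in_subgroup[OF sA] by simp
        qed
        then show ?thesis using f by (simp add: normset_def)
      qed
      from subgroup.m_inv_closed[OF subgroup_normset[OF sA] this] show ?thesis using f by simp
    qed
    have ext: "carrier G = ext G (generate G {a}) b"
      using mc_proper[OF G subgroup_ext[OF sA bA]] ext_incl[OF sA f(2)] in_generate1 by blast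
    have aH: "a \<in> H"
    proof (rule ccontr)
      assume na: "a \<notin> H"
      have "H \<inter> generate G {a} \<subseteq> {\<one>}"
      proof
        fix x assume x: "x \<in> H \<inter> generate G {a}"
        have "a \<in> generate G {x}" if "x \<noteq> \<one>" using prime_order_generator[OF f(1,3) q _ that] x by blast
        then show "x \<in> {\<one>}" using na generate_single_incl[OF H(1)] x by blast
      qed
      then show False using cyclic_ext_trivial_int[OF sA bA ext H(1)] H(3) by simp
    qed
    have bH: "b \<notin> H" using mc_proper[OF G H(1) aH] H(2) by blast
    have sI: "subgroup (H \<inter> generate G {b}) G" using subgroups_Inter_pair[OF H(1) subgroup_generate1[OF f(2)]] .
    obtain d where d: "d \<in> carrier G" "H \<inter> generate G {b} = generate G {d}"
      using cyclic_subset_sub[OF cyclic_subset_generate1[OF f(2)] sI] by (auto simp: cyclic_subset_def)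
    have dH: "d \<in> H" "d \<in> generate G {b}" using d in_generate1[of d] by auto
    then obtain i :: nat where i: "d = b [^] i" using generate_single_iff f by blast
    have "p dvd i"
    proof (rule ccontr)
      assume "\<not> p dvd i"
      then have "coprime i (p ^ n)" using p by (metis coprime_commute coprime_power_left_iff prime_imp_coprime)
      then obtain l where "[i * l = Suc 0] (mod p ^ n)" using cong_solve_coprime_nat by blast
      then have "b [^] (i * l) = b [^] Suc 0" by (rule pow_cong[OF f(2,4)])
      then have "b = d [^] l" using i f by (simp add: nat_pow_pow)
      then show False using bH pow_in_subgroup[OF H(1) dH(1)] by simp
    qed
    then obtain i' where "i = p * i'" by blast
    then have "d = (b [^] p) [^] i'" using i f by (simp add: nat_pow_pow)
    then have da: "d \<otimes> a = a \<otimes> d" using comm_pow[OF _ f(1) bpa] f by simp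
    have "d [^] (p ^ n) = \<one>" using i mc_one_nat(3)[OF G] f by (simp add: nat_pow_pow)
    then have gen: "d \<in> generate G {d \<otimes> a}" "a \<in> generate G {d \<otimes> a}"
      using coprime_generate[OF d(1) f(1) da _ f(3)] primes_coprime[OF p q ne] by simp_all
    have daH: "d \<otimes> a \<in> H" using subgroup.m_closed[OF H(1) dH(1) aH] .
    have sg: "subgroup (generate G {d \<otimes> a}) G" using subgroup_generate1 Hc[OF daH] by simp
    have "H \<subseteq> generate G {d \<otimes> a}"
    proof
      fix h assume h: "h \<in> H"
      obtain i j :: nat where ij: "h = b [^] i \<otimes> a [^] j" "i < p ^ n" "j < q" using split_mc_elt[OF G Hc[OF h]] .
      then have "b [^] i = h \<otimes> inv (a [^] j)" using f Hc[OF h] by (simp add: m_assoc)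
      then have "b [^] i \<in> H" using subgroup.m_closed[OF H(1) h subgroup.m_inv_closed[OF H(1) pow_in_subgroup[OF H(1) aH]]] by simp
      then have "b [^] i \<in> generate G {d}" using d generate_single_iff[OF f(2)] by blast
      then have "b [^] i \<in> generate G {d \<otimes> a}" using generate_single_incl[OF sg gen(1)] by blast
      then show "h \<in> generate G {d \<otimes> a}" unfolding ij using subgroup.m_closed[OF sg] pow_in_subgroup[OF sg gen(2)] by simp
    qed
    then have "H = generate G {d \<otimes> a}" using generate_single_incl[OF H(1) daH] by blast
    then have "cyclic_subset G H" using cyclic_subset_generate1 Hc[OF daH] by simp
    then show "admits_partition (G\<lparr>carrier := H\<rparr>)" using H(3) by simp
  qed (use f z zC in auto)
qed

end

section \<open>The quaternion group and Frobenius complements\<close>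

lemma hamilton_assoc: "hamilton_mult (hamilton_mult x y) z = hamilton_mult x (hamilton_mult y z)"
  by (cases x; cases y; cases z) (simp add: algebra_simps)

lemma group_Q8: "group Q8"
proof (rule groupI)
  show "x \<otimes>\<^bsub>Q8\<^esub> y \<in> carrier Q8" if "x \<in> carrier Q8" "y \<in> carrier Q8" for x y
    using that unfolding Q8_def by auto
  show "x \<otimes>\<^bsub>Q8\<^esub> y \<otimes>\<^bsub>Q8\<^esub> z = x \<otimes>\<^bsub>Q8\<^esub> (y \<otimes>\<^bsub>Q8\<^esub> z)" for x y z
    by (simp add: Q8_def hamilton_assoc)
  show "\<one>\<^bsub>Q8\<^esub> \<in> carrier Q8" by (simp add: Q8_def)
  show "\<one>\<^bsub>Q8\<^esub> \<otimes>\<^bsub>Q8\<^esub> x = x" for x by (cases x) (simp add: Q8_def)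
  show "\<exists>y\<in>carrier Q8. y \<otimes>\<^bsub>Q8\<^esub> x = \<one>\<^bsub>Q8\<^esub>" if "x \<in> carrier Q8" for x
    using that unfolding Q8_def by auto
qed

interpretation Q8: group Q8 by (rule group_Q8)

lemma card_Q8: "card (carrier Q8) = 8"
  by (simp add: Q8_def)

lemma Q8_mult: "x \<otimes>\<^bsub>Q8\<^esub> y = hamilton_mult x y"
  by (simp add: Q8_def)

context fin_group begin

lemma Q8_minimal_PF:
  assumes "G \<cong> Q8" shows "minimal_PF_group G"
proof -
  have "Q8 \<cong> G" by (rule iso_sym[OF assms])
  then obtain h where h: "h \<in> hom Q8 G" "bij_betw h (carrier Q8) (carrier G)" by (auto simp: is_iso_def iso_def)
  interpret h: group_hom Q8 G h by (simp add: group_hom_def group_hom_axioms_def h is_group group_Q8)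
  have inj: "h x = h y \<longleftrightarrow> x = y" if "x \<in> carrier Q8" "y \<in> carrier Q8" for x y
    using inj_on_eq_iff[OF bij_betw_imp_inj_on[OF h(2)] that] .
  have surj: "h ` carrier Q8 = carrier G" using bij_betw_imp_surj_on[OF h(2)] .
  let ?i = "(0,1,0,0) :: int \<times> int \<times> int \<times> int" and ?j = "(0,0,1,0) :: int \<times> int \<times> int \<times> int"
    and ?m = "(-1,0,0,0) :: int \<times> int \<times> int \<times> int"
  have c: "?i \<in> carrier Q8" "?j \<in> carrier Q8" "?m \<in> carrier Q8" by (simp_all add: Q8_def)
  have one: "\<one>\<^bsub>Q8\<^esub> = (1,0,0,0)" by (simp add: Q8_def)
  have h1: "h (1,0,0,0) = \<one>" using h.hom_one unfolding one .
  have "h ?m = h (1,0,0,0) \<longleftrightarrow> ?m = (1,0,0,0)" by (rule inj) (simp_all add: Q8_def)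
  then have hm: "h ?m \<noteq> \<one>" unfolding h1 by simp
  have sq: "h x [^] (2::nat) = h (hamilton_mult x x)" if x: "x \<in> carrier Q8" for x
  proof -
    have "h x [^] (2::nat) = h x \<otimes> h x" using x by (simp add: numeral_2_eq_2)
    also have "\<dots> = h (x \<otimes>\<^bsub>Q8\<^esub> x)" by (rule h.hom_mult[OF x x, symmetric])
    finally show ?thesis unfolding Q8_mult .
  qed
  show ?thesis
  proof (rule order_p3_minimal_PF[where p = 2 and z = "h ?m" and S = "{h ?i, h ?j}"])
    show "order G = 2 ^ 3" using bij_betw_same_card[OF h(2)] card_Q8 by (simp add: order_def)
    show "\<not> cyclic_subset G (carrier G)"
    proof
      assume "cyclic_subset G (carrier G)"
      from cyclic_comm[OF this h.hom_closed[OF c(1)] h.hom_closed[OF c(2)]]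
      have "h (?i \<otimes>\<^bsub>Q8\<^esub> ?j) = h (?j \<otimes>\<^bsub>Q8\<^esub> ?i)" unfolding h.hom_mult[OF c(1,2)] h.hom_mult[OF c(2,1)] .
      moreover have "h (?i \<otimes>\<^bsub>Q8\<^esub> ?j) = h (?j \<otimes>\<^bsub>Q8\<^esub> ?i) \<longleftrightarrow> ?i \<otimes>\<^bsub>Q8\<^esub> ?j = ?j \<otimes>\<^bsub>Q8\<^esub> ?i"
        using c by (intro inj) simp_all
      ultimately show False by (simp add: Q8_mult)
    qed
    show "h ?m \<in> group_center G"
      unfolding group_center_def
    proof (intro CollectI conjI ballI)
      fix g assume "g \<in> carrier G"
      then obtain x where x: "x \<in> carrier Q8" "g = h x" unfolding surj[symmetric] by (elim imageE)
      have "?m \<otimes>\<^bsub>Q8\<^esub> x = x \<otimes>\<^bsub>Q8\<^esub> ?m" by (cases x) (simp add: Q8_mult)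
      then have "h (?m \<otimes>\<^bsub>Q8\<^esub> x) = h (x \<otimes>\<^bsub>Q8\<^esub> ?m)" by (rule arg_cong)
      then show "h ?m \<otimes> g = g \<otimes> h ?m" unfolding x(2) h.hom_mult[OF c(3) x(1)] h.hom_mult[OF x(1) c(3)] .
    qed (use c in simp)
    show "h ?m [^] (2::nat) = \<one>" unfolding sq[OF c(3)] using h1 by simp
    show "generate G {h ?i, h ?j} = carrier G"
    proof -
      let ?g = "generate Q8 {?i, ?j}"
      have m: "hamilton_mult x y \<in> ?g" if "x \<in> ?g" "y \<in> ?g" for x y
        using generate.eng[OF that] by (simp add: Q8_mult)
      have i: "?i \<in> ?g" and j: "?j \<in> ?g" by (auto intro: generate.incl)
      have k: "(0,0,0,1) \<in> ?g" using m[OF i j] by simp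
      have mm: "?m \<in> ?g" using m[OF i i] by simp
      have "carrier Q8 \<subseteq> ?g"
        using i j k mm m[OF mm i] m[OF mm j] m[OF mm k] m[OF mm mm] by (simp add: Q8_def)
      moreover have "?g \<subseteq> carrier Q8" using c by (intro Q8.generate_incl) simp
      ultimately have "?g = carrier Q8" by simp
      then show ?thesis using h.generate_img[of "{?i, ?j}"] c surj by simp
    qed
    show "s [^] (2::nat) \<noteq> \<one>" if "s \<in> {h ?i, h ?j}" for s
    proof -
      have "h ?i [^] (2::nat) \<noteq> \<one>" "h ?j [^] (2::nat) \<noteq> \<one>" unfolding sq[OF c(1)] sq[OF c(2)] using hm by simp_all
      then show ?thesis using that by (elim insertE emptyE) simp_all
    qed
  qed (use c h.hom_closed hm in simp_all)
qed

lemma Q8_iso: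
  assumes t: "t \<in> carrier G" and u: "u \<in> carrier G" and rel: "u \<otimes> u = t \<otimes> t" "(t \<otimes> t) \<otimes> (t \<otimes> t) = \<one>"
    "u \<otimes> t = (t \<otimes> t) \<otimes> (t \<otimes> u)" and gen: "generate G {t, u} = carrier G" and card: "card (carrier G) = 8"
  shows "G \<cong> Q8"
proof -
  define z where "z = t \<otimes> t"
  have zc: "z \<in> carrier G" using t by (simp add: z_def)
  have r1: "t \<otimes> t = z" "u \<otimes> u = z" "z \<otimes> z = \<one>" "u \<otimes> t = z \<otimes> (t \<otimes> u)" using rel by (simp_all add: z_def)
  have tz: "t \<otimes> z = z \<otimes> t" using t by (simp add: z_def m_assoc)
  have uz: "u \<otimes> z = z \<otimes> u" unfolding r1(2)[symmetric] using u by (simp add: m_assoc)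
  have ctx: "a \<otimes> (b \<otimes> x) = d \<otimes> x" if "a \<otimes> b = d" "a \<in> carrier G" "b \<in> carrier G" "x \<in> carrier G" for a b d x
    using that m_assoc[of a b x] by simp
  have r2: "t \<otimes> (t \<otimes> x) = z \<otimes> x" "u \<otimes> (u \<otimes> x) = z \<otimes> x" "z \<otimes> (z \<otimes> x) = x"
    "u \<otimes> (t \<otimes> x) = z \<otimes> (t \<otimes> (u \<otimes> x))" "t \<otimes> (z \<otimes> x) = z \<otimes> (t \<otimes> x)" "u \<otimes> (z \<otimes> x) = z \<otimes> (u \<otimes> x)"
    if "x \<in> carrier G" for x
    using that t u zc ctx[OF r1(1) t t that] ctx[OF r1(2) u u that] ctx[OF r1(3) zc zc that] ctx[OF r1(4) u t that]
      ctx[OF tz t zc that] ctx[OF uz u zc that] by (simp_all add: m_assoc)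
  define g where "g = (\<lambda>(a, b, c, d). if a = (1::int) then \<one> else if a = -1 then z
    else if b = (1::int) then t else if b = -1 then z \<otimes> t else if c = (1::int) then u else if c = -1 then z \<otimes> u
    else if d = (1::int) then t \<otimes> u else z \<otimes> (t \<otimes> u))"
  have hom: "g \<in> hom Q8 G"
  proof (rule homI)
    show "g x \<in> carrier G" if "x \<in> carrier Q8" for x using t u zc by (simp add: g_def split: prod.split)
    show "g (x \<otimes>\<^bsub>Q8\<^esub> y) = g x \<otimes> g y" if "x \<in> carrier Q8" "y \<in> carrier Q8" for x y
    proof -
      have x: "x \<in> {(1,0,0,0), (-1,0,0,0), (0,1,0,0), (0,-1,0,0), (0,0,1,0), (0,0,-1,0), (0,0,0,1), (0,0,0,-1)}"
        and y: "y \<in> {(1,0,0,0), (-1,0,0,0), (0,1,0,0), (0,-1,0,0), (0,0,1,0), (0,0,-1,0), (0,0,0,1), (0,0,0,-1)}"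
        using that by (simp_all add: Q8_def)
      show ?thesis using x y unfolding Q8_mult
        by (elim insertE emptyE; hypsubst) (simp_all add: g_def t u zc r1 tz uz r2 m_assoc)
    qed
  qed
  interpret g: group_hom Q8 G g by (simp add: group_hom_def group_hom_axioms_def hom is_group group_Q8)
  have "generate G {t, u} \<subseteq> g ` carrier Q8"
  proof (rule generate_subgroup_incl[OF _ g.img_is_subgroup])
    have "t = g (0,1,0,0)" "u = g (0,0,1,0)" by (simp_all add: g_def)
    then show "{t, u} \<subseteq> g ` carrier Q8" by (auto simp: Q8_def)
  qed
  then have surj: "g ` carrier Q8 = carrier G" using gen g.hom_closed by auto
  have "finite (carrier Q8)" by (simp add: Q8_def)
  moreover have "card (g ` carrier Q8) = card (carrier Q8)" using surj card card_Q8 by simp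
  ultimately have "inj_on g (carrier Q8)" by (rule eq_card_imp_inj_on)
  then have "Q8 \<cong> G" using hom surj by (auto simp: is_iso_def iso_def bij_betw_def)
  then show ?thesis by (rule Q8.iso_sym)
qed

end

context fin_group begin

lemma frobenius_complementD:
  assumes "frobenius_complement G H"
  shows "subgroup H G" "H \<noteq> {\<one>}" "H \<noteq> carrier G"
    "\<And>g x. g \<in> carrier G ==> g \<notin> H ==> x \<in> H ==> conj_el G g x \<in> H ==> x = \<one>"
proof -
  show 1: "subgroup H G" "H \<noteq> {\<one>}" "H \<noteq> carrier G" using assms by (simp_all add: frobenius_complement_def)
  show "x = \<one>" if x: "g \<in> carrier G" "g \<notin> H" "x \<in> H" "conj_el G g x \<in> H" for g x
  proof -
    have "H \<inter> conj_el G g ` H = {\<one>}"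
      using assms x(1,2) by (simp add: frobenius_complement_def conjugate_set_conj_el)
    then have "conj_el G g x = \<one>" using x(3,4) by blast
    then show ?thesis using conj_eq_one x(1) subgroup.mem_carrier[OF 1(1) x(3)] by blast
  qed
qed

lemma frobenius_complementI:
  assumes H: "subgroup H G" "H \<noteq> {\<one>}" "H \<noteq> carrier G"
    and ti: "\<And>g x. g \<in> carrier G ==> g \<notin> H ==> x \<in> H ==> conj_el G g x \<in> H ==> x = \<one>"
  shows "frobenius_complement G H"
  unfolding frobenius_complement_def conjugate_set_conj_el
proof (intro conjI ballI H)
  fix g assume g: "g \<in> carrier G - H"
  have 1: "\<one> \<in> H" using subgroup.one_closed[OF H(1)] .
  show "H \<inter> conj_el G g ` H = {\<one>}"
  proof
    show "H \<inter> conj_el G g ` H \<subseteq> {\<one>}"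
    proof
      fix y assume "y \<in> H \<inter> conj_el G g ` H"
      then obtain x where x: "x \<in> H" "y = conj_el G g x" "y \<in> H" by blast
      then have "x = \<one>" using ti[of g x] g by simp
      then show "y \<in> {\<one>}" using x g by simp
    qed
    have "\<one> = conj_el G g \<one>" using g by simp
    then show "{\<one>} \<subseteq> H \<inter> conj_el G g ` H" using 1 by (metis IntI empty_subsetI imageI insert_subset)
  qed
qed

text \<open>
  The conjugates of the complement meet pairwise in 1, and their number is its index.
\<close>
lemma frobenius_kernel_card:
  assumes "frobenius_complement G H"
  shows "card (insert \<one> (carrier G - (\<Union>g\<in>carrier G. conjugate_set G g H))) * card H = card (carrier G)"
proof -
  note H = frobenius_complementD[OF assms]
  have Hc: "\<And>h. h \<in> H ==> h \<in> carrier G" using subgroup.mem_carrier[OF H(1)] .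
  have 1: "\<one> \<in> H" using subgroup.one_closed[OF H(1)] .
  let ?S = "H - {\<one>}" let ?U = "\<Union>g\<in>carrier G. conj_el G g ` ?S"
  have c: "card ?U * card H = card (carrier G) * card ?S"
  proof (rule card_conj_union[OF subgroup_self H(1) subgroup.subset[OF H(1)]])
    show "conj_el G g s \<in> ?S" if "g \<in> H" "s \<in> ?S" for g s
      using that conj_in_subgroup[OF H(1)] conj_eq_one[of g s] Hc by auto
    show "g \<in> H" if "g \<in> carrier G" "s \<in> ?S" "conj_el G g s \<in> ?S" for g s
      using that H(4)[of g s] by auto
  qed (use Hc in auto)
  have Uc: "?U \<subseteq> carrier G" using Hc by auto
  have n1: "\<one> \<notin> ?U"
  proof
    assume "\<one> \<in> ?U"
    then obtain g s where gs: "g \<in> carrier G" "s \<in> ?S" "\<one> = conj_el G g s" by blast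
    then have "s = \<one>" using conj_eq_one[of g s] Hc[of s] by simp
    then show False using gs(2) by simp
  qed
  have "insert \<one> (carrier G - (\<Union>g\<in>carrier G. conjugate_set G g H)) = carrier G - ?U"
  proof -
    have "(\<Union>g\<in>carrier G. conjugate_set G g H) = insert \<one> ?U"
    proof
      show "(\<Union>g\<in>carrier G. conjugate_set G g H) \<subseteq> insert \<one> ?U"
      proof
        fix y assume "y \<in> (\<Union>g\<in>carrier G. conjugate_set G g H)"
        then obtain g x where gx: "g \<in> carrier G" "x \<in> H" "y = conj_el G g x" unfolding conjugate_set_conj_el by blast
        show "y \<in> insert \<one> ?U"
        proof (cases "x = \<one>")
          case True then show ?thesis using gx by simp
        next
          case False then show ?thesis using gx by blast
        qed
      qed
      have "\<one> = conj_el G \<one> \<one>" by simp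
      then have "\<one> \<in> conj_el G \<one> ` H" using 1 by (rule image_eqI)
      then show "insert \<one> ?U \<subseteq> (\<Union>g\<in>carrier G. conjugate_set G g H)"
        unfolding conjugate_set_conj_el by blast
    qed
    moreover have "insert u (C - insert u V) = C - V" if "u \<in> C" "u \<notin> V" for u :: 'a and C V using that by auto
    ultimately show ?thesis using n1 one_closed by simp
  qed
  then have kc: "card (insert \<one> (carrier G - (\<Union>g\<in>carrier G. conjugate_set G g H))) = card (carrier G) - card ?U"
    using card_Diff_subset[OF finite_subset[OF Uc fin] Uc] by simp
  have hp: "card ?S = card H - 1" "0 < card H"
    using 1 finite_subgroup[OF H(1)] by (auto simp: card_gt_0_iff)
  have "card ?U * card H = card (carrier G) * card H - card (carrier G)"
    unfolding c hp(1) by (simp add: diff_mult_distrib2)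
  moreover have "card (carrier G) \<le> card (carrier G) * card H" using hp(2) by simp
  ultimately show ?thesis unfolding kc diff_mult_distrib by linarith
qed

lemma frobenius_complement_conj:
  assumes "frobenius_complement G H" and g: "g \<in> carrier G"
  shows "frobenius_complement G (conj_el G g ` H)" "card (conj_el G g ` H) = card H"
proof -
  note H = frobenius_complementD[OF assms(1)]
  have Hc: "\<And>h. h \<in> H ==> h \<in> carrier G" using subgroup.mem_carrier[OF H(1)] .
  have inj: "inj_on (conj_el G g) H" using conj_inj[OF g] Hc by (auto simp: inj_on_def)
  show card: "card (conj_el G g ` H) = card H" by (rule card_image[OF inj])
  have mem: "x \<in> conj_el G g ` H \<longleftrightarrow> conj_el G (inv g) x \<in> H" if "x \<in> carrier G" for x
  proof
    show "conj_el G (inv g) x \<in> H" if xH: "x \<in> conj_el G g ` H"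
    proof -
      obtain h where "h \<in> H" "x = conj_el G g h" using xH by blast
      then show ?thesis using g Hc by simp
    qed
    show "x \<in> conj_el G g ` H" if "conj_el G (inv g) x \<in> H"
      using that g \<open>x \<in> carrier G\<close> by (intro image_eqI[of _ _ "conj_el G (inv g) x"]) simp_all
  qed
  show "frobenius_complement G (conj_el G g ` H)"
  proof (rule frobenius_complementI)
    show "subgroup (conj_el G g ` H) G"
    proof (rule subgroupI)
      show "conj_el G g ` H \<subseteq> carrier G" using g Hc by auto
      show "conj_el G g ` H \<noteq> {}" using subgroup.one_closed[OF H(1)] by auto
      show "inv a \<in> conj_el G g ` H" if "a \<in> conj_el G g ` H" for a
        using that g Hc subgroup.m_inv_closed[OF H(1)] by (auto simp: conj_inv[symmetric])
      show "a \<otimes> b \<in> conj_el G g ` H" if "a \<in> conj_el G g ` H" "b \<in> conj_el G g ` H" for a b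
        using that g Hc subgroup.m_closed[OF H(1)] by (auto simp: conj_mult[symmetric])
    qed
    show "conj_el G g ` H \<noteq> {\<one>}"
    proof
      assume e: "conj_el G g ` H = {\<one>}"
      have "h = \<one>" if "h \<in> H" for h
        using imageI[OF that, of "conj_el G g"] conj_eq_one[OF g Hc[OF that]] unfolding e by simp
      then show False using H(2) subgroup.one_closed[OF H(1)] by blast
    qed
    show "conj_el G g ` H \<noteq> carrier G"
    proof
      assume "conj_el G g ` H = carrier G"
      then have "card H = card (carrier G)" using card by simp
      then show False using H(3) card_subset_eq[OF fin subgroup.subset[OF H(1)]] by simp
    qed
    fix k x assume k: "k \<in> carrier G" "k \<notin> conj_el G g ` H" and x: "x \<in> conj_el G g ` H" "conj_el G k x \<in> conj_el G g ` H"
    have xc: "x \<in> carrier G" using x(1) conj_closed[OF g Hc] by blast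
    let ?x = "conj_el G (inv g) x" and ?k = "conj_el G (inv g) k"
    have 1: "?x \<in> H" "conj_el G (inv g) (conj_el G k x) \<in> H"
      using x mem[OF xc] mem[OF conj_closed[OF k(1) xc]] by simp_all
    have kH: "?k \<notin> H" using mem[OF k(1)] k(2) by simp
    have "conj_el G ?k ?x = conj_el G (inv g) (conj_el G k x)"
      unfolding conj_el_def using g k(1) xc by (simp add: m_assoc inv_mult_group inv_solve_left') (simp add: m_assoc[symmetric])
    then have "?x = \<one>" using H(4)[of ?k ?x] 1 kH g k by simp
    then show "x = \<one>" using conj_eq_one[of "inv g" x] g xc by simp
  qed
qed

text \<open>quotient by the centre\<close>

lemma normal_center: "group_center G \<lhd> G"
  unfolding normal_inv_iff
proof (intro conjI ballI subgroup_center)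
  fix x h assume x: "x \<in> carrier G" and h: "h \<in> group_center G"
  have "h \<in> carrier G" using h by (simp add: group_center_def)
  then have "x \<otimes> h \<otimes> inv x = h" unfolding center_comm[OF h x, symmetric] using x by (simp add: m_assoc)
  then show "x \<otimes> h \<otimes> inv x \<in> group_center G" using h by simp
qed

abbreviation qc :: "'a set monoid" where "qc \<equiv> G Mod group_center G"
abbreviation pr :: "'a => 'a set" where "pr g \<equiv> group_center G #> g"

lemma fin_group_qc: "fin_group qc"
proof -
  have "group qc" by (rule normal.factorgroup_is_group[OF normal_center])
  moreover have "finite (carrier qc)" using fin by (simp add: carrier_FactGroup)
  ultimately show ?thesis by (simp add: fin_group_def fin_group_axioms_def)
qed

lemma pr_hom: "group_hom G qc pr"
  using normal.r_coset_hom_Mod[OF normal_center] is_group fin_group_qc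
  by (simp add: group_hom_def group_hom_axioms_def fin_group_def)

lemma carrier_qc: "carrier qc = pr ` carrier G"
  by (rule carrier_FactGroup)

lemma pr_eq_one: "g \<in> carrier G ==> pr g = \<one>\<^bsub>qc\<^esub> \<longleftrightarrow> g \<in> group_center G"
  using coset_join2[OF _ subgroup_center, of g] coset_join1[OF _ _ subgroup_center, of g] by auto

lemma pr_eq:
  assumes "g \<in> carrier G" "h \<in> carrier G" "pr g = pr h"
  shows "\<exists>c\<in>group_center G. g = c \<otimes> h"
proof -
  have "g \<in> pr h" using rcos_self[OF assms(1) subgroup_center] assms(3) by simp
  then show ?thesis by (auto simp: r_coset_def)
qed

lemma card_preimage:
  assumes A: "A \<subseteq> carrier qc"
  shows "card {g \<in> carrier G. pr g \<in> A} = card A * card (group_center G)"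
proof -
  have Zs: "group_center G \<subseteq> carrier G" using subgroup.subset[OF subgroup_center] .
  have A': "A \<subseteq> rcosets (group_center G)" using A by (simp add: FactGroup_def)
  have "{g \<in> carrier G. pr g \<in> A} = \<Union>A"
  proof
    show "{g \<in> carrier G. pr g \<in> A} \<subseteq> \<Union>A" using rcos_self[OF _ subgroup_center] by blast
    show "\<Union>A \<subseteq> {g \<in> carrier G. pr g \<in> A}"
    proof
      fix x assume "x \<in> \<Union>A"
      then obtain B where B: "B \<in> A" "x \<in> B" by blast
      then obtain a where a: "a \<in> carrier G" "B = pr a" using A' by (auto simp: RCOSETS_def)
      have "x \<in> carrier G" using B a r_coset_subset_G[OF Zs] by blast
      moreover have "pr a = pr x" using repr_independence[OF _ a(1) subgroup_center, of x] B a by simp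
      ultimately show "x \<in> {g \<in> carrier G. pr g \<in> A}" using B a by simp
    qed
  qed
  moreover have "card (group_center G) * card A = card (\<Union>A)"
  proof (rule card_partition)
    show "finite A" using finite_subset[OF A] fin_group.fin[OF fin_group_qc] by blast
    have "\<Union>A \<subseteq> carrier G" using A' rcosets_part_G[OF subgroup_center] by blast
    then show "finite (\<Union>A)" using fin finite_subset by blast
    show "card c = card (group_center G)" if "c \<in> A" for c
      using card_rcosets_equal[OF _ Zs] that A' by (metis subsetD)
    show "c1 \<inter> c2 = {}" if "c1 \<in> A" "c2 \<in> A" "c1 \<noteq> c2" for c1 c2
      using rcos_disjoint[OF subgroup_center] that A' by (auto simp: pairwise_def disjnt_def)
  qed
  ultimately show ?thesis by (simp add: mult.commute)
qed

lemma card_qc: "card (carrier qc) * card (group_center G) = card (carrier G)"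
proof -
  have "{g \<in> carrier G. pr g \<in> carrier qc} = carrier G" using carrier_qc by auto
  then show ?thesis using card_preimage[of "carrier qc"] by simp
qed

end

section \<open>Quasi-Frobenius groups with centre of prime order\<close>

context fin_group begin

lemma conj_el_sub:
  assumes "subgroup L G" "g \<in> L" shows "conj_el (G\<lparr>carrier := L\<rparr>) g x = conj_el G g x"
  using m_inv_consistent[OF assms] by (simp add: conj_el_def)

text \<open>
  A subgroup that meets a complement properly and non-trivially inherits a Frobenius complement. In a minimal
  Frobenius group this leaves few subgroups.
\<close>
lemma frobenius_subgroup:
  assumes C: "frobenius_complement G C" and L: "subgroup L G" and D: "L \<inter> C \<noteq> {\<one>}" "L \<inter> C \<noteq> L"
  shows "frobenius_group (G\<lparr>carrier := L\<rparr>)"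
proof -
  interpret L: fin_group "G\<lparr>carrier := L\<rparr>" by (rule fin_group_subgroup[OF L])
  note c = frobenius_complementD[OF C]
  have s: "subgroup (L \<inter> C) G" using subgroups_Inter_pair[OF L c(1)] .
  have "frobenius_complement (G\<lparr>carrier := L\<rparr>) (L \<inter> C)"
  proof (rule L.frobenius_complementI)
    show "subgroup (L \<inter> C) (G\<lparr>carrier := L\<rparr>)" by (rule subgroup_incl[OF s L]) simp
    show "L \<inter> C \<noteq> {\<one>\<^bsub>G\<lparr>carrier := L\<rparr>\<^esub>}" "L \<inter> C \<noteq> carrier (G\<lparr>carrier := L\<rparr>)" using D by simp_all
    fix g x assume g: "g \<in> carrier (G\<lparr>carrier := L\<rparr>)" "g \<notin> L \<inter> C" and x: "x \<in> L \<inter> C"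
      and cx: "conj_el (G\<lparr>carrier := L\<rparr>) g x \<in> L \<inter> C"
    have gL: "g \<in> L" "g \<in> carrier G" "g \<notin> C" using g subgroup.mem_carrier[OF L] by simp_all
    have "conj_el G g x \<in> C" using cx unfolding conj_el_sub[OF L gL(1)] by simp
    then show "x = \<one>\<^bsub>G\<lparr>carrier := L\<rparr>\<^esub>" using c(4)[OF gL(2,3)] x by simp
  qed
  then show ?thesis using L.is_group L.fin by (auto simp: frobenius_group_def)
qed

text \<open>
  A complement is its own normalizer, whereas normalizers grow in p-groups.
\<close>
lemma pgroup_not_frobenius:
  assumes "order G = p ^ k" "prime (p::nat)" shows "\<not> frobenius_group G"
proof
  assume "frobenius_group G"
  then obtain C where C: "frobenius_complement G C" by (auto simp: frobenius_group_def)
  note c = frobenius_complementD[OF C]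
  obtain x where x: "x \<in> carrier G" "x \<notin> C" "x \<in> normset G C"
    using pgroup_normalizer_grows_order[OF assms c(1,3)] by auto
  have "h = \<one>" if "h \<in> C" for h using c(4)[OF x(1,2) that] x(3) that by (simp add: normset_def)
  then show False using c(2) subgroup.one_closed[OF c(1)] by blast
qed

lemma subgroup_preimage:
  assumes "subgroup L qc" shows "subgroup {g \<in> carrier G. pr g \<in> L} G"
proof -
  interpret h: group_hom G qc pr by (rule pr_hom)
  show ?thesis
  proof (rule subgroupI)
    show "{g \<in> carrier G. pr g \<in> L} \<noteq> {}"
    proof -
      have "\<one> \<in> {g \<in> carrier G. pr g \<in> L}" using h.hom_one subgroup.one_closed[OF assms] by simp
      then show ?thesis by blast
    qed
    show "inv a \<in> {g \<in> carrier G. pr g \<in> L}" if "a \<in> {g \<in> carrier G. pr g \<in> L}" for a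
      using that h.hom_inv[of a] subgroup.m_inv_closed[OF assms, of "pr a"] by simp
    show "a \<otimes> b \<in> {g \<in> carrier G. pr g \<in> L}" if "a \<in> {g \<in> carrier G. pr g \<in> L}" "b \<in> {g \<in> carrier G. pr g \<in> L}" for a b
      using that h.hom_mult[of a b] subgroup.m_closed[OF assms, of "pr a" "pr b"] by simp
  qed auto
qed

lemma card_preimage_image:
  assumes H: "subgroup H G" "group_center G \<subseteq> H"
  shows "{g \<in> carrier G. pr g \<in> pr ` H} = H" "card (pr ` H) * card (group_center G) = card H"
proof -
  have Hc: "\<And>h. h \<in> H ==> h \<in> carrier G" using subgroup.mem_carrier[OF H(1)] .
  show e: "{g \<in> carrier G. pr g \<in> pr ` H} = H"
  proof
    show "{g \<in> carrier G. pr g \<in> pr ` H} \<subseteq> H"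
    proof
      fix g assume "g \<in> {g \<in> carrier G. pr g \<in> pr ` H}"
      then obtain h where h: "g \<in> carrier G" "h \<in> H" "pr g = pr h" by auto
      then obtain c where "c \<in> group_center G" "g = c \<otimes> h" using pr_eq[OF h(1) Hc[OF h(2)]] by auto
      then show "g \<in> H" using H h subgroup.m_closed[OF H(1)] by blast
    qed
    show "H \<subseteq> {g \<in> carrier G. pr g \<in> pr ` H}" using Hc by blast
  qed
  have "pr ` H \<subseteq> carrier qc" using Hc unfolding carrier_qc by blast
  from card_preimage[OF this] show "card (pr ` H) * card (group_center G) = card H" unfolding e by simp
qed

lemma generate_complement:
  assumes S: "subgroup S G" "S \<noteq> carrier G" shows "generate G (carrier G - S) = carrier G"
proof
  show "generate G (carrier G - S) \<subseteq> carrier G" by (rule generate_incl) simp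
  obtain y where y: "y \<in> carrier G" "y \<notin> S" using S subgroup.subset by blast
  have g: "subgroup (generate G (carrier G - S)) G" by (rule generate_is_subgroup) simp
  have yg: "y \<in> generate G (carrier G - S)" using y by (intro generate.incl) simp
  show "carrier G \<subseteq> generate G (carrier G - S)"
  proof
    fix x assume x: "x \<in> carrier G"
    show "x \<in> generate G (carrier G - S)"
    proof (cases "x \<in> S")
      case True
      have "x \<otimes> y \<notin> S"
      proof
        assume "x \<otimes> y \<in> S"
        then have "inv x \<otimes> (x \<otimes> y) \<in> S" using subgroup.m_closed[OF S(1) subgroup.m_inv_closed[OF S(1) True]] by simp
        then show False using x y by (simp add: m_assoc[symmetric])
      qed
      then have "x \<otimes> y \<in> generate G (carrier G - S)" using x y by (intro generate.incl) simp
      then have "(x \<otimes> y) \<otimes> inv y \<in> generate G (carrier G - S)"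
        using subgroup.m_closed[OF g] subgroup.m_inv_closed[OF g yg] by simp
      then show ?thesis using x y by (simp add: m_assoc)
    next
      case False then show ?thesis using x by (intro generate.incl) simp
    qed
  qed
qed

lemma coprime_pow_one:
  assumes "x \<in> carrier G" "x [^] i = \<one>" "x [^] (j::nat) = \<one>" "coprime i j" shows "x = \<one>"
proof -
  have "ord x dvd i" "ord x dvd j" using assms pow_eq_id by simp_all
  then have "ord x = 1" using assms(4) coprime_common_divisor_nat by blast
  then show ?thesis using ord_eq_1[OF assms(1)] by simp
qed

text \<open>
  The preimage of the Frobenius kernel is the Sylow q-subgroup S, of exponent q. The elements outside S generate G
  and have non-trivial q-th powers. A proper subgroup H that is not contained in S is cyclic if it contains the
  centre, since its image is then a complement by minimality; otherwise its elements outside S have order p.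
\<close>
lemma case7_minimal_PF:
  assumes p: "prime (p::nat)" and q: "prime (q::nat)" and pq: "p \<noteq> q"
    and min: "minimal_frobenius_group qc" and ord: "Coset.order qc = q ^ \<alpha> * p"
    and ker: "\<exists>K. frobenius_kernel qc K \<and> card K = q ^ \<alpha>"
    and Zq: "G\<lparr>carrier := group_center G\<rparr> \<cong> cyc q"
    and syl: "\<forall>S. sylow_subgroup q G S --> group_exponent (G\<lparr>carrier := S\<rparr>) = q"
  shows "minimal_PF_group G"
proof -
  interpret Q: fin_group qc by (rule fin_group_qc)
  interpret h: group_hom G qc pr by (rule pr_hom)
  have gt: "1 < p" "1 < q" using p q prime_gt_1_nat by blast+
  have cop: "coprime p q" using primes_coprime[OF p q pq] .
  let ?Z = "group_center G"
  have cZ: "card ?Z = q"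
  proof -
    have "card ?Z = card (carrier (cyc q))" using iso_same_card[OF Zq] by simp
    then show ?thesis using gt by (simp add: carrier_integer_mod_group)
  qed
  have cQ: "card (carrier qc) = q ^ \<alpha> * p" using ord by (simp add: order_def)
  have cG: "card (carrier G) = q ^ (\<alpha> + 1) * p" using card_qc unfolding cQ cZ by (simp add: mult_ac)
  obtain K where K: "frobenius_kernel qc K" "card K = q ^ \<alpha>" using ker by blast
  then obtain C where C: "frobenius_complement qc C"
    and KC: "K = insert \<one>\<^bsub>qc\<^esub> (carrier qc - (\<Union>g\<in>carrier qc. conjugate_set qc g C))" by (auto simp: frobenius_kernel_def)
  have cC: "card C = p"
  proof -
    have "q ^ \<alpha> * card C = q ^ \<alpha> * p" using Q.frobenius_kernel_card[OF C] unfolding KC[symmetric] K(2) cQ .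
    then show ?thesis using gt by simp
  qed
  have conjC: "\<exists>C'. frobenius_complement qc C' \<and> card C' = p \<and> x \<in> C'" if x: "x \<in> carrier qc" "x \<notin> K" for x
  proof -
    have "x \<in> (\<Union>g\<in>carrier qc. conjugate_set qc g C)" using x unfolding KC by blast
    then obtain g where g: "g \<in> carrier qc" "x \<in> conj_el qc g ` C" unfolding conjugate_set_conj_el by blast
    then show ?thesis using Q.frobenius_complement_conj[OF C g(1)] cC by auto
  qed
  have xp: "x [^]\<^bsub>qc\<^esub> p = \<one>\<^bsub>qc\<^esub>" if x: "x \<in> carrier qc" "x \<notin> K" for x
  proof -
    obtain C' where C': "frobenius_complement qc C'" "card C' = p" "x \<in> C'" using conjC[OF x] by blast
    show ?thesis using Q.pow_card_subgroup[OF Q.frobenius_complementD(1)[OF C'(1)] C'(3)] C'(2) by simp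
  qed
  have oneK: "\<one>\<^bsub>qc\<^esub> \<in> K" using KC by simp
  have Kc: "K \<subseteq> carrier qc" unfolding KC using Q.one_closed by blast
  obtain S where S: "subgroup S G" "card S = q ^ (\<alpha> + 1)"
    using sylow_thm[OF q is_group _ fin, of "\<alpha> + 1" p] cG by (auto simp: order_def)
  have mult: "multiplicity q (Coset.order G) = \<alpha> + 1"
  proof (rule multiplicity_eqI)
    show "q ^ (\<alpha> + 1) dvd Coset.order G" using cG by (simp add: order_def)
    show "\<not> q ^ Suc (\<alpha> + 1) dvd Coset.order G"
    proof
      assume "q ^ Suc (\<alpha> + 1) dvd Coset.order G"
      then have "q ^ (\<alpha> + 1) * q dvd q ^ (\<alpha> + 1) * p" using cG by (simp add: order_def mult.commute)
      then have "q dvd p" using gt by simp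
      then show False using primes_dvd_imp_eq[OF q p] pq by simp
    qed
  qed
  have exS: "x [^] q = \<one>" if x: "x \<in> S" for x
  proof -
    have e: "group_exponent (G\<lparr>carrier := S\<rparr>) = q" using syl S mult by (simp add: sylow_subgroup_def)
    define Pr where "Pr = (\<lambda>n::nat. n > 0 \<and> (\<forall>x\<in>carrier (G\<lparr>carrier := S\<rparr>). x [^]\<^bsub>G\<lparr>carrier := S\<rparr>\<^esub> n = \<one>\<^bsub>G\<lparr>carrier := S\<rparr>\<^esub>))"
    have "Pr (card S)" using pow_card_subgroup[OF S(1)] nat_pow_consistent[of _ "card S" S] S gt by (simp add: Pr_def)
    then have "Pr (LEAST n. Pr n)" by (rule LeastI)
    moreover have "(LEAST n. Pr n) = q" using e by (simp add: group_exponent_def Pr_def)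
    ultimately have "Pr q" by simp
    then have "\<forall>x\<in>S. x [^]\<^bsub>G\<lparr>carrier := S\<rparr>\<^esub> q = \<one>" by (simp add: Pr_def)
    then show ?thesis using x nat_pow_consistent[of x q S] by simp
  qed
  have SK: "S = {g \<in> carrier G. pr g \<in> K}"
  proof (rule card_subset_eq)
    show "finite {g \<in> carrier G. pr g \<in> K}" using fin by simp
    show "S \<subseteq> {g \<in> carrier G. pr g \<in> K}"
    proof
      fix x assume x: "x \<in> S"
      have xc: "x \<in> carrier G" using subgroup.mem_carrier[OF S(1) x] .
      have "pr x \<in> K"
      proof (rule ccontr)
        assume n: "pr x \<notin> K"
        have "pr x [^]\<^bsub>qc\<^esub> q = \<one>\<^bsub>qc\<^esub>" using h.hom_nat_pow[OF xc, of q] exS[OF x] h.hom_one by simp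
        then have "pr x = \<one>\<^bsub>qc\<^esub>" using Q.coprime_pow_one[OF h.hom_closed[OF xc] xp[OF h.hom_closed[OF xc] n] _ cop] by simp
        then show False using n oneK by simp
      qed
      then show "x \<in> {g \<in> carrier G. pr g \<in> K}" using xc by simp
    qed
    show "card S = card {g \<in> carrier G. pr g \<in> K}" using card_preimage[OF Kc] S(2) K(2) cZ by simp
  qed
  have outK: "pr g \<notin> K" if "g \<in> carrier G" "g \<notin> S" for g using that SK by simp
  have Sne: "S \<noteq> carrier G" using S(2) cG gt by auto
  have ZS: "?Z \<subseteq> S"
  proof
    fix x assume x: "x \<in> ?Z"
    have xc: "x \<in> carrier G" using subgroup.mem_carrier[OF subgroup_center x] .
    have "pr x = \<one>\<^bsub>qc\<^esub>" using pr_eq_one[OF xc] x by blast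
    then have "pr x \<in> K" using oneK by metis
    then show "x \<in> S" using xc unfolding SK by blast
  qed
  obtain z where z: "z \<in> ?Z" "z \<noteq> \<one>"
  proof -
    have "\<not> ?Z \<subseteq> {\<one>}" using cZ gt card_mono[of "{\<one>}" ?Z] by auto
    then show ?thesis using that by blast
  qed
  have zq: "x [^] q = \<one>" if "x \<in> ?Z" for x using pow_card_subgroup[OF subgroup_center that] cZ by simp
  show ?thesis
  proof (rule minimal_PF_I[where z = z and p = q and S = "carrier G - S"])
    show "\<not> cyclic_subset G (carrier G)"
    proof
      assume "cyclic_subset G (carrier G)"
      from cyclic_comm[OF this] have "?Z = carrier G" by (auto simp: group_center_def)
      then have "q ^ \<alpha> * p = 1" using cG cZ gt by simp
      then show False using gt by simp
    qed
    show "z \<in> ?Z" "z \<noteq> \<one>" using z by auto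
    show "z [^] q = \<one>" by (rule zq[OF z(1)])
    show "generate G (carrier G - S) = carrier G" by (rule generate_complement[OF S(1) Sne])
    show "s [^] q \<noteq> \<one>" if s: "s \<in> carrier G - S" for s
    proof
      assume e: "s [^] q = \<one>"
      have sc: "s \<in> carrier G" "s \<notin> S" using s by auto
      have "pr s [^]\<^bsub>qc\<^esub> q = \<one>\<^bsub>qc\<^esub>" using h.hom_nat_pow[OF sc(1), of q] e h.hom_one by simp
      then have "pr s = \<one>\<^bsub>qc\<^esub>"
        using Q.coprime_pow_one[OF h.hom_closed[OF sc(1)] xp[OF h.hom_closed[OF sc(1)] outK[OF sc]] _ cop] by simp
      then show False using outK[OF sc] oneK by simp
    qed
    fix H assume H: "subgroup H G" "H \<noteq> carrier G" "\<not> cyclic_subset G H"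
    have Hc: "\<And>h. h \<in> H ==> h \<in> carrier G" using subgroup.mem_carrier[OF H(1)] .
    have cH: "card H dvd q ^ (\<alpha> + 1) * p" using card_proper(1)[OF H(1,2)] cG by simp
    show "admits_partition (G\<lparr>carrier := H\<rparr>)"
    proof (cases "H \<subseteq> S")
      case True
      then show ?thesis using exS by (intro exponent_p_partition[OF H(1,3) q]) auto
    next
      case False
      then obtain h0 where h0: "h0 \<in> H" "h0 \<notin> S" by blast
      have h0c: "h0 \<in> carrier G" using Hc h0 by simp
      show ?thesis
      proof (cases "?Z \<subseteq> H")
        case True
        obtain C' where C': "frobenius_complement qc C'" "card C' = p" "pr h0 \<in> C'"
          using conjC[OF h.hom_closed[OF h0c] outK[OF h0c h0(2)]] by blast
        have sL: "subgroup (pr ` H) qc" by (rule h.subgroup_img_is_subgroup[OF H(1)])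
        have cL: "card (pr ` H) * q = card H" using card_preimage_image(2)[OF H(1) True] cZ by simp
        have Lne: "pr ` H \<noteq> carrier qc"
        proof
          assume "pr ` H = carrier qc"
          then have "card H = card (carrier G)" using cL cQ cG by (simp add: ac_simps)
          then show False using card_proper(2)[OF H(1,2)] by simp
        qed
        have "pr ` H \<inter> C' = pr ` H"
        proof (rule ccontr)
          assume ne: "pr ` H \<inter> C' \<noteq> pr ` H"
          have "pr h0 \<noteq> \<one>\<^bsub>qc\<^esub>" using outK[OF h0c h0(2)] oneK by auto
          then have "pr ` H \<inter> C' \<noteq> {\<one>\<^bsub>qc\<^esub>}" using C'(3) h0(1) by blast
          from Q.frobenius_subgroup[OF C'(1) sL this ne] show False
            using min sL Lne by (simp add: minimal_frobenius_group_def)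
        qed
        then have "pr ` H \<subseteq> C'" by blast
        then have "card (pr ` H) dvd p"
          using Q.subgroup_card_dvd[OF sL Q.frobenius_complementD(1)[OF C'(1)]] C'(2) by simp
        then have "card H dvd q * p" using cL[symmetric] by (simp add: mult.commute)
        then have "cyclic_subset G H"
          using cyclic_two_primes[OF H(1) _ q p pq[symmetric] _ z(2) zq[OF z(1)]] z(1) True center_comm[OF z(1) Hc] by blast
        then show ?thesis using H(3) by simp
      next
        case False
        have ZH: "x = \<one>" if x: "x \<in> ?Z" "x \<in> H" for x
        proof (rule ccontr)
          assume n: "x \<noteq> \<one>"
          have xc: "x \<in> carrier G" using Hc x by simp
          have "ord x = q" using ord_prime[OF xc n zq[OF x(1)] q] .
          then have "card (generate G {x}) = q" using generate_pow_card[OF xc] by simp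
          moreover have "generate G {x} \<subseteq> ?Z" by (rule generate_single_incl[OF subgroup_center x(1)])
          ultimately have "generate G {x} = ?Z" using card_subset_eq[OF finite_subgroup[OF subgroup_center]] cZ by simp
          then show False using False generate_single_incl[OF H(1) x(2)] by simp
        qed
        have hp: "x [^] p = \<one>" if x: "x \<in> H" "x \<notin> S" for x
        proof -
          have xc: "x \<in> carrier G" using Hc x by simp
          have "pr (x [^] p) = \<one>\<^bsub>qc\<^esub>" using h.hom_nat_pow[OF xc, of p] xp[OF h.hom_closed[OF xc] outK[OF xc x(2)]] by simp
          then have "x [^] p \<in> ?Z" using pr_eq_one[of "x [^] p"] xc by simp
          then show ?thesis using ZH pow_in_subgroup[OF H(1) x(1)] by simp
        qed
        have sI: "subgroup (H \<inter> S) G" using subgroups_Inter_pair[OF H(1) S(1)] .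
        show ?thesis
        proof (rule admits_partition_sub[OF H(1) sI _ _ _ p])
          show "H \<inter> S \<noteq> H" using h0 by blast
          show "H \<inter> S \<noteq> {\<one>}"
          proof
            assume e: "H \<inter> S = {\<one>}"
            have all: "x [^] p = \<one>" if "x \<in> H" for x
            proof (cases "x \<in> S")
              case True then have "x = \<one>" using e that by blast
              then show ?thesis by simp
            next
              case False then show ?thesis using hp that by simp
            qed
            have "\<not> q dvd card H"
            proof
              assume "q dvd card H"
              then obtain x where x: "x \<in> H" "x \<noteq> \<one>" "x [^] q = \<one>" using cauchy[OF H(1) q] by auto
              then show False using coprime_pow_one[OF Hc[OF x(1)] all[OF x(1)] x(3) cop] by simp
            qed
            then have "coprime (card H) (q ^ (\<alpha> + 1))" using q by (simp add: coprime_commute prime_imp_coprime)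
            then have "card H dvd p" using cH coprime_dvd_mult_right_iff by blast
            then show False using cyclic_prime_card[OF H(1) _ p] H(3) by simp
          qed
        qed (use hp in auto)
      qed
    qed
  qed simp
qed

lemma cyc_iso:
  assumes "carrier G = generate G {z}" "z \<in> carrier G" shows "G \<cong> cyc (ord z)"
proof -
  let ?n = "ord z"
  have n: "0 < ?n" using ord_pos assms by simp
  have cc: "carrier (cyc ?n) = {0..<int ?n}" using n by (simp add: carrier_integer_mod_group)
  interpret C: group "cyc ?n" by (rule group_integer_mod_group)
  have hom: "(\<lambda>i. z [^] i) \<in> hom (cyc ?n) G"
  proof (rule homI)
    show "z [^] (x \<otimes>\<^bsub>cyc ?n\<^esub> y) = z [^] x \<otimes> z [^] y" for x y
      using int_pow_mod[OF assms(2) pow_ord_eq_1[OF assms(2)], of "x + y"] assms(2) by (simp add: int_pow_mult)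
  qed (use assms(2) in simp)
  have "carrier G \<subseteq> (\<lambda>i. z [^] i) ` carrier (cyc ?n)"
  proof
    fix x assume "x \<in> carrier G"
    then obtain k :: nat where k: "x = z [^] k" using assms generate_single_iff by blast
    have "x = z [^] (int k mod int ?n)"
      unfolding int_pow_mod[OF assms(2) pow_ord_eq_1[OF assms(2)]] using k by (simp add: int_pow_int)
    then show "x \<in> (\<lambda>i. z [^] i) ` carrier (cyc ?n)" using n by (intro image_eqI[of _ _ "int k mod int ?n"]) (simp_all add: cc)
  qed
  then have surj: "(\<lambda>i. z [^] i) ` carrier (cyc ?n) = carrier G" using assms(2) by auto
  have "card (carrier G) = ?n" using assms generate_pow_card by simp
  then have "inj_on (\<lambda>i. z [^] i) (carrier (cyc ?n))"
    using surj by (intro eq_card_imp_inj_on) (simp_all add: cc)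
  then have "cyc ?n \<cong> G" using hom surj by (auto simp: is_iso_def iso_def bij_betw_def)
  then show ?thesis by (rule C.iso_sym)
qed

text \<open>
  The image of \<langle>u\<rangle> meets its conjugates trivially: if u commutes with n \<in> N modulo the centre,
  the central commutator has order dividing q and so is trivial, and then n is central.
\<close>
lemma frobenius_quotient:
  assumes u: "u \<in> carrier G" "u [^] q = \<one>" "prime (q::nat)" and N: "subgroup N G" "group_center G \<subseteq> N"
    and norm: "u \<in> normset G N" "u \<notin> N" and ext: "carrier G = ext G N u"
    and cent: "\<And>x. x \<in> N ==> x \<otimes> u = u \<otimes> x ==> x \<in> group_center G"
    and Zq: "\<And>c. c \<in> group_center G ==> c [^] q = \<one> ==> c = \<one>"
  shows "frobenius_complement qc (pr ` generate G {u})" "card (pr ` generate G {u}) = q" "frobenius_group qc"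
proof -
  interpret Q: fin_group qc by (rule fin_group_qc)
  interpret h: group_hom G qc pr by (rule pr_hom)
  let ?Z = "group_center G" and ?U = "generate G {u}"
  have sU: "subgroup ?U G" by (rule subgroup_generate1[OF u(1)])
  have Uc: "\<And>x. x \<in> ?U ==> x \<in> carrier G" using subgroup.mem_carrier[OF sU] .
  have Nc: "\<And>x. x \<in> N ==> x \<in> carrier G" using subgroup.mem_carrier[OF N(1)] .
  have Uq: "x [^] q = \<one>" if x: "x \<in> ?U" for x
  proof -
    obtain k :: nat where "x = u [^] k" using x generate_single_iff[OF u(1)] by blast
    then have "x [^] q = (u [^] q) [^] k" using u(1) by (simp add: nat_pow_pow mult.commute)
    then show ?thesis using u(2) by simp
  qed
  have UN: "x = \<one>" if x: "x \<in> ?U" "x \<in> N" for x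
  proof (rule ccontr)
    assume "x \<noteq> \<one>"
    from prime_order_generator[OF u x(1) this] have "u \<in> N" using generate_single_incl[OF N(1) x(2)] by blast
    then show False using norm(2) by simp
  qed
  have Ucomm: "x \<otimes> u = u \<otimes> x" if "x \<in> ?U" for x
    using cyclic_comm[OF cyclic_subset_generate1[OF u(1)] that in_generate1] .
  have u1: "u \<noteq> \<one>" using norm(2) subgroup.one_closed[OF N(1)] by auto
  have inj: "inj_on pr ?U"
  proof (rule inj_onI)
    fix x y assume xy: "x \<in> ?U" "y \<in> ?U" "pr x = pr y"
    obtain c where c: "c \<in> ?Z" "x = c \<otimes> y" using pr_eq[OF Uc[OF xy(1)] Uc[OF xy(2)] xy(3)] by blast
    have cc: "c \<in> carrier G" using c subgroup.mem_carrier[OF subgroup_center] by simp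
    have "c = x \<otimes> inv y" using c(2) cc Uc[OF xy(2)] by (simp add: m_assoc)
    then have "c \<in> ?U" using subgroup.m_closed[OF sU xy(1) subgroup.m_inv_closed[OF sU xy(2)]] by simp
    then have "c = \<one>" using UN c(1) N(2) by blast
    then show "x = y" using c(2) Uc[OF xy(2)] by simp
  qed
  have ou: "ord u = q" using ord_prime[OF u(1) u1 u(2,3)] .
  show card: "card (pr ` ?U) = q" using card_image[OF inj] generate_pow_card[OF u(1)] ou by simp
  show compl: "frobenius_complement qc (pr ` ?U)"
  proof (rule Q.frobenius_complementI)
    show "subgroup (pr ` ?U) qc" by (rule h.subgroup_img_is_subgroup[OF sU])
    show "pr ` ?U \<noteq> {\<one>\<^bsub>qc\<^esub>}" using card prime_gt_1_nat[OF u(3)] by auto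
    show "pr ` ?U \<noteq> carrier qc"
    proof
      assume e: "pr ` ?U = carrier qc"
      have "N \<subseteq> ?Z"
      proof
        fix x assume x: "x \<in> N"
        have "pr x \<in> pr ` ?U" unfolding e by (rule h.hom_closed[OF Nc[OF x]])
        then obtain y where y: "y \<in> ?U" "pr x = pr y" by blast
        obtain c where c: "c \<in> ?Z" "x = c \<otimes> y" using pr_eq[OF Nc[OF x] Uc[OF y(1)] y(2)] by blast
        have cc: "c \<in> carrier G" using c subgroup.mem_carrier[OF subgroup_center] by simp
        have "x \<otimes> u = c \<otimes> (u \<otimes> y)" using c cc Uc[OF y(1)] u(1) Ucomm[OF y(1)] by (simp add: m_assoc)
        also have "\<dots> = u \<otimes> x"
          using c(2) cc Uc[OF y(1)] u(1) center_comm[OF c(1) u(1)] by (simp add: m_assoc[symmetric])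
        finally show "x \<in> ?Z" using cent[OF x] by simp
      qed
      have "u \<in> ?Z"
        unfolding group_center_def
      proof (intro CollectI conjI ballI u(1))
        fix g assume "g \<in> carrier G"
        then obtain n and i :: nat where g: "n \<in> N" "g = n \<otimes> u [^] i" unfolding ext by (auto simp: ext_def)
        have nZ: "n \<in> ?Z" using g \<open>N \<subseteq> ?Z\<close> by blast
        have "u \<otimes> n = n \<otimes> u" using center_comm[OF nZ u(1)] by simp
        then have "u \<otimes> g = n \<otimes> (u \<otimes> u [^] i)" using g Nc[OF g(1)] u(1) by (simp add: m_assoc[symmetric])
        also have "u \<otimes> u [^] i = u [^] i \<otimes> u" using comm_pow[OF u(1) u(1) refl, of i] by simp
        finally show "u \<otimes> g = g \<otimes> u" using g Nc[OF g(1)] u(1) by (simp add: m_assoc)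
      qed
      then show False using norm(2) N(2) by blast
    qed
    fix gb x assume gb: "gb \<in> carrier qc" "gb \<notin> pr ` ?U" and x: "x \<in> pr ` ?U" "conj_el qc gb x \<in> pr ` ?U"
    obtain g where g: "g \<in> carrier G" "gb = pr g" using gb(1) unfolding carrier_qc by blast
    obtain y where y: "y \<in> ?U" "x = pr y" using x(1) by blast
    have yc: "y \<in> carrier G" using Uc y by simp
    have "conj_el qc gb x = pr (conj_el G g y)"
      unfolding g(2) y(2) conj_el_def using g(1) yc h.hom_mult h.hom_inv by simp
    then obtain w where w: "w \<in> ?U" "pr w = pr (conj_el G g y)" using x(2) by auto
    have cgy: "conj_el G g y \<in> carrier G" using g yc by simp
    obtain c where c: "c \<in> ?Z" "w = c \<otimes> conj_el G g y" using pr_eq[OF Uc[OF w(1)] cgy w(2)] by blast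
    have cc: "c \<in> carrier G" using c subgroup.mem_carrier[OF subgroup_center] by simp
    have "c [^] q = \<one>"
    proof -
      have "conj_el G g y [^] q = \<one>" using conj_pow[OF g(1) yc, of q] Uq[OF y(1)] g(1) by simp
      then have "w [^] q = c [^] q" unfolding c(2) using pow_mult_distrib[OF center_comm[OF c(1) cgy] cc cgy, of q] cc by simp
      then show ?thesis using Uq[OF w(1)] by simp
    qed
    then have "c = \<one>" using Zq c(1) by blast
    then have wy: "w = conj_el G g y" using c(2) cgy by simp
    show "x = \<one>\<^bsub>qc\<^esub>"
    proof (rule ccontr)
      assume "x \<noteq> \<one>\<^bsub>qc\<^esub>"
      then have "y \<noteq> \<one>" using y(2) h.hom_one by auto
      from prime_order_generator[OF u y(1) this] obtain l :: nat where l: "u = y [^] l" using generate_single_iff[OF yc] by blast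
      have "conj_el G g u = w [^] l" unfolding l wy by (rule conj_pow[OF g(1) yc])
      then have guU: "conj_el G g u \<in> ?U" using pow_in_subgroup[OF sU w(1)] by simp
      obtain n and i :: nat where ni: "n \<in> N" "g = n \<otimes> u [^] i" using g(1) unfolding ext by (auto simp: ext_def)
      have nc: "n \<in> carrier G" using Nc ni by simp
      have "conj_el G g u = conj_el G n (conj_el G (u [^] i) u)" unfolding ni(2) using nc u(1) by (simp add: conj_mult_left)
      also have "conj_el G (u [^] i) u = u" using conj_eq_self[of "u [^] i" u] comm_pow[OF u(1) u(1) refl, of i] u(1) by simp
      finally have nuU: "conj_el G n u \<in> ?U" using guU by simp
      have "conj_el G n u \<otimes> inv u = n \<otimes> conj_el G u (inv n)" using nc u(1) by (simp add: conj_el_def m_assoc)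
      moreover have "n \<otimes> conj_el G u (inv n) \<in> N"
        using subgroup.m_closed[OF N(1) ni(1)] norm(1) subgroup.m_inv_closed[OF N(1) ni(1)] by (simp add: normset_def)
      moreover have "conj_el G n u \<otimes> inv u \<in> ?U"
        using subgroup.m_closed[OF sU nuU subgroup.m_inv_closed[OF sU in_generate1]] .
      ultimately have "conj_el G n u \<otimes> inv u = \<one>" using UN by simp
      then have "conj_el G n u = u" using nc u(1) inv_solve_right'[of \<one> "conj_el G n u" u] by simp
      then have "n \<otimes> u = u \<otimes> n" using conj_eq_self[OF nc u(1)] by simp
      then have "n \<in> ?Z" using cent ni(1) by simp
      then have prn: "pr n = \<one>\<^bsub>qc\<^esub>" using pr_eq_one[OF nc] by blast
      have uic: "u [^] i \<in> carrier G" using u(1) by simp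
      have "gb = pr n \<otimes>\<^bsub>qc\<^esub> pr (u [^] i)" unfolding g(2) ni(2) by (rule h.hom_mult[OF nc uic])
      then have "gb = pr (u [^] i)" unfolding prn Q.l_one[OF h.hom_closed[OF uic]] .
      then show False using gb(2) pow_in_subgroup[OF sU in_generate1] by blast
    qed
  qed
  show "frobenius_group qc" using compl Q.is_group Q.fin by (auto simp: frobenius_group_def)
qed

text \<open>
  By the hypothesis on H, the proper subgroups of the central quotient are p-groups or have order q, hence are not
  Frobenius groups.
\<close>
lemma case7_forward:
  assumes p: "prime (p::nat)" and q: "prime (q::nat)" and pq: "p \<noteq> q"
    and Z: "card (group_center G) = p" "group_center G = generate G {z}" "z \<in> carrier G"
    and P: "subgroup P G" "group_center G \<subseteq> P" "card P = p ^ (\<alpha> + 1)" "\<alpha> > 0" "\<And>x. x \<in> P ==> x [^] p = \<one>"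
    and nP: "\<And>g. g \<in> carrier G ==> g \<in> normset G P"
    and u: "u \<in> carrier G" "u [^] q = \<one>" "u \<notin> P" and ext: "carrier G = ext G P u"
    and cent: "\<And>x. x \<in> P ==> x \<otimes> u = u \<otimes> x ==> x \<in> group_center G"
    and sub: "\<And>H. subgroup H G ==> group_center G \<subseteq> H ==> H \<noteq> carrier G ==> H \<subseteq> P \<or> card H = p * q"
  shows "quasi_frobenius_group G \<and> minimal_frobenius_group qc \<and> Coset.order qc = p ^ \<alpha> * q \<and>
    (\<exists>K. frobenius_kernel qc K \<and> card K = p ^ \<alpha>) \<and> G\<lparr>carrier := group_center G\<rparr> \<cong> cyc p \<and>
    (\<forall>S. sylow_subgroup p G S --> group_exponent (G\<lparr>carrier := S\<rparr>) = p)"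
proof -
  interpret Q: fin_group qc by (rule fin_group_qc)
  interpret h: group_hom G qc pr by (rule pr_hom)
  have gt: "1 < p" "1 < q" using p q prime_gt_1_nat by blast+
  have cop: "coprime p q" using primes_coprime[OF p q pq] .
  let ?Z = "group_center G"
  have Zq: "c = \<one>" if c: "c \<in> ?Z" "c [^] q = \<one>" for c
    using coprime_pow_one[OF subgroup.mem_carrier[OF subgroup_center c(1)] _ c(2) cop]
      pow_card_subgroup[OF subgroup_center c(1)] Z(1) by simp
  have F: "frobenius_complement qc (pr ` generate G {u})" "card (pr ` generate G {u}) = q" "frobenius_group qc"
    using frobenius_quotient[OF u(1,2) q P(1,2) nP[OF u(1)] u(3) ext] cent Zq by blast+
  have "u [^] q \<in> P" using u(2) subgroup.one_closed[OF P(1)] by simp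
  then have cG: "card (carrier G) = p ^ (\<alpha> + 1) * q" using card_ext[OF P(1) u(1,3) _ q] ext P(3) by simp
  have "card (carrier qc) * p = p ^ \<alpha> * q * p" using card_qc unfolding cG Z(1) by (simp add: mult_ac)
  then have cQ: "card (carrier qc) = p ^ \<alpha> * q" using gt by simp
  have quasi: "quasi_frobenius_group G" unfolding quasi_frobenius_group_def by (intro conjI is_group fin F(3))
  have kern: "\<exists>K. frobenius_kernel qc K \<and> card K = p ^ \<alpha>"
  proof -
    let ?K = "insert \<one>\<^bsub>qc\<^esub> (carrier qc - (\<Union>g\<in>carrier qc. conjugate_set qc g (pr ` generate G {u})))"
    have "card ?K * q = p ^ \<alpha> * q" using Q.frobenius_kernel_card[OF F(1)] unfolding F(2) cQ .
    then have "card ?K = p ^ \<alpha>" using gt by simp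
    moreover have "frobenius_kernel qc ?K" unfolding frobenius_kernel_def by (intro exI[of _ "pr ` generate G {u}"] conjI F(1) refl)
    ultimately show ?thesis by blast
  qed
  have iso: "G\<lparr>carrier := ?Z\<rparr> \<cong> cyc p"
  proof -
    interpret Z: fin_group "G\<lparr>carrier := ?Z\<rparr>" by (rule fin_group_subgroup[OF subgroup_center])
    have zZ: "z \<in> ?Z" unfolding Z(2) by (rule in_generate1)
    have g: "generate (G\<lparr>carrier := ?Z\<rparr>) {z} = ?Z"
      using generate_consistent[OF _ subgroup_center, of "{z}"] zZ Z(2) by simp
    have "Z.ord z = p" using Z.generate_pow_card[of z] g zZ Z(1) by simp
    then show ?thesis using Z.cyc_iso[of z] g zZ by simp
  qed
  have minF: "minimal_frobenius_group qc"
    unfolding minimal_frobenius_group_def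
  proof (intro conjI F(3) allI impI, elim conjE)
    fix L assume L: "subgroup L qc" "L \<noteq> carrier qc"
    let ?H = "{g \<in> carrier G. pr g \<in> L}"
    have sH: "subgroup ?H G" by (rule subgroup_preimage[OF L(1)])
    have ZH: "?Z \<subseteq> ?H"
    proof
      fix x assume x: "x \<in> ?Z"
      have xc: "x \<in> carrier G" using subgroup.mem_carrier[OF subgroup_center x] .
      have "pr x = \<one>\<^bsub>qc\<^esub>" using pr_eq_one[OF xc] x by blast
      then have "pr x \<in> L" using subgroup.one_closed[OF L(1)] by metis
      then show "x \<in> ?H" using xc by blast
    qed
    have Lc: "L \<subseteq> carrier qc" using subgroup.subset[OF L(1)] .
    have cH: "card ?H = card L * p" using card_preimage[OF Lc] Z(1) by simp
    have "?H \<noteq> carrier G"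
    proof
      assume "?H = carrier G"
      then have "carrier qc \<subseteq> L" unfolding carrier_qc by auto
      then show False using L(2) Lc by simp
    qed
    then consider "?H \<subseteq> P" | "card ?H = p * q" using sub[OF sH ZH] by blast
    then have "\<exists>r k. prime (r::nat) \<and> card L = r ^ k"
    proof cases
      case 1
      then have "card ?H dvd p ^ (\<alpha> + 1)" using subgroup_card_dvd[OF sH P(1)] P(3) by simp
      then have "card L dvd p ^ (\<alpha> + 1)" unfolding cH by (rule dvd_mult_left)
      then show ?thesis using divides_primepow_nat[OF p] p by blast
    next
      case 2
      then have "card L = q ^ 1" using cH gt by simp
      then show ?thesis using q by blast
    qed
    then obtain r k where rk: "prime (r::nat)" "card L = r ^ k" by blast
    interpret L: fin_group "qc\<lparr>carrier := L\<rparr>" by (rule Q.fin_group_subgroup[OF L(1)])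
    show "\<not> frobenius_group (qc\<lparr>carrier := L\<rparr>)"
      using L.pgroup_not_frobenius[OF _ rk(1), of k] rk(2) by (simp add: order_def)
  qed
  have syl: "group_exponent (G\<lparr>carrier := S\<rparr>) = p" if S: "sylow_subgroup p G S" for S
  proof -
    have mult: "multiplicity p (Coset.order G) = \<alpha> + 1"
    proof (rule multiplicity_eqI)
      show "p ^ (\<alpha> + 1) dvd Coset.order G" using cG by (simp add: order_def)
      show "\<not> p ^ Suc (\<alpha> + 1) dvd Coset.order G"
      proof
        assume "p ^ Suc (\<alpha> + 1) dvd Coset.order G"
        then have "p ^ (\<alpha> + 1) * p dvd p ^ (\<alpha> + 1) * q" using cG by (simp add: order_def mult.commute)
        then have "p dvd q" using gt by simp
        then show False using primes_dvd_imp_eq[OF p q] pq by simp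
      qed
    qed
    have sS: "subgroup S G" "card S = p ^ (\<alpha> + 1)" using S mult by (simp_all add: sylow_subgroup_def)
    have Sc: "\<And>x. x \<in> S ==> x \<in> carrier G" using subgroup.mem_carrier[OF sS(1)] .
    have key: "x \<in> P" if x: "x \<in> carrier G" "x [^] p \<in> P" for x
    proof (rule ccontr)
      assume n: "x \<notin> P"
      have "card (ext G P x) dvd card (carrier G)"
        using subgroup_ext[OF P(1) nP[OF x(1)]] subgroup_card_dvd[OF _ subgroup_self] subgroup.subset by blast
      then have "p ^ (\<alpha> + 1) * p dvd p ^ (\<alpha> + 1) * q" using card_ext[OF P(1) x(1) n x(2) p] P(3) cG by simp
      then have "p dvd q" using gt by simp
      then show False using primes_dvd_imp_eq[OF p q] pq by simp
    qed
    have pw: "x \<in> P" if "x \<in> carrier G" "x [^] (p ^ i) \<in> P" for x i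
      using that
    proof (induction i)
      case (Suc i)
      have "(x [^] (p ^ i)) [^] p \<in> P" using Suc.prems by (simp add: nat_pow_pow mult.commute)
      then show ?case using key[of "x [^] (p ^ i)"] Suc by simp
    qed simp
    have "S \<subseteq> P"
    proof
      fix x assume x: "x \<in> S"
      have "x [^] (p ^ (\<alpha> + 1)) \<in> P" using pow_card_subgroup[OF sS(1) x] sS(2) subgroup.one_closed[OF P(1)] by simp
      then show "x \<in> P" by (rule pw[OF Sc[OF x]])
    qed
    then have SP: "S = P" using card_subset_eq[OF finite_subgroup[OF P(1)]] sS(2) P(3) by simp
    show ?thesis
      unfolding group_exponent_def
    proof (rule Least_equality)
      show "0 < p \<and> (\<forall>x\<in>carrier (G\<lparr>carrier := S\<rparr>). x [^]\<^bsub>G\<lparr>carrier := S\<rparr>\<^esub> p = \<one>\<^bsub>G\<lparr>carrier := S\<rparr>\<^esub>)"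
        using gt P(5) SP nat_pow_consistent[of _ p S] by simp
      fix n :: nat assume n: "0 < n \<and> (\<forall>x\<in>carrier (G\<lparr>carrier := S\<rparr>). x [^]\<^bsub>G\<lparr>carrier := S\<rparr>\<^esub> n = \<one>\<^bsub>G\<lparr>carrier := S\<rparr>\<^esub>)"
      have "p dvd card P" using P(3) by simp
      then obtain x where x: "x \<in> P" "x \<noteq> \<one>" "x [^] p = \<one>" using cauchy[OF P(1) p] by auto
      have xc: "x \<in> carrier G" using subgroup.mem_carrier[OF P(1) x(1)] .
      have "x [^] n = \<one>" using n x(1) SP nat_pow_consistent[of x n S] by simp
      then have "p dvd n" using ord_prime[OF xc x(2,3) p] pow_eq_id[OF xc, of n] by simp
      then show "p \<le> n" using n dvd_imp_le by blast
    qed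
  qed
  show ?thesis using quasi minF cQ kern iso syl by (simp add: order_def)
qed

end

section \<open>Cyclic and prime power subgroups\<close>

lemma prime_part: "n \<noteq> 0 ==> prime (r::nat) ==> \<exists>m i. n = m * r ^ i \<and> \<not> r dvd m"
  using multiplicity_decompose'[of n r] by (metis mult.commute not_prime_unit)

context fin_group begin

lemma cyclic_ord_generate:
  assumes C: "cyclic_subset G C" and x: "x \<in> C" "y \<in> C" "y [^] ord x = \<one>"
  shows "y \<in> generate G {x}"
proof -
  obtain c where c: "c \<in> carrier G" "C = generate G {c}" using C by (auto simp: cyclic_subset_def)
  obtain i :: nat where i: "x = c [^] i" using x(1) c generate_single_iff by blast
  obtain j :: nat where j: "y = c [^] j" using x(2) c generate_single_iff by blast
  have xc: "x \<in> carrier G" using i c by simp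
  let ?n = "ord c"
  have n0: "0 < ?n" using ord_pos[OF c(1)] .
  let ?g = "gcd ?n i"
  have "?g dvd j"
  proof (cases "i = 0")
    case True
    then have "ord x = 1" using i ord_eq_1[OF xc] by simp
    then have "c [^] j = \<one>" using x(3) j c by simp
    then show ?thesis using True pow_eq_id[OF c(1)] by simp
  next
    case False
    have ox: "ord x = ?n div ?g" unfolding i using ord_pow_gen[OF c(1), of i] False by simp
    have "c [^] (j * (?n div ?g)) = \<one>" using x(3) j c ox by (simp add: nat_pow_pow)
    then have "?n dvd j * (?n div ?g)" using pow_eq_id[OF c(1)] by simp
    moreover have "?n = ?g * (?n div ?g)" by simp
    moreover have "0 < ?n div ?g" using n0 by (simp add: div_greater_zero_iff dvd_imp_le)
    ultimately show ?thesis by (metis dvd_mult_cancel2 mult.commute nat_mult_dvd_cancel1)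
  qed
  then obtain e where e: "j = ?g * e" by blast
  have "\<exists>l. [i * l = ?g] (mod ?n)"
  proof (cases "i = 0")
    case True then show ?thesis by (auto simp: cong_def)
  next
    case False then show ?thesis using cong_solve_nat[of i ?n] by (simp add: gcd.commute)
  qed
  then obtain l where "[i * l = ?g] (mod ?n)" by blast
  then have "c [^] (i * l) = c [^] ?g" by (rule pow_cong[OF c(1) pow_ord_eq_1[OF c(1)]])
  then have "x [^] (l * e) = (c [^] ?g) [^] e" using i c(1) by (simp add: nat_pow_pow[symmetric])
  also have "\<dots> = y" using j e c(1) by (simp add: nat_pow_pow)
  finally show ?thesis using generate_single_iff[OF xc] by blast
qed

lemma cyclic_normset:
  assumes A: "cyclic_subset G A" "g \<in> normset G A" "a \<in> A"
  shows "g \<in> normset G (generate G {a})"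
proof -
  have s: "subgroup A G" by (rule cyclic_subset_subgroup[OF A(1)])
  have ac: "a \<in> carrier G" using subgroup.mem_carrier[OF s A(3)] .
  have g: "g \<in> carrier G" "conj_el G g a \<in> A" using A by (simp_all add: normset_def)
  have "conj_el G g a [^] ord a = \<one>" using conj_pow[OF g(1) ac, of "ord a"] pow_ord_eq_1[OF ac] g(1) by simp
  then have c: "conj_el G g a \<in> generate G {a}" by (rule cyclic_ord_generate[OF A(1,3) g(2)])
  have "conj_el G g n \<in> generate G {a}" if n: "n \<in> generate G {a}" for n
  proof -
    obtain i :: nat where i: "n = a [^] i" using n generate_single_iff[OF ac] by blast
    show ?thesis unfolding i conj_pow[OF g(1) ac] by (rule pow_in_subgroup[OF subgroup_generate1[OF ac] c])
  qed
  then show ?thesis using g(1) by (simp add: normset_def)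
qed

lemma commutator_obtain:
  assumes A: "subgroup A G" "y \<in> normset G A" "a \<in> A"
  obtains w where "w \<in> A" "conj_el G y a = w \<otimes> a" "y \<otimes> a = w \<otimes> (a \<otimes> y)"
proof (rule that[of "conj_el G y a \<otimes> inv a"])
  have c: "y \<in> carrier G" "a \<in> carrier G" using A subgroup.mem_carrier by (auto simp: normset_def)
  show "conj_el G y a \<otimes> inv a \<in> A"
    using A(2,3) by (intro subgroup.m_closed[OF A(1)] subgroup.m_inv_closed[OF A(1)]) (auto simp: normset_def)
  show "conj_el G y a = conj_el G y a \<otimes> inv a \<otimes> a" using c by (simp add: m_assoc)
  show "y \<otimes> a = conj_el G y a \<otimes> inv a \<otimes> (a \<otimes> y)"
    using mult_eq_conj[OF c] c by (simp add: m_assoc inv_solve_left' flip: m_assoc[of "inv a" a y])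
qed

lemma cyclic_pgroup_chain:
  assumes C: "cyclic_subset G C" "card C = p ^ k" "prime (p::nat)" and x: "x \<in> C" "y \<in> C"
  shows "x \<in> generate G {y} \<or> y \<in> generate G {x}"
proof -
  have s: "subgroup C G" using cyclic_subset_subgroup[OF C(1)] .
  have xc: "x \<in> carrier G" "y \<in> carrier G" using subgroup.mem_carrier[OF s] x by simp_all
  obtain i where i: "ord x = p ^ i" using ord_dvd_card[OF s x(1)] C divides_primepow_nat by metis
  obtain j where j: "ord y = p ^ j" using ord_dvd_card[OF s x(2)] C divides_primepow_nat by metis
  show ?thesis
  proof (cases "i \<le> j")
    case True
    then have "x [^] ord y = \<one>" using pow_eq_id[OF xc(1)] i j by (simp add: le_imp_power_dvd)
    then show ?thesis using cyclic_ord_generate[OF C(1) x(2,1)] by simp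
  next
    case False
    then have "y [^] ord x = \<one>" using pow_eq_id[OF xc(2)] i j by (simp add: le_imp_power_dvd)
    then show ?thesis using cyclic_ord_generate[OF C(1) x(1,2)] by simp
  qed
qed

lemma center_normset: "x \<in> group_center G ==> subgroup N G ==> x \<in> normset G N"
proof -
  assume x: "x \<in> group_center G" and N: "subgroup N G"
  have xc: "x \<in> carrier G" using subgroup.mem_carrier[OF subgroup_center x] .
  have "conj_el G x n \<in> N" if n: "n \<in> N" for n
  proof -
    have nc: "n \<in> carrier G" using subgroup.mem_carrier[OF N n] .
    have "conj_el G x n = n" using conj_eq_self[OF xc nc] center_comm[OF x nc] by simp
    then show ?thesis using n by simp
  qed
  then show ?thesis using xc by (simp add: normset_def)
qed

lemma comm_normset:
  assumes "x \<in> carrier G" "y \<in> carrier G" "x \<otimes> y = y \<otimes> x" shows "x \<in> normset G (generate G {y})"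
proof -
  have "conj_el G x n \<in> generate G {y}" if n: "n \<in> generate G {y}" for n
  proof -
    obtain k :: nat where k: "n = y [^] k" using n generate_single_iff[OF assms(2)] by blast
    have "x \<otimes> n = n \<otimes> x" unfolding k using comm_pow[OF assms(2,1) assms(3)[symmetric], of k] by simp
    then have "conj_el G x n = n" using conj_eq_self[of x n] assms k by simp
    then show ?thesis using n by simp
  qed
  then show ?thesis using assms(1) by (simp add: normset_def)
qed

lemma ext_abelian:
  assumes x: "x \<in> carrier G" "y \<in> carrier G" "x \<otimes> y = y \<otimes> x"
  shows "subgroup (ext G (generate G {y}) x) G"
    "\<And>v. v \<in> ext G (generate G {y}) x ==> v \<otimes> x = x \<otimes> v"
    "\<And>v. v \<in> ext G (generate G {y}) x ==> v \<otimes> y = y \<otimes> v"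
    "x \<in> ext G (generate G {y}) x" "y \<in> ext G (generate G {y}) x"
proof -
  have s: "subgroup (generate G {y}) G" by (rule subgroup_generate1[OF x(2)])
  show "subgroup (ext G (generate G {y}) x) G" by (rule subgroup_ext[OF s comm_normset[OF x]])
  have "y \<in> centralizer G x" "x \<in> centralizer G x" "y \<in> centralizer G y" "x \<in> centralizer G y"
    using x by (simp_all add: centralizer_def)
  then have "ext G (generate G {y}) x \<subseteq> centralizer G x" "ext G (generate G {y}) x \<subseteq> centralizer G y"
    using ext_least[OF subgroup_centralizer[OF x(1)] generate_single_incl[OF subgroup_centralizer[OF x(1)]]]
      ext_least[OF subgroup_centralizer[OF x(2)] generate_single_incl[OF subgroup_centralizer[OF x(2)]]] by simp_all
  then show "\<And>v. v \<in> ext G (generate G {y}) x ==> v \<otimes> x = x \<otimes> v"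
    "\<And>v. v \<in> ext G (generate G {y}) x ==> v \<otimes> y = y \<otimes> v" by (auto simp: centralizer_def)
  show "x \<in> ext G (generate G {y}) x" "y \<in> ext G (generate G {y}) x" using ext_incl[OF s x(1)] in_generate1 by auto
qed

lemma prime_power_outside:
  assumes H: "subgroup H G" and x: "x \<in> carrier G" "x \<notin> H"
  obtains r k :: nat where "prime r" "x [^] k \<notin> H" "(x [^] k) [^] r \<in> H"
proof -
  define d where "d = (LEAST d::nat. d > 0 \<and> x [^] d \<in> H)"
  have "ord x > 0 \<and> x [^] ord x \<in> H" using ord_pos x subgroup.one_closed[OF H] by simp
  then have d: "d > 0 \<and> x [^] d \<in> H" unfolding d_def by (rule LeastI)
  have least: "d \<le> e" if "e > 0" "x [^] e \<in> H" for e :: nat unfolding d_def using that by (intro Least_le) simp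
  have "d \<noteq> 1" using d x by auto
  then obtain r where r: "prime r" "r dvd d" using prime_factor_nat by blast
  then obtain k where k: "d = r * k" by blast
  have "0 < k" "k < d" using d k prime_gt_1_nat[OF r(1)] by auto
  then have "x [^] k \<notin> H" using least[of k] by auto
  moreover have "(x [^] k) [^] r \<in> H" using d k x by (simp add: nat_pow_pow mult.commute)
  ultimately show ?thesis using that r(1) by blast
qed

lemma prime_power_outside':
  assumes H: "subgroup H G" and x: "x \<in> carrier G" "x \<notin> H" "x [^] r \<in> H" "prime (r::nat)"
  obtains k i :: nat where "x [^] k \<notin> H" "(x [^] k) [^] r \<in> H" "(x [^] k) [^] (r ^ i) = \<one>"
proof -
  have o0: "ord x \<noteq> 0" using ord_pos[OF x(1)] by simp
  obtain m i where m: "ord x = m * r ^ i" "\<not> r dvd m"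
    using prime_part[OF o0 x(4)] by blast
  have "coprime m r" using m(2) x(4) by (metis coprime_commute prime_imp_coprime)
  have "x [^] m \<notin> H"
  proof
    assume a: "x [^] m \<in> H"
    obtain l where "[m * l = Suc 0] (mod r)" using cong_solve_coprime_nat[OF \<open>coprime m r\<close>] by blast
    then have "(m * l) mod r = 1" using prime_gt_1_nat[OF x(4)] by (simp add: cong_def)
    then have e: "m * l = r * (m * l div r) + 1" by (metis mult_div_mod_eq)
    have "(x [^] m) [^] l = (x [^] r) [^] (m * l div r) \<otimes> x"
      unfolding nat_pow_pow[OF x(1)] by (subst e) (simp add: x(1))
    then have "x = inv ((x [^] r) [^] (m * l div r)) \<otimes> (x [^] m) [^] l"
      using x(1) by (simp add: inv_solve_left)
    also have "\<dots> \<in> H" by (intro subgroup.m_closed[OF H] subgroup.m_inv_closed[OF H] pow_in_subgroup[OF H] a x(3))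
    finally show False using x(2) by simp
  qed
  moreover have "(x [^] m) [^] r \<in> H"
    using pow_in_subgroup[OF H x(3), of m] x(1) by (simp add: nat_pow_pow mult.commute)
  moreover have "(x [^] m) [^] (r ^ i) = \<one>" using x(1) m(1) pow_ord_eq_1[OF x(1)] by (simp add: nat_pow_pow)
  ultimately show ?thesis using that by blast
qed

lemma pgroup_card:
  assumes H: "subgroup H G" and p: "prime (p::nat)" and e: "\<And>x. x \<in> H ==> \<exists>i. x [^] (p ^ i) = \<one>"
  shows "\<exists>k. card H = p ^ k"
proof -
  have c0: "card H \<noteq> 0" using finite_subgroup[OF H] subgroup.one_closed[OF H] by auto
  obtain m i where m: "card H = m * p ^ i" "\<not> p dvd m"
    using prime_part[OF c0 p] by blast
  have "m = 1"
  proof (rule ccontr)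
    assume "m \<noteq> 1"
    then obtain q where q: "prime q" "q dvd m" using prime_factor_nat by blast
    then have "q \<noteq> p" using m(2) by auto
    obtain x where x: "x \<in> H" "x \<noteq> \<one>" "x [^] q = \<one>" using cauchy[OF H q(1)] q(2) m(1) by auto
    obtain i where "x [^] (p ^ i) = \<one>" using e[OF x(1)] by blast
    moreover have "coprime q (p ^ i)" using primes_coprime[OF q(1) p \<open>q \<noteq> p\<close>] by simp
    ultimately show False using coprime_pow_one[OF subgroup.mem_carrier[OF H x(1)] x(3)] x(2) by blast
  qed
  then show ?thesis using m by auto
qed

text \<open>
  Let x have maximal order. An r-element outside \<langle>x\<rangle> would generate, with the r-part of x, a
  larger cyclic r-group, and so an element of larger order.
\<close>
lemma abelian_cyclic:
  assumes comm: "\<And>x y. x \<in> carrier G ==> y \<in> carrier G ==> x \<otimes> y = y \<otimes> x"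
    and cyc: "\<And>H r k. subgroup H G ==> prime r ==> card H = r ^ k ==> cyclic_subset G H"
  shows "cyclic_subset G (carrier G)"
proof -
  have "finite (ord ` carrier G)" "ord ` carrier G \<noteq> {}" using fin one_closed by auto
  then have "Max (ord ` carrier G) \<in> ord ` carrier G" by (rule Max_in)
  then obtain x where x: "x \<in> carrier G" "ord x = Max (ord ` carrier G)" by auto
  have mx: "ord y \<le> ord x" if "y \<in> carrier G" for y using x fin that by simp
  have "carrier G \<subseteq> generate G {x}"
  proof (rule ccontr)
    assume "\<not> carrier G \<subseteq> generate G {x}"
    then obtain y0 where y0: "y0 \<in> carrier G" "y0 \<notin> generate G {x}" by blast
    have sx: "subgroup (generate G {x}) G" by (rule subgroup_generate1[OF x(1)])
    obtain r k :: nat where rk: "prime r" "y0 [^] k \<notin> generate G {x}" "(y0 [^] k) [^] r \<in> generate G {x}"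
      using prime_power_outside[OF sx y0] .
    have "y0 [^] k \<in> carrier G" using y0 by simp
    obtain k' i :: nat where k': "(y0 [^] k) [^] k' \<notin> generate G {x}" "((y0 [^] k) [^] k') [^] (r ^ i) = \<one>"
      using prime_power_outside'[OF sx \<open>y0 [^] k \<in> carrier G\<close> rk(2,3,1)] by metis
    define y where "y = (y0 [^] k) [^] k'"
    have y: "y \<in> carrier G" "y \<notin> generate G {x}" "y [^] (r ^ i) = \<one>" using k' y0 by (simp_all add: y_def)
    have o0: "ord x \<noteq> 0" using ord_pos[OF x(1)] by simp
    obtain m a where m: "ord x = m * r ^ a" "\<not> r dvd m"
      using prime_part[OF o0 rk(1)] by blast
    have m0: "m \<noteq> 0" using m o0 by auto
    have cop: "coprime m r" using m(2) rk(1) by (metis coprime_commute prime_imp_coprime)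
    let ?u = "x [^] m" and ?v = "x [^] (r ^ a)"
    have u: "?u \<in> carrier G" "?v \<in> carrier G" using x by simp_all
    have r0: "r ^ a \<noteq> 0" using prime_gt_0_nat[OF rk(1)] by simp
    have ou: "ord ?u = r ^ a" using ord_pow[OF x(1), of m] m m0 by simp
    have ov: "ord ?v = m" using ord_pow[OF x(1), of "r ^ a"] m r0 by simp
    note A = ext_abelian[OF y(1) u(1) comm[OF y(1) u(1)]]
    let ?H = "ext G (generate G {?u}) y"
    have "\<exists>j. h [^] (r ^ j) = \<one>" if hH: "h \<in> ?H" for h
    proof -
      obtain n and l :: nat where nl: "n \<in> generate G {?u}" "h = n \<otimes> y [^] l" using hH unfolding ext_def by blast
      obtain t :: nat where t: "n = ?u [^] t" using nl(1) generate_single_iff[OF u(1)] by blast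
      have "n [^] (r ^ (a + i)) = \<one>"
      proof -
        have "n [^] (r ^ (a + i)) = (?u [^] ord ?u) [^] (t * r ^ i)" unfolding t ou using u(1) by (simp only: nat_pow_pow power_add mult_ac)
        then show ?thesis using pow_ord_eq_1[OF u(1)] by simp
      qed
      moreover have "(y [^] l) [^] (r ^ (a + i)) = (y [^] (r ^ i)) [^] (l * r ^ a)" using y(1) by (simp only: nat_pow_pow power_add mult_ac)
      ultimately have "h [^] (r ^ (a + i)) = \<one>"
        unfolding nl(2) using pow_mult_distrib[of n "y [^] l"] comm[of n "y [^] l"] y t u(1) by simp
      then show ?thesis by blast
    qed
    then obtain b where "card ?H = r ^ b" using pgroup_card[OF A(1) rk(1)] by blast
    from cyc[OF A(1) rk(1) this] obtain d where d: "d \<in> carrier G" "?H = generate G {d}" by (auto simp: cyclic_subset_def)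
    have "card ?H = ord d" using d generate_pow_card[OF d(1)] by simp
    have "generate G {?u} \<subset> ?H"
    proof
      show "generate G {?u} \<subseteq> ?H" by (rule generate_single_incl[OF A(1,5)])
      show "generate G {?u} \<noteq> ?H"
      proof
        assume "generate G {?u} = ?H"
        then have "y \<in> generate G {?u}" using A(4) by simp
        then show False using y(2) generate_single_incl[OF sx pow_in_subgroup[OF sx in_generate1]] by blast
      qed
    qed
    then have "card (generate G {?u}) < card ?H" by (rule psubset_card_mono[OF finite_subgroup[OF A(1)]])
    then have lt: "r ^ a < ord d" using \<open>card ?H = ord d\<close> generate_pow_card[OF u(1)] ou by simp
    have "coprime (ord d) (ord ?v)" using \<open>card ?H = r ^ b\<close> \<open>card ?H = ord d\<close> ov cop by (metis coprime_commute coprime_power_left_iff)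
    then have "ord (d \<otimes> ?v) = ord d * m" using ord_coprime_mult[OF d(1) u(2) comm[OF d(1) u(2)]] ov by simp
    then have "ord x < ord (d \<otimes> ?v)" using lt m m0 by (simp add: mult.commute)
    then show False using mx[of "d \<otimes> ?v"] d(1) u(2) by simp
  qed
  then have "carrier G = generate G {x}" using generate_incl[of "{x}"] x by auto
  then show ?thesis using x by (auto simp: cyclic_subset_def)
qed

end

context min_PF_z begin

lemma centralizer_cyclic:
  assumes e: "e \<in> carrier G" "e [^] p \<noteq> \<one>" "e \<notin> group_center G"
  shows "cyclic_subset G (centralizer G e)"
proof (rule proper_cyclic[OF subgroup_centralizer[OF e(1)] _ _ _ e(2)])
  show "centralizer G e \<noteq> carrier G"
  proof
    assume c: "centralizer G e = carrier G"
    have "e \<otimes> g = g \<otimes> e" if "g \<in> carrier G" for g using that unfolding c[symmetric] by (simp add: centralizer_def)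
    then show False using e by (simp add: group_center_def)
  qed
  show "z \<in> centralizer G e" using zc zcomm[OF e(1)] by (simp add: centralizer_def)
  show "e \<in> centralizer G e" using e by (simp add: centralizer_def)
qed (simp add: centralizer_def)

lemma central_cyclic:
  assumes e: "e \<in> group_center G" "e [^] p \<noteq> \<one>" and M: "subgroup M G" "M \<noteq> carrier G" "z \<in> M" "e \<in> M"
  shows "cyclic_subset G M"
  using proper_cyclic[OF M e(2)] center_comm[OF e(1)] subgroup.mem_carrier[OF M(1)] by simp

lemma ord_z: "ord z = p" by (rule ord_prime[OF zc z(2,3) p])

lemma E_nonempty: "\<exists>e\<in>carrier G. e [^] p \<noteq> \<one>"
proof (rule ccontr)
  assume "\<not> ?thesis"
  then have "insert z {x \<in> carrier G. x [^] p \<noteq> \<one>} = {z}" by auto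
  then have "carrier G = generate G {z}" using hughes_eq unfolding hughes_def by metis
  then show False using not_cyclic zc by (auto simp: cyclic_subset_def)
qed

lemma E_not_in_proper:
  assumes "subgroup M G" "M \<noteq> carrier G" "z \<in> M"
  shows "\<exists>e\<in>carrier G. e [^] p \<noteq> \<one> \<and> e \<notin> M"
  using hughes_least[OF assms(1,3), of "carrier G" p] hughes_eq assms(2) subgroup.subset[OF assms(1)] by blast

text \<open>
  All elements of Q except 1 have non-trivial p-th powers. If Q \<langle>z\<rangle> were proper, Q would lie in
  its cyclic Hughes subgroup.
\<close>
lemma q_subgroup:
  assumes Q: "subgroup Q G" "card Q = q ^ k" "prime (q::nat)" "q \<noteq> p" and nc: "\<not> cyclic_subset G Q"
  shows "carrier G = ext G Q z" "z \<notin> Q"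
proof -
  have cop: "coprime (q ^ k) p" using primes_coprime[OF Q(3) p Q(4)] by simp
  have one: "x = \<one>" if "x \<in> Q" "x [^] p = \<one>" for x
    using coprime_pow_one[OF subgroup.mem_carrier[OF Q(1) that(1)] _ that(2) cop] pow_card_subgroup[OF Q(1) that(1)] Q(2) by simp
  have zn: "z \<in> normset G Q" by (rule center_normset[OF z(1) Q(1)])
  note s = subgroup_ext[OF Q(1) zn]
  note i = ext_incl[OF Q(1) zc]
  show "z \<notin> Q" using one z by blast
  show "carrier G = ext G Q z"
  proof (rule ccontr)
    assume "carrier G \<noteq> ext G Q z"
    then have ne: "ext G Q z \<noteq> carrier G" by simp
    have sh: "subgroup (hughes G p z (ext G Q z)) G" by (rule hughes_subgroup(1)[OF s i(2)])
    have "Q \<subseteq> hughes G p z (ext G Q z)"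
    proof
      fix x assume x: "x \<in> Q"
      show "x \<in> hughes G p z (ext G Q z)"
      proof (cases "x [^] p = \<one>")
        case True then show ?thesis using one[OF x] subgroup.one_closed[OF sh] by simp
      next
        case False then show ?thesis using hughes_incl[of x "ext G Q z" p z] i(1) x by blast
      qed
    qed
    then show False using cyclic_subset_sub[OF hughesM[OF s ne i(2)] Q(1)] nc by simp
  qed
qed

text \<open>
  If Q is not cyclic, then G = Q \<langle>z\<rangle> and a central element u of Q is central in G. The first
  argument, now with u and q, yields v of order q outside \<langle>u\<rangle>; the non-cyclic group \<langle>u,
  v\<rangle> can take the place of Q.
\<close>
lemma q_subgroup_cyclic:
  assumes Q: "subgroup Q G" "card Q = q ^ k" "prime (q::nat)" "q \<noteq> p" and n4: "\<not> (\<exists>a b. split_mc G a b (p * q) q 1)"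
  shows "cyclic_subset G Q"
proof (rule ccontr)
  assume nc: "\<not> cyclic_subset G Q"
  note ext = q_subgroup[OF Q nc]
  have Qc: "\<And>x. x \<in> Q ==> x \<in> carrier G" using subgroup.mem_carrier[OF Q(1)] .
  have "k > 0"
  proof (rule ccontr)
    assume "\<not> k > 0"
    then have "card Q = 1" using Q by simp
    then show False using cyclic_prime_card[OF Q(1) _ Q(3)] nc by simp
  qed
  then obtain u where u: "u \<in> Q" "u \<noteq> \<one>" "u [^] q = \<one>" "\<And>x. x \<in> Q ==> x \<otimes> u = u \<otimes> x"
    using pgroup_center_sub[OF Q(1-3)] by blast
  have uc: "u \<in> carrier G" using Qc u by simp
  have "ext G Q z \<subseteq> centralizer G u"
    using u Qc uc zc zcomm[OF uc] by (intro ext_least[OF subgroup_centralizer[OF uc]]) (auto simp: centralizer_def)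
  then have "g \<otimes> u = u \<otimes> g" if "g \<in> carrier G" for g using that ext(1) by (auto simp: centralizer_def)
  then have uZ: "u \<in> group_center G" using uc by (simp add: group_center_def)
  interpret U: min_PF_z G u q by unfold_locales (use uZ u Q in auto)
  have Qne: "Q \<noteq> carrier G" using ext(2) zc by blast
  note hs = hughes_subgroup[OF Q(1) u(1), of q]
  have "hughes G q u Q \<noteq> Q" using U.hughesM[OF Q(1) Qne u(1)] nc by auto
  then obtain v where v: "v \<in> Q" "v \<notin> hughes G q u Q" using hs by blast
  have vq: "v [^] q = \<one>" using hughes_incl[OF v(1), of q u] v(2) by blast
  have vc: "v \<in> carrier G" using Qc v by simp
  have vu: "v \<notin> generate G {u}" using v(2) generate_single_incl[OF hs(1,3)] by blast
  note A = ext_abelian[OF vc uc U.zcomm[OF vc]]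
  let ?R = "ext G (generate G {u}) v"
  have sU: "subgroup (generate G {u}) G" by (rule subgroup_generate1[OF uc])
  have cR: "card ?R = q * q"
    using card_ext[OF sU vc vu _ Q(3)] vq subgroup.one_closed[OF sU] generate_pow_card[OF uc] U.ord_z by simp
  have ncR: "\<not> cyclic_subset G ?R"
    using cyclic_prime_order[OF _ A(5) u(2,3) Q(3) A(4) vq] vu by blast
  have cR2: "card ?R = q ^ 2" using cR by (simp add: power2_eq_square)
  note extR = q_subgroup[OF A(1) cR2 Q(3,4) ncR]
  have cG: "card (carrier G) = p * q * q"
    using card_ext[OF A(1) zc extR(2) _ p] z(3) subgroup.one_closed[OF A(1)] extR(1) cR by simp
  let ?a = "z \<otimes> u"
  have zu: "z \<otimes> u = u \<otimes> z" using zcomm[OF uc] by simp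
  have ac: "?a \<in> carrier G" using zc uc by simp
  have "(z \<otimes> u) [^] (p * q) = (z [^] p) [^] q \<otimes> (u [^] q) [^] p"
    using pow_mult_distrib[OF zu zc uc, of "p * q"] zc uc by (simp add: nat_pow_pow mult.commute)
  then have an: "?a [^] (p * q) = \<one>" using z(3) u(3) by simp
  have av: "?a \<otimes> v = v \<otimes> ?a" using zcomm[OF vc] U.zcomm[OF vc] zc uc vc by (metis m_assoc)
  have rel: "mc_rel G ?a v (p * q) q 1"
    using ac vc an vq av prime_gt_0_nat[OF p] prime_gt_0_nat[OF Q(3)] by (simp add: mc_rel_def)
  have sG: "subgroup (generate G {?a, v}) G" using ac vc by (intro generate_is_subgroup) simp
  have gens: "?a \<in> generate G {?a, v}" "v \<in> generate G {?a, v}" by (auto intro: generate.incl)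
  have "z \<in> generate G {?a}" "u \<in> generate G {?a}"
    using coprime_generate[OF zc uc zu z(3) u(3)] primes_coprime[OF p Q(3)] Q(4) by auto
  then have zu': "z \<in> generate G {?a, v}" "u \<in> generate G {?a, v}" using generate_single_incl[OF sG gens(1)] by blast+
  have "?R \<subseteq> generate G {?a, v}" by (rule ext_least[OF sG generate_single_incl[OF sG zu'(2)] gens(2)])
  then have "carrier G \<subseteq> generate G {?a, v}" using ext_least[OF sG _ zu'(1)] extR(1) by blast
  then have "generate G {?a, v} = carrier G" using subgroup.subset[OF sG] by simp
  then have "split_mc G ?a v (p * q) q 1" using rel cG is_group by (simp add: split_mc_def)
  then show False using n4 by blast
qed

end

context min_PF begin

lemma abelian_case4:
  assumes comm: "\<And>x y. x \<in> carrier G ==> y \<in> carrier G ==> x \<otimes> y = y \<otimes> x"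
    and pq: "prime (p::nat)" "prime (q::nat)" "p \<noteq> q" "p dvd card (carrier G)" "q dvd card (carrier G)"
  shows "\<exists>p q a b. prime (p::nat) \<and> prime (q::nat) \<and> p \<noteq> q \<and> split_mc G a b (q * p) p 1"
proof (rule ccontr)
  assume n: "\<not> ?thesis"
  obtain z where z: "z \<in> carrier G" "z \<noteq> \<one>" "z [^] p = \<one>" using cauchy[OF subgroup_self pq(1,4)] by auto
  obtain w where w: "w \<in> carrier G" "w \<noteq> \<one>" "w [^] q = \<one>" using cauchy[OF subgroup_self pq(2,5)] by auto
  have c: "x \<in> group_center G" if "x \<in> carrier G" for x unfolding group_center_def using that comm by blast
  interpret P: min_PF_z G z p by unfold_locales (use c[OF z(1)] z pq in auto)
  interpret Q: min_PF_z G w q by unfold_locales (use c[OF w(1)] w pq in auto)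
  have "cyclic_subset G (carrier G)"
  proof (rule abelian_cyclic[OF comm])
    fix H r k assume H: "subgroup H G" "prime (r::nat)" "card H = r ^ k"
    show "cyclic_subset G H"
    proof (cases "r = p")
      case False
      then show ?thesis using P.q_subgroup_cyclic[OF H(1,3,2)] n H(2) pq(1) by blast
    next
      case True
      then have "r \<noteq> q" using pq by simp
      then show ?thesis using Q.q_subgroup_cyclic[OF H(1,3,2)] n H(2) pq(2) by blast
    qed
  qed
  then show False using not_cyclic by simp
qed

end

section \<open>Groups of prime power order\<close>

context group begin

lemma commutator_pow:
  assumes c: "s \<in> carrier G" "y \<in> carrier G" "w \<in> carrier G" and sw: "s \<otimes> w = w \<otimes> s"
    and r: "s \<otimes> y = w \<otimes> (y \<otimes> s)"
  shows "s [^] (i::nat) \<otimes> y = w [^] i \<otimes> (y \<otimes> s [^] i)"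
proof (induction i)
  case 0 then show ?case using c by simp
next
  case (Suc i)
  have siw: "s [^] i \<otimes> w = w \<otimes> s [^] i" using nat_pow_comm[of s] c sw by (metis group_commutes_pow)
  have "s [^] Suc i \<otimes> y = s [^] i \<otimes> (w \<otimes> (y \<otimes> s))" using c r by (simp add: m_assoc)
  also have "\<dots> = (s [^] i \<otimes> w) \<otimes> (y \<otimes> s)" using c by (simp add: m_assoc)
  also have "\<dots> = w \<otimes> ((s [^] i \<otimes> y) \<otimes> s)" unfolding siw using c by (simp add: m_assoc)
  also have "\<dots> = (w \<otimes> w [^] i) \<otimes> (y \<otimes> (s [^] i \<otimes> s))" unfolding Suc using c by (simp add: m_assoc)
  also have "w \<otimes> w [^] i = w [^] Suc i" using nat_pow_Suc2[OF c(3), of i] by simp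
  finally show ?case by simp
qed

lemma commutator_product_pow:
  assumes c: "s \<in> carrier G" "y \<in> carrier G" "w \<in> carrier G" and sw: "s \<otimes> w = w \<otimes> s" "y \<otimes> w = w \<otimes> y"
    and r: "s \<otimes> y = w \<otimes> (y \<otimes> s)"
  shows "(y \<otimes> s) [^] (i::nat) = (y [^] i \<otimes> s [^] i) \<otimes> w [^] (\<Sum>j<i. j)"
proof (induction i)
  case 0 then show ?case by simp
next
  case (Suc i)
  let ?S = "\<Sum>j<i. j"
  have ws: "w [^] ?S \<otimes> s = s \<otimes> w [^] ?S" using c sw by (metis group_commutes_pow)
  have wy: "w [^] ?S \<otimes> y = y \<otimes> w [^] ?S" using c sw by (metis group_commutes_pow)
  have wiy: "w [^] i \<otimes> y = y \<otimes> w [^] i" using c sw by (metis group_commutes_pow)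
  have wis: "w [^] i \<otimes> s [^] Suc i = s [^] Suc i \<otimes> w [^] i" using c sw by (metis group_commutes_pow nat_pow_closed)
  have "(y \<otimes> s) [^] Suc i = ((y [^] i \<otimes> s [^] i) \<otimes> w [^] ?S) \<otimes> (y \<otimes> s)" using Suc by simp
  also have "\<dots> = (y [^] i \<otimes> s [^] i) \<otimes> ((w [^] ?S \<otimes> y) \<otimes> s)" using c by (simp add: m_assoc)
  also have "\<dots> = (y [^] i \<otimes> (s [^] i \<otimes> y)) \<otimes> (w [^] ?S \<otimes> s)" unfolding wy using c by (simp add: m_assoc)
  also have "\<dots> = (y [^] i \<otimes> (w [^] i \<otimes> (y \<otimes> s [^] i))) \<otimes> (s \<otimes> w [^] ?S)"
    unfolding ws commutator_pow[OF c sw(1) r] by (rule refl)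
  also have "\<dots> = (y [^] i \<otimes> (w [^] i \<otimes> y)) \<otimes> (s [^] Suc i \<otimes> w [^] ?S)" using c by (simp add: m_assoc)
  also have "\<dots> = (y [^] i \<otimes> y) \<otimes> (w [^] i \<otimes> s [^] Suc i) \<otimes> w [^] ?S" unfolding wiy using c by (simp add: m_assoc)
  also have "\<dots> = (y [^] i \<otimes> y) \<otimes> s [^] Suc i \<otimes> (w [^] i \<otimes> w [^] ?S)" unfolding wis using c by (simp add: m_assoc)
  also have "w [^] i \<otimes> w [^] ?S = w [^] (\<Sum>j<Suc i. j)" using c by (simp add: nat_pow_mult add.commute)
  finally show ?case by simp
qed

end

lemma prime_dvd_sum_less:
  assumes "prime (p::nat)" "p \<noteq> 2" shows "p dvd (\<Sum>j<p. j)"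
proof -
  have e: "2 * (\<Sum>j<n. j) = n * (n - 1)" for n :: nat by (induction n) (auto simp: algebra_simps)
  have "p dvd 2 * (\<Sum>j<p. j)" unfolding e by simp
  moreover have "\<not> p dvd 2" using assms primes_dvd_imp_eq[of p 2] two_is_prime_nat by blast
  ultimately show ?thesis using prime_dvd_multD[OF assms(1)] by blast
qed

context fin_group begin

lemma split_mcI:
  assumes a: "a \<in> carrier G" "ord a = n" and b: "b \<in> normset G (generate G {a})" "b \<notin> generate G {a}" "b [^] m = \<one>" "prime (m::nat)"
    and rel: "a \<otimes> b = b \<otimes> a [^] (k::int)" and card: "card (carrier G) = n * m"
  shows "split_mc G a b n m k"
proof -
  have bc: "b \<in> carrier G" using b by (simp add: normset_def)
  have s: "subgroup (generate G {a}) G" by (rule subgroup_generate1[OF a(1)])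
  have sG: "subgroup (generate G {a, b}) G" using a bc by (intro generate_is_subgroup) simp
  have gens: "a \<in> generate G {a, b}" "b \<in> generate G {a, b}" by (auto intro: generate.incl)
  have "card (ext G (generate G {a}) b) = card (carrier G)"
    using card_ext[OF s bc b(2) _ b(4)] b(3) subgroup.one_closed[OF s] generate_pow_card[OF a(1)] a(2) card by simp
  then have "ext G (generate G {a}) b = carrier G"
    using card_subset_eq[OF fin subgroup.subset[OF subgroup_ext[OF s b(1)]]] by simp
  moreover have "ext G (generate G {a}) b \<subseteq> generate G {a, b}"
    by (rule ext_least[OF sG generate_single_incl[OF sG gens(1)] gens(2)])
  ultimately have "generate G {a, b} = carrier G" using subgroup.subset[OF sG] by simp
  moreover have "0 < n" using ord_pos[OF a(1)] a(2) by simp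
  ultimately show ?thesis
    using a bc b pow_ord_eq_1[OF a(1)] rel card prime_gt_0_nat[OF b(4)] is_group by (simp add: split_mc_def mc_rel_def)
qed

lemma maximal_subgroup:
  assumes "subgroup H G" "H \<noteq> carrier G"
  obtains M where "subgroup M G" "M \<noteq> carrier G" "H \<subseteq> M" "\<And>K. subgroup K G ==> M \<subseteq> K ==> K \<noteq> M ==> K = carrier G"
proof -
  define A where "A = {M. subgroup M G \<and> M \<noteq> carrier G \<and> H \<subseteq> M}"
  have "A \<subseteq> Pow (carrier G)" unfolding A_def using subgroup.subset by blast
  then have "finite A" using fin finite_subset by blast
  moreover have "H \<in> A" unfolding A_def using assms by simp
  then have "A \<noteq> {}" by blast
  ultimately have "\<exists>M\<in>A. \<forall>K\<in>A. M \<le> K --> M = K" by (rule finite_has_maximal)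
  then obtain M where M: "M \<in> A" "\<forall>K\<in>A. M \<le> K --> M = K" ..
  have M1: "subgroup M G" "M \<noteq> carrier G" "H \<subseteq> M" using M(1) unfolding A_def by simp_all
  show ?thesis
  proof (rule that[OF M1])
    fix K assume K: "subgroup K G" "M \<subseteq> K" "K \<noteq> M"
    show "K = carrier G"
    proof (rule ccontr)
      assume n: "K \<noteq> carrier G"
      have "H \<subseteq> K" using M1(3) K(2) by (rule subset_trans)
      then have "K \<in> A" unfolding A_def using K(1) n by simp
      then show False using M(2) K(2,3) by blast
    qed
  qed
qed

lemma ord_prime_square:
  assumes t: "t \<in> carrier G" "t [^] p \<noteq> \<one>" "t [^] (p ^ 2) = \<one>" "prime (p::nat)" shows "ord t = p ^ 2"
proof -
  have "ord t dvd p ^ 2" using pow_eq_id[OF t(1)] t(3) by simp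
  then obtain i where i: "i \<le> 2" "ord t = p ^ i" using divides_primepow_nat[OF t(4)] by blast
  have "\<not> ord t dvd p" using pow_eq_id[OF t(1)] t(2) by simp
  then have "\<not> p ^ i dvd p" using i(2) by simp
  then have "i \<noteq> 0" "i \<noteq> 1" by (metis power_0 one_dvd, metis power_one_right dvd_refl)
  then have "i = 2" using i(1) by simp
  then show ?thesis using i by simp
qed

lemma power_of_order_prime_square:
  assumes "prime (p::nat)" "e \<in> carrier G" "e [^] p \<noteq> \<one>" "e [^] (p ^ n) = \<one>"
  shows "\<exists>k::nat. (e [^] k) [^] p \<noteq> \<one> \<and> (e [^] k) [^] (p ^ 2) = \<one>"
  using assms(2-4)
proof (induction n arbitrary: e)
  case 0 then show ?case by simp
next
  case (Suc n)
  show ?case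
  proof (cases "(e [^] p) [^] p = \<one>")
    case True
    then have "(e [^] (1::nat)) [^] (p ^ 2) = \<one>" using Suc(2) by (simp add: nat_pow_pow power2_eq_square)
    then show ?thesis using Suc(2,3) by (intro exI[of _ 1]) simp
  next
    case False
    have "(e [^] p) [^] (p ^ n) = \<one>" using Suc(2,4) by (simp add: nat_pow_pow)
    then obtain k :: nat where "((e [^] p) [^] k) [^] p \<noteq> \<one>" "((e [^] p) [^] k) [^] (p ^ 2) = \<one>"
      using Suc(1)[of "e [^] p"] Suc(2) False by auto
    then show ?thesis using Suc(2) by (intro exI[of _ "p * k"]) (simp add: nat_pow_pow)
  qed
qed

end

context min_PF_z begin

lemma pgroup_direct:
  assumes t: "t \<in> carrier G" "t [^] p \<noteq> \<one>" "t [^] (p ^ 2) = \<one>" and zt: "z \<notin> generate G {t}"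
  shows "split_mc G t z (p ^ 2) p 1"
proof -
  have tz: "z \<otimes> t = t \<otimes> z" using zcomm[OF t(1)] by simp
  note A = ext_abelian[OF zc t(1) tz]
  have s: "subgroup (generate G {t}) G" by (rule subgroup_generate1[OF t(1)])
  have ot: "ord t = p ^ 2" by (rule ord_prime_square[OF t p])
  have tp: "t [^] p \<in> generate G {t}" by (rule pow_in_subgroup[OF s in_generate1])
  have nc: "\<not> cyclic_subset G (ext G (generate G {t}) z)"
  proof
    assume c: "cyclic_subset G (ext G (generate G {t}) z)"
    have "(t [^] p) [^] p = \<one>" using t by (simp add: nat_pow_pow power2_eq_square)
    then have "z \<in> generate G {t [^] p}"
      using cyclic_prime_order[OF c pow_in_subgroup[OF A(1,5)] t(2) _ p A(4) z(3)] by simp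
    then show False using generate_single_incl[OF s tp] zt by blast
  qed
  have "ext G (generate G {t}) z = carrier G"
    using proper_cyclic[OF A(1) _ A(4) A(5) t(2) A(3)] nc by blast
  then have "card (carrier G) = p ^ 2 * p"
    using card_ext[OF s zc zt _ p] z(3) subgroup.one_closed[OF s] generate_pow_card[OF t(1)] ot by simp
  then show ?thesis
    using split_mcI[OF t(1) ot comm_normset[OF zc t(1) tz] zt z(3) p, of 1] tz t(1) int_pow_1[OF t(1)] by simp
qed

text \<open>
  A maximal subgroup M is normal, and t lies in its cyclic Hughes subgroup, which contains only one subgroup of
  each order.
\<close>
lemma pgroup_normal:
  assumes G: "card (carrier G) = p ^ k" and M: "subgroup M G" "M \<noteq> carrier G" "z \<in> M"
    and max: "\<And>K. subgroup K G ==> M \<subseteq> K ==> K \<noteq> M ==> K = carrier G"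
  shows "normset G M = carrier G"
    "\<And>g t. g \<in> carrier G ==> t \<in> M ==> t [^] p \<noteq> \<one> ==> g \<in> normset G (generate G {t})"
proof -
  obtain x where "x \<in> carrier G" "x \<notin> M" "x \<in> normset G M"
    using pgroup_normalizer_grows_order[OF _ p M(1,2)] G by (auto simp: order_def)
  then show N: "normset G M = carrier G"
    using max[OF subgroup_normset[OF M(1)] subgroup_le_normset[OF M(1)]] by blast
  fix g t assume gt: "g \<in> carrier G" "t \<in> M" "t [^] p \<noteq> \<one>"
  have tc: "t \<in> carrier G" using subgroup.mem_carrier[OF M(1) gt(2)] .
  let ?t = "conj_el G g t"
  have tM: "?t \<in> M" using N gt by (auto simp: normset_def)
  have "?t [^] p \<noteq> \<one>" using conj_pow[OF gt(1) tc, of p] conj_eq_one[OF gt(1), of "t [^] p"] gt(3) tc by simp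
  then have h: "?t \<in> hughes G p z M" "t \<in> hughes G p z M" using hughes_incl tM gt by blast+
  have "?t [^] ord t = \<one>" using conj_pow[OF gt(1) tc, of "ord t"] pow_ord_eq_1[OF tc] gt(1) by simp
  then have c: "?t \<in> generate G {t}" using cyclic_ord_generate[OF hughesM[OF M] h(2,1)] by simp
  have "conj_el G g n \<in> generate G {t}" if n: "n \<in> generate G {t}" for n
  proof -
    obtain i :: nat where i: "n = t [^] i" using n generate_single_iff[OF tc] by blast
    show ?thesis unfolding i conj_pow[OF gt(1) tc] by (rule pow_in_subgroup[OF subgroup_generate1[OF tc] c])
  qed
  then show "g \<in> normset G (generate G {t})" using gt(1) by (simp add: normset_def)
qed

lemma in_generate_z: "x \<in> generate G {z} ==> x \<in> group_center G \<and> x [^] p = \<one>"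
proof -
  assume x: "x \<in> generate G {z}"
  then have "x \<in> group_center G" using generate_single_incl[OF subgroup_center z(1)] by blast
  moreover obtain i :: nat where i: "x = z [^] i" using x generate_single_iff[OF zc] by blast
  have "x [^] p = (z [^] p) [^] i" unfolding i using zc by (simp add: nat_pow_pow mult.commute)
  ultimately show ?thesis using z(3) by simp
qed

text \<open>
  Two elements with non-trivial p-th powers that do not commute generate G, and their commutator w lies in
  \<langle>z\<rangle>. So G is non-abelian of order p^3 with an element of order p^2.
\<close>
lemma pgroup_noncentral:
  assumes G: "card (carrier G) = p ^ k" and t: "t \<in> carrier G" "t [^] p \<noteq> \<one>" "t [^] (p ^ 2) = \<one>"
    and zt: "z \<in> generate G {t}" and nT: "\<And>g. g \<in> carrier G ==> g \<in> normset G (generate G {t})"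
    and nc: "t \<notin> group_center G"
  shows "(p = 2 \<and> G \<cong> Q8) \<or> (p \<noteq> 2 \<and> (\<exists>a b. split_mc G a b (p ^ 2) p (1 + int p)))"
proof -
  let ?T = "generate G {t}" and ?B = "centralizer G t"
  have sT: "subgroup ?T G" by (rule subgroup_generate1[OF t(1)])
  have cycT: "cyclic_subset G ?T" by (rule cyclic_subset_generate1[OF t(1)])
  have tT: "t \<in> ?T" by (rule in_generate1)
  have sB: "subgroup ?B G" by (rule subgroup_centralizer[OF t(1)])
  have cycB: "cyclic_subset G ?B" by (rule centralizer_cyclic[OF t(1,2) nc])
  have ot: "ord t = p ^ 2" by (rule ord_prime_square[OF t p])
  have zB: "z \<in> ?B" using zc zcomm[OF t(1)] by (simp add: centralizer_def)
  have tB: "t \<in> ?B" using t(1) by (simp add: centralizer_def)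
  have TB: "?T \<subseteq> ?B" by (rule generate_single_incl[OF sB tB])
  have "?B \<noteq> carrier G" using cycB not_cyclic by auto
  then obtain s where s: "s \<in> carrier G" "s [^] p \<noteq> \<one>" "s \<notin> ?B" using E_not_in_proper[OF sB _ zB] by blast
  have st: "s \<otimes> t \<noteq> t \<otimes> s" using s by (simp add: centralizer_def)
  have sT': "s \<notin> ?T" using TB s(3) by blast
  note sW = subgroup_ext[OF sT nT[OF s(1)]]
  note iW = ext_incl[OF sT s(1)]
  have W: "ext G ?T s = carrier G"
  proof (rule ccontr)
    assume "ext G ?T s \<noteq> carrier G"
    then have "s \<otimes> t = t \<otimes> s"
      using proper_comm[OF sW _ _ iW(2) _ s(2) t(2)] iW(1) zt tT by blast
    then show False using st by simp
  qed
  have pz: "x \<in> generate G {z}" if "x \<in> ?T" "x [^] p = \<one>" for x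
    by (rule cyclic_prime_order[OF cycT zt z(2,3) p that])
  have tp: "t [^] p \<in> generate G {z}"
    using t(1,3) by (intro pz pow_in_subgroup[OF sT tT]) (simp add: nat_pow_pow power2_eq_square)
  obtain w where wT: "w \<in> ?T" and e1: "conj_el G s t = w \<otimes> t" and r: "s \<otimes> t = w \<otimes> (t \<otimes> s)"
    using commutator_obtain[OF sT nT[OF s(1)] tT] .
  have wc: "w \<in> carrier G" using subgroup.mem_carrier[OF sT wT] .
  have wt: "w \<otimes> t = t \<otimes> w" by (rule cyclic_comm[OF cycT wT tT])
  have "conj_el G s t [^] p = t [^] p"
    using conj_pow[OF s(1) t(1), of p] conj_eq_self[OF s(1), of "t [^] p"] in_generate_z[OF tp] center_comm[of "t [^] p" s] s(1) t(1) by simp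
  then have "w [^] p \<otimes> t [^] p = t [^] p" unfolding e1 using pow_mult_distrib[OF wt wc t(1)] by simp
  then have "w [^] p = \<one>" using wc t(1) by simp
  then have wz: "w \<in> generate G {z}" using pz wT by blast
  have wZ: "w \<in> group_center G" "w [^] p = \<one>" using in_generate_z[OF wz] by simp_all
  have w1: "w \<noteq> \<one>" using r st s(1) t(1) by auto
  have sw: "s \<otimes> w = w \<otimes> s" using center_comm[OF wZ(1) s(1)] by simp
  have spc: "s [^] p \<in> carrier G" using s(1) by simp
  have spt: "s [^] p \<otimes> t = t \<otimes> s [^] p" using commutator_pow[OF s(1) t(1) wc sw r, of p] wZ(2) s(1) t(1) by simp
  have spB: "s [^] p \<in> ?B" using spt spc by (simp add: centralizer_def)
  obtain j where cB: "card ?B = p ^ j"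
    using subgroup_card_dvd[OF sB subgroup_self] subgroup.subset[OF sB] G divides_primepow_nat[OF p] by auto
  have nts: "t \<notin> generate G {s [^] p}"
  proof
    assume "t \<in> generate G {s [^] p}"
    then obtain i :: nat where "t = (s [^] p) [^] i" using generate_single_iff[OF spc] by blast
    then have "t = s [^] (p * i)" using s(1) by (simp add: nat_pow_pow)
    then show False using st comm_pow[OF s(1) s(1), of "p * i"] s(1) by simp
  qed
  then have spT: "s [^] p \<in> ?T" using cyclic_pgroup_chain[OF cycB cB p spB tB] by blast
  have "(s [^] p) [^] p = \<one>"
  proof (rule ccontr)
    assume ne: "(s [^] p) [^] p \<noteq> \<one>"
    obtain i :: nat where i: "s [^] p = t [^] i" using spT generate_single_iff[OF t(1)] by blast
    have "(s [^] p) [^] (p ^ 2) = (t [^] (p ^ 2)) [^] i" unfolding i using t(1) by (simp add: nat_pow_pow mult.commute)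
    then have "ord (s [^] p) = p ^ 2" using ord_prime_square[OF spc ne _ p] t(3) by simp
    then have "t [^] ord (s [^] p) = \<one>" using t(3) by simp
    then show False using cyclic_ord_generate[OF cycT spT tT] nts by simp
  qed
  then have spz: "s [^] p \<in> generate G {z}" using pz spT by blast
  have cG: "card (carrier G) = p ^ 2 * p"
    using card_ext[OF sT s(1) sT' spT p] W generate_pow_card[OF t(1)] ot by simp
  show ?thesis
  proof (cases "p = 2")
    case True
    have two: "x = \<one> \<or> x = z" if xz: "x \<in> generate G {z}" for x
    proof -
      obtain i :: nat where i: "x = z [^] i" using xz generate_single_iff[OF zc] by blast
      have "x = z [^] (i mod 2)" unfolding i using nat_pow_mod[OF zc z(3), of i] True by simp
      moreover have "i mod 2 = 0 \<or> i mod 2 = 1" by auto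
      ultimately show ?thesis using zc by auto
    qed
    have sq: "x [^] (2::nat) = x \<otimes> x" if "x \<in> carrier G" for x using that by (simp add: numeral_2_eq_2)
    have tt: "t \<otimes> t = z" using two[OF tp] t(1,2) sq[OF t(1)] True by simp
    have ss: "s \<otimes> s = z" using two[OF spz] s(1,2) sq[OF s(1)] True by simp
    have ww: "w = z" using two[OF wz] w1 by simp
    have "z \<otimes> z = \<one>" using z(3) sq[OF zc] True by simp
    have sG: "subgroup (generate G {t, s}) G" using t s by (intro generate_is_subgroup) simp
    have gens: "t \<in> generate G {t, s}" "s \<in> generate G {t, s}" by (auto intro: generate.incl)
    have "carrier G \<subseteq> generate G {t, s}"
      using ext_least[OF sG generate_single_incl[OF sG gens(1)] gens(2)] W by simp
    then have "generate G {t, s} = carrier G" using subgroup.subset[OF sG] by simp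
    then have "G \<cong> Q8"
      using Q8_iso[OF t(1) s(1)] tt ss ww r \<open>z \<otimes> z = \<one>\<close> cG True by simp
    then show ?thesis using True by simp
  next
    case False
    have tpc: "t [^] p \<in> carrier G" using t(1) by simp
    have ztp: "z \<in> generate G {t [^] p}" by (rule prime_order_generator[OF zc z(3) p tp t(2)])
    have "inv (s [^] p) \<in> generate G {z}" by (rule subgroup.m_inv_closed[OF subgroup_generate1[OF zc] spz])
    then have "inv (s [^] p) \<in> generate G {t [^] p}"
      using generate_single_incl[OF subgroup_generate1[OF tpc] ztp] by blast
    then obtain l :: nat where l: "inv (s [^] p) = (t [^] p) [^] l" using generate_single_iff[OF tpc] by blast
    define y where "y = t [^] l"
    have yc: "y \<in> carrier G" using t(1) by (simp add: y_def)
    have "y [^] p = inv (s [^] p)" using l t(1) by (simp add: y_def nat_pow_pow mult.commute)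
    then have ysp: "y [^] p \<otimes> s [^] p = \<one>" using spc by simp
    have wlZ: "w [^] l \<in> group_center G" by (rule pow_in_subgroup[OF subgroup_center wZ(1)])
    have wlc: "w [^] l \<in> carrier G" using wc by simp
    have "conj_el G s y = (w \<otimes> t) [^] l" unfolding y_def conj_pow[OF s(1) t(1)] e1 by (rule refl)
    then have ry: "s \<otimes> y = w [^] l \<otimes> (y \<otimes> s)"
      using mult_eq_conj[OF s(1) yc] pow_mult_distrib[OF wt wc t(1), of l] wc t(1) s(1) by (simp add: y_def m_assoc)
    define b where "b = y \<otimes> s"
    have bc: "b \<in> carrier G" using yc s(1) by (simp add: b_def)
    obtain h where h: "(\<Sum>j<p. j) = p * h" using prime_dvd_sum_less[OF p False] by blast
    have "(w [^] l) [^] (\<Sum>j<p. j) = (w [^] p) [^] (l * h)" unfolding h using wc by (simp add: nat_pow_pow mult.left_commute)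
    then have bp: "b [^] p = \<one>"
      unfolding b_def
      using commutator_product_pow[OF s(1) yc wlc center_comm[OF wlZ s(1), symmetric] center_comm[OF wlZ yc, symmetric] ry, of p] ysp wZ(2) by simp
    have ty: "t \<otimes> y = y \<otimes> t" unfolding y_def using comm_pow[OF t(1) t(1), of l] by simp
    have "b \<otimes> t = y \<otimes> (w \<otimes> (t \<otimes> s))" unfolding b_def using yc s(1) t(1) r by (simp add: m_assoc)
    also have "\<dots> = w \<otimes> ((y \<otimes> t) \<otimes> s)" using center_comm[OF wZ(1) yc] yc s(1) t(1) wc by (metis m_assoc m_closed)
    also have "\<dots> = w \<otimes> (t \<otimes> b)" unfolding ty[symmetric] b_def using yc s(1) t(1) by (simp add: m_assoc)
    finally have rb: "b \<otimes> t = w \<otimes> (t \<otimes> b)" .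
    have zw: "z \<in> generate G {w}" by (rule prime_order_generator[OF zc z(3) p wz w1])
    have "inv (t [^] p) \<in> generate G {z}" by (rule subgroup.m_inv_closed[OF subgroup_generate1[OF zc] tp])
    then have "inv (t [^] p) \<in> generate G {w}" using generate_single_incl[OF subgroup_generate1[OF wc] zw] by blast
    then obtain m :: nat where m: "inv (t [^] p) = w [^] m" using generate_single_iff[OF wc] by blast
    define b' where "b' = b [^] m"
    have b'c: "b' \<in> carrier G" using bc by (simp add: b'_def)
    have b'p: "b' [^] p = \<one>"
    proof -
      have "b' [^] p = (b [^] p) [^] m" unfolding b'_def using bc by (simp add: nat_pow_pow mult.commute)
      then show ?thesis using bp by simp
    qed
    have "b' \<otimes> t = inv (t [^] p) \<otimes> (t \<otimes> b')"
      unfolding b'_def m by (rule commutator_pow[OF bc t(1) wc center_comm[OF wZ(1) bc, symmetric] rb])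
    then have e2: "t [^] p \<otimes> (b' \<otimes> t) = t \<otimes> b'" using tpc b'c t(1) by (simp add: m_assoc[symmetric])
    have "b' \<otimes> t [^] (1 + int p) = b' \<otimes> (t [^] p \<otimes> t)"
      using int_pow_int[of G t "Suc p"] t(1) by simp
    also have "\<dots> = t [^] p \<otimes> (b' \<otimes> t)"
      using center_comm[of "t [^] p" b'] in_generate_z[OF tp] b'c tpc t(1) by (metis m_assoc)
    finally have rel: "t \<otimes> b' = b' \<otimes> t [^] (1 + int p)" using e2 by simp
    have "b' \<notin> ?T"
    proof
      assume "b' \<in> ?T"
      then have "t \<otimes> b' = b' \<otimes> t" using cyclic_comm[OF cycT tT] by simp
      then have "t [^] p \<otimes> (t \<otimes> b') = t \<otimes> b'" using e2 by simp
      then show False using t(1,2) tpc b'c r_cancel_one[of "t \<otimes> b'" "t [^] p"] by simp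
    qed
    then have "split_mc G t b' (p ^ 2) p (1 + int p)"
      by (rule split_mcI[OF t(1) ot nT[OF b'c] _ b'p p rel cG])
    then show ?thesis using False by blast
  qed
qed

text \<open>
  Now a maximal subgroup M = \<langle>c\<rangle> containing t is cyclic. An element x outside M is corrected by a
  power of c to some y with y^p \<in> \<langle>z\<rangle>. As \<langle>t, y\<rangle> is abelian and not cyclic, it
  is G.
\<close>
lemma pgroup_central:
  assumes G: "card (carrier G) = p ^ k" and t: "t \<in> carrier G" "t [^] p \<noteq> \<one>" "t [^] (p ^ 2) = \<one>"
    and zt: "z \<in> generate G {t}" and tZ: "t \<in> group_center G"
    and M: "subgroup M G" "M \<noteq> carrier G" "t \<in> M" and max: "\<And>K. subgroup K G ==> M \<subseteq> K ==> K \<noteq> M ==> K = carrier G"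
  shows "\<exists>a b. split_mc G a b (p ^ 2) p 1"
proof -
  let ?T = "generate G {t}"
  have sT: "subgroup ?T G" by (rule subgroup_generate1[OF t(1)])
  have cycT: "cyclic_subset G ?T" by (rule cyclic_subset_generate1[OF t(1)])
  have tT: "t \<in> ?T" by (rule in_generate1)
  have ot: "ord t = p ^ 2" by (rule ord_prime_square[OF t p])
  have TM: "?T \<subseteq> M" by (rule generate_single_incl[OF M(1,3)])
  have zM: "z \<in> M" using TM zt by blast
  have cycM: "cyclic_subset G M" by (rule central_cyclic[OF tZ t(2) M(1,2) zM M(3)])
  then obtain c where c: "c \<in> carrier G" "M = generate G {c}" by (auto simp: cyclic_subset_def)
  have cM: "c \<in> M" unfolding c(2) by (rule in_generate1)
  note nM = pgroup_normal[OF G M(1,2) zM max]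
  obtain x0 where x0: "x0 \<in> carrier G" "x0 \<notin> M" using M(2) subgroup.subset[OF M(1)] by blast
  have ex: "x0 [^] (p ^ k) \<in> M" using pow_card_subgroup[OF subgroup_self x0(1)] G subgroup.one_closed[OF M(1)] by simp
  define i where "i = (LEAST i. x0 [^] (p ^ i) \<in> M)"
  have iM: "x0 [^] (p ^ i) \<in> M" unfolding i_def by (rule LeastI[of "\<lambda>i. x0 [^] (p ^ i) \<in> M", OF ex])
  then have "i \<noteq> 0" using x0 by (metis nat_pow_eone power_0)
  then obtain i' where i': "i = Suc i'" using not0_implies_Suc by blast
  define x where "x = x0 [^] (p ^ i')"
  have xc: "x \<in> carrier G" using x0 by (simp add: x_def)
  have xM: "x \<notin> M" using not_less_Least[of i' "\<lambda>i. x0 [^] (p ^ i) \<in> M"] i' by (simp add: i_def x_def)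
  have xpM: "x [^] p \<in> M" using iM x0 i' by (simp add: x_def nat_pow_pow mult.commute)
  have xpc: "x [^] p \<in> carrier G" using xc by simp
  have extM: "ext G M x = carrier G"
    using max[OF subgroup_ext[OF M(1)]] nM(1) xc ext_incl[OF M(1) xc] xM by blast
  have oc: "card M = ord c" using c generate_pow_card by simp
  obtain j where cj: "card M = p ^ j"
    using subgroup_card_dvd[OF M(1) subgroup_self] subgroup.subset[OF M(1)] G divides_primepow_nat[OF p] by auto
  have cp: "c [^] p \<noteq> \<one>"
  proof
    assume a: "c [^] p = \<one>"
    obtain e :: nat where e: "t = c [^] e" using M(3) c generate_single_iff by blast
    have "t [^] p = (c [^] p) [^] e" unfolding e using c(1) by (simp add: nat_pow_pow mult.commute)
    then show False using a t(2) by simp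
  qed
  have cpc: "c [^] p \<in> carrier G" using c(1) by simp
  have cpM: "c [^] p \<in> M" by (rule pow_in_subgroup[OF M(1) cM])
  have pc: "p dvd ord c"
  proof (rule ccontr)
    assume "\<not> p dvd ord c"
    then have "j = 0" using oc cj by (metis dvd_power neq0_conv)
    then have "c = \<one>" using oc cj ord_eq_1[OF c(1)] by simp
    then show False using cp by simp
  qed
  have ocp: "ord (c [^] p) * p = ord c"
    using ord_pow[OF c(1) pc] prime_gt_0_nat[OF p] pc by simp
  have scp: "subgroup (generate G {c [^] p}) G" by (rule subgroup_generate1[OF cpc])
  \<comment> \<open>If \<open>x^p\<close> generated \<open>M\<close>, then \<open>x\<close> would generate \<open>G\<close>.\<close>
  have xp: "x [^] p \<in> generate G {c [^] p}"
  proof (rule ccontr)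
    assume n: "x [^] p \<notin> generate G {c [^] p}"
    obtain e :: nat where e: "x [^] p = c [^] e" using xpM c generate_single_iff by blast
    have "\<not> p dvd e"
    proof
      assume "p dvd e"
      then obtain f where "e = p * f" by blast
      then have "x [^] p = (c [^] p) [^] f" using e c(1) by (simp add: nat_pow_pow)
      then show False using n generate_single_iff[OF cpc] by blast
    qed
    then have "coprime e (p ^ j)" using p by (metis coprime_commute coprime_power_right_iff prime_imp_coprime)
    moreover have "ord c = p ^ j" using oc cj by simp
    ultimately have "coprime e (ord c)" by metis
    from cong_solve_coprime_nat[OF this] obtain f where f: "[e * f = Suc 0] (mod ord c)" by blast
    have "(x [^] p) [^] f = c" unfolding e using pow_cong[OF c(1) pow_ord_eq_1[OF c(1)] f] c(1) by (simp add: nat_pow_pow)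
    moreover have sx: "subgroup (generate G {x}) G" by (rule subgroup_generate1[OF xc])
    ultimately have "c \<in> generate G {x}"
      using pow_in_subgroup[OF sx pow_in_subgroup[OF sx in_generate1, of p], of f] by simp
    then have "carrier G \<subseteq> generate G {x}"
      using ext_least[OF sx, of M x] generate_single_incl[OF sx] c(2) in_generate1 extM by auto
    then have "carrier G = generate G {x}" using subgroup.subset[OF sx] by auto
    then show False using not_cyclic xc by (auto simp: cyclic_subset_def)
  qed
  have xcp: "x \<otimes> c [^] p = c [^] p \<otimes> x"
  proof (cases "t \<in> generate G {c [^] p}")
    case False
    then have "c [^] p \<in> generate G {t}" using cyclic_pgroup_chain[OF cycM cj p M(3) cpM] by blast
    then have "c [^] p \<in> group_center G" using generate_single_incl[OF subgroup_center tZ] by blast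
    then show ?thesis using center_comm xc by simp
  next
    case True
    have nx: "x \<in> normset G (generate G {c [^] p})"
    proof -
      have "conj_el G x n \<in> generate G {c [^] p}" if n: "n \<in> generate G {c [^] p}" for n
      proof -
        have nM': "n \<in> M" using generate_single_incl[OF M(1) cpM] n by blast
        have nc: "n \<in> carrier G" using subgroup.mem_carrier[OF M(1) nM'] .
        have cn: "conj_el G x n \<in> M" using nM(1) xc nM' by (auto simp: normset_def)
        have "n [^] ord (c [^] p) = \<one>" using pow_card_subgroup[OF scp n] generate_pow_card[OF cpc] by simp
        then have "conj_el G x n [^] ord (c [^] p) = \<one>" using conj_pow[OF xc nc, of "ord (c [^] p)"] xc by simp
        then show ?thesis by (rule cyclic_ord_generate[OF cycM cpM cn])
      qed
      then show ?thesis using xc by (simp add: normset_def)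
    qed
    have xn: "x \<notin> generate G {c [^] p}" using generate_single_incl[OF M(1) cpM] xM by blast
    let ?W = "ext G (generate G {c [^] p}) x"
    have sW: "subgroup ?W G" by (rule subgroup_ext[OF scp nx])
    have "card ?W = card M" using card_ext[OF scp xc xn xp p] generate_pow_card[OF cpc] ocp oc by simp
    then have ne: "?W \<noteq> carrier G" using card_proper(2)[OF M(1,2)] by auto
    have tW: "t \<in> ?W" "x \<in> ?W" "c [^] p \<in> ?W" using ext_incl[OF scp xc] True in_generate1 by blast+
    have "z \<in> ?W" using generate_single_incl[OF sW tW(1)] zt by blast
    then show ?thesis using cyclic_comm[OF central_cyclic[OF tZ t(2) sW ne _ tW(1)] tW(2,3)] by simp
  qed
  obtain e :: nat where e: "x [^] p = (c [^] p) [^] e" using xp generate_single_iff[OF cpc] by blast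
  define d where "d = inv (c [^] e)"
  have dM: "d \<in> M" unfolding d_def by (intro subgroup.m_inv_closed[OF M(1)] pow_in_subgroup[OF M(1) cM])
  have dc: "d \<in> carrier G" using subgroup.mem_carrier[OF M(1) dM] .
  have "(c [^] e) [^] p = x [^] p" using e c(1) by (simp add: nat_pow_pow mult.commute)
  then have dp: "d [^] p = inv (x [^] p)" unfolding d_def using c(1) by (simp add: nat_pow_inv)
  have xN: "x \<in> normset G M" using nM(1) xc by simp
  obtain w where wM: "w \<in> M" and e1: "conj_el G x d = w \<otimes> d" and r: "x \<otimes> d = w \<otimes> (d \<otimes> x)"
    using commutator_obtain[OF M(1) xN dM] .
  have wc: "w \<in> carrier G" using subgroup.mem_carrier[OF M(1) wM] .
  have wd: "w \<otimes> d = d \<otimes> w" by (rule cyclic_comm[OF cycM wM dM])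
  have "x \<otimes> inv (x [^] p) = inv (x [^] p) \<otimes> x"
    using comm_inv[OF xpc xc comm_pow[OF xc xc refl]] by simp
  then have "conj_el G x d [^] p = d [^] p"
    using conj_pow[OF xc dc, of p] conj_eq_self[OF xc, of "inv (x [^] p)"] xpc unfolding dp by simp
  then have "w [^] p \<otimes> d [^] p = d [^] p" unfolding e1 using pow_mult_distrib[OF wd wc dc] by simp
  then have wp: "w [^] p = \<one>" using wc dc by simp
  have wz: "w \<in> generate G {z}" by (rule cyclic_prime_order[OF cycM zM z(2,3) p wM wp])
  have wZ: "w \<in> group_center G" using in_generate_z[OF wz] by simp
  define y where "y = d \<otimes> x"
  have yc: "y \<in> carrier G" using dc xc by (simp add: y_def)
  have "y [^] p = w [^] (\<Sum>j<p. j)"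
    unfolding y_def
    using commutator_product_pow[OF xc dc wc center_comm[OF wZ xc, symmetric] center_comm[OF wZ dc, symmetric] r, of p] dp xpc wc by simp
  then have ypz: "y [^] p \<in> generate G {z}" using pow_in_subgroup[OF subgroup_generate1[OF zc] wz] by simp
  have yM: "y \<notin> M"
  proof
    assume "y \<in> M"
    then have "inv d \<otimes> y \<in> M" by (intro subgroup.m_closed[OF M(1)] subgroup.m_inv_closed[OF M(1)] dM)
    then show False using xM dc xc by (simp add: y_def m_assoc[symmetric])
  qed
  have ypc: "y [^] p \<in> carrier G" using yc by simp
  have yT: "y \<notin> ?T" using TM yM by blast
  have yt: "y \<otimes> t = t \<otimes> y" using center_comm[OF tZ yc] by simp
  note A = ext_abelian[OF yc t(1) yt]
  have zA: "z \<in> ext G ?T y" using generate_single_incl[OF A(1,5)] zt by blast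
  have "\<not> cyclic_subset G (ext G ?T y)"
  proof
    assume cy: "cyclic_subset G (ext G ?T y)"
    have "y [^] ord t = (y [^] p) [^] p" unfolding ot using yc by (simp add: nat_pow_pow power2_eq_square)
    then have "y [^] ord t = \<one>" using in_generate_z[OF ypz] by simp
    then show False using cyclic_ord_generate[OF cy A(5,4)] yT by simp
  qed
  then have extY: "ext G ?T y = carrier G" using central_cyclic[OF tZ t(2) A(1) _ zA A(5)] by blast
  have ypT: "y [^] p \<in> ?T" using generate_single_incl[OF sT zt] ypz by blast
  have cG: "card (carrier G) = p ^ 2 * p" using card_ext[OF sT yc yT ypT p] extY generate_pow_card[OF t(1)] ot by simp
  have tpc: "t [^] p \<in> carrier G" using t(1) by simp
  have "(t [^] p) [^] p = \<one>" using t by (simp add: nat_pow_pow power2_eq_square)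
  then have tpz: "t [^] p \<in> generate G {z}"
    by (intro cyclic_prime_order[OF cycT zt z(2,3) p] pow_in_subgroup[OF sT tT])
  have "z \<in> generate G {t [^] p}" by (rule prime_order_generator[OF zc z(3) p tpz t(2)])
  then have "y [^] p \<in> generate G {t [^] p}" using generate_single_incl[OF subgroup_generate1[OF tpc]] ypz by blast
  then obtain l :: nat where l: "y [^] p = (t [^] p) [^] l" using generate_single_iff[OF tpc] by blast
  define b where "b = inv (t [^] l) \<otimes> y"
  have tlc: "t [^] l \<in> carrier G" using t(1) by simp
  have tlZ: "inv (t [^] l) \<in> group_center G"
    by (intro subgroup.m_inv_closed[OF subgroup_center] pow_in_subgroup[OF subgroup_center tZ])
  have bc: "b \<in> carrier G" using yc tlc by (simp add: b_def)
  have "(t [^] l) [^] p = y [^] p" using l t(1) by (simp add: nat_pow_pow mult.commute)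
  then have "b [^] p = \<one>"
    unfolding b_def using pow_mult_distrib[OF center_comm[OF tlZ yc], of p] tlc yc ypc by (simp add: nat_pow_inv)
  moreover have "b \<notin> ?T"
  proof
    assume "b \<in> ?T"
    then have "t [^] l \<otimes> b \<in> ?T" by (intro subgroup.m_closed[OF sT] pow_in_subgroup[OF sT tT])
    then show False using yT tlc yc by (simp add: b_def m_assoc[symmetric])
  qed
  moreover have bt: "b \<otimes> t = t \<otimes> b" using center_comm[OF tZ bc] by simp
  moreover have "t \<otimes> b = b \<otimes> t [^] (1::int)" using bt int_pow_1[OF t(1)] by simp
  ultimately have "split_mc G t b (p ^ 2) p 1"
    using split_mcI[OF t(1) ot comm_normset[OF bc t(1) bt] _ _ p _ cG, of 1] by simp
  then show ?thesis by blast
qed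

theorem pgroup_classification:
  assumes G: "card (carrier G) = p ^ k"
  shows "(\<exists>a b. split_mc G a b (p ^ 2) p 1) \<or> G \<cong> Q8 \<or> (p \<noteq> 2 \<and> (\<exists>a b. split_mc G a b (p ^ 2) p (1 + int p)))"
proof -
  obtain e where e: "e \<in> carrier G" "e [^] p \<noteq> \<one>" using E_nonempty by blast
  have "e [^] (p ^ k) = \<one>" using pow_card_subgroup[OF subgroup_self e(1)] G by simp
  then obtain l :: nat where l: "(e [^] l) [^] p \<noteq> \<one>" "(e [^] l) [^] (p ^ 2) = \<one>"
    using power_of_order_prime_square[OF p e] by blast
  define t where "t = e [^] l"
  have tc: "t \<in> carrier G" using e by (simp add: t_def)
  have tp: "t [^] p \<noteq> \<one>" and tpp: "t [^] (p ^ 2) = \<one>" unfolding t_def by (rule l)+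
  show ?thesis
  proof (cases "z \<in> generate G {t}")
    case False
    then show ?thesis using pgroup_direct[OF tc tp tpp] by blast
  next
    case True
    have sT: "subgroup (generate G {t}) G" by (rule subgroup_generate1[OF tc])
    have "generate G {t} \<noteq> carrier G" using not_cyclic cyclic_subset_generate1[OF tc] by auto
    then obtain M where M: "subgroup M G" "M \<noteq> carrier G" "generate G {t} \<subseteq> M"
      and max: "\<And>K. subgroup K G ==> M \<subseteq> K ==> K \<noteq> M ==> K = carrier G"
      using maximal_subgroup[OF sT] by blast
    have tM: "t \<in> M" "z \<in> M" using M(3) True in_generate1 by blast+
    show ?thesis
    proof (cases "t \<in> group_center G")
      case True
      then show ?thesis using pgroup_central[OF G tc tp tpp \<open>z \<in> generate G {t}\<close> True M(1,2) tM(1) max] by blast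
    next
      case False
      show ?thesis
        using pgroup_noncentral[OF G tc tp tpp True pgroup_normal(2)[OF G M(1,2) tM(2) max _ tM(1) tp] False] by blast
    qed
  qed
qed

end

section \<open>A normal cyclic centralizer\<close>

context fin_group begin

lemma pow_eq_cong:
  assumes "x \<in> carrier G" "x [^] (i::nat) = x [^] (j::nat)" shows "[i = j] (mod ord x)"
proof -
  have "x [^] int i = x [^] int j" using assms(2) by (simp only: int_pow_int)
  then have "int (ord x) dvd int j - int i" using int_pow_eq[OF assms(1)] by simp
  then have "[int j = int i] (mod int (ord x))" by (simp add: cong_iff_dvd_diff)
  then show ?thesis using cong_int_iff cong_sym by blast
qed

lemma prime_power_if:
  assumes "(n::nat) \<noteq> 0" "prime (r::nat)" "\<And>s. prime s ==> s dvd n ==> s = r"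
  shows "\<exists>j. n = r ^ j"
proof -
  obtain m i where m: "n = m * r ^ i" "\<not> r dvd m" using prime_part[OF assms(1,2)] by blast
  have "m = 1"
  proof (rule ccontr)
    assume "m \<noteq> 1"
    then obtain s where s: "prime s" "s dvd m" using prime_factor_nat by blast
    then have "s = r" using assms(3) m(1) by simp
    then show False using s m(2) by simp
  qed
  then show ?thesis using m(1) by auto
qed

end

context min_PF_z begin

lemma cyclic_exponent_p_central:
  assumes "cyclic_subset G A" "z \<in> A" "x \<in> A" "x [^] p = \<one>" shows "x \<in> group_center G"
  using in_generate_z cyclic_prime_order[OF assms(1,2) z(2,3) p assms(3,4)] by blast

lemma noncommuting_full:
  assumes "subgroup M G" "z \<in> M" "x \<in> M" "y \<in> M" "x [^] p \<noteq> \<one>" "y [^] p \<noteq> \<one>" "x \<otimes> y \<noteq> y \<otimes> x"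
  shows "M = carrier G"
  using proper_comm[OF assms(1) _ assms(2-6)] assms(7) by blast

lemma center_le_centralizer: "x \<in> carrier G ==> group_center G \<subseteq> centralizer G x"
  using center_comm subgroup.mem_carrier[OF subgroup_center] by (auto simp: centralizer_def)

lemma self_centralizer: "x \<in> carrier G ==> x \<in> centralizer G x" by (simp add: centralizer_def)

lemma centralizer_proper:
  assumes "e \<in> carrier G" "e [^] p \<noteq> \<one>" "e \<notin> group_center G" shows "centralizer G e \<noteq> carrier G"
  using centralizer_cyclic[OF assms] not_cyclic by auto

text \<open>
  If y^p = 1 then y, a power of an element y0 with cyclic centralizer, would lie in \<langle>z\<rangle>.
\<close>
lemma normal_centralizer_outside:
  assumes e: "e \<in> carrier G" "e [^] p \<noteq> \<one>" "e \<notin> group_center G"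
  shows "\<exists>y r i. prime (r::nat) \<and> y \<in> carrier G \<and> y \<notin> centralizer G e \<and> y [^] p \<noteq> \<one> \<and>
    y [^] r \<in> centralizer G e \<and> y [^] (r ^ i) = \<one>"
proof -
  let ?A = "centralizer G e"
  have s: "subgroup ?A G" by (rule subgroup_centralizer[OF e(1)])
  note ZA = center_le_centralizer[OF e(1)]
  have "z \<in> ?A" using ZA z(1) by blast
  then obtain y0 where y0: "y0 \<in> carrier G" "y0 [^] p \<noteq> \<one>" "y0 \<notin> ?A"
    using E_not_in_proper[OF s centralizer_proper[OF e]] by blast
  obtain r k :: nat where rk: "prime r" "y0 [^] k \<notin> ?A" "(y0 [^] k) [^] r \<in> ?A"
    using prime_power_outside[OF s y0(1,3)] .
  have kc: "y0 [^] k \<in> carrier G" using y0 by simp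
  obtain k' i :: nat where k': "(y0 [^] k) [^] k' \<notin> ?A" "((y0 [^] k) [^] k') [^] r \<in> ?A" "((y0 [^] k) [^] k') [^] (r ^ i) = \<one>"
    using prime_power_outside'[OF s kc rk(2,3,1)] .
  define y where "y = (y0 [^] k) [^] k'"
  have sy: "subgroup (centralizer G y0) G" by (rule subgroup_centralizer[OF y0(1)])
  have "y \<in> centralizer G y0" unfolding y_def by (intro pow_in_subgroup[OF sy] self_centralizer y0(1))
  moreover have "y0 \<notin> group_center G" using ZA y0(3) by blast
  moreover have "z \<in> centralizer G y0" using center_le_centralizer[OF y0(1)] z(1) by blast
  ultimately have "y [^] p = \<one> ==> y \<in> group_center G"
    using cyclic_exponent_p_central[OF centralizer_cyclic[OF y0(1,2)]] by blast
  then have "y [^] p \<noteq> \<one>" using ZA k'(1) y_def by blast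
  moreover have "y \<in> carrier G" using kc by (simp add: y_def)
  ultimately show ?thesis using rk(1) k' y_def by blast
qed

end

text \<open>
  The situation in which the cyclic centralizer A of some e is normal. By no4, the Sylow subgroups for primes
  other than p are cyclic.
\<close>
locale min_PF_normal = min_PF_z +
  fixes A y e and r i :: nat
  assumes e: "e \<in> carrier G" "e [^] p \<noteq> \<one>" "e \<notin> group_center G"
    and A_def: "A = centralizer G e" and normA: "normset G A = carrier G"
    and r: "prime r" and y: "y \<in> carrier G" "y \<notin> A" "y [^] p \<noteq> \<one>" "y [^] r \<in> A" "y [^] (r ^ i) = \<one>"
    and mixed: "\<exists>q. prime (q::nat) \<and> q \<noteq> p \<and> q dvd card (carrier G)"
    and no4: "\<And>q. prime q ==> q \<noteq> p ==> \<not> (\<exists>a b. split_mc G a b (p * q) q 1)"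
begin

lemma cycA: "cyclic_subset G A" unfolding A_def by (rule centralizer_cyclic[OF e])
lemma sA: "subgroup A G" by (rule cyclic_subset_subgroup[OF cycA])
lemma Ac: "a \<in> A ==> a \<in> carrier G" by (rule subgroup.mem_carrier[OF sA])
lemma Acomm: "a \<in> A ==> b \<in> A ==> a \<otimes> b = b \<otimes> a" by (rule cyclic_comm[OF cycA])
lemma ZA: "group_center G \<subseteq> A" unfolding A_def by (rule center_le_centralizer[OF e(1)])
lemma zA: "z \<in> A" using ZA z(1) by blast
lemma eA: "e \<in> A" unfolding A_def by (rule self_centralizer[OF e(1)])
lemma yA: "y \<in> normset G A" using normA y(1) by simp

lemma ye: "y \<otimes> e \<noteq> e \<otimes> y" using y(1,2) unfolding A_def by (simp add: centralizer_def)

lemma extA: "ext G A y = carrier G"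
proof (rule noncommuting_full[OF subgroup_ext[OF sA yA] _ _ _ y(3) e(2) ye])
  show "z \<in> ext G A y" "y \<in> ext G A y" "e \<in> ext G A y" using ext_incl[OF sA y(1)] zA eA by blast+
qed

lemma card_G: "card (carrier G) = card A * r"
  using card_ext[OF sA y(1,2,4) r] extA by simp

lemma y_noncentral: "\<exists>a\<in>A. a \<otimes> y \<noteq> y \<otimes> a" using eA ye by metis

lemma central_if: "x \<in> A ==> x \<otimes> y = y \<otimes> x ==> x \<in> group_center G"
proof -
  assume x: "x \<in> A" "x \<otimes> y = y \<otimes> x"
  have "A \<subseteq> centralizer G x" using Acomm[OF x(1)] Ac by (auto simp: centralizer_def)
  moreover have "y \<in> centralizer G x" using x(2) y(1) by (simp add: centralizer_def)
  ultimately have "carrier G \<subseteq> centralizer G x" using ext_least[OF subgroup_centralizer[OF Ac[OF x(1)]]] extA by blast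
  then have "x \<otimes> g = g \<otimes> x" if "g \<in> carrier G" for g using that by (auto simp: centralizer_def)
  then show "x \<in> group_center G" using Ac[OF x(1)] by (simp add: group_center_def)
qed

text \<open>
  The elements of r-power order in A generate an r-group together with y. It is cyclic if r \<noteq> p, and proper
  if r = p.
\<close>
lemma r_part_comm:
  assumes a: "a \<in> A" "a [^] (r ^ j) = \<one>" shows "a \<otimes> y = y \<otimes> a"
proof -
  define Q where "Q = {b \<in> A. \<exists>j. b [^] (r ^ j) = \<one>}"
  have sQ: "subgroup Q G"
  proof (rule subgroupI)
    show "Q \<subseteq> carrier G" "Q \<noteq> {}" using Ac a by (auto simp: Q_def)
    fix b assume b: "b \<in> Q"
    then obtain j where j: "b \<in> A" "b [^] (r ^ j) = \<one>" by (auto simp: Q_def)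
    then have "inv b [^] (r ^ j) = \<one>" using Ac[OF j(1)] by (simp add: nat_pow_inv)
    then show "inv b \<in> Q" using subgroup.m_inv_closed[OF sA j(1)] by (auto simp: Q_def)
    fix c assume c: "c \<in> Q"
    then obtain j' where j': "c \<in> A" "c [^] (r ^ j') = \<one>" by (auto simp: Q_def)
    have "b [^] (r ^ (j + j')) = (b [^] (r ^ j)) [^] (r ^ j')" using Ac[OF j(1)] by (simp add: nat_pow_pow power_add)
    moreover have "c [^] (r ^ (j + j')) = (c [^] (r ^ j')) [^] (r ^ j)" using Ac[OF j'(1)] by (simp add: nat_pow_pow power_add mult.commute)
    ultimately have "(b \<otimes> c) [^] (r ^ (j + j')) = \<one>"
      using pow_mult_distrib[OF Acomm[OF j(1) j'(1)] Ac[OF j(1)] Ac[OF j'(1)]] j(2) j'(2) by simp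
    then show "b \<otimes> c \<in> Q" using subgroup.m_closed[OF sA j(1) j'(1)] unfolding Q_def by blast
  qed
  have QA: "Q \<subseteq> A" by (auto simp: Q_def)
  have nQ: "y \<in> normset G Q"
  proof -
    have "conj_el G y b \<in> Q" if b: "b \<in> Q" for b
    proof -
      obtain j where j: "b \<in> A" "b [^] (r ^ j) = \<one>" using b by (auto simp: Q_def)
      have "conj_el G y b [^] (r ^ j) = \<one>" using conj_pow[OF y(1) Ac[OF j(1)], of "r ^ j"] j(2) y(1) by simp
      then show ?thesis using yA j(1) by (auto simp: normset_def Q_def)
    qed
    then show ?thesis using y(1) by (simp add: normset_def)
  qed
  have yrQ: "y [^] r \<in> Q"
  proof -
    have "(y [^] r) [^] (r ^ i) = (y [^] (r ^ i)) [^] r" using y(1) by (simp add: nat_pow_pow mult.commute)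
    then have "(y [^] r) [^] (r ^ i) = \<one>" using y(5) by simp
    then show ?thesis using y(4) unfolding Q_def by blast
  qed
  have "y \<notin> Q" using QA y(2) by blast
  then have cE: "card (ext G Q y) = card Q * r" by (rule card_ext[OF sQ y(1) _ yrQ r])
  obtain k where "card Q = r ^ k" using pgroup_card[OF sQ r] by (auto simp: Q_def)
  then have cE: "card (ext G Q y) = r ^ Suc k" using cE by simp
  note sE = subgroup_ext[OF sQ nQ]
  have aQ: "a \<in> Q" using a by (auto simp: Q_def)
  have inE: "a \<in> ext G Q y" "y \<in> ext G Q y" using ext_incl[OF sQ y(1)] aQ by blast+
  show ?thesis
  proof (cases "r = p")
    case False
    then show ?thesis using cyclic_comm[OF q_subgroup_cyclic[OF sE cE r False no4[OF r False]] inE] by simp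
  next
    case True
    have ne: "ext G Q y \<noteq> carrier G"
    proof
      assume "ext G Q y = carrier G"
      then have "card (carrier G) = p ^ Suc k" using cE True by simp
      moreover obtain q where q: "prime q" "q \<noteq> p" "q dvd card (carrier G)" using mixed by blast
      ultimately have "q dvd p" using prime_dvd_power[OF q(1)] by metis
      then show False using primes_dvd_imp_eq[OF q(1) p] q(2) by simp
    qed
    have "z [^] (r ^ 1) = \<one>" using z(3) True by simp
    then have "z \<in> Q" using zA unfolding Q_def by blast
    then have zE: "z \<in> ext G Q y" using ext_incl(1)[OF sQ y(1)] by blast
    show ?thesis
    proof (cases "a [^] p = \<one>")
      case True
      then show ?thesis using center_comm[OF cyclic_exponent_p_central[OF cycA zA a(1)] y(1)] by simp
    next
      case False
      then show ?thesis using proper_comm[OF sE ne zE inE _ y(3)] by simp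
    qed
  qed
qed

text \<open>
  Coprime action: let a be an element of A of least order not commuting with y. Its order has a prime divisor
  s \<noteq> r, and its commutator w with y satisfies w^s = 1. If y commuted with w, then w^r = 1 would follow from
  y^r \<in> A, hence w = 1. So w is not central and s \<noteq> p.
\<close>
lemma noncommuting_prime:
  "\<exists>w s. prime (s::nat) \<and> s \<noteq> p \<and> s \<noteq> r \<and> w \<in> A \<and> w \<noteq> \<one> \<and> w [^] s = \<one> \<and> w \<otimes> y \<noteq> y \<otimes> w"
proof (rule ccontr)
  assume "\<not> ?thesis"
  then have H: "\<And>w s. prime (s::nat) ==> s \<noteq> p ==> s \<noteq> r ==> w \<in> A ==> w [^] s = \<one> ==> w \<noteq> \<one> ==> w \<otimes> y = y \<otimes> w" by blast
  have "a \<otimes> y = y \<otimes> a" if aA: "a \<in> A" for a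
    using aA
  proof (induction "ord a" arbitrary: a rule: less_induct)
    case less
    have ac: "a \<in> carrier G" using Ac[OF less(2)] .
    show ?case
    proof (cases "\<exists>s. prime s \<and> s dvd ord a \<and> s \<noteq> r")
      case False
      then obtain j where "ord a = r ^ j" using prime_power_if[of "ord a" r] ord_pos[OF ac] r by auto
      then have "a [^] (r ^ j) = \<one>" using pow_ord_eq_1[OF ac] by simp
      then show ?thesis by (rule r_part_comm[OF less(2)])
    next
      case True
      then obtain s where s: "prime s" "s dvd ord a" "s \<noteq> r" by blast
      have s1: "1 < s" using prime_gt_1_nat[OF s(1)] .
      have "ord (a [^] s) = ord a div s" using ord_pow[OF ac s(2)] s1 by simp
      also have "\<dots> < ord a" using ord_pos[OF ac] s1 by simp
      finally have as: "a [^] s \<otimes> y = y \<otimes> a [^] s" by (rule less(1)[OF _ pow_in_subgroup[OF sA less(2)]])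
      obtain w where wA: "w \<in> A" and e1: "conj_el G y a = w \<otimes> a" and rel: "y \<otimes> a = w \<otimes> (a \<otimes> y)"
        using commutator_obtain[OF sA yA less(2)] .
      have wc: "w \<in> carrier G" using Ac[OF wA] .
      have "conj_el G y a [^] s = a [^] s" using conj_pow[OF y(1) ac, of s] conj_eq_self[OF y(1), of "a [^] s"] as ac by simp
      then have "w [^] s \<otimes> a [^] s = a [^] s" unfolding e1 using pow_mult_distrib[OF Acomm[OF wA less(2)] wc ac] by simp
      then have ws: "w [^] s = \<one>" using wc ac by simp
      have wy: "w \<otimes> y = y \<otimes> w"
      proof (cases "w = \<one>")
        case True then show ?thesis using y(1) by simp
      next
        case w1: False
        show ?thesis
        proof (cases "s = p")
          case True
          then have "w \<in> group_center G" using cyclic_exponent_p_central[OF cycA zA wA] ws by simp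
          then show ?thesis using center_comm[of w, OF _ y(1)] by simp
        next
          case False
          then show ?thesis using H[OF s(1) _ s(3) wA ws w1] by simp
        qed
      qed
      have "y [^] r \<otimes> a = w [^] r \<otimes> (a \<otimes> y [^] r)" by (rule commutator_pow[OF y(1) ac wc wy[symmetric] rel])
      then have "w [^] r = \<one>" using Acomm[OF less(2) y(4)] wc ac y(1) by simp
      then have "w = \<one>" using coprime_pow_one[OF wc ws _ primes_coprime[OF s(1) r s(3)]] by simp
      then show ?thesis using rel ac y(1) by simp
    qed
  qed
  then show False using y_noncentral by blast
qed

lemma conj_relation:
  assumes a: "a \<in> A" obtains k :: nat where "a \<otimes> y = y \<otimes> a [^] k" "conj_el G (inv y) a = a [^] k"
proof -
  have "inv y \<in> normset G A" using normA y(1) by simp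
  then have "inv y \<in> normset G (generate G {a})" by (rule cyclic_normset[OF cycA _ a])
  then have "conj_el G (inv y) a \<in> generate G {a}" using in_generate1 by (simp add: normset_def)
  then obtain k :: nat where k: "conj_el G (inv y) a = a [^] k" using generate_single_iff[OF Ac[OF a]] by blast
  have "a = conj_el G y (a [^] k)" using k y(1) Ac[OF a] by (metis conj_inv_left' )
  then have "a \<otimes> y = conj_el G y (a [^] k) \<otimes> y" by simp
  also have "\<dots> = y \<otimes> a [^] k" using mult_eq_conj[OF y(1), of "a [^] k"] Ac[OF a] by simp
  finally show ?thesis using that k by blast
qed

lemma prime_generator_noncomm:
  assumes w: "w \<in> A" "w [^] s = \<one>" "prime (s::nat)" "w \<otimes> y \<noteq> y \<otimes> w" and t: "t \<in> generate G {w}" "t \<noteq> \<one>"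
  shows "t \<otimes> y \<noteq> y \<otimes> t"
proof
  assume c: "t \<otimes> y = y \<otimes> t"
  have wc: "w \<in> carrier G" using Ac[OF w(1)] .
  have tA: "t \<in> A" using generate_single_incl[OF sA w(1)] t(1) by blast
  have "w \<in> generate G {t}" by (rule prime_order_generator[OF wc w(2,3) t])
  then have "w \<in> group_center G" using generate_single_incl[OF subgroup_center central_if[OF tA c]] by blast
  then show False using center_comm[of w, OF _ y(1)] w(4) by simp
qed

text \<open>
  Otherwise y^r is a central r-element. Applied to a power of it of order r, cyclicity of Hughes subgroups shows
  that w and y commute, as they generate a group that does not contain z.
\<close>
lemma generator_order_r:
  assumes w: "w \<in> A" "w \<noteq> \<one>" "w [^] s = \<one>" "prime (s::nat)" "s \<noteq> p" "s \<noteq> r" "w \<otimes> y \<noteq> y \<otimes> w" and rp: "r \<noteq> p"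
  shows "y [^] r = \<one>"
proof (rule ccontr)
  assume ne: "y [^] r \<noteq> \<one>"
  have wc: "w \<in> carrier G" using Ac[OF w(1)] .
  have sw: "subgroup (generate G {w}) G" by (rule subgroup_generate1[OF wc])
  have nw: "y \<in> normset G (generate G {w})" by (rule cyclic_normset[OF cycA yA w(1)])
  let ?M = "ext G (generate G {w}) y"
  have sM: "subgroup ?M G" by (rule subgroup_ext[OF sw nw])
  have inM: "w \<in> ?M" "y \<in> ?M" using ext_incl[OF sw y(1)] in_generate1 by blast+
  have zM: "z \<notin> ?M"
  proof
    assume "z \<in> ?M"
    then obtain n and b :: nat where nb: "n \<in> generate G {w}" "z = n \<otimes> y [^] b" unfolding ext_def by blast
    have nA: "n \<in> A" using generate_single_incl[OF sA w(1)] nb(1) by blast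
    have nc: "n \<in> carrier G" using Ac[OF nA] .
    have "y [^] b = inv n \<otimes> z" using nb(2) nc y(1) by (simp add: m_assoc[symmetric])
    then have ybA: "y [^] b \<in> A" using subgroup.m_closed[OF sA subgroup.m_inv_closed[OF sA nA] zA] by simp
    obtain l :: nat where l: "n = w [^] l" using nb(1) generate_single_iff[OF wc] by blast
    have "n [^] (s * r ^ i) = (w [^] s) [^] (l * r ^ i)" unfolding l using wc by (simp add: nat_pow_pow mult.left_commute)
    then have n1: "n [^] (s * r ^ i) = \<one>" using w(3) by simp
    have "(y [^] b) [^] (s * r ^ i) = (y [^] (r ^ i)) [^] (b * s)" using y(1) by (simp add: nat_pow_pow ac_simps)
    then have "z [^] (s * r ^ i) = \<one>"
      unfolding nb(2) using pow_mult_distrib[OF Acomm[OF nA ybA] nc, of "s * r ^ i"] n1 y(1,5) by simp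
    moreover have "coprime p (s * r ^ i)" using primes_coprime[OF p w(4)] primes_coprime[OF p r] w(5) rp by simp
    ultimately show False using coprime_pow_one[OF zc z(3)] z(2) by blast
  qed
  then have neM: "?M \<noteq> carrier G" using zc by blast
  have yrc: "y [^] r \<in> carrier G" using y(1) by simp
  have yrZ: "y [^] r \<in> group_center G" by (rule central_if[OF y(4) comm_pow[OF y(1) y(1) refl]])
  have "\<exists>c\<in>generate G {y [^] r}. c \<noteq> \<one> \<and> c [^] r = \<one>"
  proof -
    have s: "subgroup (generate G {y [^] r}) G" by (rule subgroup_generate1[OF yrc])
    have "(y [^] r) [^] (r ^ i) = (y [^] (r ^ i)) [^] r" using y(1) by (simp add: nat_pow_pow mult.commute)
    then have "ord (y [^] r) dvd r ^ i" using pow_eq_id[OF yrc] y(5) by simp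
    then obtain j where j: "ord (y [^] r) = r ^ j" using divides_primepow_nat[OF r] by blast
    have "j \<noteq> 0" using j ne ord_eq_1[OF yrc] by auto
    then have "r dvd card (generate G {y [^] r})" using j generate_pow_card[OF yrc] by simp
    then show ?thesis using cauchy[OF s r] by blast
  qed
  then obtain c where c: "c \<in> generate G {y [^] r}" "c \<noteq> \<one>" "c [^] r = \<one>" by blast
  have cZ: "c \<in> group_center G" using generate_single_incl[OF subgroup_center yrZ] c(1) by blast
  have cM: "c \<in> ?M" using generate_single_incl[OF sM pow_in_subgroup[OF sM inM(2)]] c(1) by blast
  have cyc: "cyclic_subset G (hughes G r c ?M)"
    using hughes_cyclic[OF sM neM cM c(2,3)] center_comm[OF cZ] subgroup.mem_carrier[OF sM] by simp
  have "w [^] r \<noteq> \<one>" using coprime_pow_one[OF wc w(3) _ primes_coprime[OF w(4) r w(6)]] w(2) by blast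
  then have "w \<in> hughes G r c ?M" "y \<in> hughes G r c ?M" using hughes_incl inM ne by blast+
  then show False using cyclic_comm[OF cyc] w(7) by blast
qed

text \<open>
  As w and y do not commute, G = \<langle>z w, y\<rangle>, where z w has order p s.
\<close>
lemma case5_forward:
  assumes w: "w \<in> A" "w \<noteq> \<one>" "w [^] s = \<one>" "prime (s::nat)" "s \<noteq> p" "s \<noteq> r" "w \<otimes> y \<noteq> y \<otimes> w" and rp: "r \<noteq> p"
  shows "quasi_frobenius_group G \<and> (\<exists>a b k. split_mc G a b (p * s) r k \<and> [k = 1] (mod int p) \<and> \<not> [k = 1] (mod int s))"
proof -
  have wc: "w \<in> carrier G" using Ac[OF w(1)] .
  have yr: "y [^] r = \<one>" by (rule generator_order_r[OF w rp])
  have ow: "ord w = s" by (rule ord_prime[OF wc w(2,3,4)])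
  have cop: "coprime p s" using primes_coprime[OF p w(4)] w(5) by simp
  define a where "a = z \<otimes> w"
  have zw: "z \<otimes> w = w \<otimes> z" using zcomm[OF wc] by simp
  have aA: "a \<in> A" unfolding a_def by (rule subgroup.m_closed[OF sA zA w(1)])
  have ac: "a \<in> carrier G" using Ac[OF aA] .
  have oa: "ord a = p * s" unfolding a_def using ord_coprime_mult[OF zc wc zw] ord_z ow cop by simp
  have za: "z \<in> generate G {a}" "w \<in> generate G {a}" unfolding a_def by (rule coprime_generate[OF zc wc zw z(3) w(3) cop])+
  have sa: "subgroup (generate G {a}) G" by (rule subgroup_generate1[OF ac])
  have na: "y \<in> normset G (generate G {a})" by (rule cyclic_normset[OF cycA yA aA])
  have ya: "y \<notin> generate G {a}" using generate_single_incl[OF sA aA] y(2) by blast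
  have wE: "w [^] p \<noteq> \<one>" using coprime_pow_one[OF wc _ w(3) cop] w(2) by blast
  have "ext G (generate G {a}) y = carrier G"
    by (rule noncommuting_full[OF subgroup_ext[OF sa na] _ _ _ wE y(3) w(7)]) (use ext_incl[OF sa y(1)] za in blast)+
  then have cG: "card (carrier G) = (p * s) * r"
    using card_ext[OF sa y(1) ya _ r] yr subgroup.one_closed[OF sa] generate_pow_card[OF ac] oa by simp
  obtain k :: nat where k: "a \<otimes> y = y \<otimes> a [^] k" "conj_el G (inv y) a = a [^] k" using conj_relation[OF aA] .
  have rel: "a \<otimes> y = y \<otimes> a [^] int k" using k(1) int_pow_int[of G a k] by simp
  have mc: "split_mc G a y (p * s) r (int k)" by (rule split_mcI[OF ac oa na ya yr r rel cG])
  have powk: "a [^] (k * j) = conj_el G (inv y) (a [^] j)" for j :: nat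
    using conj_pow[of "inv y" a j] k(2) ac y(1) by (simp add: nat_pow_pow)
  have iyc: "inv y \<in> carrier G" using y(1) by simp
  have "a [^] s = z [^] s" unfolding a_def using pow_mult_distrib[OF zw zc wc, of s] w(3) zc by simp
  then have asZ: "a [^] s \<in> group_center G" using pow_in_subgroup[OF subgroup_center z(1)] by simp
  have "conj_el G (inv y) (a [^] s) = a [^] s"
    using conj_eq_self[OF iyc, of "a [^] s"] center_comm[OF asZ iyc] ac by simp
  then have "a [^] (k * s) = a [^] s" using powk[of s] by simp
  then have "[k * s = s] (mod p * s)" using pow_eq_cong[OF ac] oa by metis
  then have "[k * s = 1 * s] (mod p * s)" by simp
  then have kp: "[k = 1] (mod p)" using w(4) prime_gt_0_nat[OF w(4)] by (simp add: cong_def mod_mult_mult2)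
  have ks: "\<not> [k = 1] (mod s)"
  proof
    assume a1: "[k = 1] (mod s)"
    then have "[k * p = 1 * p] (mod s * p)" using prime_gt_0_nat[OF p] by (simp add: cong_def mod_mult_mult2)
    then have "a [^] (k * p) = a [^] p"
      using pow_cong[OF ac, of "p * s" "k * p" p] pow_ord_eq_1[OF ac] oa by (simp add: mult.commute)
    then have c: "conj_el G (inv y) (a [^] p) = a [^] p" using powk[of p] by simp
    have ap: "a [^] p = w [^] p" unfolding a_def using pow_mult_distrib[OF zw zc wc, of p] z(3) wc by simp
    have "inv y \<otimes> w [^] p = w [^] p \<otimes> inv y" using c conj_eq_self[OF iyc, of "w [^] p"] wc unfolding ap by simp
    from comm_inv[OF iyc nat_pow_closed[OF wc] this]
    have "w [^] p \<otimes> y = y \<otimes> w [^] p" using y(1) by simp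
    then show False
      using prime_generator_noncomm[OF w(1,3,4,7) pow_in_subgroup[OF subgroup_generate1[OF wc] in_generate1] wE] by simp
  qed
  have cA: "card A = p * s" using card_G cG prime_gt_0_nat[OF r] by simp
  have "frobenius_group qc"
  proof (rule frobenius_quotient(3)[OF y(1) yr r sA ZA yA y(2) extA[symmetric]])
    show "\<And>x. x \<in> A ==> x \<otimes> y = y \<otimes> x ==> x \<in> group_center G" by (rule central_if)
    fix c assume c: "c \<in> group_center G" "c [^] r = \<one>"
    have cA': "c \<in> A" using ZA c(1) by blast
    have "c [^] (p * s) = \<one>" using pow_card_subgroup[OF sA cA'] cA by simp
    moreover have "coprime r (p * s)" using primes_coprime[OF r p rp] primes_coprime[OF r w(4)] w(6) by simp
    ultimately show "c = \<one>" using coprime_pow_one[OF Ac[OF cA'] c(2)] by blast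
  qed
  then have "quasi_frobenius_group G" using is_group fin by (simp add: quasi_frobenius_group_def)
  moreover have "[int k = 1] (mod int p)" using kp cong_int_iff[of k 1 p] by simp
  moreover have "\<not> [int k = 1] (mod int s)" using ks cong_int_iff[of k 1 s] by simp
  ultimately show ?thesis using mc by blast
qed

lemma case6_forward:
  assumes w: "w \<in> A" "w \<noteq> \<one>" "w [^] s = \<one>" "prime (s::nat)" "s \<noteq> p" "w \<otimes> y \<noteq> y \<otimes> w" and rp: "r = p"
  shows "\<exists>a b n k. n \<ge> 2 \<and> split_mc G a b s (p ^ n) k \<and> \<not> [k = 1] (mod int s) \<and> [k ^ p = 1] (mod int s)"
proof -
  have wc: "w \<in> carrier G" using Ac[OF w(1)] .
  have ow: "ord w = s" by (rule ord_prime[OF wc w(2,3,4)])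
  have cop: "coprime p s" using primes_coprime[OF p w(4)] w(5) by simp
  have wE: "w [^] p \<noteq> \<one>" using coprime_pow_one[OF wc _ w(3) cop] w(2) by blast
  have "ord y dvd p ^ i" using pow_eq_id[OF y(1)] y(5) rp by simp
  then obtain n where n: "ord y = p ^ n" using divides_primepow_nat[OF p] by blast
  have "\<not> ord y dvd p" using pow_eq_id[OF y(1)] y(3) by simp
  then have "n \<noteq> 0" "n \<noteq> 1" unfolding n by (metis power_0 one_dvd, metis power_one_right dvd_refl)
  then have n2: "n \<ge> 2" by simp
  have yZ: "y \<notin> group_center G" using ZA y(2) by blast
  have sy: "subgroup (generate G {y}) G" by (rule subgroup_generate1[OF y(1)])
  have sCy: "subgroup (centralizer G y) G" by (rule subgroup_centralizer[OF y(1)])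
  \<comment> \<open>\<open>z\<close> lies in every subgroup of order \<open>p\<close> of the cyclic centralizer of \<open>y\<close>\<close>
  have zy: "z \<in> generate G {y}"
  proof -
    have "p dvd card (generate G {y})" using n \<open>n \<noteq> 0\<close> generate_pow_card[OF y(1)] by simp
    then obtain c where c: "c \<in> generate G {y}" "c \<noteq> \<one>" "c [^] p = \<one>" using cauchy[OF sy p] by blast
    have "c \<in> centralizer G y" using generate_single_incl[OF sCy self_centralizer[OF y(1)]] c(1) by blast
    moreover have "z \<in> centralizer G y" using center_le_centralizer[OF y(1)] z(1) by blast
    ultimately have "z \<in> generate G {c}"
      using cyclic_prime_order[OF centralizer_cyclic[OF y(1,3) yZ] _ c(2,3) p _ z(3)] by blast
    then show ?thesis using generate_single_incl[OF sy c(1)] by blast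
  qed
  have sG: "subgroup (generate G {w, y}) G" using wc y(1) by (intro generate_is_subgroup) simp
  have gens: "w \<in> generate G {w, y}" "y \<in> generate G {w, y}" by (auto intro: generate.incl)
  have "z \<in> generate G {w, y}" using generate_single_incl[OF sG gens(2)] zy by blast
  then have gen: "generate G {w, y} = carrier G" by (rule noncommuting_full[OF sG _ gens wE y(3) w(6)])
  obtain k :: nat where k: "w \<otimes> y = y \<otimes> w [^] k" using conj_relation[OF w(1)] .
  have rel: "w \<otimes> y = y \<otimes> w [^] int k" using k int_pow_int[of G w k] by simp
  have s0: "0 < s" using prime_gt_0_nat[OF w(4)] .
  have p0: "0 < p ^ n" using prime_gt_0_nat[OF p] by simp
  have ypn: "y [^] (p ^ n) = \<one>" using pow_ord_eq_1[OF y(1)] n by simp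
  have mr: "mc_rel G w y s (p ^ n) (int k)" using wc y(1) s0 p0 w(3) ypn rel by (simp add: mc_rel_def)
  have "card (carrier G) \<le> card (mc_index s (p ^ n))"
    unfolding gen[symmetric] mc_generate[OF mr] by (rule card_image_le) simp
  then have le: "card (carrier G) \<le> s * p ^ n" unfolding card_mc_index .
  have "s dvd card (carrier G)" "p ^ n dvd card (carrier G)"
    using ord_dvd_card[OF subgroup_self wc] ord_dvd_card[OF subgroup_self y(1)] ow n by simp_all
  moreover have "coprime s (p ^ n)" using cop by (simp add: coprime_commute)
  ultimately have "s * p ^ n dvd card (carrier G)" by (simp add: divides_mult)
  moreover have "0 < card (carrier G)" using fin one_closed card_gt_0_iff[of "carrier G"] by blast
  ultimately have cG: "card (carrier G) = s * p ^ n" using le dvd_imp_le by fastforce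
  have mc: "split_mc G w y s (p ^ n) (int k)" using mr gen cG is_group by (simp add: split_mc_def)
  have "\<not> [int k = 1] (mod int s)"
    using split_mc_abelian[OF mc _ wc y(1)] w(6) by blast
  moreover have "[int k ^ p = 1] (mod int s)"
  proof -
    have "w [^] (1::int) \<otimes> y [^] p = y [^] p \<otimes> w [^] (1 * int k ^ p)" by (rule mc_comm[OF mr])
    then have "y [^] p \<otimes> w = y [^] p \<otimes> w [^] (int k ^ p)" using Acomm[OF w(1) y(4)] rp int_pow_1[OF wc] by simp
    then have "w [^] (int k ^ p) = w" using wc y(1) by simp
    then have "w [^] (int k ^ p - 1) = \<one>" using int_pow_diff[OF wc, of "int k ^ p" 1] int_pow_1[OF wc] wc by simp
    then have "int s dvd int k ^ p - 1" using mc_one_nat(4)[OF mc] by blast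
    then show ?thesis by (simp add: cong_iff_dvd_diff)
  qed
  ultimately show ?thesis using mc n2 by blast
qed

end

context min_PF_z begin

theorem normal_centralizer_case:
  assumes e: "e \<in> carrier G" "e [^] p \<noteq> \<one>" "e \<notin> group_center G" and norm: "normset G (centralizer G e) = carrier G"
    and mixed: "\<exists>q. prime (q::nat) \<and> q \<noteq> p \<and> q dvd card (carrier G)"
    and no4: "\<And>q. prime q ==> q \<noteq> p ==> \<not> (\<exists>a b. split_mc G a b (p * q) q 1)"
  shows "(\<exists>s r a b k. prime (s::nat) \<and> prime (r::nat) \<and> s \<noteq> r \<and> s \<noteq> p \<and> r \<noteq> p \<and> quasi_frobenius_group G \<and>
      split_mc G a b (p * s) r k \<and> [k = 1] (mod int p) \<and> \<not> [k = 1] (mod int s)) \<or>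
    (\<exists>s n a b k. prime (s::nat) \<and> s \<noteq> p \<and> n \<ge> 2 \<and> split_mc G a b s (p ^ n) k \<and>
      \<not> [k = 1] (mod int s) \<and> [k ^ p = 1] (mod int s))"
proof -
  obtain y and r i :: nat where y: "prime r" "y \<in> carrier G" "y \<notin> centralizer G e" "y [^] p \<noteq> \<one>"
    "y [^] r \<in> centralizer G e" "y [^] (r ^ i) = \<one>" using normal_centralizer_outside[OF e] by blast
  interpret N: min_PF_normal G z p "centralizer G e" y e r i
    by unfold_locales (use e norm y mixed no4 in auto)
  obtain w s where w: "prime (s::nat)" "s \<noteq> p" "s \<noteq> r" "w \<in> centralizer G e" "w \<noteq> \<one>" "w [^] s = \<one>" "w \<otimes> y \<noteq> y \<otimes> w"
    using N.noncommuting_prime by blast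
  show ?thesis
  proof (cases "r = p")
    case True
    then show ?thesis using N.case6_forward[OF w(4,5,6,1,2,7) True] w(1,2) by blast
  next
    case False
    then show ?thesis using N.case5_forward[OF w(4,5,6,1,2,3,7) False] w(1,2,3) y(1) by blast
  qed
qed

end

section \<open>Cyclic centralizers and a normal p-subgroup\<close>

context fin_group begin

lemma conj_center_iff:
  assumes "g \<in> carrier G" "x \<in> carrier G" shows "conj_el G g x \<in> group_center G \<longleftrightarrow> x \<in> group_center G"
proof
  assume x: "x \<in> group_center G"
  have "conj_el G g x = x" using conj_eq_self[OF assms] center_comm[OF x assms(1)] by simp
  then show "conj_el G g x \<in> group_center G" using x by simp
next
  assume x: "conj_el G g x \<in> group_center G"
  have i: "inv g \<in> carrier G" using assms by simp
  have c: "conj_el G g x \<in> carrier G" using assms by simp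
  have "conj_el G (inv g) (conj_el G g x) = conj_el G g x"
    using conj_eq_self[OF i c] center_comm[OF x i] by metis
  then have "conj_el G g x = x" unfolding conj_inv_left[OF assms] by (rule sym)
  then show "x \<in> group_center G" using x by simp
qed

lemma conj_pow_one_iff:
  assumes "g \<in> carrier G" "x \<in> carrier G" shows "conj_el G g x [^] (k::nat) = \<one> \<longleftrightarrow> x [^] k = \<one>"
  using conj_pow[OF assms, of k] conj_eq_one[OF assms(1), of "x [^] k"] assms by simp

lemma conj_commute:
  assumes "g \<in> carrier G" "x \<in> carrier G" "y \<in> carrier G" "x \<otimes> y = y \<otimes> x"
  shows "conj_el G g x \<otimes> conj_el G g y = conj_el G g y \<otimes> conj_el G g x"
  using conj_mult[OF assms(1,2,3)] conj_mult[OF assms(1,3,2)] assms(4) by simp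

lemma subgroup_conj:
  assumes P: "subgroup P G" and g: "g \<in> carrier G"
  shows "subgroup (conj_el G g ` P) G" "card (conj_el G g ` P) = card P"
proof -
  have c: "h \<in> carrier G" if "h \<in> P" for h using subgroup.mem_carrier[OF P that] .
  show "subgroup (conj_el G g ` P) G"
  proof (rule subgroupI)
    show "conj_el G g ` P \<subseteq> carrier G" using c g by blast
    show "conj_el G g ` P \<noteq> {}" using subgroup.one_closed[OF P] by blast
    fix a assume "a \<in> conj_el G g ` P"
    then obtain h where h: "h \<in> P" "a = conj_el G g h" by blast
    show "inv a \<in> conj_el G g ` P"
      using conj_inv[OF g c[OF h(1)]] h(2) subgroup.m_inv_closed[OF P h(1)] by (metis imageI)
    fix b assume "b \<in> conj_el G g ` P"
    then obtain k where k: "k \<in> P" "b = conj_el G g k" by blast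
    show "a \<otimes> b \<in> conj_el G g ` P"
      using conj_mult[OF g c[OF h(1)] c[OF k(1)]] h(2) k(2) subgroup.m_closed[OF P h(1) k(1)] by (metis imageI)
  qed
  show "card (conj_el G g ` P) = card P"
    by (rule card_image) (use conj_inj[OF g] c in \<open>auto simp: inj_on_def\<close>)
qed

lemma conj_pow_left:
  assumes g: "g \<in> carrier G" and t: "t \<in> carrier G" "conj_el G g t = t [^] (k::nat)"
  shows "conj_el G (g [^] (j::nat)) t = t [^] (k ^ j)"
proof (induction j)
  case 0 then show ?case using t by simp
next
  case (Suc j)
  have "conj_el G (g [^] Suc j) t = conj_el G (g [^] j) (conj_el G g t)" using conj_mult_left[of "g [^] j" g t] g t by simp
  also have "\<dots> = t [^] (k ^ j * k)" unfolding t(2) using conj_pow[of "g [^] j" t k] g t(1) Suc by (simp add: nat_pow_pow)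
  finally show ?case by (simp add: mult.commute)
qed

end

context min_PF_z begin

definition noncentral_E where "noncentral_E e \<longleftrightarrow> e \<in> carrier G \<and> e [^] p \<noteq> \<one> \<and> e \<notin> group_center G"
definition noncentral_p where "noncentral_p x \<longleftrightarrow> x \<in> carrier G \<and> x [^] p = \<one> \<and> x \<notin> group_center G"
definition cent_class where "cent_class e = (\<Union>g\<in>carrier G. conj_el G g ` (centralizer G e - group_center G))"

lemma cyc_cent: "noncentral_E e ==> cyclic_subset G (centralizer G e)"
  unfolding noncentral_E_def using centralizer_cyclic by blast

lemma z_cent: "x \<in> carrier G ==> z \<in> centralizer G x"
  using center_le_centralizer z(1) by blast

text \<open>
  The centralizers of the elements e form a family of maximal cyclic subgroups that pairwise meet in the centre.
\<close>
lemma cent_eq: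
  assumes e: "noncentral_E e" and a: "a \<in> centralizer G e" "a \<notin> group_center G"
  shows "noncentral_E a" "centralizer G a = centralizer G e"
proof -
  have ec: "e \<in> carrier G" using e by (simp add: noncentral_E_def)
  have ac: "a \<in> carrier G" "a \<otimes> e = e \<otimes> a" using a by (simp_all add: centralizer_def)
  show na: "noncentral_E a"
    unfolding noncentral_E_def using cyclic_exponent_p_central[OF cyc_cent[OF e] z_cent[OF ec] a(1)] a(2) ac(1) by blast
  have "e \<in> centralizer G a" using ec ac by (simp add: centralizer_def)
  then have "h \<in> centralizer G e" if h: "h \<in> centralizer G a" for h
    using cyclic_comm[OF cyc_cent[OF na] h] h by (simp add: centralizer_def)
  moreover have "h \<in> centralizer G a" if h: "h \<in> centralizer G e" for h
    using cyclic_comm[OF cyc_cent[OF e] h a(1)] h by (simp add: centralizer_def)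
  ultimately show "centralizer G a = centralizer G e" by blast
qed

lemma conj_centralizer:
  assumes "g \<in> carrier G" "x \<in> carrier G" "h \<in> centralizer G x"
  shows "conj_el G g h \<in> centralizer G (conj_el G g x)"
  using conj_commute[of g h x] assms by (simp add: centralizer_def)

lemma cent_ti:
  assumes e: "noncentral_E e" and a: "a \<in> centralizer G e" "a \<notin> group_center G"
    and g: "g \<in> carrier G" "conj_el G g a \<in> centralizer G e"
  shows "g \<in> normset G (centralizer G e)"
proof -
  have ac: "a \<in> carrier G" using a by (simp add: centralizer_def)
  have n: "conj_el G g a \<notin> group_center G" using conj_center_iff[OF g(1) ac] a(2) by simp
  have "conj_el G g h \<in> centralizer G e" if "h \<in> centralizer G e" for h
    using conj_centralizer[OF g(1) ac, of h] cent_eq(2)[OF e a] cent_eq(2)[OF e g(2) n] that by simp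
  then show ?thesis using g(1) by (simp add: normset_def)
qed

lemma card_cent_class:
  assumes e: "noncentral_E e"
  shows "card (cent_class e) * card (normset G (centralizer G e)) =
    card (carrier G) * (card (centralizer G e) - card (group_center G))"
proof -
  have ec: "e \<in> carrier G" using e by (simp add: noncentral_E_def)
  have s: "subgroup (centralizer G e) G" by (rule subgroup_centralizer[OF ec])
  have N: "subgroup (normset G (centralizer G e)) G" by (rule subgroup_normset[OF s])
  have cc: "h \<in> carrier G" if "h \<in> centralizer G e" for h using that by (simp add: centralizer_def)
  have "card (cent_class e) * card (normset G (centralizer G e)) =
    card (carrier G) * card (centralizer G e - group_center G)"
    unfolding cent_class_def
  proof (rule card_conj_union[OF subgroup_self N subgroup.subset[OF N]])
    show "centralizer G e - group_center G \<subseteq> carrier G" using cc by blast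
    fix g s assume s: "s \<in> centralizer G e - group_center G"
    show "conj_el G g s \<in> centralizer G e - group_center G" if g: "g \<in> normset G (centralizer G e)"
      using g s conj_center_iff[of g s] cc[of s] by (simp add: normset_def)
    show "g \<in> normset G (centralizer G e)" if g: "g \<in> carrier G" "conj_el G g s \<in> centralizer G e - group_center G"
      using cent_ti[OF e, of s g] s g by simp
  qed
  also have "card (centralizer G e - group_center G) = card (centralizer G e) - card (group_center G)"
    by (rule card_Diff_subset[OF finite_subgroup[OF subgroup_center] center_le_centralizer[OF ec]])
  finally show ?thesis .
qed

lemma center_pos: "0 < card (group_center G)"
  using finite_subgroup[OF subgroup_center] z(1) card_gt_0_iff by blast

lemma card_cent_ge:
  assumes e: "noncentral_E e" shows "2 * card (group_center G) \<le> card (centralizer G e)"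
proof -
  have ec: "e \<in> carrier G" "e \<notin> group_center G" using e by (simp_all add: noncentral_E_def)
  note s = subgroup_centralizer[OF ec(1)]
  note Z = center_le_centralizer[OF ec(1)]
  obtain k where k: "card (centralizer G e) = card (group_center G) * k"
    using subgroup_card_dvd[OF subgroup_center s Z] by blast
  have "group_center G \<subset> centralizer G e" using Z self_centralizer[OF ec(1)] ec(2) by blast
  then have "card (group_center G) < card (centralizer G e)" by (rule psubset_card_mono[OF finite_subgroup[OF s]])
  then have "k \<ge> 2" using k by (cases k) auto
  then show ?thesis using k by (metis mult.commute mult_le_mono2)
qed

lemma cent_class_props:
  assumes e: "noncentral_E e" and x: "x \<in> cent_class e" shows "noncentral_E x"
proof -
  obtain g a where g: "g \<in> carrier G" "a \<in> centralizer G e" "a \<notin> group_center G" "x = conj_el G g a"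
    using x by (auto simp: cent_class_def)
  note a = cent_eq(1)[OF e g(2,3)]
  then have ac: "a \<in> carrier G" "a [^] p \<noteq> \<one>" by (simp_all add: noncentral_E_def)
  show ?thesis unfolding noncentral_E_def g(4) using conj_center_iff[OF g(1) ac(1)] conj_pow_one_iff[OF g(1) ac(1)] ac g by simp
qed

lemma cent_class_disjoint:
  assumes e: "noncentral_E e" and f: "noncentral_E f" "f \<notin> cent_class e"
  shows "cent_class e \<inter> cent_class f = {}"
proof (rule ccontr)
  assume "cent_class e \<inter> cent_class f \<noteq> {}"
  then obtain x where x: "x \<in> cent_class e" "x \<in> cent_class f" by blast
  obtain g a where g: "g \<in> carrier G" "a \<in> centralizer G e" "a \<notin> group_center G" "x = conj_el G g a"
    using x(1) by (auto simp: cent_class_def)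
  obtain h b where h: "h \<in> carrier G" "b \<in> centralizer G f" "b \<notin> group_center G" "x = conj_el G h b"
    using x(2) by (auto simp: cent_class_def)
  have c: "a \<in> carrier G" "b \<in> carrier G" "f \<in> carrier G" using g h f by (simp_all add: centralizer_def noncentral_E_def)
  let ?k = "inv g \<otimes> h"
  have k: "?k \<in> carrier G" using g h by simp
  have "conj_el G ?k b = conj_el G (inv g) x" using conj_mult_left[of "inv g" h b] g(1) h c by simp
  then have kb: "conj_el G ?k b = a" using conj_inv_left[OF g(1) c(1)] g(4) by simp
  have "f \<in> centralizer G b" using h(2) c by (simp add: centralizer_def)
  then have "conj_el G ?k f \<in> centralizer G a" using conj_centralizer[OF k c(2)] kb by simp
  then have "conj_el G ?k f \<in> centralizer G e" using cent_eq(2)[OF e g(2,3)] by simp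
  moreover have "conj_el G ?k f \<notin> group_center G" using conj_center_iff[OF k c(3)] f(1) by (simp add: noncentral_E_def)
  ultimately have "conj_el G (inv ?k) (conj_el G ?k f) \<in> cent_class e" using k unfolding cent_class_def by blast
  then show False using conj_inv_left[OF k c(3)] f(2) by simp
qed

lemma cent_normalizer_outside:
  assumes e: "noncentral_E e" and ne: "normset G (centralizer G e) \<noteq> carrier G"
    and v: "v \<in> normset G (centralizer G e)" "v \<notin> centralizer G e"
  shows "v [^] p = \<one>"
proof (rule ccontr)
  assume vp: "v [^] p \<noteq> \<one>"
  have ec: "e \<in> carrier G" "e [^] p \<noteq> \<one>" using e by (simp_all add: noncentral_E_def)
  note s = subgroup_centralizer[OF ec(1)]
  have "e \<in> normset G (centralizer G e)" "z \<in> normset G (centralizer G e)"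
    using subgroup_le_normset[OF s] self_centralizer[OF ec(1)] z_cent[OF ec(1)] by blast+
  then have "v \<otimes> e = e \<otimes> v" using proper_comm[OF subgroup_normset[OF s] ne _ v(1) _ vp ec(2)] by blast
  then show False using v by (simp add: centralizer_def normset_def)
qed

lemma finite_cent_class: "finite (cent_class e)"
proof -
  have "centralizer G e \<subseteq> carrier G" by (auto simp: centralizer_def)
  then have "cent_class e \<subseteq> carrier G" unfolding cent_class_def using conj_closed by blast
  then show ?thesis using fin finite_subset by blast
qed

end

text \<open>
  The remaining situation; the cyclic centralizers are not normal, and G is neither abelian nor a p-group.
\<close>
locale min_PF_count = min_PF_z +
  assumes nonnormal: "\<And>e. noncentral_E e ==> normset G (centralizer G e) \<noteq> carrier G"
    and nonabelian: "group_center G \<noteq> carrier G"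
    and mixed: "\<exists>q. prime (q::nat) \<and> q \<noteq> p \<and> q dvd card (carrier G)"
begin

lemma not_pgroup: "card (carrier G) \<noteq> p ^ k"
proof
  assume "card (carrier G) = p ^ k"
  moreover obtain q where q: "prime q" "q \<noteq> p" "q dvd card (carrier G)" using mixed by blast
  ultimately have "q dvd p" using prime_dvd_power[OF q(1)] by metis
  then show False using primes_dvd_imp_eq[OF q(1) p] q(2) by simp
qed

lemma ex_noncentral_E: "\<exists>e. noncentral_E e"
  unfolding noncentral_E_def using E_not_in_proper[OF subgroup_center nonabelian z(1)] by blast

text \<open>
  Otherwise every cyclic centralizer is its own normalizer. Then the conjugates of one of them cover at least half
  of G, but not everything outside the centre, and a second class leaves no room for the centre.
\<close>
lemma ex_noncentral_p: "\<exists>x. noncentral_p x"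
proof (rule ccontr)
  assume "\<not> ?thesis"
  then have noR: "x \<in> group_center G" if "x \<in> carrier G" "x [^] p = \<one>" for x using that by (auto simp: noncentral_p_def)
  let ?n = "card (carrier G)" and ?m = "card (group_center G)"
  have N: "normset G (centralizer G e) = centralizer G e" if e: "noncentral_E e" for e
  proof -
    have ec: "e \<in> carrier G" using e by (simp add: noncentral_E_def)
    have "v \<in> centralizer G e" if v: "v \<in> normset G (centralizer G e)" for v
    proof (rule ccontr)
      assume n: "v \<notin> centralizer G e"
      have "v \<in> group_center G"
        using noR[OF _ cent_normalizer_outside[OF e nonnormal[OF e] v n]] v by (simp add: normset_def)
      then show False using center_le_centralizer[OF ec] n by blast
    qed
    then show ?thesis using subgroup_le_normset[OF subgroup_centralizer[OF ec]] by blast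
  qed
  have U: "card (cent_class e) * card (centralizer G e) = ?n * (card (centralizer G e) - ?m)" if "noncentral_E e" for e
    using card_cent_class[OF that] N[OF that] by simp
  have half: "?n \<le> 2 * card (cent_class e)" if e: "noncentral_E e" for e
  proof -
    let ?a = "card (centralizer G e)"
    have "?n * ?a \<le> ?n * (2 * (?a - ?m))" using card_cent_ge[OF e] by (intro mult_le_mono2) simp
    also have "\<dots> = 2 * (card (cent_class e) * ?a)" unfolding U[OF e] by simp
    finally have "?n * ?a \<le> (2 * card (cent_class e)) * ?a" by simp
    moreover have "0 < ?a" using card_cent_ge[OF e] center_pos by simp
    ultimately show ?thesis by simp
  qed
  obtain e where e: "noncentral_E e" using ex_noncentral_E by blast
  have ec: "e \<in> carrier G" using e by (simp add: noncentral_E_def)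
  have Zf: "finite (group_center G)" by (rule finite_subgroup[OF subgroup_center])
  have ZU: "group_center G \<inter> cent_class f = {}" if "noncentral_E f" for f
    using cent_class_props[OF that] by (auto simp: noncentral_E_def)
  have "\<exists>f. noncentral_E f \<and> f \<notin> cent_class e"
  proof (rule ccontr)
    assume "\<not> ?thesis"
    then have "carrier G \<subseteq> group_center G \<union> cent_class e" using noR by (auto simp: noncentral_E_def)
    then have "?n \<le> card (group_center G \<union> cent_class e)" using Zf finite_cent_class by (intro card_mono) auto
    also have "\<dots> = ?m + card (cent_class e)" by (rule card_Un_disjoint[OF Zf finite_cent_class ZU[OF e]])
    finally have le: "?n \<le> ?m + card (cent_class e)" .
    let ?a = "card (centralizer G e)"
    have "?n * ?a \<le> ?m * ?a + card (cent_class e) * ?a" using mult_le_mono1[OF le, of ?a] by (simp add: algebra_simps)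
    then have "?n * ?a \<le> ?m * ?a + (?n * ?a - ?n * ?m)" unfolding U[OF e] by (simp add: algebra_simps)
    moreover have "?n * ?m \<le> ?n * ?a" using card_cent_ge[OF e] by (intro mult_le_mono2) simp
    ultimately have "?n * ?m \<le> ?m * ?a" by linarith
    then have "?n \<le> ?a" using center_pos by (simp add: mult.commute)
    moreover have "?a < ?n"
    proof (rule psubset_card_mono[OF fin])
      show "centralizer G e \<subset> carrier G"
        using subgroup.subset[OF subgroup_centralizer[OF ec]] centralizer_proper[OF ec] e by (auto simp: noncentral_E_def)
    qed
    ultimately show False by simp
  qed
  then obtain f where f: "noncentral_E f" "f \<notin> cent_class e" by blast
  have d: "group_center G \<inter> (cent_class e \<union> cent_class f) = {}" using ZU[OF e] ZU[OF f(1)] by blast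
  have "?m + (card (cent_class e) + card (cent_class f)) = card (group_center G \<union> (cent_class e \<union> cent_class f))"
    using card_Un_disjoint[OF Zf _ d] card_Un_disjoint[OF finite_cent_class finite_cent_class cent_class_disjoint[OF e f]]
      finite_cent_class by simp
  also have "\<dots> \<le> ?n"
    using subgroup.subset[OF subgroup_center] cent_class_props[OF e] cent_class_props[OF f(1)] fin
    by (intro card_mono) (auto simp: noncentral_E_def)
  finally show False using half[OF e] half[OF f(1)] center_pos by linarith
qed

lemma center_exponent: "c \<in> group_center G ==> c [^] p = \<one>"
proof (rule ccontr)
  assume c: "c \<in> group_center G" "c [^] p \<noteq> \<one>"
  obtain x where x: "x \<in> carrier G" "x [^] p = \<one>" "x \<notin> group_center G" using ex_noncentral_p by (auto simp: noncentral_p_def)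
  note s = subgroup_centralizer[OF x(1)]
  have ne: "centralizer G x \<noteq> carrier G"
  proof
    assume a: "centralizer G x = carrier G"
    have "x \<otimes> g = g \<otimes> x" if "g \<in> carrier G" for g using that unfolding a[symmetric] by (simp add: centralizer_def)
    then show False using x by (simp add: group_center_def)
  qed
  have "c \<in> centralizer G x" using center_le_centralizer[OF x(1)] c(1) by blast
  then have "cyclic_subset G (centralizer G x)" by (rule central_cyclic[OF c s ne z_cent[OF x(1)]])
  then show False using cyclic_exponent_p_central[OF _ z_cent[OF x(1)] self_centralizer[OF x(1)] x(2)] x(3) by simp
qed

lemma center_generate: "group_center G = generate G {z}" "card (group_center G) = p"
proof -
  obtain e where e: "noncentral_E e" using ex_noncentral_E by blast
  then have ec: "e \<in> carrier G" by (simp add: noncentral_E_def)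
  have "c \<in> generate G {z}" if c: "c \<in> group_center G" for c
    using cyclic_prime_order[OF cyc_cent[OF e] z_cent[OF ec] z(2,3) p _ center_exponent[OF c]]
      center_le_centralizer[OF ec] c by blast
  then show "group_center G = generate G {z}" using in_generate_z by blast
  then show "card (group_center G) = p" using generate_pow_card[OF zc] ord_z by simp
qed

lemma coprime_noncentral_E:
  assumes "u \<in> carrier G" "u \<noteq> \<one>" "u [^] q = \<one>" "prime (q::nat)" "q \<noteq> p" shows "noncentral_E u"
proof -
  have "u [^] p \<noteq> \<one>" using coprime_pow_one[OF assms(1,3) _ primes_coprime[OF assms(4) p assms(5)]] assms(2) by blast
  then show ?thesis using center_exponent assms(1) by (auto simp: noncentral_E_def)
qed

lemma cent_no_p: "noncentral_E e ==> noncentral_p x ==> x \<notin> centralizer G e"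
  using cyclic_exponent_p_central[OF cyc_cent z_cent] by (auto simp: noncentral_E_def noncentral_p_def)

text \<open>
  The element u and its conjugate by d commute, so the commutator of d and u has order dividing q. It also lies in
  the p-group D.
\<close>
lemma coprime_commute_normal:
  assumes M: "subgroup M G" "M \<noteq> carrier G" "z \<in> M" and D: "subgroup D G" "D \<subseteq> M" "M \<subseteq> normset G D" "card D = p ^ k"
    and u: "u \<in> M" "u [^] q = \<one>" "prime (q::nat)" "q \<noteq> p" and d: "d \<in> D"
  shows "d \<otimes> u = u \<otimes> d"
proof (cases "u = \<one>")
  case True then show ?thesis using subgroup.mem_carrier[OF D(1) d] by simp
next
  case False
  have uc: "u \<in> carrier G" using subgroup.mem_carrier[OF M(1) u(1)] .
  have dc: "d \<in> carrier G" using subgroup.mem_carrier[OF D(1) d] .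
  have up: "u [^] p \<noteq> \<one>" using coprime_noncentral_E[OF uc False u(2-4)] by (simp add: noncentral_E_def)
  define c where "c = conj_el G d u"
  have cc: "c \<in> carrier G" using uc dc by (simp add: c_def)
  have cM: "c \<in> M" unfolding c_def using conj_in_subgroup[OF M(1) _ u(1)] D(2) d by blast
  have "c [^] p \<noteq> \<one>" unfolding c_def using conj_pow_one_iff[OF dc uc] up by simp
  then have cu: "c \<otimes> u = u \<otimes> c" using proper_comm[OF M cM u(1) _ up] by simp
  have iu: "inv u \<in> carrier G" using uc by simp
  have ciu: "c \<otimes> inv u = inv u \<otimes> c" using comm_inv[OF uc cc cu[symmetric]] by simp
  define v where "v = c \<otimes> inv u"
  have vc: "v \<in> carrier G" using cc iu by (simp add: v_def)
  have "v = d \<otimes> conj_el G u (inv d)" unfolding v_def c_def conj_el_def using uc dc by (simp add: m_assoc)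
  moreover have "conj_el G u (inv d) \<in> D" using D(3) u(1) subgroup.m_inv_closed[OF D(1) d] by (auto simp: normset_def)
  ultimately have "v \<in> D" using subgroup.m_closed[OF D(1) d] by simp
  then have v1: "v [^] (p ^ k) = \<one>" using pow_card_subgroup[OF D(1)] D(4) by metis
  have "c [^] q = \<one>" unfolding c_def using conj_pow_one_iff[OF dc uc] u(2) by simp
  then have "v [^] q = \<one>" unfolding v_def using pow_mult_distrib[OF ciu cc iu, of q] u(2) uc by (simp add: nat_pow_inv)
  moreover have "coprime q (p ^ k)" using primes_coprime[OF u(3) p u(4)] by simp
  ultimately have "v = \<one>" using coprime_pow_one[OF vc _ v1] by blast
  then have "c = u" unfolding v_def using cc uc by (metis inv_equality inv_inv iu)
  then show ?thesis unfolding c_def using conj_eq_self[OF dc uc] by simp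
qed

text \<open>
  An element u of prime order q \<noteq> p in M would commute with x, so that x would lie in the cyclic
  centralizer of u.
\<close>
lemma local_pgroup:
  assumes M: "subgroup M G" "M \<noteq> carrier G" "z \<in> M" and D: "subgroup D G" "D \<subseteq> M" "M \<subseteq> normset G D" "card D = p ^ k"
    and x: "x \<in> D" "noncentral_p x"
  shows "\<exists>j. card M = p ^ j"
proof (rule prime_power_if[OF _ p])
  show "card M \<noteq> 0" using finite_subgroup[OF M(1)] M(3) by auto
  fix q assume q: "prime q" "q dvd card M"
  show "q = p"
  proof (rule ccontr)
    assume qp: "q \<noteq> p"
    obtain u where u: "u \<in> M" "u \<noteq> \<one>" "u [^] q = \<one>" using cauchy[OF M(1) q] by blast
    have uc: "u \<in> carrier G" using subgroup.mem_carrier[OF M(1) u(1)] .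
    have "x \<otimes> u = u \<otimes> x" by (rule coprime_commute_normal[OF M D u(1,3) q(1) qp x(1)])
    then have "x \<in> centralizer G u" using x(2) by (simp add: centralizer_def noncentral_p_def)
    then show False using cent_no_p[OF coprime_noncentral_E[OF uc u(2,3) q(1) qp] x(2)] by simp
  qed
qed

text \<open>
  After adding z to it, the normal p-subgroup P has a complement of prime order q, since every proper subgroup
  that contains P is a p-group. It has exponent p: an element y with y^p \<noteq> 1 commutes with its conjugates,
  and its centralizer would be normal.
\<close>
lemma normal_pgroup_case:
  assumes Q: "subgroup Q G" "card Q = p ^ k" "normset G Q = carrier G" "x \<in> Q" "noncentral_p x"
  shows "\<exists>q \<alpha>. prime (q::nat) \<and> q \<noteq> p \<and> \<alpha> > 0 \<and> quasi_frobenius_group G \<and> minimal_frobenius_group qc \<and>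
    Coset.order qc = p ^ \<alpha> * q \<and> (\<exists>K. frobenius_kernel qc K \<and> card K = p ^ \<alpha>) \<and>
    G\<lparr>carrier := group_center G\<rparr> \<cong> cyc p \<and> (\<forall>S. sylow_subgroup p G S --> group_exponent (G\<lparr>carrier := S\<rparr>) = p)"
proof -
  have "\<exists>P k. subgroup P G \<and> card P = p ^ k \<and> normset G P = carrier G \<and> x \<in> P \<and> z \<in> P"
  proof (cases "z \<in> Q")
    case True then show ?thesis using Q by blast
  next
    case False
    have zn: "z \<in> normset G Q" using Q(3) zc by simp
    note sE = subgroup_ext[OF Q(1) zn]
    have "card (ext G Q z) = p ^ Suc k" using card_ext[OF Q(1) zc False _ p] z(3) subgroup.one_closed[OF Q(1)] Q(2) by simp
    moreover have "g \<in> normset G (ext G Q z)" if g: "g \<in> carrier G" for g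
    proof -
      have "conj_el G g h \<in> ext G Q z" if h: "h \<in> ext G Q z" for h
      proof -
        obtain n and l :: nat where nl: "n \<in> Q" "h = n \<otimes> z [^] l" using h unfolding ext_def by blast
        have nc: "n \<in> carrier G" using subgroup.mem_carrier[OF Q(1) nl(1)] .
        have "conj_el G g (z [^] l) = z [^] l"
          using conj_eq_self[OF g, of "z [^] l"] center_comm[OF pow_in_subgroup[OF subgroup_center z(1), of l] g] zc by simp
        then have "conj_el G g h = conj_el G g n \<otimes> z [^] l" unfolding nl(2) using conj_mult[OF g nc, of "z [^] l"] zc by simp
        moreover have "conj_el G g n \<in> Q" using Q(3) g nl(1) by (auto simp: normset_def)
        ultimately show ?thesis unfolding ext_def by blast
      qed
      then show ?thesis using g by (simp add: normset_def)
    qed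
    then have "normset G (ext G Q z) = carrier G" by (auto simp: normset_def)
    ultimately show ?thesis using sE ext_incl[OF Q(1) zc] Q(4) by blast
  qed
  then obtain P k where P: "subgroup P G" "card P = p ^ k" "normset G P = carrier G" "x \<in> P" "z \<in> P" by blast
  have Pc: "g \<in> P ==> g \<in> carrier G" for g using subgroup.mem_carrier[OF P(1)] .
  have Pne: "P \<noteq> carrier G" using P(2) not_pgroup by auto
  have ZP: "group_center G \<subseteq> P" unfolding center_generate(1) by (rule generate_single_incl[OF P(1,5)])
  obtain q where q: "prime q" "q \<noteq> p" "q dvd card (carrier G)" using mixed by blast
  obtain u where u: "u \<in> carrier G" "u \<noteq> \<one>" "u [^] q = \<one>" using cauchy[OF subgroup_self q(1,3)] by blast
  have uE: "noncentral_E u" by (rule coprime_noncentral_E[OF u q(1,2)])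
  have exP: "y [^] p = \<one>" if y: "y \<in> P" for y
  proof (rule ccontr)
    assume yp: "y [^] p \<noteq> \<one>"
    have yE: "noncentral_E y" using yp Pc[OF y] center_exponent by (auto simp: noncentral_E_def)
    have "g \<in> normset G (centralizer G y)" if g: "g \<in> carrier G" for g
    proof (rule cent_ti[OF yE self_centralizer[OF Pc[OF y]] _ g])
      show "y \<notin> group_center G" using yE by (simp add: noncentral_E_def)
      have gy: "conj_el G g y \<in> P" using P(3) g y by (auto simp: normset_def)
      have "conj_el G g y [^] p \<noteq> \<one>" using conj_pow_one_iff[OF g Pc[OF y]] yp by simp
      then have "conj_el G g y \<otimes> y = y \<otimes> conj_el G g y" using proper_comm[OF P(1) Pne P(5) gy y _ yp] by simp
      then show "conj_el G g y \<in> centralizer G y" using Pc[OF gy] by (simp add: centralizer_def)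
    qed
    then have "normset G (centralizer G y) = carrier G" by (auto simp: normset_def)
    then show False using nonnormal[OF yE] by simp
  qed
  have full: "carrier G = ext G P v" if v: "v \<in> carrier G" "v \<noteq> \<one>" "v [^] q = \<one>" for v
  proof (rule ccontr)
    assume ne: "carrier G \<noteq> ext G P v"
    have vn: "v \<in> normset G P" using v P(3) by simp
    note sE = subgroup_ext[OF P(1) vn]
    note i = ext_incl[OF P(1) v(1)]
    have "ext G P v \<subseteq> normset G P" using subgroup.subset[OF sE] P(3) by simp
    then obtain j where j: "card (ext G P v) = p ^ j"
      using local_pgroup[OF sE ne[symmetric] _ P(1) i(1) _ P(2,4) Q(5)] i(1) P(5) by blast
    have "v [^] (p ^ j) = \<one>" using pow_card_subgroup[OF sE i(2)] j by simp
    moreover have "coprime q (p ^ j)" using primes_coprime[OF q(1) p q(2)] by simp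
    ultimately show False using coprime_pow_one[OF v(1,3)] v(2) by blast
  qed
  have notP: "v \<notin> P" if v: "v \<in> carrier G" "v \<noteq> \<one>" "v [^] q = \<one>" for v
    using exP coprime_noncentral_E[OF v q(1,2)] by (auto simp: noncentral_E_def)
  have cG: "card (carrier G) = p ^ k * q"
    using card_ext[OF P(1) u(1) notP[OF u] _ q(1)] full[OF u] u(3) subgroup.one_closed[OF P(1)] P(2) by simp
  have "k \<ge> 2"
  proof (rule ccontr)
    assume "\<not> k \<ge> 2"
    then have "k = 0 \<or> k = 1" by linarith
    then have "card P \<le> card (group_center G)" unfolding P(2) center_generate(2)
      using prime_gt_0_nat[OF p] by auto
    then have "group_center G = P" using card_seteq[OF finite_subgroup[OF P(1)] ZP] by simp
    then show False using P(4) Q(5) by (simp add: noncentral_p_def)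
  qed
  define \<alpha> where "\<alpha> = k - 1"
  have \<alpha>: "k = \<alpha> + 1" "\<alpha> > 0" using \<open>k \<ge> 2\<close> by (simp_all add: \<alpha>_def)
  have sub: "H \<subseteq> P \<or> card H = p * q" if H: "subgroup H G" "group_center G \<subseteq> H" "H \<noteq> carrier G" for H
  proof (rule disjCI)
    assume "card H \<noteq> p * q"
    show "H \<subseteq> P"
    proof (rule ccontr)
      assume "\<not> H \<subseteq> P"
      then obtain h where h: "h \<in> H" "h \<notin> P" by blast
      have hc: "h \<in> carrier G" using subgroup.mem_carrier[OF H(1) h(1)] .
      obtain r l :: nat where r: "prime r" "h [^] l \<notin> P" "(h [^] l) [^] r \<in> P" using prime_power_outside[OF P(1) hc h(2)] .
      have hl: "h [^] l \<in> carrier G" using hc by simp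
      have "h [^] l \<in> normset G P" using hl P(3) by simp
      from subgroup_card_dvd[OF subgroup_ext[OF P(1) this] subgroup_self subgroup.subset[OF subgroup_ext[OF P(1) this]]]
      have "p ^ k * r dvd p ^ k * q" using card_ext[OF P(1) hl r(2,3,1)] cG P(2) by simp
      then have "r dvd q" using prime_gt_0_nat[OF p] by simp
      then have rq: "r = q" by (rule primes_dvd_imp_eq[OF r(1) q(1)])
      obtain l' i :: nat where l': "(h [^] l) [^] l' \<notin> P" "((h [^] l) [^] l') [^] r \<in> P" "((h [^] l) [^] l') [^] (r ^ i) = \<one>"
        using prime_power_outside'[OF P(1) hl r(2,3,1)] .
      define v where "v = (h [^] l) [^] l'"
      have vH: "v \<in> H" unfolding v_def by (intro pow_in_subgroup[OF H(1)] h(1))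
      have vc: "v \<in> carrier G" using subgroup.mem_carrier[OF H(1) vH] .
      have vP: "v \<notin> P" using l'(1) by (simp add: v_def)
      have v1: "v \<noteq> \<one>" using vP subgroup.one_closed[OF P(1)] by auto
      have vqc: "v [^] q \<in> carrier G" using vc by simp
      have "(v [^] q) [^] p = \<one>" using exP l'(2) rq by (simp add: v_def)
      moreover have "(v [^] q) [^] (q ^ i) = \<one>"
      proof -
        have "(v [^] q) [^] (q ^ i) = (v [^] (q ^ i)) [^] q" using vc by (simp add: nat_pow_pow mult.commute)
        then show ?thesis using l'(3) rq by (simp add: v_def)
      qed
      moreover have "coprime p (q ^ i)" using primes_coprime[OF p q(1)] q(2) by simp
      ultimately have vq: "v [^] q = \<one>" using coprime_pow_one[OF vqc] by blast
      have zH: "z \<in> H" using H(2) z(1) by blast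
      have sI: "subgroup (H \<inter> P) G" by (rule subgroups_Inter_pair[OF H(1) P(1)])
      obtain j where j: "card (H \<inter> P) = p ^ j"
        using subgroup_card_dvd[OF sI P(1)] P(2) divides_primepow_nat[OF p] by auto
      have HN: "H \<subseteq> normset G (H \<inter> P)"
      proof
        fix g assume g: "g \<in> H"
        have gc: "g \<in> carrier G" using subgroup.mem_carrier[OF H(1) g] .
        have "conj_el G g d \<in> H \<inter> P" if "d \<in> H \<inter> P" for d
          using conj_in_subgroup[OF H(1) g] P(3) gc that by (auto simp: normset_def)
        then show "g \<in> normset G (H \<inter> P)" using gc by (simp add: normset_def)
      qed
      have vE: "noncentral_E v" by (rule coprime_noncentral_E[OF vc v1 vq q(1,2)])
      have "d \<in> group_center G" if d: "d \<in> H \<inter> P" for d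
      proof -
        have dc: "d \<in> carrier G" "d [^] p = \<one>" using Pc exP d by simp_all
        have "d \<otimes> v = v \<otimes> d"
          by (rule coprime_commute_normal[OF H(1,3) zH sI _ HN j vH vq q(1,2) d]) simp
        then have "d \<in> centralizer G v" using dc by (simp add: centralizer_def)
        then show ?thesis using cent_no_p[OF vE, of d] dc by (auto simp: noncentral_p_def)
      qed
      then have HP: "H \<inter> P = group_center G" using H(2) ZP by blast
      have vZ: "v \<notin> group_center G" using vE by (simp add: noncentral_E_def)
      have "H \<subseteq> ext G (group_center G) v"
      proof
        fix g assume g: "g \<in> H"
        have "g \<in> ext G P v" using full[OF vc v1 vq] subgroup.mem_carrier[OF H(1) g] by simp
        then obtain n and b :: nat where nb: "n \<in> P" "g = n \<otimes> v [^] b" unfolding ext_def by blast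
        have vb: "v [^] b \<in> H" by (rule pow_in_subgroup[OF H(1) vH])
        have "n = g \<otimes> inv (v [^] b)" using nb Pc vc by (simp add: m_assoc)
        then have "n \<in> H" using subgroup.m_closed[OF H(1) g subgroup.m_inv_closed[OF H(1) vb]] by simp
        then have "n \<in> group_center G" using HP nb(1) by blast
        then show "g \<in> ext G (group_center G) v" using nb(2) unfolding ext_def by blast
      qed
      then have "H = ext G (group_center G) v" using ext_least[OF H(1,2) vH] by blast
      then have "card H = p * q"
        using card_ext[OF subgroup_center vc vZ _ q(1)] vq subgroup.one_closed[OF subgroup_center] center_generate(2) by simp
      then show False using \<open>card H \<noteq> p * q\<close> by simp
    qed
  qed
  have cent: "y \<in> group_center G" if y: "y \<in> P" "y \<otimes> u = u \<otimes> y" for y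
  proof -
    have "y \<in> centralizer G u" using y Pc by (simp add: centralizer_def)
    then show ?thesis using cent_no_p[OF uE, of y] Pc exP y(1) by (auto simp: noncentral_p_def)
  qed
  have nP: "g \<in> normset G P" if "g \<in> carrier G" for g using P(3) that by simp
  have cP: "card P = p ^ (\<alpha> + 1)" using P(2) \<alpha>(1) by simp
  note main = case7_forward[OF p q(1) q(2)[symmetric] center_generate(2,1) zc P(1) ZP cP \<alpha>(2)]
  have R: "quasi_frobenius_group G \<and> minimal_frobenius_group qc \<and> Coset.order qc = p ^ \<alpha> * q \<and>
    (\<exists>K. frobenius_kernel qc K \<and> card K = p ^ \<alpha>) \<and> G\<lparr>carrier := group_center G\<rparr> \<cong> cyc p \<and>
    (\<forall>S. sylow_subgroup p G S --> group_exponent (G\<lparr>carrier := S\<rparr>) = p)"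
    by (rule main, erule exP, erule nP, rule u(1), rule u(3), rule notP[OF u], rule full[OF u], erule (1) cent, erule (2) sub)
  show ?thesis by (rule exI[of _ q], rule exI[of _ \<alpha>], rule conjI[OF q(1) conjI[OF q(2) conjI[OF \<alpha>(2) R]]])
qed

end

section \<open>Counting conjugacy classes\<close>

context min_PF_count begin

text \<open>
  The elements of the normalizer outside the cyclic group A have order p. Some t \<in> A with centralizer A has at
  most p conjugates: if t has prime order q \<noteq> p, these are powers of t with exponents solving k^p = 1
  modulo q; if A is a p-group and t has order p^2, they lie in t \<langle>z\<rangle>.
\<close>
lemma card_cent_normalizer:
  assumes e: "noncentral_E e"
  shows "card (normset G (centralizer G e)) = card (centralizer G e) \<or>
    card (normset G (centralizer G e)) = card (centralizer G e) * p"
proof -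
  let ?A = "centralizer G e" and ?M = "normset G (centralizer G e)"
  have ec: "e \<in> carrier G" "e [^] p \<noteq> \<one>" "e \<notin> group_center G" using e by (simp_all add: noncentral_E_def)
  have sA: "subgroup ?A G" by (rule subgroup_centralizer[OF ec(1)])
  have sM: "subgroup ?M G" by (rule subgroup_normset[OF sA])
  have AM: "?A \<subseteq> ?M" by (rule subgroup_le_normset[OF sA])
  have cycA: "cyclic_subset G ?A" by (rule cyc_cent[OF e])
  have zA: "z \<in> ?A" by (rule z_cent[OF ec(1)])
  have Ac: "a \<in> carrier G" if "a \<in> ?A" for a using that by (simp add: centralizer_def)
  have Mc: "v \<in> carrier G" if "v \<in> ?M" for v using that by (simp add: normset_def)
  have MA: "conj_el G v a \<in> ?A" if "v \<in> ?M" "a \<in> ?A" for v a using that by (simp add: normset_def)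
  have out: "v [^] p \<in> ?A" if v: "v \<in> ?M" for v
  proof (cases "v \<in> ?A")
    case True then show ?thesis by (rule pow_in_subgroup[OF sA])
  next
    case False
    then show ?thesis using cent_normalizer_outside[OF e nonnormal[OF e] v] subgroup.one_closed[OF sA] by simp
  qed
  have "\<exists>t B. t \<in> ?A \<and> t \<notin> group_center G \<and> finite B \<and> card B \<le> p \<and> (\<forall>v\<in>?M. conj_el G v t \<in> B)"
  proof (cases "\<exists>q. prime q \<and> q dvd card ?A \<and> q \<noteq> p")
    case True
    then obtain q where q: "prime q" "q dvd card ?A" "q \<noteq> p" by blast
    obtain w where w: "w \<in> ?A" "w \<noteq> \<one>" "w [^] q = \<one>" using cauchy[OF sA q(1,2)] by blast
    have wc: "w \<in> carrier G" using Ac[OF w(1)] .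
    have ow: "ord w = q" by (rule ord_prime[OF wc w(2,3) q(1)])
    have wZ: "w \<notin> group_center G" using coprime_noncentral_E[OF wc w(2,3) q(1,3)] by (simp add: noncentral_E_def)
    define B where "B = (\<lambda>k. w [^] k) ` {k \<in> {..<q}. [k ^ p = 1] (mod q)}"
    have "card B \<le> card {k \<in> {..<q}. [k ^ p = 1] (mod q)}" unfolding B_def by (rule card_image_le) simp
    also have "\<dots> \<le> p" by (rule roots_mod_prime_bound[OF q(1) prime_gt_0_nat[OF p]])
    finally have cB: "card B \<le> p" .
    have "conj_el G v w \<in> B" if v: "v \<in> ?M" for v
    proof -
      have "v \<in> normset G (generate G {w})" by (rule cyclic_normset[OF cycA v w(1)])
      then have "conj_el G v w \<in> generate G {w}" using in_generate1 by (simp add: normset_def)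
      then obtain k0 :: nat where "conj_el G v w = w [^] k0" using generate_single_iff[OF wc] by blast
      then have k: "conj_el G v w = w [^] (k0 mod q)" using nat_pow_mod[OF wc w(3)] by simp
      have "v [^] p \<otimes> w = w \<otimes> v [^] p" by (rule cyclic_comm[OF cycA out[OF v] w(1)])
      then have "conj_el G (v [^] p) w = w" using conj_eq_self[of "v [^] p" w] Mc[OF v] wc by simp
      then have "w [^] ((k0 mod q) ^ p) = w [^] (1::nat)" using conj_pow_left[OF Mc[OF v] wc k, of p] wc by simp
      then have "[(k0 mod q) ^ p = 1] (mod q)" using pow_eq_cong[OF wc] ow by metis
      moreover have "k0 mod q < q" using prime_gt_0_nat[OF q(1)] by simp
      ultimately show ?thesis unfolding B_def k by blast
    qed
    moreover have "finite B" unfolding B_def by simp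
    ultimately show ?thesis using w(1) wZ cB by blast
  next
    case False
    have c0: "card ?A \<noteq> 0" using finite_subgroup[OF sA] zA by auto
    obtain j where j: "card ?A = p ^ j" using prime_power_if[OF c0 p] False by blast
    have "e [^] (p ^ j) = \<one>" using pow_card_subgroup[OF sA self_centralizer[OF ec(1)]] j by simp
    then obtain k :: nat where k: "(e [^] k) [^] p \<noteq> \<one>" "(e [^] k) [^] (p ^ 2) = \<one>"
      using power_of_order_prime_square[OF p ec(1,2)] by blast
    define t where "t = e [^] k"
    have tA: "t \<in> ?A" unfolding t_def by (rule pow_in_subgroup[OF sA self_centralizer[OF ec(1)]])
    have tc: "t \<in> carrier G" using Ac[OF tA] .
    have tZ: "t \<notin> group_center G" using center_exponent k(1) t_def by blast
    have tpA: "t [^] p \<in> ?A" by (rule pow_in_subgroup[OF sA tA])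
    have "(t [^] p) [^] p = \<one>" using k(2) tc by (simp add: t_def[symmetric] nat_pow_pow power2_eq_square)
    then have tpZ: "t [^] p \<in> group_center G" by (rule cyclic_exponent_p_central[OF cycA zA tpA])
    define B where "B = (\<lambda>c. c \<otimes> t) ` group_center G"
    have fZ: "finite (group_center G)" by (rule finite_subgroup[OF subgroup_center])
    have cB: "card B \<le> p" unfolding B_def using card_image_le[OF fZ] center_generate(2) by metis
    have "conj_el G v t \<in> B" if v: "v \<in> ?M" for v
    proof -
      obtain c where cA: "c \<in> ?A" and ct: "conj_el G v t = c \<otimes> t" using commutator_obtain[OF sA v tA] .
      have cc: "c \<in> carrier G" using Ac[OF cA] .
      have tpc: "t [^] p \<in> carrier G" using tc by simp
      have "v \<otimes> t [^] p = t [^] p \<otimes> v" using center_comm[OF tpZ Mc[OF v]] by simp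
      then have "conj_el G v (t [^] p) = t [^] p" using conj_eq_self[OF Mc[OF v] tpc] by simp
      then have "(c \<otimes> t) [^] p = t [^] p" using conj_pow[OF Mc[OF v] tc, of p] ct by simp
      then have "c [^] p \<otimes> t [^] p = t [^] p" using pow_mult_distrib[OF cyclic_comm[OF cycA cA tA] cc tc, of p] by simp
      then have "c [^] p = \<one>" using cc tc by simp
      then have "c \<in> group_center G" by (rule cyclic_exponent_p_central[OF cycA zA cA])
      then show ?thesis unfolding B_def ct by blast
    qed
    moreover have "finite B" unfolding B_def using fZ by simp
    ultimately show ?thesis using tA tZ cB by blast
  qed
  then obtain t B where t: "t \<in> ?A" "t \<notin> group_center G" "finite B" "card B \<le> p" "\<And>v. v \<in> ?M ==> conj_el G v t \<in> B" by blast
  have tc: "t \<in> carrier G" using Ac[OF t(1)] .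
  have "card (\<Union>g\<in>?M. conj_el G g ` {t}) * card ?A = card ?M * card {t}"
  proof (rule card_conj_union[OF sM sA AM])
    show "{t} \<subseteq> carrier G" using tc by simp
    show "conj_el G g s \<in> {t}" if g: "g \<in> ?A" "s \<in> {t}" for g s
      using cyclic_comm[OF cycA g(1) t(1)] conj_eq_self[OF Ac[OF g(1)] tc] g(2) by simp
    show "g \<in> ?A" if g: "g \<in> ?M" "s \<in> {t}" "conj_el G g s \<in> {t}" for g s
    proof -
      have "g \<otimes> t = t \<otimes> g" using conj_eq_self[OF Mc[OF g(1)] tc] g by simp
      then have "g \<in> centralizer G t" using Mc[OF g(1)] by (simp add: centralizer_def)
      then show ?thesis using cent_eq(2)[OF e t(1,2)] by simp
    qed
  qed
  moreover have "card (\<Union>g\<in>?M. conj_el G g ` {t}) \<le> p"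
  proof -
    have "(\<Union>g\<in>?M. conj_el G g ` {t}) \<subseteq> B" using t(5) by blast
    then show ?thesis using card_mono[OF t(3)] t(4) le_trans by blast
  qed
  ultimately have le: "card ?M \<le> p * card ?A" using mult_le_mono1 by (metis card_1_singleton_iff mult.right_neutral One_nat_def)
  show ?thesis
  proof (cases "?M = ?A")
    case True then show ?thesis by simp
  next
    case False
    then obtain v where v: "v \<in> ?M" "v \<notin> ?A" using AM by blast
    have "card (ext G ?A v) = card ?A * p" by (rule card_ext[OF sA Mc[OF v(1)] v(2) out[OF v(1)] p])
    moreover have "ext G ?A v \<subseteq> ?M" by (rule ext_least[OF sM AM v(1)])
    ultimately have "card ?A * p \<le> card ?M" using card_mono[OF finite_subgroup[OF sM]] by metis
    then show ?thesis using le by (simp add: mult.commute)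
  qed
qed

definition max_p where
  "max_p P x \<longleftrightarrow> subgroup P G \<and> (\<exists>k. card P = p ^ k) \<and> x \<in> P \<and>
    (\<forall>D k. subgroup D G --> card D = p ^ k --> x \<in> D --> D \<subseteq> P)"

end

locale min_PF_no_normal_p = min_PF_count +
  assumes no_normal_p: "\<And>D k x. subgroup D G ==> card D = p ^ k ==> x \<in> D ==> noncentral_p x ==> normset G D \<noteq> carrier G"
begin

lemma normalizer_pgroup:
  assumes D: "subgroup D G" "card D = p ^ k" and x: "x \<in> D" "noncentral_p x"
  shows "\<exists>j. card (normset G D) = p ^ j"
  using local_pgroup[OF subgroup_normset[OF D(1)] no_normal_p[OF D x] center_normset[OF z(1) D(1)] D(1)
      subgroup_le_normset[OF D(1)] subset_refl D(2) x] .

text \<open>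
  Let P be maximal among the p-subgroups containing x, and choose another one E not contained in P with largest
  intersection. The normalizer of the intersection is a p-group that meets P in a larger subgroup and contains
  elements of E outside P.
\<close>
lemma max_p_exists:
  assumes x: "noncentral_p x" shows "\<exists>P. max_p P x"
proof -
  have xc: "x \<in> carrier G" "x [^] p = \<one>" using x by (simp_all add: noncentral_p_def)
  have x1: "x \<noteq> \<one>" using x subgroup.one_closed[OF subgroup_center] by (auto simp: noncentral_p_def)
  define S where "S = {D. subgroup D G \<and> (\<exists>k. card D = p ^ k) \<and> x \<in> D}"
  have "S \<subseteq> Pow (carrier G)" unfolding S_def using subgroup.subset by blast
  then have fS: "finite S" using fin finite_subset by blast
  have "card (generate G {x}) = p ^ 1" using generate_pow_card[OF xc(1)] ord_prime[OF xc(1) x1 xc(2) p] by simp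
  then have "generate G {x} \<in> S" unfolding S_def using subgroup_generate1[OF xc(1)] in_generate1 by blast
  then have "S \<noteq> {}" by blast
  with fS have "\<exists>P\<in>S. \<forall>D\<in>S. P \<le> D --> P = D" by (rule finite_has_maximal)
  then obtain P where P: "P \<in> S" "\<forall>D\<in>S. P \<le> D --> P = D" ..
  obtain kP where P1: "subgroup P G" "card P = p ^ kP" "x \<in> P" using P(1) unfolding S_def by blast
  have all: "D \<subseteq> P" if DS: "D \<in> S" for D
  proof (rule ccontr)
    assume nD: "\<not> D \<subseteq> P"
    define B where "B = {D \<in> S. \<not> D \<subseteq> P}"
    have fB: "finite B" "B \<noteq> {}" using fS DS nD by (auto simp: B_def)
    define m where "m = Max ((\<lambda>D. card (D \<inter> P)) ` B)"
    have "m \<in> (\<lambda>D. card (D \<inter> P)) ` B" unfolding m_def using fB by (intro Max_in) auto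
    then obtain E where E: "E \<in> B" "card (E \<inter> P) = m" by blast
    have mx: "card (F \<inter> P) \<le> card (E \<inter> P)" if "F \<in> B" for F
      unfolding E(2) m_def using fB(1) that by (intro Max_ge) auto
    have "E \<in> S" "\<not> E \<subseteq> P" using E(1) unfolding B_def by blast+
    then obtain kE where E1: "subgroup E G" "card E = p ^ kE" "x \<in> E" "\<not> E \<subseteq> P" unfolding S_def by blast
    let ?I = "E \<inter> P"
    have sI: "subgroup ?I G" by (rule subgroups_Inter_pair[OF E1(1) P1(1)])
    obtain kI where kI: "card ?I = p ^ kI"
      using subgroup_card_dvd[OF sI P1(1)] P1(2) divides_primepow_nat[OF p] by auto
    have neE: "?I \<noteq> E" using E1(4) by blast
    have neP: "?I \<noteq> P"
    proof
      assume "?I = P"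
      then have "P \<le> E" by blast
      then have "P = E" using P(2) \<open>E \<in> S\<close> by blast
      then show False using E1(4) by blast
    qed
    obtain d where d: "d \<in> E" "d \<notin> ?I" "d \<in> normset G ?I"
      using pgroup_normalizer_grows[OF E1(1,2) p sI _ neE] by blast
    obtain b where b: "b \<in> P" "b \<notin> ?I" "b \<in> normset G ?I"
      using pgroup_normalizer_grows[OF P1(1,2) p sI _ neP] by blast
    let ?M = "normset G ?I"
    have xI: "x \<in> ?I" using E1(3) P1(3) by blast
    have sM: "subgroup ?M G" by (rule subgroup_normset[OF sI])
    have IM: "?I \<subseteq> ?M" by (rule subgroup_le_normset[OF sI])
    have MS: "?M \<in> S" unfolding S_def using sM normalizer_pgroup[OF sI kI xI x] IM xI by blast
    show False
    proof (cases "?M \<subseteq> P")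
      case True then show False using d by blast
    next
      case False
      then have "?M \<in> B" unfolding B_def using MS by blast
      from mx[OF this] have "card (?M \<inter> P) \<le> card ?I" .
      moreover have "?I \<subset> ?M \<inter> P" using IM b by blast
      then have "card ?I < card (?M \<inter> P)"
        by (rule psubset_card_mono[OF finite_subgroup[OF subgroups_Inter_pair[OF sM P1(1)]]])
      ultimately show False by simp
    qed
  qed
  show ?thesis unfolding max_p_def using P1 all unfolding S_def by blast
qed

lemma max_pD:
  assumes "max_p P x"
  shows "subgroup P G" "\<exists>k. card P = p ^ k" "x \<in> P"
    "\<And>D k. subgroup D G ==> card D = p ^ k ==> x \<in> D ==> D \<subseteq> P"
  using assms by (auto simp: max_p_def)

lemma max_p_normalizer:
  assumes "max_p P x" "noncentral_p x" shows "normset G P = P"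
proof -
  note P = max_pD[OF assms(1)]
  obtain k where k: "card P = p ^ k" using P(2) by blast
  obtain j where j: "card (normset G P) = p ^ j" using normalizer_pgroup[OF P(1) k P(3) assms(2)] by blast
  have "x \<in> normset G P" using subgroup_le_normset[OF P(1)] P(3) by blast
  then show ?thesis using P(4)[OF subgroup_normset[OF P(1)] j] subgroup_le_normset[OF P(1)] by blast
qed

lemma max_p_transfer:
  assumes P: "max_p P x" "noncentral_p x" and y: "y \<in> P" "noncentral_p y" shows "max_p P y"
proof -
  obtain R where R: "max_p R y" using max_p_exists[OF y(2)] by blast
  note P' = max_pD[OF P(1)]
  note R' = max_pD[OF R]
  obtain k where k: "card P = p ^ k" using P'(2) by blast
  obtain j where j: "card R = p ^ j" using R'(2) by blast
  have PR: "P \<subseteq> R" by (rule R'(4)[OF P'(1) k y(1)])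
  then have "R \<subseteq> P" using P'(4)[OF R'(1) j] P'(3) by blast
  then show ?thesis using PR R by simp
qed

definition p_class where "p_class P = (\<Union>g\<in>carrier G. conj_el G g ` {y \<in> P. noncentral_p y})"

lemma noncentral_p_conj: "g \<in> carrier G ==> noncentral_p y ==> noncentral_p (conj_el G g y)"
  using conj_center_iff[of g y] conj_pow_one_iff[of g y p] by (simp add: noncentral_p_def)

lemma conj_max_p:
  assumes P: "max_p P x" and y: "max_p R y" and g: "g \<in> carrier G" "h \<in> P" "conj_el G g h = y"
  shows "conj_el G g ` P \<subseteq> R"
proof -
  note P' = max_pD[OF P]
  obtain k where "card P = p ^ k" using P'(2) by blast
  then have "card (conj_el G g ` P) = p ^ k" using subgroup_conj(2)[OF P'(1) g(1)] by simp
  moreover have "y \<in> conj_el G g ` P" using g by blast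
  ultimately show ?thesis using max_pD(4)[OF y subgroup_conj(1)[OF P'(1) g(1)]] by blast
qed

lemma card_p_class:
  assumes P: "max_p P x" "noncentral_p x"
  shows "card (p_class P) * card P = card (carrier G) * card {y \<in> P. noncentral_p y}"
proof -
  note P' = max_pD[OF P(1)]
  show ?thesis
    unfolding p_class_def
  proof (rule card_conj_union[OF subgroup_self P'(1) subgroup.subset[OF P'(1)]])
    show "{y \<in> P. noncentral_p y} \<subseteq> carrier G" using subgroup.subset[OF P'(1)] by blast
    fix g s assume s: "s \<in> {y \<in> P. noncentral_p y}"
    then have s': "s \<in> P" "noncentral_p s" by simp_all
    show "conj_el G g s \<in> {y \<in> P. noncentral_p y}" if g: "g \<in> P"
      using conj_in_subgroup[OF P'(1) g s'(1)] noncentral_p_conj[OF subgroup.mem_carrier[OF P'(1) g] s'(2)] by simp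
    show "g \<in> P" if g: "g \<in> carrier G" "conj_el G g s \<in> {y \<in> P. noncentral_p y}"
    proof -
      have g': "conj_el G g s \<in> P" "noncentral_p (conj_el G g s)" using g(2) by simp_all
      have "conj_el G g ` P \<subseteq> P" by (rule conj_max_p[OF P(1) max_p_transfer[OF P g'] g(1) s'(1) refl])
      then have "g \<in> normset G P" using g(1) by (auto simp: normset_def)
      then show ?thesis using max_p_normalizer[OF P] by simp
    qed
  qed
qed

text \<open>
  The elements of P that are central or have non-trivial p-th power form a subgroup Q: the centre if P has
  exponent p, and otherwise the intersection of P with a cyclic centralizer.
\<close>
lemma p_class_density:
  assumes P: "max_p P x" "noncentral_p x"
  shows "\<exists>i. i > 0 \<and> card (p_class P) * p ^ i = card (carrier G) * (p ^ i - 1)"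
proof -
  note P' = max_pD[OF P(1)]
  have Pc: "g \<in> P ==> g \<in> carrier G" for g using subgroup.mem_carrier[OF P'(1)] .
  have zP: "z \<in> P" using center_normset[OF z(1) P'(1)] max_p_normalizer[OF P] by simp
  have ZP: "group_center G \<subseteq> P" unfolding center_generate(1) by (rule generate_single_incl[OF P'(1) zP])
  obtain k where k: "card P = p ^ k" using P'(2) by blast
  have Pne: "P \<noteq> carrier G" using k not_pgroup by auto
  have "\<exists>Q. subgroup Q G \<and> Q \<subseteq> P \<and> x \<notin> Q \<and> {y \<in> P. noncentral_p y} = P - Q"
  proof (cases "\<exists>t\<in>P. t [^] p \<noteq> \<one>")
    case False
    then have "{y \<in> P. noncentral_p y} = P - group_center G" using Pc by (auto simp: noncentral_p_def)
    then show ?thesis using subgroup_center ZP P(2) by (intro exI[of _ "group_center G"]) (auto simp: noncentral_p_def)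
  next
    case True
    then obtain t where t: "t \<in> P" "t [^] p \<noteq> \<one>" by blast
    have tE: "noncentral_E t" using t Pc center_exponent by (auto simp: noncentral_E_def)
    have tc: "t \<in> carrier G" by (rule Pc[OF t(1)])
    have "noncentral_p y" if y: "y \<in> P" "y \<notin> centralizer G t" for y
    proof -
      have "y [^] p = \<one>"
      proof (rule ccontr)
        assume "y [^] p \<noteq> \<one>"
        then have "y \<otimes> t = t \<otimes> y" using proper_comm[OF P'(1) Pne zP y(1) t(1) _ t(2)] by simp
        then show False using y Pc by (simp add: centralizer_def)
      qed
      moreover have "y \<notin> group_center G" using center_le_centralizer[OF tc] y(2) by blast
      ultimately show ?thesis using Pc[OF y(1)] by (simp add: noncentral_p_def)
    qed
    then have "{y \<in> P. noncentral_p y} = P - (P \<inter> centralizer G t)" using cent_no_p[OF tE] by blast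
    moreover have "subgroup (P \<inter> centralizer G t) G" by (rule subgroups_Inter_pair[OF P'(1) subgroup_centralizer[OF tc]])
    moreover have "x \<notin> P \<inter> centralizer G t" using cent_no_p[OF tE P(2)] by blast
    ultimately show ?thesis by blast
  qed
  then obtain Q where Q: "subgroup Q G" "Q \<subseteq> P" "x \<notin> Q" "{y \<in> P. noncentral_p y} = P - Q" by blast
  obtain c where c: "card P = card Q * c" using subgroup_card_dvd[OF Q(1) P'(1) Q(2)] by blast
  then have "c dvd p ^ k" using k by (metis dvd_triv_right)
  then obtain i where i: "c = p ^ i" using divides_primepow_nat[OF p] by blast
  have "i \<noteq> 0"
  proof
    assume "i = 0"
    then have "card P \<le> card Q" using c i by simp
    then have "Q = P" by (rule card_seteq[OF finite_subgroup[OF P'(1)] Q(2)])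
    then show False using Q(3) P'(3) by simp
  qed
  moreover have "card {y \<in> P. noncentral_p y} = card Q * (c - 1)"
    unfolding Q(4) using card_Diff_subset[OF finite_subgroup[OF Q(1)] Q(2)] c by (simp add: diff_mult_distrib2)
  then have "(card (p_class P) * c) * card Q = (card (carrier G) * (c - 1)) * card Q"
    using card_p_class[OF P] c by (simp add: ac_simps)
  then have "card (p_class P) * c = card (carrier G) * (c - 1)"
    using finite_subgroup[OF Q(1)] subgroup.one_closed[OF Q(1)] by auto
  ultimately show ?thesis using i by blast
qed

lemma p_class_props: "y \<in> p_class P ==> noncentral_p y"
  unfolding p_class_def using noncentral_p_conj by blast

lemma finite_p_class: "finite (p_class P)"
proof -
  have "p_class P \<subseteq> carrier G" using p_class_props by (auto simp: noncentral_p_def)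
  then show ?thesis using fin finite_subset by blast
qed

lemma p_class_disjoint:
  assumes P: "max_p P x" "noncentral_p x" and R: "max_p R y" "noncentral_p y" and n: "y \<notin> p_class P"
  shows "p_class P \<inter> p_class R = {}"
proof (rule ccontr)
  assume "p_class P \<inter> p_class R \<noteq> {}"
  then obtain v where v: "v \<in> p_class P" "v \<in> p_class R" by blast
  obtain g a where g: "g \<in> carrier G" "a \<in> P" "noncentral_p a" "v = conj_el G g a" using v(1) by (auto simp: p_class_def)
  obtain h b where h: "h \<in> carrier G" "b \<in> R" "noncentral_p b" "v = conj_el G h b" using v(2) by (auto simp: p_class_def)
  have c: "a \<in> carrier G" "b \<in> carrier G" "y \<in> carrier G" using g h R(2) by (simp_all add: noncentral_p_def)
  let ?k = "inv g \<otimes> h"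
  have k: "?k \<in> carrier G" using g h by simp
  have "conj_el G ?k b = conj_el G (inv g) v" using conj_mult_left[of "inv g" h b] g(1) h c by simp
  then have kb: "conj_el G ?k b = a" using conj_inv_left[OF g(1) c(1)] g(4) by simp
  have "conj_el G ?k ` R \<subseteq> P" by (rule conj_max_p[OF R(1) max_p_transfer[OF P g(2,3)] k h(2) kb])
  then have "conj_el G ?k y \<in> {y \<in> P. noncentral_p y}" using max_pD(3)[OF R(1)] noncentral_p_conj[OF k R(2)] by blast
  then have "conj_el G (inv ?k) (conj_el G ?k y) \<in> p_class P" using k unfolding p_class_def by blast
  then show False using conj_inv_left[OF k c(3)] n by simp
qed

lemma cent_class_ge:
  assumes e: "noncentral_E e" shows "card (carrier G) \<le> 2 * p * card (cent_class e)"
proof -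
  let ?n = "card (carrier G)" and ?a = "card (centralizer G e)" and ?U = "card (cent_class e)" and ?M = "card (normset G (centralizer G e))"
  have ge: "2 * p \<le> ?a" using card_cent_ge[OF e] center_generate(2) by simp
  have a0: "0 < ?a" using ge prime_gt_0_nat[OF p] by simp
  have "?M \<le> ?a * p" using card_cent_normalizer[OF e] prime_gt_0_nat[OF p] by auto
  then have "?U * ?M \<le> ?U * (?a * p)" by (rule mult_le_mono2)
  then have le: "?n * (?a - p) \<le> ?U * (?a * p)" using card_cent_class[OF e] center_generate(2) by simp
  have "?n * ?a \<le> ?n * (2 * (?a - p))" using ge by (intro mult_le_mono2) simp
  also have "\<dots> \<le> 2 * (?U * (?a * p))" using le by simp
  finally have "?n * ?a \<le> (2 * p * ?U) * ?a" by (simp add: ac_simps)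
  then show ?thesis using a0 by simp
qed

text \<open>
  Write V and U for the sizes of the two classes. Then V = n (1 - p^-i), while U is at least n / (2 p). For i > 1
  this is too much. For i = 1 there is no room for further classes, so n = p + V + U; by the two possible orders
  of the normalizer of A this forces n = p |A|, and A would be normal.
\<close>
theorem contradiction: False
proof -
  let ?n = "card (carrier G)"
  have p2: "2 \<le> p" using prime_ge_2_nat[OF p] .
  obtain x where x: "noncentral_p x" using ex_noncentral_p by blast
  obtain P where P: "max_p P x" using max_p_exists[OF x] by blast
  obtain e where e: "noncentral_E e" using ex_noncentral_E by blast
  let ?V = "card (p_class P)" and ?U = "card (cent_class e)" and ?Z = "group_center G"
  have Zf: "finite ?Z" by (rule finite_subgroup[OF subgroup_center])
  have cZ: "card ?Z = p" by (rule center_generate(2))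
  have ZV: "?Z \<inter> p_class R = {}" for R using p_class_props by (auto simp: noncentral_p_def)
  have ZU: "?Z \<inter> cent_class f = {}" if "noncentral_E f" for f using cent_class_props[OF that] by (auto simp: noncentral_E_def)
  have VU: "p_class R \<inter> cent_class f = {}" if "noncentral_E f" for R f
    using cent_class_props[OF that] p_class_props by (fastforce simp: noncentral_E_def noncentral_p_def)
  have sub: "?Z \<subseteq> carrier G" "p_class R \<subseteq> carrier G" for R
    using subgroup.subset[OF subgroup_center] p_class_props by (auto simp: noncentral_p_def)
  have subU: "cent_class f \<subseteq> carrier G" if "noncentral_E f" for f using cent_class_props[OF that] by (auto simp: noncentral_E_def)
  have base: "card (?Z \<union> p_class P \<union> cent_class e) = p + ?V + ?U"
  proof -
    have "(?Z \<union> p_class P) \<inter> cent_class e = {}" using ZU[OF e] VU[OF e] by blast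
    then show ?thesis
      using card_Un_disjoint[of "?Z \<union> p_class P" "cent_class e"] card_Un_disjoint[OF Zf finite_p_class ZV, of P]
        Zf finite_p_class finite_cent_class cZ by simp
  qed
  have baseC: "?Z \<union> p_class P \<union> cent_class e \<subseteq> carrier G" using sub subU[OF e] by blast
  have le: "p + ?V + ?U \<le> ?n" unfolding base[symmetric] by (rule card_mono[OF fin baseC])
  have U: "?n \<le> 2 * p * ?U" by (rule cent_class_ge[OF e])
  obtain i where i: "i > 0" "?V * p ^ i = ?n * (p ^ i - 1)" using p_class_density[OF P x] by blast
  have half: "?n \<le> 2 * card (p_class R)" if R: "max_p R y" "noncentral_p y" for R y
  proof -
    obtain j where j: "j > 0" "card (p_class R) * p ^ j = ?n * (p ^ j - 1)" using p_class_density[OF R] by blast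
    have pj: "2 \<le> p ^ j" using p2 j(1) self_le_power[of p j] by simp
    have "?n * p ^ j \<le> ?n * (2 * (p ^ j - 1))" using pj by (intro mult_le_mono2) simp
    also have "\<dots> = (2 * card (p_class R)) * p ^ j" using j(2) by simp
    finally show ?thesis using pj p2 by simp
  qed
  obtain W where W: "?n = ?V + W" using le by (metis add.assoc add.commute le_iff_add)
  have Wp: "W * p ^ i = ?n"
  proof -
    have "1 \<le> p ^ i" using p2 by simp
    then have "?V * p ^ i + ?n = ?n * p ^ i" using i(2) by (simp add: diff_mult_distrib2)
    moreover have "?n * p ^ i = ?V * p ^ i + W * p ^ i" using W by (simp add: algebra_simps)
    ultimately show ?thesis by simp
  qed
  have UW: "p + ?U \<le> W" using le W by simp
  have i1: "i = 1"
  proof (rule ccontr)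
    assume "i \<noteq> 1"
    then have "p ^ 2 \<le> p ^ i" using i(1) p2 by (intro power_increasing) auto
    moreover have "2 * p \<le> p * p" using mult_le_mono1[OF p2] .
    ultimately have "2 * p \<le> p ^ i" unfolding power2_eq_square by linarith
    then have "(p + ?U) * (2 * p) \<le> W * p ^ i" using UW by (rule mult_le_mono[rotated])
    then have "p * (2 * p) + 2 * p * ?U \<le> ?n" using Wp by (simp add: algebra_simps)
    moreover have "0 < p * (2 * p)" using p2 by simp
    ultimately show False using U by linarith
  qed
  then have Wp: "W * p = ?n" using Wp by simp
  have allE: "f \<in> cent_class e" if f: "noncentral_E f" for f
  proof (rule ccontr)
    assume n: "f \<notin> cent_class e"
    note d = cent_class_disjoint[OF e f n]
    have "(?Z \<union> p_class P \<union> cent_class e) \<inter> cent_class f = {}" using ZU[OF f] VU[OF f] d by blast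
    then have "p + ?V + ?U + card (cent_class f) = card ((?Z \<union> p_class P \<union> cent_class e) \<union> cent_class f)"
      using card_Un_disjoint[of "?Z \<union> p_class P \<union> cent_class e" "cent_class f"] base Zf finite_p_class finite_cent_class by simp
    also have "\<dots> \<le> ?n" using baseC subU[OF f] by (intro card_mono[OF fin]) blast
    finally have "p + ?U + card (cent_class f) \<le> W" using W by simp
    then have "(p + ?U + card (cent_class f)) * (2 * p) \<le> W * (2 * p)" by (rule mult_le_mono1)
    then have "p * (2 * p) + 2 * p * ?U + 2 * p * card (cent_class f) \<le> 2 * ?n"
      using Wp by (simp add: algebra_simps)
    moreover have "0 < p * (2 * p)" using p2 by simp
    ultimately show False using U cent_class_ge[OF f] by linarith
  qed
  have allR: "y \<in> p_class P" if y: "noncentral_p y" for y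
  proof (rule ccontr)
    assume n: "y \<notin> p_class P"
    obtain R where R: "max_p R y" using max_p_exists[OF y] by blast
    note d = p_class_disjoint[OF P x R y n]
    have "?Z \<inter> (p_class P \<union> p_class R) = {}" using ZV by blast
    then have "p + (?V + card (p_class R)) = card (?Z \<union> (p_class P \<union> p_class R))"
      using card_Un_disjoint[OF Zf, of "p_class P \<union> p_class R"] card_Un_disjoint[OF finite_p_class finite_p_class d] finite_p_class cZ by simp
    also have "\<dots> \<le> ?n" using sub by (intro card_mono[OF fin]) blast
    finally show False using half[OF P x] half[OF R y] p2 by linarith
  qed
  have "carrier G \<subseteq> ?Z \<union> p_class P \<union> cent_class e"
  proof
    fix g assume g: "g \<in> carrier G"
    show "g \<in> ?Z \<union> p_class P \<union> cent_class e"
      using allE[of g] allR[of g] g by (auto simp: noncentral_E_def noncentral_p_def)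
  qed
  then have "carrier G = ?Z \<union> p_class P \<union> cent_class e" using baseC by blast
  then have eq: "W = p + ?U" using base W by simp
  let ?a = "card (centralizer G e)"
  have ge: "2 * p \<le> ?a" using card_cent_ge[OF e] cZ by simp
  have CU: "?U * card (normset G (centralizer G e)) = ?n * (?a - p)" using card_cent_class[OF e] cZ by simp
  show False
  proof (rule disjE[OF card_cent_normalizer[OF e]])
    assume M: "card (normset G (centralizer G e)) = ?a"
    have "?n * ?a \<le> ?n * (2 * (?a - p))" using ge by (intro mult_le_mono2) simp
    also have "\<dots> = (2 * ?U) * ?a" using CU M by simp
    finally have "?n \<le> 2 * ?U" using ge p2 by simp
    moreover have "2 * W \<le> ?n" using mult_le_mono2[OF p2, of W] Wp by simp
    ultimately show False using eq p2 by linarith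
  next
    assume M: "card (normset G (centralizer G e)) = ?a * p"
    have "?n * ?a = W * (?a * p)" using Wp by (simp add: ac_simps)
    also have "\<dots> = p * (?a * p) + ?n * (?a - p)" using eq CU M by (simp add: algebra_simps)
    also have "?n * (?a - p) = ?n * ?a - ?n * p" by (simp add: diff_mult_distrib2)
    finally have "?n * p = p * (?a * p)"
      using mult_le_mono2[of p ?a ?n] ge by linarith
    then have "?n = ?a * p" using p2 by (simp add: ac_simps)
    then have "card (normset G (centralizer G e)) = ?n" using M by simp
    moreover have "normset G (centralizer G e) \<subseteq> carrier G" by (auto simp: normset_def)
    ultimately have "normset G (centralizer G e) = carrier G" using card_subset_eq[OF fin] by blast
    then show False using nonnormal[OF e] by simp
  qed
qed

end

section \<open>The classification\<close>

context min_PF begin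

theorem minimal_PF_cases:
  "(\<exists>p a b. prime (p::nat) \<and> split_mc G a b (p ^ 2) p 1) \<or> G \<cong> Q8 \<or>
    (\<exists>p a b. prime (p::nat) \<and> p \<noteq> 2 \<and> split_mc G a b (p ^ 2) p (1 + int p)) \<or>
    (\<exists>p q a b. prime (p::nat) \<and> prime (q::nat) \<and> p \<noteq> q \<and> split_mc G a b (q * p) p 1) \<or>
    (\<exists>p q r a b k. prime (p::nat) \<and> prime (q::nat) \<and> prime (r::nat) \<and> p \<noteq> q \<and> p \<noteq> r \<and> q \<noteq> r \<and>
      quasi_frobenius_group G \<and> split_mc G a b (r * p) q k \<and> [k = 1] (mod int r) \<and> \<not> [k = 1] (mod int p)) \<or>
    (\<exists>p q n a b k. prime (p::nat) \<and> prime (q::nat) \<and> p \<noteq> q \<and> n \<ge> 2 \<and> split_mc G a b q (p ^ n) k \<and>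
      \<not> [k = 1] (mod int q) \<and> [k ^ p = 1] (mod int q)) \<or>
    (\<exists>p q \<alpha>. prime (p::nat) \<and> prime (q::nat) \<and> p \<noteq> q \<and> \<alpha> > 0 \<and> quasi_frobenius_group G \<and>
      minimal_frobenius_group qc \<and> Coset.order qc = q ^ \<alpha> * p \<and>
      (\<exists>K. frobenius_kernel qc K \<and> card K = q ^ \<alpha>) \<and> G\<lparr>carrier := group_center G\<rparr> \<cong> cyc q \<and>
      (\<forall>S. sylow_subgroup q G S --> group_exponent (G\<lparr>carrier := S\<rparr>) = q))"
    (is "?c2 \<or> ?c1 \<or> ?c3 \<or> ?c4 \<or> ?c5 \<or> ?c6 \<or> ?c7")
proof -
  obtain z p where zp: "z \<in> group_center G" "prime (p::nat)" "z \<noteq> \<one>" "z [^] p = \<one>" using center_prime by blast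
  interpret C: min_PF_z G z p by unfold_locales (use zp in auto)
  show ?thesis
  proof (cases "\<exists>k. card (carrier G) = p ^ k")
    case True
    then obtain k where "card (carrier G) = p ^ k" by blast
    from C.pgroup_classification[OF this] zp(2) have "?c2 \<or> ?c1 \<or> ?c3" by blast
    then show ?thesis by argo
  next
    case False
    have c0: "card (carrier G) \<noteq> 0" using fin one_closed card_gt_0_iff[of "carrier G"] by blast
    have mixed: "\<exists>q. prime (q::nat) \<and> q \<noteq> p \<and> q dvd card (carrier G)"
      using prime_power_if[OF c0 zp(2)] False by blast
    show ?thesis
    proof (cases "\<exists>q. prime q \<and> q \<noteq> p \<and> (\<exists>a b. split_mc G a b (p * q) q 1)")
      case True
      then have ?c4 using zp(2) by blast
      then show ?thesis by argo
    next
      case no4: False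
      show ?thesis
      proof (cases "group_center G = carrier G")
        case True
        have comm: "x \<otimes> y = y \<otimes> x" if "x \<in> carrier G" "y \<in> carrier G" for x y
          using center_comm[of x y] that True by simp
        obtain q where q: "prime q" "q \<noteq> p" "q dvd card (carrier G)" using mixed by blast
        have "p dvd card (carrier G)" using ord_dvd_card[OF subgroup_self C.zc] C.ord_z by simp
        from abelian_case4[OF comm zp(2) q(1) q(2)[symmetric] this q(3)] have ?c4 .
        then show ?thesis by argo
      next
        case nonab: False
        show ?thesis
        proof (cases "\<exists>e. C.noncentral_E e \<and> normset G (centralizer G e) = carrier G")
          case True
          then obtain e where e: "e \<in> carrier G" "e [^] p \<noteq> \<one>" "e \<notin> group_center G" "normset G (centralizer G e) = carrier G"
            by (auto simp: C.noncentral_E_def)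
          have no4': "\<And>q. prime q ==> q \<noteq> p ==> \<not> (\<exists>a b. split_mc G a b (p * q) q 1)" using no4 by blast
          from C.normal_centralizer_case[OF e mixed no4'] zp(2) have "?c5 \<or> ?c6" by blast
          then show ?thesis by argo
        next
          case False
          interpret D: min_PF_count G z p by unfold_locales (use False nonab mixed in auto)
          show ?thesis
          proof (cases "\<exists>D k x. subgroup D G \<and> card D = p ^ k \<and> x \<in> D \<and> C.noncentral_p x \<and> normset G D = carrier G")
            case True
            then obtain D k x where D: "subgroup D G" "card D = p ^ k" "normset G D = carrier G" "x \<in> D" "C.noncentral_p x" by blast
            from D.normal_pgroup_case[OF D] zp(2) have ?c7 by blast
            then show ?thesis by argo
          next
            case False
            interpret E: min_PF_no_normal_p G z p by unfold_locales (use False in blast)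
            show ?thesis using E.contradiction by (rule FalseE)
          qed
        qed
      qed
    qed
  qed
qed

end

theorem mainTheorem1:
  fixes G :: "('a, 'b) monoid_scheme"
  assumes "group G" and "finite (carrier G)"
  shows "minimal_PF_group G \<longleftrightarrow>
      G \<cong> Q8
    \<or> (\<exists>p::nat. Factorial_Ring.prime p \<and> G \<cong> cyc p \<times>\<times> cyc (p ^ 2))
    \<or> (\<exists>p::nat. Factorial_Ring.prime p \<and> p \<noteq> 2 \<and> G \<cong> M3 p)
    \<or> (\<exists>p q::nat. Factorial_Ring.prime p \<and> Factorial_Ring.prime q \<and> p \<noteq> q \<and> G \<cong> (cyc p \<times>\<times> cyc p) \<times>\<times> cyc q)
    \<or> (\<exists>p q r::nat. Factorial_Ring.prime p \<and> Factorial_Ring.prime q \<and> Factorial_Ring.prime r \<and> p \<noteq> q \<and> p \<noteq> r \<and> q \<noteq> r \<and>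
         quasi_frobenius_group G \<and>
         (\<exists>\<phi>. nontrivial_action (cyc p) (cyc q) \<phi> \<and>
              G \<cong> cyc r \<times>\<times> semidirect (cyc p) (cyc q) \<phi>))
    \<or> (\<exists>(p::nat) (q::nat) (n::nat) (r::int). Factorial_Ring.prime p \<and> Factorial_Ring.prime q \<and> p \<noteq> q \<and> n \<ge> 2 \<and>
         \<not> [r = 1] (mod int q) \<and> [r ^ p = 1] (mod int q) \<and>
         G \<cong> metacyclic_presented p q n r)
    \<or> (\<exists>p q \<alpha>::nat. Factorial_Ring.prime p \<and> Factorial_Ring.prime q \<and> p \<noteq> q \<and> \<alpha> > 0 \<and>
         quasi_frobenius_group G \<and>
         minimal_frobenius_group (G Mod group_center G) \<and>
         Coset.order (G Mod group_center G) = q ^ \<alpha> * p \<and>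
         (\<exists>K. frobenius_kernel (G Mod group_center G) K \<and> card K = q ^ \<alpha>) \<and>
         G\<lparr>carrier := group_center G\<rparr> \<cong> cyc q \<and>
         (\<forall>S. sylow_subgroup q G S \<longrightarrow> group_exponent (G\<lparr>carrier := S\<rparr>) = q))"
  (is "_ \<longleftrightarrow> ?c1 \<or> ?c2 \<or> ?c3 \<or> ?c4 \<or> ?c5 \<or> ?c6 \<or> ?c7")
proof
  interpret fin_group G by (intro fin_group.intro fin_group_axioms.intro assms)
  note G = is_group
  assume "minimal_PF_group G"
  then interpret min_PF G by unfold_locales
  show "?c1 \<or> ?c2 \<or> ?c3 \<or> ?c4 \<or> ?c5 \<or> ?c6 \<or> ?c7"
    using minimal_PF_cases
  proof (elim disjE exE conjE)
    fix p :: nat and a b assume "prime p" "split_mc G a b (p ^ 2) p 1"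
    then have ?c2 using iso_C_p_C_p2[OF G] by blast
    then show ?thesis by argo
  next
    assume ?c1
    then show ?thesis by argo
  next
    fix p :: nat and a b assume "prime p" "p \<noteq> 2" "split_mc G a b (p ^ 2) p (1 + int p)"
    then have ?c3 using iso_M3[OF G] by blast
    then show ?thesis by argo
  next
    fix p q :: nat and a b assume "prime p" "prime q" "p \<noteq> q" "split_mc G a b (q * p) p 1"
    then have ?c4 using iso_C_p2_C_q[OF G] by blast
    then show ?thesis by argo
  next
    fix p q r :: nat and a b k
    assume c: "prime p" "prime q" "prime r" "p \<noteq> q" "p \<noteq> r" "q \<noteq> r" "quasi_frobenius_group G"
      "split_mc G a b (r * p) q k" "[k = 1] (mod int r)" "\<not> [k = 1] (mod int p)"
    then have "\<exists>\<phi>. nontrivial_action (cyc p) (cyc q) \<phi> \<and> G \<cong> cyc r \<times>\<times> semidirect (cyc p) (cyc q) \<phi>"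
      using iso_C_r_semidirect[OF G c(1,2,3,5)] by blast
    then have ?c5 using c(1-7) by blast
    then show ?thesis by argo
  next
    fix p q n :: nat and a b k
    assume c: "prime p" "prime q" "p \<noteq> q" "2 \<le> n" "split_mc G a b q (p ^ n) k" "\<not> [k = 1] (mod int q)" "[k ^ p = 1] (mod int q)"
    have "1 \<le> n" using c(4) by simp
    then have "G \<cong> metacyclic_presented p q n k" using iso_metacyclic[OF G c(1,2) _ c(7)] c(5) by blast
    then have ?c6 using c by blast
    then show ?thesis by argo
  next
    fix p q \<alpha> :: nat and K
    assume c: "prime p" "prime q" "p \<noteq> q" "0 < \<alpha>" "quasi_frobenius_group G" "minimal_frobenius_group (G Mod group_center G)"
      "Coset.order (G Mod group_center G) = q ^ \<alpha> * p" "G\<lparr>carrier := group_center G\<rparr> \<cong> cyc q"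
      "\<forall>S. sylow_subgroup q G S \<longrightarrow> group_exponent (G\<lparr>carrier := S\<rparr>) = q"
      "frobenius_kernel (G Mod group_center G) K" "card K = q ^ \<alpha>"
    have ?c7
      by (rule exI[of _ p], rule exI[of _ q], rule exI[of _ \<alpha>], intro conjI exI[of _ K]) (rule c)+
    then show ?thesis by argo
  qed
next
  interpret fin_group G by (intro fin_group.intro fin_group_axioms.intro assms)
  note G = is_group
  assume "?c1 \<or> ?c2 \<or> ?c3 \<or> ?c4 \<or> ?c5 \<or> ?c6 \<or> ?c7"
  then show "minimal_PF_group G"
  proof (elim disjE)
    assume ?c1
    then show ?thesis by (rule Q8_minimal_PF)
  next
    assume ?c2
    then obtain p a b where "prime (p::nat)" "split_mc G a b (p ^ 2) p 1" using iso_C_p_C_p2[OF G] by blast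
    then show ?thesis by (intro mc_case2)
  next
    assume ?c3
    then obtain p a b where "prime (p::nat)" "p \<noteq> 2" "split_mc G a b (p ^ 2) p (1 + int p)" using iso_M3[OF G] by blast
    then show ?thesis by (intro mc_case3)
  next
    assume ?c4
    then obtain p q a b where "prime (p::nat)" "prime (q::nat)" "p \<noteq> q" "split_mc G a b (q * p) p 1"
      using iso_C_p2_C_q[OF G] by blast
    then show ?thesis by (intro mc_case4)
  next
    assume ?c5
    then obtain p q r :: nat where c: "prime p" "prime q" "prime r" "p \<noteq> q" "p \<noteq> r" "q \<noteq> r"
      and e: "\<exists>\<phi>. nontrivial_action (cyc p) (cyc q) \<phi> \<and> G \<cong> cyc r \<times>\<times> semidirect (cyc p) (cyc q) \<phi>" by blast
    from e obtain a b k where "split_mc G a b (r * p) q k" "[k = 1] (mod int r)" "\<not> [k = 1] (mod int p)"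
      unfolding iso_C_r_semidirect[OF G c(1,2,3,5)] by blast
    then show ?thesis using mc_case5 c by blast
  next
    assume ?c6
    then obtain p q n :: nat and r where c: "prime p" "prime q" "p \<noteq> q" "n \<ge> 2" "\<not> [r = 1] (mod int q)"
      "[r ^ p = 1] (mod int q)" "G \<cong> metacyclic_presented p q n r" by blast
    have "1 \<le> n" using c(4) by simp
    then obtain a b where "split_mc G a b q (p ^ n) r" using iso_metacyclic[OF G c(1,2) _ c(6)] c(7) by blast
    then show ?thesis by (rule mc_case6[OF _ c(1-6)])
  next
    assume ?c7
    then show ?thesis
    proof (elim exE conjE)
      fix p q \<alpha> :: nat and K
      assume c: "prime p" "prime q" "p \<noteq> q" "0 < \<alpha>" "quasi_frobenius_group G" "minimal_frobenius_group (G Mod group_center G)"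
        "Coset.order (G Mod group_center G) = q ^ \<alpha> * p" "G\<lparr>carrier := group_center G\<rparr> \<cong> cyc q"
        "\<forall>S. sylow_subgroup q G S \<longrightarrow> group_exponent (G\<lparr>carrier := S\<rparr>) = q"
        "frobenius_kernel (G Mod group_center G) K" "card K = q ^ \<alpha>"
      show ?thesis by (rule case7_minimal_PF[OF c(1,2,3,6,7) _ c(8,9)]) (intro exI[of _ K] conjI c(10,11))
    qed
  qed
qed

end
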